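(* For each initial datum $\bar u\in H^1_{\rm per}$ there exists a solution $u(\cdot)$, $t\mapsto u(t)\in H^1_{\rm per}$, $t\in\mathbb{R}$, of the Cauchy problem for the Camassa-Holm equation $$u_t+(u^2/2)_x+P_x=0,\qquad u(0,x)=\bar u(x).$$ Namely, the map $t\mapsto u(t)$ is Lipschitz continuous from $\mathbb{R}$ into $L^2_{\rm per}$, satisfies $u(0)=\bar u$, and the identity $$\frac{d}{dt}u=-u\,u_x-P_x \qquad ( * )$$ is satisfied as an equality between elements of $L^2_{\rm per}$ at a.e. time $t\in\mathbb{R}$. This same map $t\mapsto u(t)$ is continuously differentiable from $\mathbb{R}$ into $L^p_{\rm per}$ and satisfies $( * )$ at a.e. time $t\in\mathbb{R}$, for all $p\in[1,2)$. The solution $u(\cdot)$ is conservative in the sense that, for a.e. $t\in\mathbb{R}$, $$\int_0^1\big[u^2(t,x)+u_x^2(t,x)\big]\,dx=\int_0^1\big[\bar u^2(x)+\bar u_x^2(x)\big]\,dx .$$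
   Context: $L^p_{\rm per}$ denotes the space of 1-periodic functions on $\mathbb{R}$ with norm the $L^p$ norm over one period $[0,1]$. $H^1_{\rm per}$ is the space of 1-periodic absolutely continuous functions $u:\mathbb{R}\to\mathbb{R}$ with $u_x\in L^2_{\rm per}$, with norm $\|u\|_{H^1_{\rm per}}=\big(\int_0^1|u|^2dx+\int_0^1|u_x|^2dx\big)^{1/2}$. For each time $t$, $P=P(t,\cdot)$ is the convolution on $\mathbb{R}$ $$P=\frac12 e^{-|x|}*\Big(u^2+\frac{u_x^2}{2}\Big),$$ where $u=u(t,\cdot)$. *)

theory Defs
  imports "HOL-Analysis.Analysis"
begin

text \<open>
  Elements of the periodic Lebesgue spaces are represented by functions on the whole line.
  Two representatives are identified when the seminorm \<open>Lp_norm\<close> of their difference vanishes,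
  so equalities, limits and derivatives in these spaces are all expressed through \<open>Lp_norm\<close>.
\<close>

definition Lp_per :: "real \<Rightarrow> (real \<Rightarrow> real) set" where
  "Lp_per p = {f. periodic_fun_simple' f \<and> f \<in> borel_measurable lebesgue \<and>
                  set_integrable lebesgue {0..1} (\<lambda>x. \<bar>f x\<bar> powr p)}"

definition Lp_norm :: "real \<Rightarrow> (real \<Rightarrow> real) \<Rightarrow> real" where
  "Lp_norm p f = (LINT x:{0..1}|lebesgue. \<bar>f x\<bar> powr p) powr (1 / p)"

text \<open>Absolute continuity of a function (the library constant \<open>absolutely_continuous\<close>
  is about measures).\<close>

definition abs_continuous_on_interval :: "real \<Rightarrow> real \<Rightarrow> (real \<Rightarrow> real) \<Rightarrow> bool" where
  "abs_continuous_on_interval a b f \<longleftrightarrow>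
     (\<forall>\<epsilon>>0. \<exists>\<delta>>0. \<forall>(n::nat) (l::nat \<Rightarrow> real) (r::nat \<Rightarrow> real).
        (\<forall>i<n. a \<le> l i \<and> l i \<le> r i \<and> r i \<le> b) \<longrightarrow>
        disjoint_family_on (\<lambda>i. {l i<..<r i}) {..<n} \<longrightarrow>
        (\<Sum>i<n. r i - l i) < \<delta> \<longrightarrow>
        (\<Sum>i<n. \<bar>f (r i) - f (l i)\<bar>) < \<epsilon>)"

text \<open>
  Absolute continuity on the line means absolute continuity on each compact interval.
  The derivative \<open>deriv u\<close> of such a function is the genuine one at almost every point; at the
  remaining points its value is arbitrary, which is harmless since the Lebesgue measure is
  complete.  It is again exactly 1-periodic.
\<close>

definition H1_per :: "(real \<Rightarrow> real) set" where
  "H1_per = {u. periodic_fun_simple' u \<and> (\<forall>a b. abs_continuous_on_interval a b u) \<and>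
                deriv u \<in> Lp_per 2}"

definition convolve :: "(real \<Rightarrow> real) \<Rightarrow> (real \<Rightarrow> real) \<Rightarrow> real \<Rightarrow> real" where
  "convolve f g x = (LINT y|lebesgue. f (x - y) * g y)"

definition CH_P :: "(real \<Rightarrow> real) \<Rightarrow> real \<Rightarrow> real" where
  "CH_P w = convolve (\<lambda>x. 1/2 * exp (- \<bar>x\<bar>)) (\<lambda>x. (w x)\<^sup>2 + (deriv w x)\<^sup>2 / 2)"

definition lipschitz_into_Lp :: "real \<Rightarrow> (real \<Rightarrow> real \<Rightarrow> real) \<Rightarrow> bool" where
  "lipschitz_into_Lp p u \<longleftrightarrow>
     (\<forall>t. u t \<in> Lp_per p) \<and>
     (\<exists>L. \<forall>s t. Lp_norm p (\<lambda>x. u s x - u t x) \<le> L * \<bar>s - t\<bar>)"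

text \<open>The curve \<open>u\<close> is differentiable at time \<open>t\<close> as a map into the space of exponent \<open>p\<close>,
  with derivative equal to (the class of) \<open>v\<close>.\<close>

definition has_Lp_derivative :: "real \<Rightarrow> (real \<Rightarrow> real \<Rightarrow> real) \<Rightarrow> (real \<Rightarrow> real) \<Rightarrow> real \<Rightarrow> bool" where
  "has_Lp_derivative p u v t \<longleftrightarrow>
     (\<forall>s. u s \<in> Lp_per p) \<and> v \<in> Lp_per p \<and>
     ((\<lambda>h. Lp_norm p (\<lambda>x. (u (t + h) x - u t x) / h - v x)) \<longlongrightarrow> 0) (at 0)"

definition C1_into_Lp :: "real \<Rightarrow> (real \<Rightarrow> real \<Rightarrow> real) \<Rightarrow> bool" where
  "C1_into_Lp p u \<longleftrightarrow>
     (\<exists>v :: real \<Rightarrow> real \<Rightarrow> real.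
        (\<forall>t. has_Lp_derivative p u (v t) t) \<and>
        (\<forall>t. ((\<lambda>s. Lp_norm p (\<lambda>x. v s x - v t x)) \<longlongrightarrow> 0) (at t)))"

end

theory Submission
  imports Defs
begin

text \<open>
  Followed along characteristics, the equation becomes an ordinary differential equation that does
  not notice when the gradient blows up.  Label the points of one period of the datum by \<open>\<xi>\<close>, let
  \<open>y t \<xi>\<close> be the position at time \<open>t\<close> of the point labelled \<open>\<xi>\<close>, which moves with the speed
  \<open>U = u(t, y t \<xi>)\<close>, and write \<open>y_\<xi> = \<alpha>^2\<close> and \<open>\<beta> = \<alpha> u_x\<close>.  For a smooth solution
  \<open>U_\<xi> = \<alpha> \<beta>\<close>, \<open>\<alpha>_t = \<beta> / 2\<close> and \<open>\<beta>_t = (U^2 - P) \<alpha>\<close>, while \<open>P\<close> and \<open>Q = P_x\<close> are integrals of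
  \<open>U^2 \<alpha>^2 + \<beta>^2 / 2\<close> over labels.  Breaking of the wave means \<open>\<alpha> = 0\<close>, which is harmless here: the
  system is locally Lipschitz and conserves \<open>\<integral> U^2 \<alpha>^2 + \<beta>^2\<close>.  At time 0 one has \<open>\<alpha> = 1\<close> and
  \<open>\<beta> = w\<close>, the derivative of the datum.  As \<open>w\<close> is merely square integrable, the pair is written
  \<open>\<alpha> = p1 + p2 w\<close>, \<open>\<beta> = r1 + r2 w\<close>, and the unknowns are the four bounded continuous functions
  \<open>p1, p2, r1, r2\<close> together with the value of \<open>U\<close> at the label 0.  Energy conservation bounds \<open>U\<close>,
  \<open>P\<close> and \<open>Q\<close>, hence all unknowns on bounded time intervals, and the solution is global
  (\<open>global_lagrangian_solution\<close>).

  Back on the circle, \<open>y t\<close> maps the labels onto a period and is nondecreasing, but it may have flat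
  pieces.  Because of \<open>\<bar>\<alpha> \<beta>\<bar> \<le> K \<alpha>^2 + \<beta>^2 / K\<close> for every \<open>K > 0\<close>, the function \<open>U\<close> is constant on them and
  \<open>u(t, y t \<xi>) = U t \<xi>\<close> defines an absolutely continuous \<open>u(t)\<close> (\<open>profile.ut_AC\<close>).  Its gradient
  takes the value \<open>\<beta> / \<alpha>\<close> at \<open>y t \<xi>\<close> where \<open>\<alpha> \<noteq> 0\<close>, and its energy is at most the conserved one,
  with equality when \<open>\<alpha> \<noteq> 0\<close> almost everywhere.  Call such times regular.  Since \<open>p1 r2 - p2 r1 = 1\<close>
  forever, \<open>\<alpha>\<close> and \<open>\<beta>\<close> have no common zero.  As \<open>\<alpha>_t = \<beta> / 2\<close>, the zeros of \<open>\<alpha>\<close> in time are isolated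
  for each label, and by Fubini almost every time is regular (\<open>regular_AE\<close>).

  At a regular time \<open>P\<close> and \<open>Q\<close>, read on the circle, satisfy \<open>P' = Q\<close> and
  \<open>Q' = P - (u^2 + u_x^2 / 2)\<close>.  The only bounded solution is the convolution in the equation
  (\<open>CH_P_uu\<close>, \<open>deriv_CH_P_uu\<close>).

  For the derivative in time, \<open>u(s, x) - u(t, x)\<close> is compared with the increment of \<open>U\<close> along the
  characteristic that passes through \<open>x\<close> at time \<open>t\<close>.  The difference is an integral of \<open>u_x(s)\<close> over
  an interval whose length is at most a constant times \<open>\<bar>s - t\<bar>\<close>.  So the difference quotient converges to
  \<open>- u u_x - Q\<close> in the norms in which \<open>u_x(s)\<close>, also after small translations, converges to
  \<open>u_x(t)\<close> (\<open>dq_tendsto\<close>).  In these norms convergence rests on the change of variables by \<open>y\<close>: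
  truncations of \<open>u_x(s)\<close> and their squares converge weakly, hence strongly, and the uniform bound
  in \<open>L^2\<close> gives \<open>L^1\<close> convergence at every time (\<open>transported_L1_convergence\<close>) and, by
  interpolation, \<open>L^p\<close> convergence for \<open>p < 2\<close>.  Convergence in \<open>L^2\<close> needs that no energy sits where
  \<open>\<alpha> = 0\<close>, that is, a regular time (\<open>hx_L2_convergence\<close>).
\<close>

section \<open>Total variation and absolute continuity\<close>

text \<open>
  Unlike indexed sequences, finite sets of intervals can be united and refined without renumbering.
  Degenerate intervals are excluded, so that a member is determined by its interior.
\<close>

definition interval_family :: "real => real => (real \<times> real) set => bool" where
  "interval_family a b S \<longleftrightarrow> finite S \<and> (\<forall>p\<in>S. a <= fst p \<and> fst p < snd p \<and> snd p <= b) \<and>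
     pairwise (\<lambda>p q. disjnt {fst p<..<snd p} {fst q<..<snd q}) S"

definition family_variation :: "(real => real) => (real \<times> real) set => real" where
  "family_variation f S = (\<Sum>p\<in>S. \<bar>f (snd p) - f (fst p)\<bar>)"

definition family_length :: "(real \<times> real) set => real" where
  "family_length S = (\<Sum>p\<in>S. snd p - fst p)"

lemma interval_family_finite: "interval_family a b S ==> finite S"
  by (simp add: interval_family_def)

lemma interval_family_empty [simp]: "interval_family a b {}"
  by (simp add: interval_family_def)

lemma interval_family_subset: "interval_family a b S ==> T \<subseteq> S ==> interval_family a b T"
  unfolding interval_family_def by (meson finite_subset pairwise_subset subsetD)

lemma interval_family_mono:
  "interval_family a b S ==> a' <= a ==> b <= b' ==> interval_family a' b' S"
  unfolding interval_family_def by fastforce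

lemma abs_continuous_family:
  assumes "abs_continuous_on_interval a b f" "0 < \<epsilon>"
  shows "\<exists>\<delta>>0. \<forall>S. interval_family a b S --> family_length S < \<delta> --> family_variation f S < \<epsilon>"
proof -
  from assms(1)[unfolded abs_continuous_on_interval_def, THEN spec, THEN mp, OF assms(2)]
  obtain \<delta> where d: "\<delta> > 0" and
   D: "\<forall>(n::nat) (l::nat => real) (r::nat => real).
        (\<forall>i<n. a <= l i \<and> l i <= r i \<and> r i <= b) -->
        disjoint_family_on (\<lambda>i. {l i<..<r i}) {..<n} -->
        (\<Sum>i<n. r i - l i) < \<delta> -->
        (\<Sum>i<n. \<bar>f (r i) - f (l i)\<bar>) < \<epsilon>"
    by (elim exE conjE)
  have "family_variation f S < \<epsilon>" if S: "interval_family a b S" "family_length S < \<delta>" for S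
  proof -
    obtain h where h: "bij_betw h {..<card S} S"
      using ex_bij_betw_nat_finite[OF interval_family_finite[OF S(1)]] unfolding atLeast0LessThan by blast
    have mem: "h i \<in> S" if "i < card S" for i using h that by (auto simp: bij_betw_def)
    have 1: "\<forall>i<card S. a <= fst (h i) \<and> fst (h i) <= snd (h i) \<and> snd (h i) <= b"
      using S(1) mem unfolding interval_family_def by fastforce
    have 2: "disjoint_family_on (\<lambda>i. {fst (h i)<..<snd (h i)}) {..<card S}"
      unfolding disjoint_family_on_def
    proof (intro ballI impI)
      fix i j assume ij: "i \<in> {..<card S}" "j \<in> {..<card S}" "i \<noteq> j"
      then have "h i \<noteq> h j" using h by (auto simp: bij_betw_def inj_on_def)
      then have "disjnt {fst (h i)<..<snd (h i)} {fst (h j)<..<snd (h j)}"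
        using S(1) mem ij unfolding interval_family_def pairwise_def by auto
      then show "{fst (h i)<..<snd (h i)} \<inter> {fst (h j)<..<snd (h j)} = {}"
        by (simp add: disjnt_def)
    qed
    have 3: "(\<Sum>i<card S. snd (h i) - fst (h i)) = family_length S"
      unfolding family_length_def by (rule sum.reindex_bij_betw[OF h])
    have 4: "(\<Sum>i<card S. \<bar>f (snd (h i)) - f (fst (h i))\<bar>) = family_variation f S"
      unfolding family_variation_def by (rule sum.reindex_bij_betw[OF h])
    show ?thesis using D[rule_format, of "card S" "\<lambda>i. fst (h i)" "\<lambda>i. snd (h i)"] 1 2 3 4 S(2) by simp
  qed
  then show ?thesis using d by blast
qed

text \<open>
  Induction on the size: remove the rightmost interval and shrink the right end point accordingly.
\<close>

lemma interval_family_sum_le: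
  fixes W :: "real => real"
  assumes "interval_family a b S" "a <= b" "mono_on {a..b} W"
  shows "(\<Sum>p\<in>S. W (snd p) - W (fst p)) <= W b - W a"
  using assms
proof (induction "card S" arbitrary: S b)
  case 0
  then have "S = {}" using interval_family_finite by fastforce
  moreover have "W a <= W b" using 0 by (intro mono_onD[OF 0(4)]) auto
  ultimately show ?case by simp
next
  case (Suc n)
  have fin: "finite S" and ne: "S \<noteq> {}" using Suc by (auto simp: interval_family_def)
  obtain p where p: "p \<in> S" "snd p = Max (snd ` S)"
  proof -
    have "Max (snd ` S) \<in> snd ` S" using fin ne by (intro Max_in) auto
    then obtain p where "p \<in> S" "Max (snd ` S) = snd p" by blast
    then show thesis using that by simp
  qed
  have pmax: "snd q <= snd p" if "q \<in> S" for q using p that fin by auto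
  have F: "a <= fst q \<and> fst q < snd q \<and> snd q <= b" if "q \<in> S" for q
    using Suc.prems(1) that unfolding interval_family_def by blast
  have le: "snd q <= fst p" if q: "q \<in> S - {p}" for q
  proof (rule ccontr)
    assume "\<not> snd q <= fst p"
    then have lt: "max (fst q) (fst p) < min (snd q) (snd p)" using F[of q] F[of p] pmax[of q] p q by auto
    obtain z where "max (fst q) (fst p) < z" "z < min (snd q) (snd p)" using dense[OF lt] by blast
    then have "z \<in> {fst p<..<snd p} \<inter> {fst q<..<snd q}" by auto
    moreover have "disjnt {fst p<..<snd p} {fst q<..<snd q}"
      using Suc.prems(1) p q unfolding interval_family_def pairwise_def by auto
    ultimately show False by (auto simp: disjnt_def)
  qed
  have sub: "interval_family a (fst p) (S - {p})"
    using interval_family_subset[OF Suc.prems(1), of "S - {p}"] le unfolding interval_family_def by blast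
  have "(\<Sum>p\<in>S - {p}. W (snd p) - W (fst p)) <= W (fst p) - W a"
  proof (rule Suc.hyps(1))
    show "n = card (S - {p})" using Suc.hyps(2) p fin by simp
    show "interval_family a (fst p) (S - {p})" by fact
    show "a <= fst p" using F p by blast
    show "mono_on {a..fst p} W" by (rule mono_on_subset[OF Suc.prems(3)]) (use F[OF p(1)] in auto)
  qed
  moreover have "W (snd p) <= W b" using Suc.prems(3) F[OF p(1)] by (auto simp: mono_on_def)
  moreover have "(\<Sum>p\<in>S. W (snd p) - W (fst p)) = (W (snd p) - W (fst p)) + (\<Sum>p\<in>S - {p}. W (snd p) - W (fst p))"
    by (rule sum.remove[OF fin p(1)])
  ultimately show ?case by linarith
qed

lemma family_length_le: "interval_family a b S ==> a <= b ==> family_length S <= b - a"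
  unfolding family_length_def using interval_family_sum_le[of a b S "\<lambda>x. x"] by (auto simp: mono_on_def)

lemma abs_continuousI_family:
  assumes "\<And>\<epsilon>. 0 < \<epsilon> ==> \<exists>\<delta>>0. \<forall>S. interval_family a b S --> family_length S < \<delta> --> family_variation f S < \<epsilon>"
  shows "abs_continuous_on_interval a b f"
  unfolding abs_continuous_on_interval_def
proof (intro allI impI)
  fix \<epsilon> :: real assume "0 < \<epsilon>"
  then obtain \<delta> where d: "\<delta> > 0" "\<And>S. interval_family a b S ==> family_length S < \<delta> ==> family_variation f S < \<epsilon>"
    using assms by blast
  have main: "(\<Sum>i<n. \<bar>f (r i) - f (l i)\<bar>) < \<epsilon>"
    if A: "\<forall>i<n. a <= l i \<and> l i <= r i \<and> r i <= b" "disjoint_family_on (\<lambda>i. {l i<..<r i}) {..<n}"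
       "(\<Sum>i<n. r i - l i) < \<delta>" for n :: nat and l r :: "nat => real"
  proof -
    define I where "I = {i. i < n \<and> l i < r i}"
    have finI: "finite I" "I \<subseteq> {..<n}" by (auto simp: I_def)
    have disj: "{l i<..<r i} \<inter> {l j<..<r j} = {}" if "i \<in> I" "j \<in> I" "i \<noteq> j" for i j
      using A(2) that unfolding disjoint_family_on_def I_def by auto
    have inj: "inj_on (\<lambda>i. (l i, r i)) I"
    proof (rule inj_onI, rule ccontr)
      fix i j assume ij: "i \<in> I" "j \<in> I" "(l i, r i) = (l j, r j)" "i \<noteq> j"
      then have "{l i<..<r i} = {}" using disj[of i j] by auto
      moreover have "l i < r i" using ij by (auto simp: I_def)
      ultimately show False by (simp add: greaterThanLessThan_empty_iff)
    qed
    have fam: "interval_family a b ((\<lambda>i. (l i, r i)) ` I)"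
      unfolding interval_family_def
    proof (intro conjI)
      show "finite ((\<lambda>i. (l i, r i)) ` I)" using finI by blast
      show "\<forall>p\<in>(\<lambda>i. (l i, r i)) ` I. a <= fst p \<and> fst p < snd p \<and> snd p <= b"
        using A(1) by (auto simp: I_def)
      show "pairwise (\<lambda>p q. disjnt {fst p<..<snd p} {fst q<..<snd q}) ((\<lambda>i. (l i, r i)) ` I)"
        unfolding pairwise_image
      proof (rule pairwiseI, rule impI)
        fix i j assume "i \<in> I" "j \<in> I" "i \<noteq> j"
        then show "disjnt {fst (l i, r i)<..<snd (l i, r i)} {fst (l j, r j)<..<snd (l j, r j)}"
          using disj[of i j] by (simp add: disjnt_def)
      qed
    qed
    have "family_length ((\<lambda>i. (l i, r i)) ` I) = (\<Sum>i\<in>I. r i - l i)"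
      unfolding family_length_def by (subst sum.reindex[OF inj]) simp
    also have "... = (\<Sum>i<n. r i - l i)"
    proof (rule sum.mono_neutral_left)
      show "\<forall>i\<in>{..<n} - I. r i - l i = 0"
      proof
        fix i assume "i \<in> {..<n} - I"
        then have "i < n" "\<not> l i < r i" by (auto simp: I_def)
        then have "l i = r i" using A(1) by force
        then show "r i - l i = 0" by simp
      qed
    qed (use finI in auto)
    finally have 1: "family_length ((\<lambda>i. (l i, r i)) ` I) < \<delta>" using A(3) by simp
    have "family_variation f ((\<lambda>i. (l i, r i)) ` I) = (\<Sum>i\<in>I. \<bar>f (r i) - f (l i)\<bar>)"
      unfolding family_variation_def by (subst sum.reindex[OF inj]) simp
    also have "... = (\<Sum>i<n. \<bar>f (r i) - f (l i)\<bar>)"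
    proof (rule sum.mono_neutral_left)
      show "\<forall>i\<in>{..<n} - I. \<bar>f (r i) - f (l i)\<bar> = 0"
      proof
        fix i assume "i \<in> {..<n} - I"
        then have "i < n" "\<not> l i < r i" by (auto simp: I_def)
        then have "l i = r i" using A(1) by force
        then show "\<bar>f (r i) - f (l i)\<bar> = 0" by simp
      qed
    qed (use finI in auto)
    finally show ?thesis using d(2)[OF fam 1] by simp
  qed
  show "\<exists>\<delta>>0. \<forall>(n::nat) (l::nat => real) (r::nat => real). (\<forall>i<n. a <= l i \<and> l i <= r i \<and> r i <= b) -->
        disjoint_family_on (\<lambda>i. {l i<..<r i}) {..<n} --> (\<Sum>i<n. r i - l i) < \<delta> -->
        (\<Sum>i<n. \<bar>f (r i) - f (l i)\<bar>) < \<epsilon>"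
  proof (intro exI[of _ \<delta>] conjI allI impI d(1))
    fix n :: nat and l r :: "nat => real"
    assume "\<forall>i<n. a <= l i \<and> l i <= r i \<and> r i <= b" "disjoint_family_on (\<lambda>i. {l i<..<r i}) {..<n}"
      "(\<Sum>i<n. r i - l i) < \<delta>"
    then show "(\<Sum>i<n. \<bar>f (r i) - f (l i)\<bar>) < \<epsilon>" by (rule main[of n l r])
  qed
qed

text \<open>
  The Lipschitz part of the increments is controlled by the total length of a family, and the monotone
  part telescopes.  Cauchy-Schwarz estimates produce bounds of this kind.
\<close>

lemma abs_continuous_criterion:
  fixes f :: "real => real"
  assumes "\<And>\<epsilon>. 0 < \<epsilon> ==> \<exists>L W. 0 <= L \<and> mono_on {a..b} W \<and> W b - W a < \<epsilon> \<and>
     (\<forall>x y. a <= x --> x <= y --> y <= b --> \<bar>f y - f x\<bar> <= L * (y - x) + (W y - W x))"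
  shows "abs_continuous_on_interval a b f"
proof (rule abs_continuousI_family)
  fix \<epsilon> :: real assume e: "0 < \<epsilon>"
  obtain L W where L: "0 <= L" and W: "mono_on {a..b} W" "W b - W a < \<epsilon>/2"
    and LW: "\<And>x y. a <= x ==> x <= y ==> y <= b ==> \<bar>f y - f x\<bar> <= L * (y - x) + (W y - W x)"
    using assms[OF half_gt_zero[OF e]] by blast
  define \<delta> where "\<delta> = \<epsilon> / (2 * (L + 1))"
  have d: "\<delta> > 0" using e L by (simp add: \<delta>_def)
  have "family_variation f S < \<epsilon>" if S: "interval_family a b S" "family_length S < \<delta>" for S
  proof (cases "S = {}")
    case True then show ?thesis using e by (simp add: family_variation_def)
  next
    case False
    then have ab: "a <= b" using S(1) unfolding interval_family_def by fastforce
    have "family_variation f S <= (\<Sum>p\<in>S. L * (snd p - fst p) + (W (snd p) - W (fst p)))"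
      unfolding family_variation_def
      by (rule sum_mono, rule LW) (use S(1) in \<open>auto simp: interval_family_def less_imp_le\<close>)
    also have "... = L * family_length S + (\<Sum>p\<in>S. W (snd p) - W (fst p))"
      by (simp add: family_length_def sum.distrib sum_distrib_left)
    also have "... <= L * \<delta> + (W b - W a)"
      using S L interval_family_sum_le[OF S(1) ab W(1)] by (intro add_mono mult_left_mono) auto
    also have "L * \<delta> <= \<epsilon>/2"
      using L e by (simp add: \<delta>_def field_simps)
    finally show ?thesis using W(2) by linarith
  qed
  then show "\<exists>\<delta>>0. \<forall>S. interval_family a b S --> family_length S < \<delta> --> family_variation f S < \<epsilon>"
    using d by blast
qed

lemma interval_family_Un:
  assumes S: "interval_family a b S" and T: "interval_family b c T" and abc: "a <= b" "b <= c"
  shows "interval_family a c (S \<union> T)" "family_variation f (S \<union> T) = family_variation f S + family_variation f T"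
proof -
  have d: "disjnt {fst p<..<snd p} {fst q<..<snd q}" if "p \<in> S" "q \<in> T" for p q
    using S T that unfolding interval_family_def disjnt_def by force
  show "interval_family a c (S \<union> T)"
    unfolding interval_family_def
  proof (intro conjI)
    show "finite (S \<union> T)" using S T by (auto simp: interval_family_def)
    show "\<forall>p\<in>S \<union> T. a <= fst p \<and> fst p < snd p \<and> snd p <= c"
      using S T abc unfolding interval_family_def by fastforce
    show "pairwise (\<lambda>p q. disjnt {fst p<..<snd p} {fst q<..<snd q}) (S \<union> T)"
      unfolding pairwise_def
    proof (intro ballI impI)
      fix p q assume pq: "p \<in> S \<union> T" "q \<in> S \<union> T" "p \<noteq> q"
      have dS: "disjnt {fst p<..<snd p} {fst q<..<snd q}" if "p \<in> S" "q \<in> S"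
        using S that pq unfolding interval_family_def pairwise_def by blast
      have dT: "disjnt {fst p<..<snd p} {fst q<..<snd q}" if "p \<in> T" "q \<in> T"
        using T that pq unfolding interval_family_def pairwise_def by blast
      show "disjnt {fst p<..<snd p} {fst q<..<snd q}"
        using pq dS dT d[of p q] d[of q p] by (auto simp: disjnt_sym)
    qed
  qed
  have "S \<inter> T = {}"
  proof (rule ccontr)
    assume "S \<inter> T \<noteq> {}"
    then obtain p where "p \<in> S" "p \<in> T" by blast
    then have "snd p <= b" "b <= fst p" "fst p < snd p" using S T unfolding interval_family_def by blast+
    then show False by linarith
  qed
  then show "family_variation f (S \<union> T) = family_variation f S + family_variation f T"
    unfolding family_variation_def using S T by (intro sum.union_disjoint) (auto simp: interval_family_def)
qed

lemma interval_family_split: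
  assumes S: "interval_family a c S" and x: "a <= x" "x <= c"
  shows "\<exists>S1 S2. interval_family a x S1 \<and> interval_family x c S2 \<and>
           family_variation f S <= family_variation f S1 + family_variation f S2"
proof -
  have F: "a <= fst p \<and> fst p < snd p \<and> snd p <= c" if "p \<in> S" for p
    using S that unfolding interval_family_def by blast
  have D: "{fst p<..<snd p} \<inter> {fst q<..<snd q} = {}" if "p \<in> S" "q \<in> S" "p \<noteq> q" for p q
    using S that unfolding interval_family_def pairwise_def disjnt_def by blast
  have fin: "finite S" using S by (simp add: interval_family_def)
  define A where "A = {p \<in> S. fst p < x}"
  define B where "B = {p \<in> S. x < snd p}"
  define l where "l = (\<lambda>p::real\<times>real. (fst p, min (snd p) x))"
  define r where "r = (\<lambda>p::real\<times>real. (max (fst p) x, snd p))"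
  have injl: "inj_on l A"
  proof (rule inj_onI, rule ccontr)
    fix p q assume pq: "p \<in> A" "q \<in> A" "l p = l q" "p \<noteq> q"
    have lt: "fst p < min (snd p) (snd q)" using F[of p] F[of q] pq by (auto simp: A_def l_def)
    obtain z where "fst p < z" "z < min (snd p) (snd q)" using dense[OF lt] by blast
    then have "z \<in> {fst p<..<snd p} \<inter> {fst q<..<snd q}" using pq by (auto simp: l_def)
    then show False using D[of p q] pq by (auto simp: A_def)
  qed
  have injr: "inj_on r B"
  proof (rule inj_onI, rule ccontr)
    fix p q assume pq: "p \<in> B" "q \<in> B" "r p = r q" "p \<noteq> q"
    have lt: "max (fst p) (fst q) < snd p" using F[of p] F[of q] pq by (auto simp: B_def r_def)
    obtain z where "max (fst p) (fst q) < z" "z < snd p" using dense[OF lt] by blast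
    then have "z \<in> {fst p<..<snd p} \<inter> {fst q<..<snd q}" using pq by (auto simp: r_def)
    then show False using D[of p q] pq by (auto simp: B_def)
  qed
  have 1: "interval_family a x (l ` A)"
    unfolding interval_family_def
  proof (intro conjI)
    show "finite (l ` A)" using fin by (simp add: A_def)
    show "\<forall>p\<in>l ` A. a <= fst p \<and> fst p < snd p \<and> snd p <= x" using F by (auto simp: A_def l_def)
    show "pairwise (\<lambda>p q. disjnt {fst p<..<snd p} {fst q<..<snd q}) (l ` A)"
      unfolding pairwise_image
    proof (rule pairwiseI, rule impI)
      fix p q assume "p \<in> A" "q \<in> A" "p \<noteq> q"
      then have "{fst p<..<snd p} \<inter> {fst q<..<snd q} = {}" using D by (auto simp: A_def)
      moreover have "{fst (l p)<..<snd (l p)} \<subseteq> {fst p<..<snd p}"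
         "{fst (l q)<..<snd (l q)} \<subseteq> {fst q<..<snd q}" by (auto simp: l_def)
      ultimately show "disjnt {fst (l p)<..<snd (l p)} {fst (l q)<..<snd (l q)}"
        unfolding disjnt_def by blast
    qed
  qed
  have 2: "interval_family x c (r ` B)"
    unfolding interval_family_def
  proof (intro conjI)
    show "finite (r ` B)" using fin by (simp add: B_def)
    show "\<forall>p\<in>r ` B. x <= fst p \<and> fst p < snd p \<and> snd p <= c" using F by (auto simp: B_def r_def)
    show "pairwise (\<lambda>p q. disjnt {fst p<..<snd p} {fst q<..<snd q}) (r ` B)"
      unfolding pairwise_image
    proof (rule pairwiseI, rule impI)
      fix p q assume "p \<in> B" "q \<in> B" "p \<noteq> q"
      then have "{fst p<..<snd p} \<inter> {fst q<..<snd q} = {}" using D by (auto simp: B_def)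
      moreover have "{fst (r p)<..<snd (r p)} \<subseteq> {fst p<..<snd p}"
         "{fst (r q)<..<snd (r q)} \<subseteq> {fst q<..<snd q}" by (auto simp: r_def)
      ultimately show "disjnt {fst (r p)<..<snd (r p)} {fst (r q)<..<snd (r q)}"
        unfolding disjnt_def by blast
    qed
  qed
  have "family_variation f S <= (\<Sum>p\<in>S. (if fst p < x then \<bar>f (min (snd p) x) - f (fst p)\<bar> else 0) +
       (if x < snd p then \<bar>f (snd p) - f (max (fst p) x)\<bar> else 0))"
    unfolding family_variation_def
  proof (rule sum_mono)
    fix p assume "p \<in> S"
    then have "fst p < snd p" using F by blast
    then consider "snd p <= x" "fst p < x" | "x <= fst p" "x < snd p" | "fst p < x" "x < snd p" by linarith
    then show "\<bar>f (snd p) - f (fst p)\<bar> <= (if fst p < x then \<bar>f (min (snd p) x) - f (fst p)\<bar> else 0) +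
       (if x < snd p then \<bar>f (snd p) - f (max (fst p) x)\<bar> else 0)"
      by cases (auto simp: min_def max_def)
  qed
  also have "... = (\<Sum>p\<in>A. \<bar>f (min (snd p) x) - f (fst p)\<bar>) + (\<Sum>p\<in>B. \<bar>f (snd p) - f (max (fst p) x)\<bar>)"
    unfolding sum.distrib A_def B_def using fin by (simp add: sum.inter_filter)
  also have "... = family_variation f (l ` A) + family_variation f (r ` B)"
    unfolding family_variation_def by (subst (1 2) sum.reindex) (use injl injr in \<open>auto simp: l_def r_def\<close>)
  finally show ?thesis using 1 2 by blast
qed

definition total_variation :: "(real => real) => real => real => real" where
  "total_variation f a b = Sup (family_variation f ` {S. interval_family a b S})"

lemma abs_continuous_subinterval:
  assumes "abs_continuous_on_interval a b f" "a <= a'" "b' <= b"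
  shows "abs_continuous_on_interval a' b' f"
proof (rule abs_continuousI_family)
  fix e :: real assume "0 < e"
  then obtain d where "d > 0" "\<forall>S. interval_family a b S --> family_length S < d --> family_variation f S < e"
    using abs_continuous_family[OF assms(1)] by blast
  then show "\<exists>d>0. \<forall>S. interval_family a' b' S --> family_length S < d --> family_variation f S < e"
    using interval_family_mono assms by blast
qed

text \<open>
  Cut \<open>[a, b]\<close> into steps so short that the variation over each is at most 1; the number of steps
  bounds the variation over the whole interval.
\<close>

lemma abs_continuous_bounded_variation:
  assumes f: "abs_continuous_on_interval a b f" and ab: "a <= b"
  shows "bdd_above (family_variation f ` {S. interval_family a b S})"
proof -
  obtain d where d: "d > 0" and
    D: "\<And>S. interval_family a b S ==> family_length S < d ==> family_variation f S < 1"
    using abs_continuous_family[OF f, of 1] by auto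
  have bound: "\<forall>S. interval_family a (min b (a + real n * (d/2))) S --> family_variation f S <= real n" for n :: nat
  proof (induction n)
    case 0
    have "S = {}" if "interval_family a (min b (a + real 0 * (d/2))) S" for S
      using that unfolding interval_family_def by fastforce
    then have "family_variation f S = 0" if "interval_family a (min b (a + real 0 * (d/2))) S" for S
      using that unfolding family_variation_def by (metis sum.empty)
    then show ?case by simp
  next
    case (Suc n)
    define x y where "x = min b (a + real n * (d/2))" and "y = min b (a + real (Suc n) * (d/2))"
    have xy: "a <= x" "x <= y" "y - x < d" "y <= b"
      using d ab by (auto simp: x_def y_def field_simps min_def)
    show ?case
    proof (intro allI impI)
      fix S assume "interval_family a (min b (a + real (Suc n) * (d/2))) S"
      then have "interval_family a y S" by (simp add: y_def)
      then obtain S1 S2 where S: "interval_family a x S1" "interval_family x y S2"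
        "family_variation f S <= family_variation f S1 + family_variation f S2"
        using interval_family_split[of a y S x f] xy by blast
      have "family_variation f S1 <= real n" using Suc S(1) by (simp add: x_def)
      moreover have "family_variation f S2 < 1"
        using D[of S2] interval_family_mono[OF S(2)] xy family_length_le[OF S(2)] by fastforce
      ultimately show "family_variation f S <= real (Suc n)" using S(3) by simp
    qed
  qed
  obtain n :: nat where "(b - a) / (d/2) <= real n" using real_arch_simple by blast
  then have "min b (a + real n * (d/2)) = b" using d by (simp add: field_simps)
  then have "\<forall>S. interval_family a b S --> family_variation f S <= real n" using bound[of n] by simp
  then show ?thesis by (auto simp: bdd_above_def)
qed

lemma total_variation_props:
  assumes f: "abs_continuous_on_interval a b f" and xy: "a <= x" "x <= y" "y <= b"
  shows "\<bar>f y - f x\<bar> <= total_variation f x y"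
    and "total_variation f a y = total_variation f a x + total_variation f x y"
proof -
  have bd: "bdd_above (family_variation f ` {S. interval_family u v S})" if "a <= u" "u <= v" "v <= b" for u v
    using abs_continuous_bounded_variation[OF abs_continuous_subinterval[OF f that(1) that(3)] that(2)] .
  have up: "family_variation f S <= total_variation f u v" if "a <= u" "u <= v" "v <= b" "interval_family u v S" for u v S
    unfolding total_variation_def by (rule cSUP_upper) (use bd that in auto)
  have least: "total_variation f u v <= M" if "\<And>S. interval_family u v S ==> family_variation f S <= M" for u v M
    unfolding total_variation_def
  proof (rule cSUP_least)
    show "{S. interval_family u v S} \<noteq> {}" using interval_family_empty by blast
  qed (use that in auto)
  have "interval_family x y (if x < y then {(x, y)} else {})"
    by (auto simp: interval_family_def)
  from up[OF xy this] show "\<bar>f y - f x\<bar> <= total_variation f x y"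
    using xy by (cases "x < y") (auto simp: family_variation_def)
  have "total_variation f a y <= total_variation f a x + total_variation f x y"
  proof (rule least)
    fix S assume "interval_family a y S"
    then obtain S1 S2 where S: "interval_family a x S1" "interval_family x y S2"
        "family_variation f S <= family_variation f S1 + family_variation f S2"
      using interval_family_split[of a y S x f] xy by blast
    moreover have "family_variation f S1 <= total_variation f a x" using up S xy by auto
    moreover have "family_variation f S2 <= total_variation f x y" using up S xy by auto
    ultimately show "family_variation f S <= total_variation f a x + total_variation f x y" by linarith
  qed
  moreover have "total_variation f a x + total_variation f x y <= total_variation f a y"
  proof -
    have "family_variation f S + family_variation f T <= total_variation f a y"
      if ST: "interval_family a x S" "interval_family x y T" for S T
    proof -
      have "family_variation f (S \<union> T) <= total_variation f a y"
        by (rule up) (use xy interval_family_Un(1)[OF ST xy(1,2)] in auto)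
      then show ?thesis using interval_family_Un(2)[OF ST xy(1,2), where f=f] by simp
    qed
    then have "family_variation f S <= total_variation f a y - family_variation f T"
      if "interval_family a x S" "interval_family x y T" for S T
      using that by (simp add: le_diff_eq)
    then have "total_variation f a x <= total_variation f a y - family_variation f T"
      if "interval_family x y T" for T using that least by blast
    then have "family_variation f T <= total_variation f a y - total_variation f a x"
      if "interval_family x y T" for T using that by fastforce
    then have "total_variation f x y <= total_variation f a y - total_variation f a x" using least by blast
    then show ?thesis by simp
  qed
  ultimately show "total_variation f a y = total_variation f a x + total_variation f x y" by simp
qed

lemma interval_family_UN:
  assumes "interval_family a b T" "\<And>p. p \<in> T ==> interval_family (fst p) (snd p) (S p)"
  shows "interval_family a b (\<Union>p\<in>T. S p)"
    "family_length (\<Union>p\<in>T. S p) <= family_length T"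
    "family_variation f (\<Union>p\<in>T. S p) = (\<Sum>p\<in>T. family_variation f (S p))"
proof -
  have fin: "finite T" and F: "\<And>p. p \<in> T ==> a <= fst p \<and> fst p < snd p \<and> snd p <= b"
    and dT: "\<And>p q. p \<in> T ==> q \<in> T ==> p \<noteq> q ==> {fst p<..<snd p} \<inter> {fst q<..<snd q} = {}"
    using assms(1) unfolding interval_family_def pairwise_def disjnt_def by blast+
  have finS: "finite (S p)" and FS: "\<And>q. q \<in> S p ==> fst p <= fst q \<and> fst q < snd q \<and> snd q <= snd p"
    and dS: "\<And>q q'. q \<in> S p ==> q' \<in> S p ==> q \<noteq> q' ==> {fst q<..<snd q} \<inter> {fst q'<..<snd q'} = {}"
    if "p \<in> T" for p
    using assms(2)[OF that] unfolding interval_family_def pairwise_def disjnt_def by blast+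
  have cross: "{fst q<..<snd q} \<inter> {fst q'<..<snd q'} = {}" if "p \<in> T" "p' \<in> T" "p \<noteq> p'" "q \<in> S p" "q' \<in> S p'" for p p' q q'
  proof -
    have "{fst q<..<snd q} \<subseteq> {fst p<..<snd p}" "{fst q'<..<snd q'} \<subseteq> {fst p'<..<snd p'}"
      using FS[OF that(1) that(4)] FS[OF that(2) that(5)] by auto
    then show ?thesis using dT[OF that(1-3)] by blast
  qed
  show "interval_family a b (\<Union>p\<in>T. S p)"
    unfolding interval_family_def
  proof (intro conjI)
    show "finite (\<Union>p\<in>T. S p)" using fin finS by blast
    show "\<forall>q\<in>\<Union>p\<in>T. S p. a <= fst q \<and> fst q < snd q \<and> snd q <= b"
    proof
      fix q assume "q \<in> (\<Union>p\<in>T. S p)"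
      then obtain p where "p \<in> T" "q \<in> S p" by blast
      then show "a <= fst q \<and> fst q < snd q \<and> snd q <= b" using F[of p] FS[of p q] by linarith
    qed
    show "pairwise (\<lambda>p q. disjnt {fst p<..<snd p} {fst q<..<snd q}) (\<Union>p\<in>T. S p)"
      unfolding pairwise_def
    proof (intro ballI impI)
      fix q q' assume "q \<in> (\<Union>p\<in>T. S p)" "q' \<in> (\<Union>p\<in>T. S p)" and ne: "q \<noteq> q'"
      then obtain p p' where p: "p \<in> T" "q \<in> S p" "p' \<in> T" "q' \<in> S p'" by blast
      show "disjnt {fst q<..<snd q} {fst q'<..<snd q'}"
        unfolding disjnt_def using dS[of p q q'] cross[of p p' q q'] p ne by (cases "p = p'") simp_all
    qed
  qed
  have dis: "S p \<inter> S p' = {}" if pp: "p \<in> T" "p' \<in> T" "p \<noteq> p'" for p p'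
  proof (rule ccontr)
    assume "S p \<inter> S p' \<noteq> {}"
    then obtain q where q: "q \<in> S p" "q \<in> S p'" by blast
    then have "{fst q<..<snd q} = {}" using cross[OF pp q] by simp
    moreover have "fst q < snd q" using FS[OF pp(1) q(1)] by simp
    ultimately show False by (simp add: greaterThanLessThan_empty_iff)
  qed
  show "family_variation f (\<Union>p\<in>T. S p) = (\<Sum>p\<in>T. family_variation f (S p))"
    unfolding family_variation_def
    by (rule sum.UNION_disjoint) (use fin finS dis in auto)
  have "family_length (\<Union>p\<in>T. S p) = (\<Sum>p\<in>T. family_length (S p))"
    unfolding family_length_def
    by (rule sum.UNION_disjoint) (use fin finS dis in auto)
  also have "... <= (\<Sum>p\<in>T. snd p - fst p)"
    by (rule sum_mono, rule family_length_le) (use assms(2) F in \<open>auto intro: less_imp_le\<close>)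
  finally show "family_length (\<Union>p\<in>T. S p) <= family_length T" by (simp add: family_length_def)
qed

text \<open>
  Replace every interval of a short family by intervals inside it that nearly exhaust its total
  variation.  The refined family is no longer than the given one, so its variation is small.
\<close>

lemma abs_continuous_total_variation:
  assumes f: "abs_continuous_on_interval a b f"
  shows "abs_continuous_on_interval a b (total_variation f a)"
proof (rule abs_continuousI_family)
  fix e :: real assume e: "0 < e"
  obtain d where d: "d > 0" and
    D: "\<And>S. interval_family a b S ==> family_length S < d ==> family_variation f S < e/2"
    using abs_continuous_family[OF f, of "e/2"] e by auto
  have "family_variation (total_variation f a) T < e" if T: "interval_family a b T" "family_length T < d" for T
  proof -
    define c where "c = e / (2 * (real (card T) + 1))"
    have c: "c > 0" using e by (simp add: c_def add_nonneg_pos)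
    have F: "a <= fst p \<and> fst p < snd p \<and> snd p <= b" if "p \<in> T" for p
      using T(1) that unfolding interval_family_def by blast
    have "\<exists>S. interval_family (fst p) (snd p) S \<and> total_variation f (fst p) (snd p) - c < family_variation f S"
      if p: "p \<in> T" for p
    proof -
      have "bdd_above (family_variation f ` {S. interval_family (fst p) (snd p) S})"
        by (rule abs_continuous_bounded_variation[OF abs_continuous_subinterval[OF f]]) (use F[OF p] in auto)
      moreover have "{S. interval_family (fst p) (snd p) S} \<noteq> {}" using interval_family_empty by blast
      moreover have "total_variation f (fst p) (snd p) - c < Sup (family_variation f ` {S. interval_family (fst p) (snd p) S})"
        using c by (simp add: total_variation_def)
      ultimately show ?thesis using less_cSUP_iff[of "{S. interval_family (fst p) (snd p) S}" "family_variation f"] by blast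
    qed
    then obtain S where S: "\<And>p. p \<in> T ==> interval_family (fst p) (snd p) (S p)"
       "\<And>p. p \<in> T ==> total_variation f (fst p) (snd p) - c < family_variation f (S p)" by metis
    have "family_variation (total_variation f a) T = (\<Sum>p\<in>T. total_variation f (fst p) (snd p))"
      unfolding family_variation_def
    proof (rule sum.cong[OF refl])
      fix p assume "p \<in> T"
      then have "a <= fst p" "fst p <= snd p" "snd p <= b" using F[OF \<open>p \<in> T\<close>] by auto
      from total_variation_props[OF f this]
      show "\<bar>total_variation f a (snd p) - total_variation f a (fst p)\<bar> = total_variation f (fst p) (snd p)"
        by linarith
    qed
    also have "... <= (\<Sum>p\<in>T. family_variation f (S p) + c)"
      by (rule sum_mono) (use S(2) in \<open>auto simp: less_imp_le algebra_simps\<close>)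
    also have "... = family_variation f (\<Union>p\<in>T. S p) + real (card T) * c"
      using interval_family_UN(3)[of a b T S f, OF T(1) S(1)]
      by (simp add: sum.distrib)
    also have "family_variation f (\<Union>p\<in>T. S p) < e/2"
    proof (rule D)
      show "interval_family a b (\<Union>p\<in>T. S p)"
        by (rule interval_family_UN(1)[OF T(1)]) (rule S(1))
      have "family_length (\<Union>p\<in>T. S p) <= family_length T"
        by (rule interval_family_UN(2)[OF T(1)]) (rule S(1))
      then show "family_length (\<Union>p\<in>T. S p) < d" using T(2) by simp
    qed
    also have "real (card T) * c <= e/2"
      using e by (simp add: c_def field_simps)
    finally show ?thesis by simp
  qed
  then show "\<exists>d>0. \<forall>S. interval_family a b S --> family_length S < d --> family_variation (total_variation f a) S < e"
    using d by blast
qed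

text \<open>
  The density is the Radon-Nikodym derivative of the Stieltjes measure of \<open>F\<close>.  By inner regularity,
  absolute continuity of that measure has to be checked on compact null sets only.  A neighbourhood of
  small length contains all cells of a fine equidistant grid that meet such a set, and the absolute
  continuity of \<open>F\<close> bounds the mass of these cells.
\<close>

lemma mono_abs_continuous_density:
  fixes F :: "real => real"
  assumes mono: "mono F" and cont: "continuous_on UNIV F" and ab: "a < b"
    and left: "\<And>x. x <= a ==> F x = F a" and right: "\<And>x. b <= x ==> F x = F b"
    and AC: "abs_continuous_on_interval a b F"
  shows "\<exists>g. g \<in> borel_measurable borel \<and> integrable lborel g \<and>
            (\<forall>x y. x <= y --> (LINT z:{x..y}|lborel. g z) = F y - F x)"
proof -
  define \<mu> where "\<mu> = interval_measure F"
  have m: "\<And>x y. x <= y ==> F x <= F y" using mono by (auto simp: mono_def)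
  have rc: "\<And>x. continuous (at_right x) F"
    using cont by (meson UNIV_I continuous_at_imp_continuous_within continuous_on_eq_continuous_at open_UNIV)
  have sets_mu [measurable_cong]: "sets \<mu> = sets borel" by (simp add: \<mu>_def)
  have Ioc: "emeasure \<mu> {x<..y} = ennreal (F y - F x)" if "x <= y" for x y
    unfolding \<mu>_def using emeasure_interval_measure_Ioc[OF that m rc] by simp
  have Icc: "emeasure \<mu> {x..y} = ennreal (F y - F x)" if "x <= y" for x y
    unfolding \<mu>_def using emeasure_interval_measure_Icc[OF that m cont] by simp
  have n1: "emeasure \<mu> {..a} = 0"
  proof -
    have "{..a} = (\<Union>n::nat. {a - real n<..a})"
    proof (intro set_eqI iffI)
      fix x assume "x \<in> {..a}"
      moreover obtain n :: nat where "a - x < real n" using reals_Archimedean2 by blast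
      ultimately show "x \<in> (\<Union>n::nat. {a - real n<..a})" by (auto intro!: exI[of _ n])
    qed auto
    moreover have "{a - real n<..a} \<in> null_sets \<mu>" for n :: nat
      using left[of "a - real n"] Ioc[of "a - real n" a] by (simp add: null_sets_def sets_mu)
    then have "(\<Union>n::nat. {a - real n<..a}) \<in> null_sets \<mu>" by (rule null_sets_UN)
    ultimately show ?thesis by (simp add: null_sets_def)
  qed
  have n2: "emeasure \<mu> {b<..} = 0"
  proof -
    have "{b<..} = (\<Union>n::nat. {b<..b + real n})"
    proof (intro set_eqI iffI)
      fix x assume "x \<in> {b<..}"
      moreover obtain n :: nat where "x - b < real n" using reals_Archimedean2 by blast
      ultimately show "x \<in> (\<Union>n::nat. {b<..b + real n})" by (auto intro!: exI[of _ n])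
    qed auto
    moreover have "{b<..b + real n} \<in> null_sets \<mu>" for n :: nat
      using right[of "b + real n"] Ioc[of b "b + real n"] by (simp add: null_sets_def sets_mu)
    then have "(\<Union>n::nat. {b<..b + real n}) \<in> null_sets \<mu>" by (rule null_sets_UN)
    ultimately show ?thesis by (auto simp: null_sets_def)
  qed
  have space_mu: "space \<mu> = UNIV" by (simp add: \<mu>_def)
  have split: "emeasure \<mu> N <= emeasure \<mu> (N \<inter> {a<..b})" if "N \<in> sets borel" for N
  proof -
    have "emeasure \<mu> N <= emeasure \<mu> ((N \<inter> {a<..b}) \<union> ({..a} \<union> {b<..}))"
      using that by (intro emeasure_mono) (auto simp: sets_mu)
    also have "... <= emeasure \<mu> (N \<inter> {a<..b}) + emeasure \<mu> ({..a} \<union> {b<..})"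
      using that by (intro emeasure_subadditive) (auto simp: sets_mu)
    also have "emeasure \<mu> ({..a} \<union> {b<..}) <= emeasure \<mu> {..a} + emeasure \<mu> {b<..}"
      by (intro emeasure_subadditive) (auto simp: sets_mu)
    finally show ?thesis using n1 n2 by simp
  qed
  have "emeasure \<mu> UNIV <= emeasure \<mu> {a<..b}" using split[of UNIV] by simp
  then have fin: "emeasure \<mu> (space \<mu>) \<noteq> \<infinity>"
    using Ioc[of a b] ab space_mu by (auto simp: top_unique)
  have compact_null: "emeasure \<mu> K = 0"
    if K: "compact K" "K \<subseteq> {a<..b}" "K \<in> null_sets lborel" for K
  proof -
    have small: "emeasure \<mu> K <= ennreal e" if e: "0 < e" for e
    proof -
      obtain d where d: "d > 0" and
        D: "\<And>S. interval_family a b S ==> family_length S < d ==> family_variation F S < e"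
        using abs_continuous_family[OF AC e] by blast
      obtain V where V: "open V" "K \<subseteq> V" "emeasure lborel (V - K) < ennreal d"
        using outer_regular_lborel[of K d] K d by (metis null_setsD2 sets_lborel ennreal_less_zero_iff)
      have "emeasure lborel V <= emeasure lborel (V - K) + emeasure lborel K"
        using emeasure_subadditive[of "V - K" lborel K] K V(1,2) by (auto simp: Un_absorb2)
      then have Vd: "emeasure lborel V < ennreal d" using V(3) K(3) by (auto simp: null_sets_def)
      obtain r where r: "r > 0" "(\<Union>x\<in>K. ball x r) \<subseteq> V"
        using compact_subset_open_imp_ball_epsilon_subset[OF K(1) V(1,2)] by blast
      obtain n :: nat where n: "n > 0" "(b - a) / r < real n"
        using reals_Archimedean2[of "(b - a) / r"] ab r by (metis divide_pos_pos diff_gt_0_iff_gt less_trans of_nat_0_less_iff)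
      define h where "h = (b - a) / real n"
      have h: "0 < h" "h < r" "real n * h = b - a" using n ab r by (auto simp: h_def field_simps)
      define c where "c = (\<lambda>j::nat. a + real j * h)"
      have c1: "c (Suc j) = c j + h" for j by (simp add: c_def algebra_simps)
      have cm: "c i <= c j" if "i <= j" for i j using that h(1) by (simp add: c_def)
      define J where "J = {j. j < n \<and> {c j<..c (Suc j)} \<inter> K \<noteq> {}}"
      have finJ: "finite J" by (simp add: J_def)
      have inj: "inj_on (\<lambda>j. (c j, c (Suc j))) J" using h(1) by (auto simp: inj_on_def c_def)
      have disj: "{c i<..c (Suc i)} \<inter> {c j<..c (Suc j)} = {}" if "i \<noteq> j" for i j
      proof (cases "i < j")
        case True then show ?thesis using cm[of "Suc i" j] by auto
      next
        case False then show ?thesis using cm[of "Suc j" i] that by auto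
      qed
      have cells: "{c j<..c (Suc j)} \<subseteq> V" if "j \<in> J" for j
      proof
        fix x assume x: "x \<in> {c j<..c (Suc j)}"
        obtain z where z: "z \<in> K" "z \<in> {c j<..c (Suc j)}" using \<open>j \<in> J\<close> unfolding J_def by blast
        then have "dist z x < r" using x h c1[of j] by (auto simp: dist_real_def)
        then have "x \<in> ball z r" by simp
        then show "x \<in> V" using r(2) z(1) by blast
      qed
      have cover: "K \<subseteq> (\<Union>j\<in>J. {c j<..c (Suc j)})"
      proof
        fix x assume x: "x \<in> K"
        then have xab: "a < x" "x <= b" using K(2) by auto
        define j where "j = nat (\<lceil>(x - a) / h\<rceil> - 1)"
        have pos: "0 < (x - a) / h" using xab h by simp
        then have "1 <= \<lceil>(x - a) / h\<rceil>" by linarith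
        then have "real j = of_int \<lceil>(x - a) / h\<rceil> - 1" by (simp add: j_def)
        then have "real j < (x - a) / h" "(x - a) / h <= real j + 1"
          using ceiling_correct[of "(x - a) / h"] by linarith+
        then have xj: "c j < x" "x <= c (Suc j)" using h(1) by (auto simp: c_def field_simps)
        have "real j * h < real n * h" using xj(1) xab(2) h(3) by (auto simp: c_def)
        then have "j < n" using h(1) by simp
        then have "j \<in> J" using xj x by (auto simp: J_def)
        then show "x \<in> (\<Union>j\<in>J. {c j<..c (Suc j)})" using xj by auto
      qed
      define S where "S = (\<lambda>j. (c j, c (Suc j))) ` J"
      have fam: "interval_family a b S"
        unfolding interval_family_def S_def
      proof (intro conjI)
        show "finite ((\<lambda>j. (c j, c (Suc j))) ` J)" using finJ by blast
        have "c (Suc j) <= b" "a <= c j" if "j \<in> J" for j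
        proof -
          have "c (Suc j) <= c n" using that by (intro cm) (auto simp: J_def)
          then show "c (Suc j) <= b" using h(3) by (simp add: c_def)
          show "a <= c j" using h(1) by (simp add: c_def)
        qed
        then show "\<forall>p\<in>(\<lambda>j. (c j, c (Suc j))) ` J. a <= fst p \<and> fst p < snd p \<and> snd p <= b"
          using h(1) c1 by auto
        show "pairwise (\<lambda>p q. disjnt {fst p<..<snd p} {fst q<..<snd q}) ((\<lambda>j. (c j, c (Suc j))) ` J)"
          unfolding pairwise_image
        proof (rule pairwiseI, rule impI)
          fix i j assume "i \<in> J" "j \<in> J" "i \<noteq> j"
          then have "{c i<..c (Suc i)} \<inter> {c j<..c (Suc j)} = {}" using disj by blast
          moreover have "{c i<..<c (Suc i)} \<subseteq> {c i<..c (Suc i)}" "{c j<..<c (Suc j)} \<subseteq> {c j<..c (Suc j)}" by auto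
          ultimately show "disjnt {fst (c i, c (Suc i))<..<snd (c i, c (Suc i))} {fst (c j, c (Suc j))<..<snd (c j, c (Suc j))}"
            unfolding disjnt_def fst_conv snd_conv by blast
        qed
      qed
      have "ennreal (family_length S) = (\<Sum>j\<in>J. emeasure lborel {c j<..c (Suc j)})"
        unfolding family_length_def S_def using h(1) c1
        by (subst sum.reindex[OF inj]) (simp add: ennreal_mult ennreal_of_nat_eq_real_of_nat)
      also have "... = emeasure lborel (\<Union>j\<in>J. {c j<..c (Suc j)})"
        by (rule sum_emeasure) (use disj finJ in \<open>auto simp: disjoint_family_on_def\<close>)
      also have "... <= emeasure lborel V"
        by (rule emeasure_mono) (use cells V(1) in auto)
      finally have "ennreal (family_length S) < ennreal d" using Vd by simp
      then have "family_length S < d" by (meson ennreal_leI leD leI)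
      then have var: "family_variation F S < e" using D[OF fam] by blast
      have "emeasure \<mu> K <= emeasure \<mu> (\<Union>j\<in>J. {c j<..c (Suc j)})"
        by (rule emeasure_mono[OF cover]) (auto simp: sets_mu finJ)
      also have "... <= (\<Sum>j\<in>J. emeasure \<mu> {c j<..c (Suc j)})"
        by (rule emeasure_subadditive_finite) (auto simp: finJ sets_mu)
      also have "... = (\<Sum>j\<in>J. ennreal (F (c (Suc j)) - F (c j)))"
        by (rule sum.cong[OF refl], rule Ioc) (use c1 h in simp)
      also have "... = ennreal (\<Sum>j\<in>J. F (c (Suc j)) - F (c j))"
        by (rule sum_ennreal) (use m cm in auto)
      also have "(\<Sum>j\<in>J. F (c (Suc j)) - F (c j)) = family_variation F S"
        unfolding family_variation_def S_def
        by (subst sum.reindex[OF inj]) (simp add: m cm)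
      also have "ennreal (family_variation F S) <= ennreal e" using var by (intro ennreal_leI) simp
      finally show ?thesis .
    qed
    have "emeasure \<mu> K <= 0"
    proof (rule ennreal_le_epsilon)
      fix e :: real assume "0 < e"
      then show "emeasure \<mu> K <= 0 + ennreal e" using small[of e] by simp
    qed
    then show ?thesis by simp
  qed
  have ac: "absolutely_continuous lborel \<mu>"
    unfolding absolutely_continuous_def
  proof
    fix N assume N: "N \<in> null_sets (lborel :: real measure)"
    then have Nb: "N \<in> sets borel" by auto
    have "emeasure \<mu> (N \<inter> {a<..b}) = (SUP K\<in>{K. K \<subseteq> N \<inter> {a<..b} \<and> compact K}. emeasure \<mu> K)"
      by (rule inner_regular[OF sets_mu fin]) (use Nb in auto)
    also have "... <= 0"
    proof (rule SUP_least)
      fix K assume "K \<in> {K. K \<subseteq> N \<inter> {a<..b} \<and> compact K}"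
      then have K: "compact K" "K \<subseteq> {a<..b}" "K \<subseteq> N" by auto
      have "K \<in> sets lborel" using K(1) by (simp add: compact_imp_closed)
      then have "K \<in> null_sets lborel" using N K(3) null_sets_subset by blast
      then show "emeasure \<mu> K <= 0" using compact_null K by simp
    qed
    finally have "emeasure \<mu> N <= 0" using split[OF Nb] by (metis order_trans)
    then show "N \<in> null_sets \<mu>" using Nb by (auto simp: null_sets_def sets_mu)
  qed
  obtain f where f [measurable]: "f \<in> borel_measurable lborel" and dens: "density lborel f = \<mu>"
    using sigma_finite_measure.Radon_Nikodym[OF sigma_finite_lborel ac] sets_mu by auto
  have fin_f: "(\<integral>\<^sup>+x. f x \<partial>lborel) = emeasure \<mu> UNIV"
    unfolding dens[symmetric] by (subst emeasure_density) auto
  then have AEf: "AE x in lborel. f x \<noteq> \<infinity>"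
    using fin space_mu by (intro nn_integral_PInf_AE) auto
  define g where "g = (\<lambda>x. enn2real (f x))"
  have g [measurable]: "g \<in> borel_measurable borel" unfolding g_def by measurable
  have gf: "AE x in lborel. ennreal (g x) = f x"
    using AEf by eventually_elim (auto simp: g_def top.not_eq_extremum)
  have int: "integrable lborel g"
  proof (rule integrableI_nonneg)
    have "(\<integral>\<^sup>+x. ennreal (g x) \<partial>lborel) = (\<integral>\<^sup>+x. f x \<partial>lborel)"
      by (rule nn_integral_cong_AE[OF gf])
    then show "(\<integral>\<^sup>+x. ennreal (g x) \<partial>lborel) < \<infinity>"
      using fin_f fin space_mu by (simp add: top.not_eq_extremum)
  qed (auto simp: g_def)
  have "(LINT z:{x..y}|lborel. g z) = F y - F x" if "x <= y" for x y
  proof -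
    have "(LINT z:{x..y}|lborel. g z) = enn2real (\<integral>\<^sup>+z. ennreal (indicator {x..y} z *\<^sub>R g z) \<partial>lborel)"
      unfolding set_lebesgue_integral_def by (rule integral_eq_nn_integral) (auto simp: g_def)
    also have "(\<integral>\<^sup>+z. ennreal (indicator {x..y} z *\<^sub>R g z) \<partial>lborel) = (\<integral>\<^sup>+z. f z * indicator {x..y} z \<partial>lborel)"
      by (rule nn_integral_cong_AE) (use gf in eventually_elim, auto simp: indicator_def)
    also have "... = emeasure \<mu> {x..y}"
      unfolding dens[symmetric] by (subst emeasure_density) auto
    finally show ?thesis using Icc[OF that] m[OF that] by simp
  qed
  then show ?thesis using g int by blast
qed

text \<open>
  \<open>F\<close> is an indefinite integral of \<open>f\<close>.  As a relation between everywhere defined functions it can be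
  added, multiplied, composed and glued without tracking exceptional sets.
\<close>

definition has_density :: "(real => real) => (real => real) => bool" where
  "has_density F f \<longleftrightarrow> f \<in> borel_measurable borel \<and> (\<forall>a b. set_integrable lborel {a..b} f) \<and>
     (\<forall>a b. a <= b --> (LINT x:{a..b}|lborel. f x) = F b - F a)"

section \<open>Indefinite integrals and their calculus\<close>

lemma abs_continuous_dominated:
  assumes g: "abs_continuous_on_interval a b g" and L: "0 <= L"
    and le: "\<And>x y. a <= x ==> x <= y ==> y <= b ==> \<bar>f y - f x\<bar> <= L * \<bar>g y - g x\<bar>"
  shows "abs_continuous_on_interval a b f"
proof (rule abs_continuousI_family)
  fix e :: real assume e: "0 < e"
  then obtain d where d: "d > 0" "\<And>S. interval_family a b S ==> family_length S < d ==> family_variation g S < e / (L + 1)"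
    using abs_continuous_family[OF g, of "e / (L + 1)"] L by auto
  have "family_variation f S < e" if S: "interval_family a b S" "family_length S < d" for S
  proof -
    have "family_variation f S <= (\<Sum>p\<in>S. L * \<bar>g (snd p) - g (fst p)\<bar>)"
      unfolding family_variation_def
      by (rule sum_mono, rule le) (use S in \<open>auto simp: interval_family_def less_imp_le\<close>)
    also have "... = L * family_variation g S" by (simp add: family_variation_def sum_distrib_left)
    also have "... <= L * (e / (L + 1))" using d(2)[OF S] L by (intro mult_left_mono) auto
    also have "... < e" using e L by (simp add: field_simps)
    finally show ?thesis .
  qed
  then show "\<exists>d>0. \<forall>S. interval_family a b S --> family_length S < d --> family_variation f S < e"
    using d(1) by blast
qed

lemma abs_continuous_imp_continuous:
  assumes f: "abs_continuous_on_interval a b f"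
  shows "continuous_on {a..b} f"
  unfolding continuous_on_iff
proof (intro ballI allI impI)
  fix x e :: real assume x: "x \<in> {a..b}" and e: "0 < e"
  obtain d where d: "d > 0" "\<And>S. interval_family a b S ==> family_length S < d ==> family_variation f S < e"
    using abs_continuous_family[OF f e] by blast
  have "dist (f y) (f x) < e" if y: "y \<in> {a..b}" "dist y x < d" for y
  proof -
    define S where "S = (if x < y then {(x, y)} else if y < x then {(y, x)} else {})"
    have "interval_family a b S" using x y by (auto simp: S_def interval_family_def)
    moreover have "family_length S < d" using y d by (auto simp: S_def family_length_def dist_real_def)
    ultimately have "family_variation f S < e" using d(2) by blast
    then show ?thesis using e by (auto simp: S_def family_variation_def dist_real_def split: if_splits)
  qed
  then show "\<exists>d>0. \<forall>y\<in>{a..b}. dist y x < d --> dist (f y) (f x) < e" using d(1) by blast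
qed

text \<open>
  Jordan decomposition: with \<open>V\<close> the total variation, \<open>f = V - (V - f)\<close>, and both parts are
  nondecreasing with increments at most twice those of \<open>V\<close>.  Clamping the argument extends \<open>f\<close> by
  constants, so that one density serves the whole line.
\<close>

lemma abs_continuous_density:
  fixes f :: "real => real"
  assumes f: "abs_continuous_on_interval a b f" and ab: "a < b"
  shows "\<exists>g. integrable lborel g \<and> has_density (\<lambda>x. f (max a (min b x))) g"
proof -
  define c where "c = (\<lambda>x. max a (min b x))"
  have c: "a <= c x" "c x <= b" for x using ab by (auto simp: c_def)
  have cm: "c x <= c y" if "x <= y" for x y using that by (auto simp: c_def)
  have cc: "continuous_on UNIV c" unfolding c_def by (intro continuous_intros)
  have cid: "c x = x" if "a <= x" "x <= b" for x using that by (auto simp: c_def)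
  define V where "V = total_variation f a"
  have V: "\<bar>f y - f x\<bar> <= V y - V x" if "a <= x" "x <= y" "y <= b" for x y
    using total_variation_props[OF f that] by (simp add: V_def)
  have VAC: "abs_continuous_on_interval a b V" unfolding V_def by (rule abs_continuous_total_variation[OF f])
  have *: "\<exists>g. g \<in> borel_measurable borel \<and> integrable lborel g \<and>
            (\<forall>x y. x <= y --> (LINT z:{x..y}|lborel. g z) = h (c y) - h (c x))"
    if h: "\<And>x y. a <= x ==> x <= y ==> y <= b ==> h x <= h y \<and> h y - h x <= 2 * (V y - V x)" for h
  proof -
    have hAC: "abs_continuous_on_interval a b h"
      by (rule abs_continuous_dominated[OF VAC, of 2]) (use h in force)+
    have hcAC: "abs_continuous_on_interval a b (\<lambda>x. h (c x))"
      by (rule abs_continuous_dominated[OF hAC, of 1]) (simp_all add: cid)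
    show ?thesis
    proof (rule mono_abs_continuous_density[OF _ _ ab _ _ hcAC])
      show "mono (\<lambda>x. h (c x))" using h c cm by (intro monoI) blast
      show "continuous_on UNIV (\<lambda>x. h (c x))"
        by (rule continuous_on_compose2[OF abs_continuous_imp_continuous[OF hAC] cc]) (use c in auto)
    qed (use ab in \<open>auto simp: c_def\<close>)
  qed
  obtain g1 where g1: "g1 \<in> borel_measurable borel" "integrable lborel g1"
      "\<And>x y. x <= y ==> (LINT z:{x..y}|lborel. g1 z) = V (c y) - V (c x)"
  proof -
    have "V x <= V y \<and> V y - V x <= 2 * (V y - V x)" if "a <= x" "x <= y" "y <= b" for x y
    proof -
      have "0 <= V y - V x" by (rule order_trans[OF abs_ge_zero V[OF that]])
      then show ?thesis by simp
    qed
    from *[OF this] show thesis using that by blast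
  qed
  have hyp2: "V x - f x <= V y - f y \<and> (V y - f y) - (V x - f x) <= 2 * (V y - V x)"
    if "a <= x" "x <= y" "y <= b" for x y
    using V[OF that] by (auto simp: abs_le_iff)
  obtain g2 where g2: "g2 \<in> borel_measurable borel" "integrable lborel g2"
      "\<And>x y. x <= y ==> (LINT z:{x..y}|lborel. g2 z) = (V (c y) - f (c y)) - (V (c x) - f (c x))"
    using *[of "\<lambda>x. V x - f x", OF hyp2] by blast
  have si: "set_integrable lborel {x..y} g1" "set_integrable lborel {x..y} g2" for x y
    using g1 g2 by (auto simp: set_integrable_def intro!: integrable_mult_indicator[where 'b=real, simplified real_scaleR_def])
  have "has_density (\<lambda>x. f (c x)) (\<lambda>x. g1 x - g2 x)"
    unfolding has_density_def
    using g1 g2 si by (auto simp: set_integral_diff)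
  then show ?thesis using g1 g2 by (auto simp: c_def)
qed

lemma has_density_integral_HK:
  assumes "has_density F f" "a <= b"
  shows "(f has_integral (F b - F a)) {a..b}"
proof -
  have "set_integrable lborel {a..b} f" using assms by (simp add: has_density_def)
  from set_borel_integral_eq_integral[OF this] show ?thesis
    using assms by (simp add: has_density_def has_integral_iff)
qed

text \<open>
  Lebesgue's differentiation theorem.  Around every point where the difference quotient misses \<open>f x\<close>
  by more than a fixed amount there are arbitrarily short intervals on which the increment of \<open>F\<close> is
  wrong by a fixed proportion of the length.  Vitali's theorem selects disjoint ones that cover almost
  all such points, and Henstock's lemma bounds the sum of the errors, hence the total length.
\<close>

theorem has_density_AE_derivative:
  assumes Ff: "has_density F f"
  shows "AE x in lborel. (F has_real_derivative f x) (at x)"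
proof -
  define S where "S = (\<lambda>n k :: nat. {x \<in> {- real n<..<real n}. \<forall>d>0. \<exists>y. y \<noteq> x \<and> \<bar>y - x\<bar> < d \<and>
      \<bar>y - x\<bar> / real (Suc k) < \<bar>F y - F x - f x * (y - x)\<bar>})"
  have negl: "negligible (S n k)" for n k
    unfolding negligible_outer_le
  proof (intro allI impI)
    fix e :: real assume e: "0 < e"
    define a b where "a = - real n" and "b = real n"
    have int: "f integrable_on cbox a b"
      using has_density_integral_HK[OF Ff, of a b] by (auto simp: a_def b_def)
    obtain \<gamma> where g: "gauge \<gamma>" and
      G: "\<And>p. [|p tagged_partial_division_of (cbox a b); \<gamma> fine p|] ==>
             sum (\<lambda>(x,k). norm(measure lborel k *\<^sub>R f x - integral k f)) p < e / real (Suc k)"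
    proof (rule Henstock_lemma[OF int, of "e / real (Suc k)"])
      show "0 < e / real (Suc k)" using e by simp
    qed (use that in blast)
    define I where "I = (\<lambda>p::real\<times>real. {min (fst p) (snd p)..max (fst p) (snd p)})"
    define K where "K = {p. fst p \<in> S n k \<and> snd p \<noteq> fst p \<and> I p \<subseteq> \<gamma> (fst p) \<inter> {a<..<b} \<and>
       \<bar>snd p - fst p\<bar> / real (Suc k) < \<bar>F (snd p) - F (fst p) - f (fst p) * (snd p - fst p)\<bar>}"
    define cen where "cen = (\<lambda>p::real\<times>real. (fst p + snd p) / 2)"
    define rad where "rad = (\<lambda>p::real\<times>real. \<bar>snd p - fst p\<bar> / 2)"
    have cb: "cball (cen p) (rad p) = I p" for p
      by (auto simp: cball_eq_atLeastAtMost cen_def rad_def I_def min_def max_def field_simps abs_if)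
    obtain C where C: "countable C" "C \<subseteq> K"
     "pairwise (\<lambda>i j. disjnt (cball (cen i) (rad i)) (cball (cen j) (rad j))) C"
     "negligible (S n k - (\<Union>i \<in> C. cball (cen i) (rad i)))"
    proof (rule Vitali_covering_theorem_cballs[of K rad "S n k" cen])
      show "0 < rad i" if "i \<in> K" for i using that by (auto simp: K_def rad_def)
      show "\<exists>i. i \<in> K \<and> x \<in> cball (cen i) (rad i) \<and> rad i < d" if x: "x \<in> S n k" and d: "0 < d" for x d
      proof -
        have "open (\<gamma> x \<inter> {a<..<b})" "x \<in> \<gamma> x \<inter> {a<..<b}"
          using g x by (auto simp: gauge_def S_def a_def b_def)
        then obtain r where r: "r > 0" "cball x r \<subseteq> \<gamma> x \<inter> {a<..<b}" using open_contains_cball by metis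
        obtain y where y: "y \<noteq> x" "\<bar>y - x\<bar> < min d r" "\<bar>y - x\<bar> / real (Suc k) < \<bar>F y - F x - f x * (y - x)\<bar>"
        proof -
          have "\<forall>d>0. \<exists>y. y \<noteq> x \<and> \<bar>y - x\<bar> < d \<and> \<bar>y - x\<bar> / real (Suc k) < \<bar>F y - F x - f x * (y - x)\<bar>"
            using x unfolding S_def by blast
          moreover have "min d r > 0" using d r(1) by simp
          ultimately show thesis using that by blast
        qed
        have "I (x, y) \<subseteq> cball x r" using y by (auto simp: I_def cball_eq_atLeastAtMost)
        then have "(x, y) \<in> K" using r y x by (auto simp: K_def)
        moreover have "x \<in> cball (cen (x, y)) (rad (x, y))" unfolding cb by (simp add: I_def)
        moreover have "rad (x, y) < d" using y d by (simp add: rad_def)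
        ultimately show ?thesis by blast
      qed
    qed (use that in blast)
    have meas: "measure lebesgue (\<Union>p\<in>D. I p) <= e" if D: "D \<subseteq> C" "finite D" for D
    proof -
      have DK: "p \<in> K" if "p \<in> D" for p using that D C by blast
      have disj: "I p \<inter> I q = {}" if "p \<in> D" "q \<in> D" "p \<noteq> q" for p q
        using C(3) D that unfolding cb pairwise_def disjnt_def by blast
      have fstI: "fst p \<in> I p" for p by (simp add: I_def)
      have inj: "inj_on (\<lambda>p. (fst p, I p)) D"
      proof (rule inj_onI, rule ccontr)
        fix p q assume pq: "p \<in> D" "q \<in> D" "(fst p, I p) = (fst q, I q)" "p \<noteq> q"
        then show False using disj[of p q] fstI[of p] by auto
      qed
      define P where "P = (\<lambda>p. (fst p, I p)) ` D"
      have "P tagged_partial_division_of (cbox a b)"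
        unfolding tagged_partial_division_of_def
      proof (intro conjI allI impI)
        show "finite P" using D by (simp add: P_def)
        fix x J assume xJ: "(x, J) \<in> P"
        then obtain p where p: "p \<in> D" "x = fst p" "J = I p" by (auto simp: P_def)
        show "x \<in> J" using p fstI by simp
        show "J \<subseteq> cbox a b" using DK[OF p(1)] p by (auto simp: K_def)
        show "\<exists>u v. J = cbox u v" using p by (auto simp: I_def)
      next
        fix x1 J1 x2 J2
        assume "(x1, J1) \<in> P \<and> (x2, J2) \<in> P \<and> (x1, J1) \<noteq> (x2, J2)"
        then obtain p q where "p \<in> D" "q \<in> D" "p \<noteq> q" "J1 = I p" "J2 = I q" by (auto simp: P_def)
        then show "interior J1 \<inter> interior J2 = {}" using disj[of p q] interior_subset by blast
      qed
      moreover have "\<gamma> fine P" unfolding fine_def P_def using DK by (auto simp: K_def)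
      ultimately have "sum (\<lambda>(x,J). norm(measure lborel J *\<^sub>R f x - integral J f)) P < e / real (Suc k)" by (rule G)
      moreover have "sum (\<lambda>(x,J). norm(measure lborel J *\<^sub>R f x - integral J f)) P =
          (\<Sum>p\<in>D. \<bar>F (snd p) - F (fst p) - f (fst p) * (snd p - fst p)\<bar>)"
        unfolding P_def
      proof (subst sum.reindex[OF inj], rule sum.cong[OF refl])
        fix p assume "p \<in> D"
        have "integral (I p) f = F (max (fst p) (snd p)) - F (min (fst p) (snd p))"
          unfolding I_def by (rule integral_unique[OF has_density_integral_HK[OF Ff]]) auto
        moreover have "measure lborel (I p) = \<bar>snd p - fst p\<bar>" by (auto simp: I_def)
        moreover have "\<bar>F (snd p) - F (fst p) - f (fst p) * (snd p - fst p)\<bar> =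
           \<bar>\<bar>snd p - fst p\<bar> * f (fst p) - (F (max (fst p) (snd p)) - F (min (fst p) (snd p)))\<bar>"
          by (cases "fst p <= snd p") (simp_all add: min_def max_def algebra_simps)
        ultimately show "((\<lambda>(x, J). norm (measure lborel J *\<^sub>R f x - integral J f)) \<circ> (\<lambda>p. (fst p, I p))) p =
          \<bar>F (snd p) - F (fst p) - f (fst p) * (snd p - fst p)\<bar>"
          by simp
      qed
      moreover have "(\<Sum>p\<in>D. \<bar>snd p - fst p\<bar> / real (Suc k)) <=
          (\<Sum>p\<in>D. \<bar>F (snd p) - F (fst p) - f (fst p) * (snd p - fst p)\<bar>)"
        by (rule sum_mono) (use DK in \<open>auto simp: K_def less_imp_le\<close>)
      ultimately have "(\<Sum>p\<in>D. \<bar>snd p - fst p\<bar>) / real (Suc k) < e / real (Suc k)"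
        by (simp add: sum_divide_distrib)
      then have "(\<Sum>p\<in>D. \<bar>snd p - fst p\<bar>) < e" by (simp add: divide_less_cancel)
      moreover have "measure lebesgue (\<Union>p\<in>D. I p) <= (\<Sum>p\<in>D. measure lebesgue (I p))"
        by (rule measure_UNION_le) (use D in \<open>auto simp: I_def\<close>)
      moreover have "measure lebesgue (I p) = \<bar>snd p - fst p\<bar>" for p by (auto simp: I_def)
      ultimately show ?thesis by simp
    qed
    have Imeas: "I p \<in> lmeasurable" for p by (auto simp: I_def)
    have U: "(\<Union>p\<in>C. I p) \<in> lmeasurable" "measure lebesgue (\<Union>p\<in>C. I p) <= e"
      using fmeasurable_UN_bound[OF C(1) Imeas, where B=e] measure_UN_bound[OF C(1) Imeas, where B=e] meas by auto
    let ?N = "S n k - (\<Union>p\<in>C. I p)"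
    have N: "?N \<in> lmeasurable" "measure lebesgue ?N = 0"
      using C(4) unfolding cb by (auto simp: negligible_iff_measure)
    have "measure lebesgue ((\<Union>p\<in>C. I p) \<union> ?N) <= e"
      using measure_Un_le[of "\<Union>p\<in>C. I p" lebesgue ?N] U N by (auto simp: fmeasurable_def)
    then show "\<exists>T. S n k \<subseteq> T \<and> T \<in> lmeasurable \<and> measure lebesgue T <= e"
      using fmeasurable.Un[OF U(1) N(1)] by (intro exI[of _ "(\<Union>p\<in>C. I p) \<union> ?N"]) auto
  qed
  have "negligible (\<Union>n. \<Union>k. S n k)"
    by (intro negligible_countable_Union countable_image) (auto intro!: negligible_countable_Union negl)
  then have "AE x in lebesgue. x \<notin> (\<Union>n. \<Union>k. S n k)"
    by (metis AE_not_in completion.complete_sets_sandwich_fmeasurable negligible_iff_null_sets)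
  then have "AE x in lebesgue. (F has_real_derivative f x) (at x)"
  proof eventually_elim
    case (elim x)
    obtain n :: nat where n: "\<bar>x\<bar> < real n" using reals_Archimedean2 by blast
    have "\<exists>d>0. \<forall>y. 0 < \<bar>y - x\<bar> \<and> \<bar>y - x\<bar> < d --> \<bar>(F y - F x) / (y - x) - f x\<bar> < e" if e: "e > 0" for e
    proof -
      obtain k where k: "1 / real (Suc k) < e" using nat_approx_posE[OF e] by blast
      have "x \<notin> S n k" using elim by blast
      then obtain d where d: "d > 0" "\<And>y. y \<noteq> x ==> \<bar>y - x\<bar> < d ==>
          \<bar>F y - F x - f x * (y - x)\<bar> <= \<bar>y - x\<bar> / real (Suc k)"
      proof -
        have "x \<in> {- real n<..<real n}" using n by auto
        with \<open>x \<notin> S n k\<close> have "\<exists>d>0. \<forall>y. \<not> (y \<noteq> x \<and> \<bar>y - x\<bar> < d \<and>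
          \<bar>y - x\<bar> / real (Suc k) < \<bar>F y - F x - f x * (y - x)\<bar>)"
          unfolding S_def by blast
        then show thesis using that not_less by blast
      qed
      have "\<bar>(F y - F x) / (y - x) - f x\<bar> < e" if y: "0 < \<bar>y - x\<bar>" "\<bar>y - x\<bar> < d" for y
      proof -
        have ne: "y \<noteq> x" using y by auto
        have "(F y - F x) / (y - x) - f x = (F y - F x - f x * (y - x)) / (y - x)"
          using ne by (simp add: field_simps)
        then have "\<bar>(F y - F x) / (y - x) - f x\<bar> = \<bar>F y - F x - f x * (y - x)\<bar> / \<bar>y - x\<bar>" by simp
        also have "... <= 1 / real (Suc k)" using d(2)[OF ne y(2)] y(1) by (simp add: divide_le_eq mult.commute)
        finally show ?thesis using k by simp
      qed
      then show ?thesis using d(1) by blast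
    qed
    then show "(F has_real_derivative f x) (at x)"
      unfolding has_field_derivative_iff LIM_eq by simp
  qed
  then show ?thesis using AE_completion_iff by blast
qed

lemma has_density_borel: "has_density F f ==> f \<in> borel_measurable borel"
  by (simp add: has_density_def)

lemma has_density_integrable: "has_density F f ==> set_integrable lborel {a..b} f"
  by (simp add: has_density_def)

lemma has_density_integral: "has_density F f ==> a <= b ==> (LINT x:{a..b}|lborel. f x) = F b - F a"
  by (simp add: has_density_def)

lemma has_density_cong_AE:
  assumes F: "has_density F f" and g: "g \<in> borel_measurable borel" and ae: "AE x in lborel. f x = g x"
  shows "has_density F g"
proof -
  have [measurable]: "f \<in> borel_measurable borel" using F by (rule has_density_borel)
  note g [measurable]
  have "set_integrable lborel {a..b} g" for a b
    using has_density_integrable[OF F, of a b] unfolding set_integrable_def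
    by (rule Bochner_Integration.integrable_cong_AE_imp) (use ae in \<open>auto elim!: eventually_mono\<close>)
  moreover have "(LINT x:{a..b}|lborel. g x) = (LINT x:{a..b}|lborel. f x)" for a b
    unfolding set_lebesgue_integral_def
    by (rule integral_cong_AE) (use ae in \<open>auto elim!: eventually_mono\<close>)
  ultimately show ?thesis using F g by (simp add: has_density_def)
qed

lemma has_density_const [intro]: "has_density (\<lambda>x. c) (\<lambda>x. 0)"
  by (simp add: has_density_def set_integrable_def set_lebesgue_integral_def)

lemma has_density_add:
  "has_density F f ==> has_density G g ==> has_density (\<lambda>x. F x + G x) (\<lambda>x. f x + g x)"
  by (auto simp: has_density_def set_integral_add)

lemma has_density_cmult: "has_density F f ==> has_density (\<lambda>x. c * F x) (\<lambda>x. c * f x)"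
  by (auto simp: has_density_def right_diff_distrib)

lemma has_density_diff:
  "has_density F f ==> has_density G g ==> has_density (\<lambda>x. F x - G x) (\<lambda>x. f x - g x)"
  by (auto simp: has_density_def set_integral_diff)

lemma has_density_shift:
  assumes "has_density F f"
  shows "has_density (\<lambda>x. F (x + c)) (\<lambda>x. f (x + c))"
proof -
  have [measurable]: "f \<in> borel_measurable borel" using assms by (rule has_density_borel)
  have eq: "indicator {a..b} x *\<^sub>R f (x + c) = indicator {a + c..b + c} (c + 1 * x) *\<^sub>R f (c + 1 * x)" for a b x :: real
    by (auto simp: indicator_def add.commute)
  have "set_integrable lborel {a..b} (\<lambda>x. f (x + c))" for a b
    unfolding set_integrable_def eq
    using has_density_integrable[OF assms, of "a + c" "b + c"] unfolding set_integrable_def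
    by (intro lborel_integrable_real_affine) auto
  moreover have "(LINT x:{a..b}|lborel. f (x + c)) = (LINT x:{a + c..b + c}|lborel. f x)" for a b
    unfolding set_lebesgue_integral_def eq
    by (subst lborel_integral_real_affine[of 1 _ c]) auto
  moreover have "(\<lambda>x. f (x + c)) \<in> borel_measurable borel" by measurable
  ultimately show ?thesis using has_density_integral[OF assms] by (simp add: has_density_def)
qed

lemma set_integral_Icc_split:
  fixes f :: "real => real"
  assumes 1: "set_integrable lborel {a..b} f" and 2: "set_integrable lborel {b..c} f" and ab: "a <= b" "b <= c"
  shows "set_integrable lborel {a..c} f"
    "(LINT x:{a..c}|lborel. f x) = (LINT x:{a..b}|lborel. f x) + (LINT x:{b..c}|lborel. f x)"
proof -
  have un: "{a..c} = {a..b} \<union> {b..c}" using ab by auto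
  show "set_integrable lborel {a..c} f"
    unfolding un by (rule set_integrable_Un[OF 1 2]) auto
  have "AE x in lborel. x \<noteq> b" by (rule AE_lborel_singleton)
  then have "AE x in lborel. \<not> (x \<in> {a..b} \<and> x \<in> {b..c})" by eventually_elim auto
  then show "(LINT x:{a..c}|lborel. f x) = (LINT x:{a..b}|lborel. f x) + (LINT x:{b..c}|lborel. f x)"
    unfolding un by (rule set_integral_Un_AE) (use 1 2 in auto)
qed

text \<open>
  Indefinite integrals on consecutive cells of length 1 fit together, by additivity of the integral.
  Periodic functions are built cell by cell in this way.
\<close>

lemma has_density_glue:
  assumes f: "f \<in> borel_measurable borel"
    and cell: "\<And>(n::int) a b. c + of_int n <= a ==> a <= b ==> b <= c + of_int n + 1 ==>
        set_integrable lborel {a..b} f \<and> (LINT x:{a..b}|lborel. f x) = F b - F a"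
  shows "has_density F f"
proof -
  define R where "R = (\<lambda>a b. a <= b \<and> set_integrable lborel {a..b} f \<and> (LINT x:{a..b}|lborel. f x) = F b - F a)"
  have trans: "R a c" if "R a b" "R b c" for a b c
    using that set_integral_Icc_split[of a b f c] unfolding R_def by auto
  have cellR: "R a b" if "c + of_int n <= a" "a <= b" "b <= c + of_int n + 1" for n a b
    using cell[OF that] that(2) by (simp add: R_def)
  have main: "\<forall>a b. a <= b --> b <= a + real n --> R a b" for n :: nat
  proof (induction n)
    case 0
    have "R a a" for a
      by (rule cellR[of "\<lfloor>a - c\<rfloor>"]) linarith+
    then show ?case by (auto dest: order.antisym)
  next
    case (Suc n)
    show ?case
    proof (intro allI impI)
      fix a b assume ab: "a <= b" "b <= a + real (Suc n)"
      define m where "m = c + of_int \<lfloor>a - c\<rfloor> + 1"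
      have m: "a <= m" "m <= a + 1" unfolding m_def by linarith+
      have am: "R a z" if "a <= z" "z <= m" for z
        by (rule cellR[of "\<lfloor>a - c\<rfloor>"]) (use that in \<open>simp_all add: m_def, linarith\<close>)
      have mz: "R m z" if "m <= z" "z <= m + 1" for z
        by (rule cellR[of "\<lfloor>a - c\<rfloor> + 1"]) (use that in \<open>simp_all add: m_def\<close>)
      show "R a b"
      proof (cases "b <= m")
        case True then show ?thesis using am ab by simp
      next
        case b: False
        show ?thesis
        proof (cases "b <= a + 1")
          case True then show ?thesis using trans[OF am[of m] mz[of b]] m b by simp
        next
          case False
          have "R a (a + 1)" using trans[OF am[of m] mz[of "a + 1"]] m by simp
          moreover have "R (a + 1) b" using Suc ab False by simp
          ultimately show ?thesis by (rule trans)
        qed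
      qed
    qed
  qed
  have R: "R a b" if "a <= b" for a b
  proof -
    obtain n :: nat where "b - a <= real n" using real_arch_simple by blast
    then show ?thesis using main[of n] that by (simp add: algebra_simps)
  qed
  have "set_integrable lborel {a..b} f" for a b
    using R[of a b] by (cases "a <= b") (auto simp: R_def set_integrable_def)
  then show ?thesis using f R by (auto simp: has_density_def R_def)
qed

lemma has_density_periodic_extension:
  assumes Ff: "has_density F f" and per: "F 0 = F 1"
  shows "has_density (\<lambda>x. F (frac (x - c))) (\<lambda>x. f (frac (x - c)))"
proof (rule has_density_glue[where c=c])
  have fm [measurable]: "f \<in> borel_measurable borel" using Ff by (rule has_density_borel)
  show meas: "(\<lambda>x. f (frac (x - c))) \<in> borel_measurable borel"
    unfolding frac_def by measurable
  fix n :: int and a b :: real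
  assume ab: "c + of_int n <= a" "a <= b" "b <= c + of_int n + 1"
  let ?s = "- (c + of_int n)"
  have sh: "has_density (\<lambda>x. F (x + ?s)) (\<lambda>x. f (x + ?s))" by (rule has_density_shift[OF Ff])
  have fr: "frac (x - c) = (if x = c + of_int n + 1 then 0 else x + ?s)" if "c + of_int n <= x" "x <= c + of_int n + 1" for x
  proof (cases "x = c + of_int n + 1")
    case True then show ?thesis by (simp add: frac_def)
  next
    case False
    then have "\<lfloor>x - c\<rfloor> = n" using that by linarith
    then show ?thesis using False by (simp add: frac_def)
  qed
  have Feq: "F (frac (x - c)) = F (x + ?s)" if "c + of_int n <= x" "x <= c + of_int n + 1" for x
    using fr[OF that] per by auto
  have "AE x in lborel. x \<noteq> c + of_int n + 1" by (rule AE_lborel_singleton)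
  then have ae: "AE x in lborel. indicator {a..b} x *\<^sub>R f (x + ?s) = indicator {a..b} x *\<^sub>R f (frac (x - c))"
    by eventually_elim (use ab fr in \<open>auto simp: indicator_def\<close>)
  have m1: "(\<lambda>x. indicator {a..b} x *\<^sub>R f (frac (x - c))) \<in> borel_measurable lborel"
    using meas by simp
  have m2: "(\<lambda>x. indicator {a..b} x *\<^sub>R f (x + ?s)) \<in> borel_measurable lborel" by simp
  have "set_integrable lborel {a..b} (\<lambda>x. f (frac (x - c)))"
    using has_density_integrable[OF sh, of a b] unfolding set_integrable_def
    by (rule Bochner_Integration.integrable_cong_AE_imp[OF _ m1]) (use ae in \<open>auto elim!: eventually_mono\<close>)
  moreover have "(LINT x:{a..b}|lborel. f (frac (x - c))) = (LINT x:{a..b}|lborel. f (x + ?s))"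
    unfolding set_lebesgue_integral_def
    by (rule integral_cong_AE[OF m1 m2]) (use ae in \<open>auto elim!: eventually_mono\<close>)
  ultimately show "set_integrable lborel {a..b} (\<lambda>x. f (frac (x - c))) \<and>
    (LINT x:{a..b}|lborel. f (frac (x - c))) = F (frac (b - c)) - F (frac (a - c))"
    using has_density_integral[OF sh ab(2)] Feq[of a] Feq[of b] ab by simp
qed

lemma has_density_indefinite_integral:
  fixes f :: "real => real"
  assumes f: "integrable lborel f"
  shows "has_density (\<lambda>x. LINT z:{..x}|lborel. f z) f"
proof -
  have si: "set_integrable lborel A f" if "A \<in> sets borel" for A
    using that integrable_mult_indicator[OF _ f, of A] by (simp add: set_integrable_def)
  have "(LINT x:{a..b}|lborel. f x) = (LINT z:{..b}|lborel. f z) - (LINT z:{..a}|lborel. f z)" if "a <= b" for a b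
  proof -
    have un: "{..b} = {..a} \<union> {a..b}" using that by auto
    have "AE x in lborel. x \<noteq> a" by (rule AE_lborel_singleton)
    then have "AE x in lborel. \<not> (x \<in> {..a} \<and> x \<in> {a..b})" by eventually_elim auto
    then have "(LINT z:{..b}|lborel. f z) = (LINT z:{..a}|lborel. f z) + (LINT x:{a..b}|lborel. f x)"
      unfolding un by (rule set_integral_Un_AE) (use si in auto)
    then show ?thesis by simp
  qed
  then show ?thesis using f si by (auto simp: has_density_def)
qed

text \<open>
  Truncate \<open>f\<close> at a high level: the bounded part has a Lipschitz primitive, and the rest has a small
  integral.
\<close>

lemma has_density_abs_continuous:
  assumes Ff: "has_density F f"
  shows "abs_continuous_on_interval a b F"
proof (cases "a <= b")
  case False
  then have "interval_family a b S ==> S = {}" for S unfolding interval_family_def by fastforce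
  then have "family_variation F S = 0" if "interval_family a b S" for S
    using that unfolding family_variation_def by (metis sum.empty)
  then show ?thesis
    by (intro abs_continuousI_family) (auto intro!: exI[of _ "1::real"])
next
  case ab: True
  have [measurable]: "f \<in> borel_measurable borel" using Ff by (rule has_density_borel)
  have fi: "set_integrable lborel {a..b} f" using Ff by (rule has_density_integrable)
  define g where "g = (\<lambda>n::nat. \<lambda>x. indicator {a..b} x * max 0 (\<bar>f x\<bar> - real n))"
  have absi: "integrable lborel (\<lambda>x. indicator {a..b} x * \<bar>f x\<bar>)"
    using integrable_abs[OF fi[unfolded set_integrable_def]] by (simp add: abs_mult)
  have gi: "integrable lborel (g n)" for n
    by (rule Bochner_Integration.integrable_bound[OF absi]) (auto simp: g_def indicator_def)
  have lim: "(\<lambda>n. LINT x|lborel. g n x) \<longlonglongrightarrow> (LINT x::real|lborel. (0::real))"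
  proof (rule integral_dominated_convergence[where s=g and f="\<lambda>x. 0" and w="\<lambda>x. indicator {a..b} x * \<bar>f x\<bar>"])
    show "AE x in lborel. (\<lambda>n. g n x) \<longlonglongrightarrow> 0"
    proof (rule AE_I2)
      fix x
      obtain N :: nat where N: "\<bar>f x\<bar> <= real N" using real_arch_simple by blast
      have "\<forall>\<^sub>F n in sequentially. g n x = 0"
        using eventually_ge_at_top[of N] by eventually_elim (use N in \<open>auto simp: g_def indicator_def\<close>)
      then show "(\<lambda>n. g n x) \<longlonglongrightarrow> 0" by (rule tendsto_eventually)
    qed
    show "AE x in lborel. norm (g n x) <= indicator {a..b} x * \<bar>f x\<bar>" for n
      by (auto simp: g_def indicator_def)
  qed (use absi in \<open>simp_all add: g_def\<close>)
  show ?thesis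
  proof (rule abs_continuous_criterion)
    fix e :: real assume e: "0 < e"
    obtain n where n: "\<bar>LINT x|lborel. g n x\<bar> < e"
      using LIMSEQ_D[OF lim e] by auto
    define W where "W = (\<lambda>x. LINT z:{..x}|lborel. g n z)"
    have W: "has_density W (g n)" unfolding W_def by (rule has_density_indefinite_integral[OF gi])
    have g0: "0 <= g n x" for x by (simp add: g_def indicator_def)
    have si: "set_integrable lborel A (g n)" if "A \<in> sets borel" for A
      using that integrable_mult_indicator[OF _ gi[of n], of A] by (simp add: set_integrable_def)
    have "mono_on {a..b} W"
      unfolding mono_on_def
    proof (intro allI impI)
      fix x y assume "x \<in> {a..b} \<and> y \<in> {a..b} \<and> x <= y"
      then have "W y - W x = (LINT z:{x..y}|lborel. g n z)" using has_density_integral[OF W] by simp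
      also have "... \<ge> 0" unfolding set_lebesgue_integral_def using g0 by (intro integral_nonneg_AE) auto
      finally show "W x <= W y" by simp
    qed
    moreover have "W b - W a < e"
    proof -
      have "W b - W a = (LINT z:{a..b}|lborel. g n z)" using has_density_integral[OF W ab] by simp
      also have "... <= (LINT z|lborel. g n z)" unfolding set_lebesgue_integral_def
        using si[of "{a..b}"] gi g0 by (intro integral_mono) (auto simp: set_integrable_def indicator_def)
      finally show ?thesis using n by linarith
    qed
    moreover have "\<bar>F y - F x\<bar> <= real n * (y - x) + (W y - W x)" if xy: "a <= x" "x <= y" "y <= b" for x y
    proof -
      have i1: "integrable lborel (\<lambda>z. indicator {x..y} z * \<bar>f z\<bar>)"
        using integrable_abs[OF has_density_integrable[OF Ff, of x y, unfolded set_integrable_def]] by (simp add: abs_mult)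
      have i2: "integrable lborel (\<lambda>z. indicator {x..y} z * real n)"
        by (intro integrable_mult_left integrable_real_indicator) (auto simp: emeasure_lborel_Icc_eq)
      have i3: "integrable lborel (\<lambda>z. indicator {x..y} z * g n z)" using si[of "{x..y}"] by (simp add: set_integrable_def)
      have "\<bar>F y - F x\<bar> = \<bar>LINT z|lborel. indicator {x..y} z * f z\<bar>"
        using has_density_integral[OF Ff xy(2)] by (simp add: set_lebesgue_integral_def)
      also have "... <= (LINT z|lborel. indicator {x..y} z * \<bar>f z\<bar>)"
        using integral_abs_bound[of lborel "\<lambda>z. indicator {x..y} z * f z"] by (simp add: abs_mult)
      also have "... <= (LINT z|lborel. indicator {x..y} z * real n + indicator {x..y} z * g n z)"
        by (rule integral_mono[OF i1 Bochner_Integration.integrable_add[OF i2 i3]])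
           (use xy in \<open>auto simp: g_def indicator_def\<close>)
      also have "... = real n * (y - x) + (W y - W x)"
        using has_density_integral[OF W xy(2)] xy(2) i2 i3
        by (subst Bochner_Integration.integral_add) (auto simp: set_lebesgue_integral_def)
      finally show ?thesis .
    qed
    ultimately show "\<exists>L W. 0 <= L \<and> mono_on {a..b} W \<and> W b - W a < e \<and>
     (\<forall>x y. a <= x --> x <= y --> y <= b --> \<bar>F y - F x\<bar> <= L * (y - x) + (W y - W x))"
      by (intro exI[of _ "real n"] exI[of _ W]) auto
  qed
qed

lemma has_density_continuous: "has_density F f ==> continuous_on A F"
proof -
  assume F: "has_density F f"
  have "isCont F x" for x
  proof -
    have "continuous_on {x - 1..x + 1} F"
      using abs_continuous_imp_continuous[OF has_density_abs_continuous[OF F]] .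
    then have "continuous_on {x - 1<..<x + 1} F" by (rule continuous_on_subset) auto
    then show ?thesis by (simp add: continuous_on_eq_continuous_at)
  qed
  then show ?thesis by (simp add: continuous_at_imp_continuous_on)
qed

text \<open>
  On a compact interval \<open>\<phi> \<circ> F\<close> is absolutely continuous, since \<open>\<phi>\<close> is Lipschitz on the range of \<open>F\<close>.
  So it has some density, which the chain rule identifies almost everywhere.
\<close>

lemma has_density_compose:
  assumes Ff: "has_density F f"
    and phi: "\<And>x. (\<phi> has_real_derivative \<phi>' x) (at x)" and cont: "continuous_on UNIV \<phi>'"
  shows "has_density (\<lambda>x. \<phi> (F x)) (\<lambda>x. \<phi>' (F x) * f x)"
proof -
  have [measurable]: "f \<in> borel_measurable borel" using Ff by (rule has_density_borel)
  have Fc: "continuous_on A F" for A using has_density_continuous[OF Ff] .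
  have [measurable]: "F \<in> borel_measurable borel" by (rule borel_measurable_continuous_onI[OF Fc])
  have [measurable]: "\<phi>' \<in> borel_measurable borel" by (rule borel_measurable_continuous_onI[OF cont])
  have k [measurable]: "(\<lambda>x. \<phi>' (F x) * f x) \<in> borel_measurable borel" by measurable
  have "set_integrable lborel {a..b} (\<lambda>x. \<phi>' (F x) * f x) \<and>
        (LINT x:{a..b}|lborel. \<phi>' (F x) * f x) = \<phi> (F b) - \<phi> (F a)" if ab: "a < b" for a b
  proof -
    have "compact (F ` {a..b})" by (rule compact_continuous_image[OF Fc]) simp
    then obtain M where M: "\<And>x. x \<in> {a..b} ==> \<bar>F x\<bar> <= M"
      using compact_imp_bounded bounded_iff by (metis image_eqI real_norm_def)
    have "compact (\<phi>' ` {-M..M})" by (rule compact_continuous_image[OF continuous_on_subset[OF cont]]) auto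
    then obtain L where L: "\<And>x. x \<in> {-M..M} ==> \<bar>\<phi>' x\<bar> <= L"
      using compact_imp_bounded bounded_iff by (metis image_eqI real_norm_def)
    have M0: "0 <= M" using M[of a] ab by (meson abs_ge_zero atLeastAtMost_iff less_imp_le order_refl order_trans)
    have L0: "0 <= L" using L[of 0] M0 abs_ge_zero[of "\<phi>' 0"] by (simp add: order_trans[OF abs_ge_zero])
    have "abs_continuous_on_interval a b (\<lambda>x. \<phi> (F x))"
    proof (rule abs_continuous_dominated[OF has_density_abs_continuous[OF Ff] L0])
      fix x y assume xy: "a <= x" "x <= y" "y <= b"
      have inM: "F x \<in> {-M..M}" "F y \<in> {-M..M}" using M[of x] M[of y] xy by (auto simp: abs_le_iff)
      have "norm (\<phi> (F y) - \<phi> (F x)) <= L * norm (F y - F x)"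
        by (rule field_differentiable_bound[of "{-M..M}" \<phi> \<phi>'])
           (use inM L in \<open>auto intro: has_field_derivative_at_within phi\<close>)
      then show "\<bar>\<phi> (F y) - \<phi> (F x)\<bar> <= L * \<bar>F y - F x\<bar>" by simp
    qed
    then obtain g where g: "has_density (\<lambda>x. \<phi> (F (max a (min b x)))) g"
      using abs_continuous_density[OF _ ab, of "\<lambda>x. \<phi> (F x)"] by blast
    have gm [measurable]: "g \<in> borel_measurable borel" using g by (rule has_density_borel)
    have "AE x in lborel. x \<noteq> a" "AE x in lborel. x \<noteq> b" by (rule AE_lborel_singleton)+
    then have ae: "AE x in lborel. x \<in> {a..b} --> g x = \<phi>' (F x) * f x"
      using has_density_AE_derivative[OF Ff] has_density_AE_derivative[OF g]
    proof eventually_elim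
      case (elim x)
      show ?case
      proof
        assume "x \<in> {a..b}"
        then have x: "x \<in> {a<..<b}" using elim by auto
        have "((\<lambda>x. \<phi> (F x)) has_real_derivative \<phi>' (F x) * f x) (at x)"
          by (rule DERIV_chain2[OF phi elim(3)])
        moreover have "\<forall>\<^sub>F z in nhds x. \<phi> (F (max a (min b z))) = \<phi> (F z)"
          using eventually_nhds_in_open[OF open_greaterThanLessThan x]
          by eventually_elim (auto simp: max_def min_def)
        ultimately have "((\<lambda>z. \<phi> (F (max a (min b z)))) has_real_derivative \<phi>' (F x) * f x) (at x)"
          by (subst DERIV_cong_ev[OF refl _ refl])
        then show "g x = \<phi>' (F x) * f x" using elim(4) DERIV_unique by blast
      qed
    qed
    have ae': "AE x in lborel. indicator {a..b} x *\<^sub>R g x = indicator {a..b} x *\<^sub>R (\<phi>' (F x) * f x)"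
      using ae by eventually_elim (auto simp: indicator_def)
    have "set_integrable lborel {a..b} (\<lambda>x. \<phi>' (F x) * f x)"
      using has_density_integrable[OF g, of a b] unfolding set_integrable_def
      by (rule Bochner_Integration.integrable_cong_AE_imp) (use ae' in \<open>auto elim!: eventually_mono\<close>)
    moreover have "(LINT x:{a..b}|lborel. \<phi>' (F x) * f x) = (LINT x:{a..b}|lborel. g x)"
      unfolding set_lebesgue_integral_def
      by (rule integral_cong_AE) (use ae' in \<open>auto elim!: eventually_mono\<close>)
    ultimately show ?thesis using has_density_integral[OF g, of a b] ab by simp
  qed
  note main = this
  have "set_integrable lborel {a..b} (\<lambda>x. \<phi>' (F x) * f x) \<and>
        (a <= b --> (LINT x:{a..b}|lborel. \<phi>' (F x) * f x) = \<phi> (F b) - \<phi> (F a))" for a b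
  proof -
    consider "a < b" | "a = b" | "b < a" by linarith
    then show ?thesis
    proof cases
      case 1 then show ?thesis using main by simp
    next
      case 2
      have z: "AE x in lborel. indicator {a..a} x *\<^sub>R (\<phi>' (F x) * f x) = 0"
        using AE_lborel_singleton[of a] by eventually_elim auto
      have "set_integrable lborel {a..a} (\<lambda>x. \<phi>' (F x) * f x)"
        unfolding set_integrable_def
        by (rule Bochner_Integration.integrable_cong_AE_imp[of _ "\<lambda>x. 0"]) (use z in \<open>auto elim!: eventually_mono\<close>)
      moreover have "(LINT x:{a..a}|lborel. \<phi>' (F x) * f x) = 0"
        unfolding set_lebesgue_integral_def by (rule integral_eq_zero_AE) (use z in auto)
      ultimately show ?thesis using 2 by simp
    next
      case 3 then show ?thesis by (simp add: set_integrable_def)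
    qed
  qed
  then show ?thesis using k by (auto simp: has_density_def)
qed

text \<open>
  By polarization the product rule follows from the chain rule for squares.
\<close>

lemma has_density_mult:
  assumes "has_density F f" "has_density G g"
  shows "has_density (\<lambda>x. F x * G x) (\<lambda>x. f x * G x + F x * g x)"
proof -
  have sq: "has_density (\<lambda>x. (H x)^2) (\<lambda>x. 2 * H x * h x)" if "has_density H h" for H h
  proof (rule has_density_compose[OF that, of "\<lambda>x. x^2" "\<lambda>x. 2 * x"])
    show "((\<lambda>x. x^2) has_real_derivative 2 * x) (at x)" for x :: real
      by (auto intro!: derivative_eq_intros)
  qed (intro continuous_intros)
  have "has_density (\<lambda>x. 1/4 * ((F x + G x)^2 - (F x - G x)^2))
     (\<lambda>x. 1/4 * (2 * (F x + G x) * (f x + g x) - 2 * (F x - G x) * (f x - g x)))"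
    by (intro has_density_cmult has_density_diff sq has_density_add assms)
  then show ?thesis
    by (simp add: algebra_simps power2_eq_square)
qed

section \<open>Ordinary differential equations in Banach spaces\<close>

lemma continuous_on_Icc_bounded:
  fixes f :: "real => 'a::real_normed_vector"
  assumes "continuous_on {a..b} f"
  shows "\<exists>M. \<forall>t\<in>{a..b}. norm (f t) <= M"
proof -
  have "bounded (f ` {a..b})"
    by (rule compact_imp_bounded[OF compact_continuous_image[OF assms]]) simp
  then show ?thesis by (auto simp: bounded_iff)
qed

text \<open>
  The mean value inequality forward and backward in time at once, with a majorant that depends on the
  distance to time 0 only.
\<close>

lemma derivative_norm_bound:
  fixes f :: "real => 'a::real_normed_vector"
  assumes f: "\<And>t. \<bar>t\<bar> <= T ==> (f has_vector_derivative f' t) (at t)"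
    and phi: "\<And>t. (\<phi> has_real_derivative \<phi>' t) (at t)"
    and le: "\<And>t. 0 <= t ==> t <= T ==> norm (f' t) <= \<phi>' t \<and> norm (f' (- t)) <= \<phi>' t"
    and t: "\<bar>t\<bar> <= T"
  shows "norm (f t - f 0) <= \<phi> \<bar>t\<bar> - \<phi> 0"
proof -
  have pc: "continuous_on A \<phi>" for A
    using phi by (meson DERIV_isCont continuous_at_imp_continuous_on)
  have main: "norm (g s - g 0) <= \<phi> s - \<phi> 0"
    if g: "\<And>t. \<bar>t\<bar> <= T ==> (g has_vector_derivative g' t) (at t)"
      and gle: "\<And>t. 0 <= t ==> t <= T ==> norm (g' t) <= \<phi>' t" and s: "0 <= s" "s <= T"
    for g :: "real => 'a" and g' s
  proof (cases "s = 0")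
    case False
    show ?thesis
    proof (rule differentiable_bound_general[of 0 s g \<phi> g' \<phi>'])
      show "0 < s" using False s by simp
      have "isCont g t" if "t \<in> {0..s}" for t
      proof -
        have "\<bar>t\<bar> <= T" using that s by auto
        then show ?thesis using g has_vector_derivative_continuous by blast
      qed
      then show "continuous_on {0..s} g" by (simp add: continuous_at_imp_continuous_on)
      show "continuous_on {0..s} \<phi>" by (rule pc)
      show "(g has_vector_derivative g' x) (at x)" if "0 < x" "x < s" for x using g[of x] that s by auto
      show "(\<phi> has_vector_derivative \<phi>' x) (at x)" if "0 < x" "x < s" for x
        using phi by (simp add: has_real_derivative_iff_has_vector_derivative)
      show "norm (g' x) <= \<phi>' x" if "0 < x" "x < s" for x using gle that s by auto
    qed
  qed simp
  show ?thesis
  proof (cases "0 <= t")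
    case True
    have "norm (f t - f 0) <= \<phi> t - \<phi> 0" by (rule main[of f f']) (use f le t True in auto)
    then show ?thesis using True by simp
  next
    case False
    have "norm (f (- (- t)) - f (- 0)) <= \<phi> (- t) - \<phi> 0"
    proof (rule main[of "\<lambda>s. f (- s)" "\<lambda>s. - f' (- s)"])
      fix s :: real assume s: "\<bar>s\<bar> <= T"
      have "((f \<circ> uminus) has_vector_derivative (- 1) *\<^sub>R f' (- s)) (at s)"
        by (rule vector_diff_chain_at) (use f[of "- s"] s in \<open>auto intro!: derivative_eq_intros\<close>)
      then show "((\<lambda>s. f (- s)) has_vector_derivative - f' (- s)) (at s)" by (simp add: o_def)
    qed (use le t False in auto)
    then show ?thesis using False by simp
  qed
qed

lemma ex_antiderivative:
  fixes g :: "real => 'a::banach"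
  assumes g: "continuous_on UNIV g"
  shows "\<exists>G. G 0 = 0 \<and> (\<forall>t. (G has_vector_derivative g t) (at t))"
proof -
  define G where "G = (\<lambda>t. if 0 <= t then integral {0..t} g else - integral {t..0} g)"
  have gi: "g integrable_on {a..b}" for a b
    by (rule integrable_continuous_real) (rule continuous_on_subset[OF g], simp)
  have "(G has_vector_derivative g t) (at t)" for t
  proof -
    define T where "T = \<bar>t\<bar> + 1"
    have eq: "G s = integral {-T..s} g - integral {-T..0} g" if s: "s \<in> {-T<..<T}" for s
    proof (cases "0 <= s")
      case True
      have "integral {-T..0} g + integral {0..s} g = integral {-T..s} g"
        by (rule Henstock_Kurzweil_Integration.integral_combine) (use True s gi in \<open>auto simp: T_def\<close>)
      then show ?thesis using True by (simp add: G_def algebra_simps)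
    next
      case False
      have "integral {-T..s} g + integral {s..0} g = integral {-T..0} g"
        by (rule Henstock_Kurzweil_Integration.integral_combine) (use False s gi in \<open>auto simp: T_def\<close>)
      then show ?thesis using False by (simp add: G_def algebra_simps)
    qed
    have tT: "t \<in> {-T<..<T}" by (auto simp: T_def)
    have "((\<lambda>u. integral {-T..u} g) has_vector_derivative g t) (at t within {-T..T})"
      by (rule integral_has_vector_derivative) (use tT in \<open>auto intro: continuous_on_subset[OF g]\<close>)
    then have "((\<lambda>u. integral {-T..u} g) has_vector_derivative g t) (at t)"
      using tT by (subst (asm) at_within_interior) auto
    then have "((\<lambda>s. integral {-T..s} g - integral {-T..0} g) has_vector_derivative g t) (at t)"
      by (auto intro!: derivative_eq_intros)
    then show ?thesis
      by (rule has_vector_derivative_transform_within_open[OF _ open_greaterThanLessThan tT]) (simp add: eq)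
  qed
  moreover have "G 0 = 0" by (simp add: G_def)
  ultimately show ?thesis by blast
qed

text \<open>
  Successive approximations.  Measured with the weight \<open>exp (- 2 L \<bar>t\<bar>)\<close>, the distance of consecutive
  iterates halves at each step, which gives uniform convergence on intervals of any length.
\<close>

theorem Picard_Lindelof_global:
  fixes f :: "real => 'a::banach => 'a"
  assumes cont: "continuous_on UNIV (\<lambda>(t, x). f t x)"
    and lip: "\<And>T. \<exists>L. \<forall>t x y. \<bar>t\<bar> <= T --> norm (f t x - f t y) <= L * norm (x - y)"
  shows "\<exists>x. x 0 = x0 \<and> (\<forall>t. (x has_vector_derivative f t (x t)) (at t))"
proof -
  define AD where "AD = (\<lambda>g :: real => 'a. SOME G. G 0 = 0 \<and> (\<forall>t. (G has_vector_derivative g t) (at t)))"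
  have AD: "AD g 0 = 0 \<and> (\<forall>t. (AD g has_vector_derivative g t) (at t))" if "continuous_on UNIV g" for g
    unfolding AD_def by (rule someI_ex[OF ex_antiderivative[OF that]])
  define X where "X = rec_nat (\<lambda>t. x0) (\<lambda>n x t. x0 + AD (\<lambda>s. f s (x s)) t)"
  have X0: "X 0 = (\<lambda>t. x0)" and XS: "X (Suc n) = (\<lambda>t. x0 + AD (\<lambda>s. f s (X n s)) t)" for n
    by (simp_all add: X_def)
  have fc: "continuous_on UNIV (\<lambda>s. f s (x s))" if "continuous_on UNIV x" for x
  proof -
    have "continuous_on UNIV (\<lambda>s. (s, x s))" by (intro continuous_on_Pair continuous_on_id that)
    from continuous_on_compose2[OF cont this] show ?thesis by simp
  qed
  have Xc: "continuous_on UNIV (X n)" for n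
  proof (induction n)
    case 0 show ?case by (simp add: X0)
  next
    case (Suc n)
    have "continuous_on UNIV (AD (\<lambda>s. f s (X n s)))"
      using AD[OF fc[OF Suc]] has_vector_derivative_continuous by (blast intro: continuous_at_imp_continuous_on)
    then show ?case unfolding XS by (intro continuous_intros)
  qed
  have XD: "(X (Suc n) has_vector_derivative f t (X n t)) (at t)" for n t
    unfolding XS using AD[OF fc[OF Xc[of n]]] by (auto intro!: derivative_eq_intros)
  have Xi: "X n 0 = x0" for n
    using AD[OF fc[OF Xc]] by (cases n) (auto simp: X0 XS)
  have unif: "\<exists>x. uniform_limit {-T..T} X x sequentially" if T: "T \<ge> 0" for T
  proof -
    obtain L0 where L0: "\<And>t x y. \<bar>t\<bar> <= T ==> norm (f t x - f t y) <= L0 * norm (x - y)" using lip[of T] by blast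
    define L where "L = max 1 L0"
    have L: "norm (f t x - f t y) <= L * norm (x - y)" if "\<bar>t\<bar> <= T" for t x y
      using L0[OF that, of x y] mult_right_mono[of L0 L "norm (x - y)"] by (simp add: L_def)
    have Lp: "L > 0" by (simp add: L_def)
    have "continuous_on {-T..T} (\<lambda>t. X 1 t - X 0 t)"
      by (intro continuous_on_diff continuous_on_subset[OF Xc]) auto
    from continuous_on_Icc_bounded[OF this]
    obtain M where M: "\<And>t. t \<in> {-T..T} ==> norm (X 1 t - X 0 t) <= M" by blast
    have M0: "0 <= M" using order_trans[OF norm_ge_zero M[of 0]] T by simp
    (* The integral of L exp (2 L s) is exp (2 L t) / 2, which gains the factor 1/2 at each step. *)
    have bound: "\<forall>t. \<bar>t\<bar> <= T --> norm (X (Suc n) t - X n t) <= M * (1/2)^n * exp (2 * L * \<bar>t\<bar>)" for n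
    proof (induction n)
      case 0
      show ?case
      proof (intro allI impI)
        fix t :: real assume t: "\<bar>t\<bar> <= T"
        have "norm (X (Suc 0) t - X 0 t) <= M" using M[of t] t by (simp add: abs_le_iff)
        also have "M <= M * exp (2 * L * \<bar>t\<bar>)" using M0 Lp by (simp add: mult_le_cancel_left1)
        finally show "norm (X (Suc 0) t - X 0 t) <= M * (1/2)^0 * exp (2 * L * \<bar>t\<bar>)" by simp
      qed
    next
      case (Suc n)
      define \<phi> where "\<phi> = (\<lambda>t. M * (1/2)^Suc n * exp (2 * L * t))"
      show ?case
      proof (intro allI impI)
        fix t :: real assume t: "\<bar>t\<bar> <= T"
        have "norm ((X (Suc (Suc n)) t - X (Suc n) t) - (X (Suc (Suc n)) 0 - X (Suc n) 0)) <= \<phi> \<bar>t\<bar> - \<phi> 0"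
        proof (rule derivative_norm_bound[where f'="\<lambda>t. f t (X (Suc n) t) - f t (X n t)" and
              \<phi>'="\<lambda>t. L * (M * (1/2)^n * exp (2 * L * t))" and T=T])
          show "((\<lambda>t. X (Suc (Suc n)) t - X (Suc n) t) has_vector_derivative f t (X (Suc n) t) - f t (X n t)) (at t)" for t
            by (intro has_vector_derivative_diff XD)
          show "(\<phi> has_real_derivative L * (M * (1/2)^n * exp (2 * L * t))) (at t)" for t
            unfolding \<phi>_def by (auto intro!: derivative_eq_intros)
          have "norm (f s (X (Suc n) s) - f s (X n s)) <= L * (M * (1/2)^n * exp (2 * L * \<bar>s\<bar>))" if "\<bar>s\<bar> <= T" for s
            using order_trans[OF L[OF that] mult_left_mono[OF Suc[rule_format, OF that]]] Lp by simp
          from this this[of "- s" for s] show "0 <= s ==> s <= T ==>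
             norm (f s (X (Suc n) s) - f s (X n s)) <= L * (M * (1/2)^n * exp (2 * L * s)) \<and>
             norm (f (- s) (X (Suc n) (- s)) - f (- s) (X n (- s))) <= L * (M * (1/2)^n * exp (2 * L * s))" for s
            by (metis abs_minus_cancel abs_of_nonneg)
        qed (use t in auto)
        then have "norm (X (Suc (Suc n)) t - X (Suc n) t) <= \<phi> \<bar>t\<bar> - \<phi> 0" by (simp add: Xi)
        also have "... <= \<phi> \<bar>t\<bar>" using M0 by (simp add: \<phi>_def)
        finally show "norm (X (Suc (Suc n)) t - X (Suc n) t) <= M * (1/2)^Suc n * exp (2 * L * \<bar>t\<bar>)" by (simp add: \<phi>_def)
      qed
    qed
    have tele: "(\<Sum>i<n. X (Suc i) t - X i t) = X n t - X 0 t" for n t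
      using sum_lessThan_telescope[of "\<lambda>i. X i t" n] by simp
    have "uniform_limit {-T..T} (\<lambda>n t. \<Sum>i<n. X (Suc i) t - X i t) (\<lambda>t. suminf (\<lambda>i. X (Suc i) t - X i t)) sequentially"
    proof (rule Weierstrass_m_test[where M="\<lambda>n. M * (1/2)^n * exp (2 * L * T)"])
      show "norm (X (Suc n) t - X n t) <= M * (1/2)^n * exp (2 * L * T)" if "t \<in> {-T..T}" for n t
      proof -
        have t: "\<bar>t\<bar> <= T" using that by auto
        have "exp (2 * L * \<bar>t\<bar>) <= exp (2 * L * T)" using t Lp by simp
        then show ?thesis using bound[of n] t M0 by (meson mult_left_mono order_trans mult_nonneg_nonneg zero_le_power zero_le_divide_1_iff zero_le_numeral)
      qed
      show "summable (\<lambda>n. M * (1/2)^n * exp (2 * L * T))"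
        by (intro summable_mult2 summable_mult summable_geometric) auto
    qed
    then have "uniform_limit {-T..T} (\<lambda>n t. x0 + (X n t - X 0 t)) (\<lambda>t. x0 + suminf (\<lambda>i. X (Suc i) t - X i t)) sequentially"
      unfolding tele by (intro uniform_limit_add uniform_limit_const)
    then show ?thesis by (auto simp: X0)
  qed
  define x where "x = (\<lambda>t. lim (\<lambda>n. X n t))"
  have ul: "uniform_limit {-T..T} X x sequentially" if T: "T \<ge> 0" for T
  proof -
    obtain y where y: "uniform_limit {-T..T} X y sequentially" using unif[OF T] by blast
    have "x t = y t" if "t \<in> {-T..T}" for t
      unfolding x_def using tendsto_uniform_limitI[OF y that] limI by blast
    then show ?thesis using y uniform_limit_cong'[of "{-T..T}" X X x y] by auto
  qed
  have xc: "continuous_on UNIV x"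
  proof -
    have "isCont x t" for t
    proof -
      have "continuous_on {-(\<bar>t\<bar> + 1)..\<bar>t\<bar> + 1} x"
        by (rule uniform_limit_theorem[OF _ ul])
           (auto intro!: always_eventually continuous_on_subset[OF Xc])
      then have "continuous_on {-(\<bar>t\<bar> + 1)<..<\<bar>t\<bar> + 1} x" by (rule continuous_on_subset) auto
      moreover have "t \<in> {-(\<bar>t\<bar> + 1)<..<\<bar>t\<bar> + 1}" unfolding greaterThanLessThan_iff by linarith
      ultimately show ?thesis by (simp add: continuous_on_eq_continuous_at)
    qed
    then show ?thesis by (simp add: continuous_at_imp_continuous_on)
  qed
  note ADx = AD[OF fc[OF xc]]
  have xeq: "x t = x0 + AD (\<lambda>s. f s (x s)) t" for t
  proof -
    define T where "T = \<bar>t\<bar>"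
    obtain L0 where L0: "\<And>t x y. \<bar>t\<bar> <= T ==> norm (f t x - f t y) <= L0 * norm (x - y)" using lip[of T] by blast
    define L where "L = max 1 L0"
    have L: "norm (f t x - f t y) <= L * norm (x - y)" if "\<bar>t\<bar> <= T" for t x y
      using L0[OF that, of x y] mult_right_mono[of L0 L "norm (x - y)"] by (simp add: L_def)
    have Lp: "L > 0" by (simp add: L_def)
    have tend: "(\<lambda>n. X (Suc n) t) \<longlonglongrightarrow> x0 + AD (\<lambda>s. f s (x s)) t"
    proof (rule LIMSEQ_I)
      fix e :: real assume e: "0 < e"
      define d where "d = e / (L * (T + 1))"
      have d: "d > 0" using e Lp by (simp add: d_def T_def add_nonneg_pos)
      have "\<forall>\<^sub>F n in sequentially. \<forall>s\<in>{-T..T}. dist (X n s) (x s) < d"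
        using uniform_limitD[OF ul d, of T] by (simp add: T_def)
      then obtain N where N: "\<And>n s. n \<ge> N ==> s \<in> {-T..T} ==> dist (X n s) (x s) < d"
        unfolding eventually_sequentially by blast
      have "norm (X (Suc n) t - (x0 + AD (\<lambda>s. f s (x s)) t)) < e" if n: "n \<ge> N" for n
      proof -
        have "norm ((X (Suc n) t - AD (\<lambda>s. f s (x s)) t) - (X (Suc n) 0 - AD (\<lambda>s. f s (x s)) 0))
            <= (\<lambda>s. L * d * s) \<bar>t\<bar> - (\<lambda>s. L * d * s) 0"
        proof (rule derivative_norm_bound[where f'="\<lambda>t. f t (X n t) - f t (x t)" and \<phi>'="\<lambda>t. L * d" and T=T])
          show "((\<lambda>t. X (Suc n) t - AD (\<lambda>s. f s (x s)) t) has_vector_derivative f t (X n t) - f t (x t)) (at t)" for t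
            using ADx by (intro has_vector_derivative_diff XD) auto
          show "((\<lambda>s. L * d * s) has_real_derivative L * d) (at t)" for t
            by (auto intro!: derivative_eq_intros)
          have *: "norm (f s (X n s) - f s (x s)) <= L * d" if "\<bar>s\<bar> <= T" for s
          proof -
            have "s \<in> {-T..T}" using that by auto
            then have "norm (X n s - x s) <= d" using N[OF n, of s] by (simp add: dist_norm)
            then show ?thesis using order_trans[OF L[OF that] mult_left_mono] Lp by simp
          qed
          show "norm (f s (X n s) - f s (x s)) <= L * d \<and> norm (f (- s) (X n (- s)) - f (- s) (x (- s))) <= L * d"
            if "0 <= s" "s <= T" for s
            using *[of s] *[of "- s"] that by simp
        qed (simp add: T_def)
        then have "norm (X (Suc n) t - (x0 + AD (\<lambda>s. f s (x s)) t)) <= L * d * T"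
          using ADx by (simp add: Xi T_def algebra_simps)
        also have "L * d * T = e * (T / (T + 1))" using Lp by (simp add: d_def T_def)
        also have "... < e * 1" using e by (intro mult_strict_left_mono) (auto simp: T_def)
        also have "... = e" by simp
        finally show ?thesis .
      qed
      then show "\<exists>no. \<forall>n\<ge>no. norm (X (Suc n) t - (x0 + AD (\<lambda>s. f s (x s)) t)) < e" by blast
    qed
    have "(\<lambda>n. X n t) \<longlonglongrightarrow> x t" by (rule tendsto_uniform_limitI[OF ul[of "\<bar>t\<bar>"]]) auto
    then have "(\<lambda>n. X (Suc n) t) \<longlonglongrightarrow> x t" by (rule LIMSEQ_Suc)
    then show ?thesis using tend LIMSEQ_unique by blast
  qed
  have "(x has_vector_derivative f t (x t)) (at t)" for t
  proof -
    have "((\<lambda>t. x0 + AD (\<lambda>s. f s (x s)) t) has_vector_derivative f t (x t)) (at t)"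
      using ADx by (auto intro!: derivative_eq_intros)
    moreover have "(\<lambda>t. x0 + AD (\<lambda>s. f s (x s)) t) = x" by (intro ext) (rule xeq[symmetric])
    ultimately show ?thesis by (simp only:)
  qed
  moreover have "x 0 = x0" using xeq[of 0] ADx by simp
  ultimately show ?thesis by blast
qed

definition ball_retraction :: "real => 'a::real_normed_vector => 'a" where
  "ball_retraction R x = (1 / max 1 (norm x / R)) *\<^sub>R x"

lemma ball_retraction_id: "0 < R ==> norm x <= R ==> ball_retraction R x = x"
  by (simp add: ball_retraction_def max_def)

lemma norm_ball_retraction: "0 < R ==> norm (ball_retraction R x) <= R"
  by (auto simp: ball_retraction_def max_def field_simps)

lemma ball_retraction_lipschitz:
  fixes x y :: "'a::real_normed_vector"
  assumes R: "0 < R"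
  shows "norm (ball_retraction R x - ball_retraction R y) <= 2 * norm (x - y)"
proof -
  have main: "norm (ball_retraction R x - ball_retraction R y) <= 2 * norm (x - y)" if le: "norm y <= norm x" for x y :: 'a
  proof -
    define a b where "a = max 1 (norm x / R)" and "b = max 1 (norm y / R)"
    have ab: "1 <= b" "b <= a" using le R by (auto simp: a_def b_def divide_right_mono max.coboundedI2)
    have eq: "ball_retraction R x - ball_retraction R y = (1 / a) *\<^sub>R (x - y) - (1/b - 1/a) *\<^sub>R y"
      by (simp add: ball_retraction_def a_def b_def algebra_simps)
    have ai: "1 / a <= 1" "0 <= 1 / a" using ab by auto
    have bi: "0 <= 1/b - 1/a" using ab by (simp add: frac_le)
    have "(1/b - 1/a) * norm y <= norm (x - y)"
    proof (cases "a = b")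
      case False
      then have "1 < a" using ab by simp
      then have a: "a = norm x / R" unfolding a_def by linarith
      have ba: "a - b <= (norm x - norm y) / R" using a R by (auto simp: b_def diff_divide_distrib)
      have nb: "norm y <= R * b" using R by (auto simp: b_def max_def field_simps)
      have "(1/b - 1/a) * norm y = (a - b) * norm y / (a * b)" using ab by (simp add: field_simps)
      also have "... <= ((norm x - norm y) / R) * (R * b) / (a * b)"
        using ba nb ab le R by (intro divide_right_mono mult_mono) auto
      also have "... = (norm x - norm y) / a" using ab R by (simp add: field_simps)
      also have "... <= (norm x - norm y) / 1" using ab le by (intro divide_left_mono) auto
      also have "... <= norm (x - y)" using norm_triangle_ineq2[of x y] by simp
      finally show ?thesis .
    qed simp
    moreover have "norm (ball_retraction R x - ball_retraction R y) <= (1/a) * norm (x - y) + (1/b - 1/a) * norm y"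
      unfolding eq using norm_triangle_ineq4[of "(1 / a) *\<^sub>R (x - y)" "(1/b - 1/a) *\<^sub>R y"] ai bi by simp
    moreover have "(1/a) * norm (x - y) <= 1 * norm (x - y)" using ai by (intro mult_right_mono) auto
    ultimately show ?thesis by linarith
  qed
  show ?thesis
  proof (cases "norm y <= norm x")
    case True then show ?thesis by (rule main)
  next
    case False
    then show ?thesis using main[of x y] by (simp add: norm_minus_commute)
  qed
qed

text \<open>
  Retracting the argument onto a ball of radius \<open>R \<bar>t\<bar>\<close> makes the vector field globally Lipschitz.
  Up to the first time at which the solution of the modified equation touches the sphere it solves the
  original equation, and the a priori bound excludes that it is on the sphere at that time.
\<close>

theorem global_solution_of_a_priori_bound:
  fixes F :: "'a::banach => 'a"
  assumes lip: "\<And>R. \<exists>L. \<forall>x y. norm x <= R --> norm y <= R --> norm (F x - F y) <= L * norm (x - y)"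
    and R: "continuous_on UNIV R" "\<And>t. 0 < R t"
    and apriori: "\<And>x T. 0 <= T ==> x 0 = x0 ==> continuous_on UNIV x ==>
        (\<And>t. \<bar>t\<bar> <= T ==> (x has_vector_derivative F (x t)) (at t)) ==>
        \<forall>t. \<bar>t\<bar> <= T --> norm (x t) < R \<bar>t\<bar>"
    and R0: "norm x0 <= R 0"
  shows "\<exists>x. x 0 = x0 \<and> (\<forall>t. (x has_vector_derivative F (x t)) (at t)) \<and> (\<forall>t. norm (x t) < R \<bar>t\<bar>)"
proof -
  have Fc: "continuous_on UNIV F"
  proof -
    have "isCont F x" for x
    proof -
      obtain L where L: "\<And>u v. norm u <= norm x + 1 ==> norm v <= norm x + 1 ==> norm (F u - F v) <= L * norm (u - v)"
        using lip[of "norm x + 1"] by blast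
      have "(\<lambda>y. F y - F x) \<midarrow>x\<rightarrow> 0"
      proof (rule Lim_null_comparison)
        have "\<forall>\<^sub>F y in at x. dist y x < 1" by (rule eventually_at_ball'[of 1 x UNIV, THEN eventually_mono]) (auto simp: dist_commute)
        then show "\<forall>\<^sub>F y in at x. norm (F y - F x) <= L * norm (y - x)"
        proof eventually_elim
          case (elim y)
          have "norm y <= norm x + 1" using elim norm_triangle_ineq2[of y x] by (simp add: dist_norm)
          then show ?case by (intro L) auto
        qed
        show "((\<lambda>y. L * norm (y - x)) \<longlongrightarrow> 0) (at x)" by (auto intro!: tendsto_eq_intros)
      qed
      then show ?thesis unfolding isCont_def using LIM_zero_iff by blast
    qed
    then show ?thesis by (simp add: continuous_at_imp_continuous_on)
  qed
  define f where "f = (\<lambda>t x. F (ball_retraction (R \<bar>t\<bar>) x))"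
  have Rc: "continuous_on UNIV (\<lambda>p :: real \<times> 'a. R \<bar>fst p\<bar>)"
    by (rule continuous_on_compose2[OF R(1)]) (auto intro!: continuous_intros)
  have nz: "R s \<noteq> 0" "\<not> R s <= 0" for s using R(2)[of s] by simp_all
  have "continuous_on UNIV (\<lambda>p :: real \<times> 'a. ball_retraction (R \<bar>fst p\<bar>) (snd p))"
    unfolding ball_retraction_def using R(2) by (intro continuous_intros Rc) (auto simp: nz max_def)
  then have fc: "continuous_on UNIV (\<lambda>(t, x). f t x)"
    unfolding f_def case_prod_beta by (rule continuous_on_compose2[OF Fc]) auto
  have fl: "\<exists>L. \<forall>t x y. \<bar>t\<bar> <= T --> norm (f t x - f t y) <= L * norm (x - y)" for T
  proof -
    have "continuous_on {0..T} R" by (rule continuous_on_subset[OF R(1)]) simp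
    from continuous_on_Icc_bounded[OF this]
    obtain M where M: "\<And>t. t \<in> {0..T} ==> norm (R t) <= M" by blast
    obtain L where L: "\<And>x y. norm x <= M ==> norm y <= M ==> norm (F x - F y) <= L * norm (x - y)"
      using lip[of M] by blast
    have "norm (f t x - f t y) <= (2 * max 0 L) * norm (x - y)" if t: "\<bar>t\<bar> <= T" for t x y
    proof -
      have RM: "R \<bar>t\<bar> <= M" using M[of "\<bar>t\<bar>"] t by auto
      have n: "norm (ball_retraction (R \<bar>t\<bar>) z) <= M" for z :: 'a
        using norm_ball_retraction[OF R(2)] RM order_trans by blast
      have "norm (f t x - f t y) <= L * norm (ball_retraction (R \<bar>t\<bar>) x - ball_retraction (R \<bar>t\<bar>) y)"
        unfolding f_def by (rule L) (rule n)+
      also have "... <= max 0 L * norm (ball_retraction (R \<bar>t\<bar>) x - ball_retraction (R \<bar>t\<bar>) y)"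
        by (intro mult_right_mono) auto
      also have "... <= max 0 L * (2 * norm (x - y))"
        by (intro mult_left_mono ball_retraction_lipschitz R) auto
      finally show ?thesis by (simp add: mult_ac)
    qed
    then show ?thesis by blast
  qed
  obtain x where x0: "x 0 = x0" and xD: "\<And>t. (x has_vector_derivative f t (x t)) (at t)"
    using Picard_Lindelof_global[OF fc fl, of x0] by blast
  have xcont: "isCont x t" for t using xD has_vector_derivative_continuous by blast
  then have xc: "continuous_on UNIV x" by (simp add: continuous_at_imp_continuous_on)
  have true_ode: "(x has_vector_derivative F (x t)) (at t)" if "norm (x t) <= R \<bar>t\<bar>" for t
    using xD[of t] ball_retraction_id[OF R(2) that] by (simp add: f_def)
  have inside: "norm (x t) < R \<bar>t\<bar>" for t
  proof (rule ccontr)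
    assume neg: "\<not> norm (x t) < R \<bar>t\<bar>"
    define B where "B = {s. 0 <= s \<and> (R s <= norm (x s) \<or> R s <= norm (x (- s)))}"
    have Bclosed: "closed B"
    proof -
      have xm: "continuous_on UNIV (\<lambda>s. x (- s))" by (rule continuous_on_compose2[OF xc]) (auto intro!: continuous_intros)
      have "B = {s. 0 <= s} \<inter> ({s. R s <= norm (x s)} \<union> {s. R s <= norm (x (- s))})" by (auto simp: B_def)
      then show ?thesis
        using R(1) xc xm by (auto intro!: closed_Int closed_Un closed_Collect_le continuous_intros)
    qed
    have "\<bar>t\<bar> \<in> B" using neg by (auto simp: B_def abs_if)
    then have ne: "B \<noteq> {}" by blast
    have bb: "bdd_below B" by (auto simp: B_def intro: bdd_belowI[of _ 0])
    define T where "T = Inf B"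
    have TB: "T \<in> B" unfolding T_def by (rule closed_contains_Inf[OF ne bb Bclosed])
    then have T0: "0 <= T" by (simp add: B_def)
    have "norm (x s) < R \<bar>s\<bar>" if "\<bar>s\<bar> < T" for s
    proof -
      have "\<bar>s\<bar> \<notin> B" using that cInf_lower[OF _ bb] unfolding T_def by fastforce
      then show ?thesis by (auto simp: B_def abs_if not_le split: if_splits)
    qed
    note lt = this
    have le: "norm (x s) <= R \<bar>s\<bar>" if s: "\<bar>s\<bar> <= T" for s
    proof (cases "T = 0")
      case True
      then show ?thesis using s x0 R0 by simp
    next
      case False
      then have Tp: "T > 0" using T0 by simp
      have cl: "closed {s. norm (x s) <= R \<bar>s\<bar>}"
      proof (intro closed_Collect_le)
        show "continuous_on UNIV (\<lambda>s. norm (x s))" using xc by (intro continuous_intros)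
        show "continuous_on UNIV (\<lambda>s. R \<bar>s\<bar>)"
          by (rule continuous_on_compose2[OF R(1) continuous_on_rabs[OF continuous_on_id]]) (rule subset_UNIV)
      qed
      have "closure {-T<..<T} \<subseteq> {s. norm (x s) <= R \<bar>s\<bar>}"
        by (rule closure_minimal[OF _ cl]) (use lt in \<open>force simp: abs_less_iff less_imp_le\<close>)
      moreover have "s \<in> closure {-T<..<T}" using s Tp by auto
      ultimately show ?thesis by blast
    qed
    have "\<forall>s. \<bar>s\<bar> <= T --> norm (x s) < R \<bar>s\<bar>"
      by (rule apriori[OF T0 x0 xc]) (use true_ode le in blast)
    then have "norm (x T) < R T" "norm (x (- T)) < R T" using T0 by (metis abs_of_nonneg abs_minus_cancel order_refl)+
    then show False using TB by (auto simp: B_def)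
  qed
  show ?thesis using x0 true_ode inside by (blast intro: less_imp_le)
qed

lemma gronwall_two_sided:
  fixes f :: "real => real"
  assumes f: "\<And>t. \<bar>t\<bar> <= T ==> (f has_real_derivative f' t) (at t)"
    and le: "\<And>t. \<bar>t\<bar> <= T ==> \<bar>f' t\<bar> <= K * f t" and t: "\<bar>t\<bar> <= T"
  shows "f t <= f 0 * exp (K * \<bar>t\<bar>)"
proof -
  have main: "g s <= g 0 * exp (K * s)"
    if g: "\<And>t. \<bar>t\<bar> <= T ==> (g has_real_derivative g' t) (at t)"
      and gle: "\<And>t. \<bar>t\<bar> <= T ==> \<bar>g' t\<bar> <= K * g t" and s: "0 <= s" "s <= T" for g g' s
  proof -
    have "g s * exp (- K * s) <= g 0 * exp (- K * 0)"
    proof (rule DERIV_nonpos_imp_nonincreasing[OF s(1)])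
      fix x assume x: "0 <= x" "x <= s"
      have "((\<lambda>s. g s * exp (- K * s)) has_real_derivative (g' x - K * g x) * exp (- K * x)) (at x)"
        using g[of x] x s by (auto intro!: derivative_eq_intros simp: algebra_simps)
      moreover have "(g' x - K * g x) * exp (- K * x) <= 0"
        using gle[of x] x s by (intro mult_nonpos_nonneg) auto
      ultimately show "\<exists>y. ((\<lambda>s. g s * exp (- K * s)) has_real_derivative y) (at x) \<and> y <= 0" by blast
    qed
    then have "g s * exp (- K * s) * exp (K * s) <= g 0 * exp (K * s)" by (intro mult_right_mono) auto
    then show ?thesis by (simp add: mult.assoc flip: exp_add)
  qed
  show ?thesis
  proof (cases "0 <= t")
    case True
    have "f t <= f 0 * exp (K * t)" by (rule main[of f f', OF f le True]) (use t in auto)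
    then show ?thesis using True by simp
  next
    case False
    have "f (- (- t)) <= f (- 0) * exp (K * (- t))"
    proof (rule main[of "\<lambda>s. f (- s)" "\<lambda>s. - f' (- s)"])
      fix s :: real assume s: "\<bar>s\<bar> <= T"
      show "((\<lambda>s. f (- s)) has_real_derivative - f' (- s)) (at s)"
      proof -
        have "((\<lambda>x. - x) has_real_derivative - 1) (at s)" by (auto intro!: derivative_eq_intros)
        moreover have "(f has_real_derivative f' (- s)) (at (- s))" using f[of "- s"] s by simp
        ultimately show ?thesis using DERIV_chain2[of f "f' (- s)" "\<lambda>x. - x" s "-1" UNIV] by simp
      qed
      show "\<bar>- f' (- s)\<bar> <= K * f (- s)" using le[of "- s"] s by simp
    qed (use t False in auto)
    then show ?thesis using False by simp
  qed
qed

section \<open>States and quadratic functionals of states\<close>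

text \<open>
  The components of a state are the value \<open>U(0)\<close> (carried as a function of the label so that all
  five components have the same type) and the coefficients \<open>p1\<close>, \<open>p2\<close>, \<open>r1\<close>, \<open>r2\<close>.
\<close>

type_synonym state = "real \<Rightarrow>\<^sub>C (real \<times> real \<times> real \<times> real \<times> real)"

definition st_m :: "state => real => real" where "st_m x \<xi> = fst (apply_bcontfun x \<xi>)"
definition st_p1 :: "state => real => real" where "st_p1 x \<xi> = fst (snd (apply_bcontfun x \<xi>))"
definition st_p2 :: "state => real => real" where "st_p2 x \<xi> = fst (snd (snd (apply_bcontfun x \<xi>)))"
definition st_r1 :: "state => real => real" where "st_r1 x \<xi> = fst (snd (snd (snd (apply_bcontfun x \<xi>))))"
definition st_r2 :: "state => real => real" where "st_r2 x \<xi> = snd (snd (snd (snd (apply_bcontfun x \<xi>))))"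

lemmas st_defs = st_m_def st_p1_def st_p2_def st_r1_def st_r2_def

lemma state_apply:
  "apply_bcontfun x \<xi> = (st_m x \<xi>, st_p1 x \<xi>, st_p2 x \<xi>, st_r1 x \<xi>, st_r2 x \<xi>)"
  by (simp add: st_defs)

lemma bounded_linear_apply_bcontfun:
  "bounded_linear (\<lambda>x :: ('a::topological_space \<Rightarrow>\<^sub>C 'b::real_normed_vector). apply_bcontfun x \<xi>)"
  by (rule bounded_linear_intro[where K=1]) (simp_all add: norm_bounded)

lemma bounded_linear_st:
  "bounded_linear (\<lambda>x. st_m x \<xi>)" "bounded_linear (\<lambda>x. st_p1 x \<xi>)" "bounded_linear (\<lambda>x. st_p2 x \<xi>)"
  "bounded_linear (\<lambda>x. st_r1 x \<xi>)" "bounded_linear (\<lambda>x. st_r2 x \<xi>)"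
  unfolding st_defs
  by (intro bounded_linear_compose[OF bounded_linear_fst] bounded_linear_compose[OF bounded_linear_snd]
      bounded_linear_apply_bcontfun)+

lemma norm_fst_le_norm: "norm (fst z) <= norm z" for z :: "'b::real_normed_vector \<times> 'c::real_normed_vector"
  using norm_fst_le[of "fst z" "snd z"] by simp

lemma norm_snd_le_norm: "norm (snd z) <= norm z" for z :: "'b::real_normed_vector \<times> 'c::real_normed_vector"
  using norm_snd_le[of "snd z" "fst z"] by simp

lemma abs_st_le:
  "\<bar>st_m x \<xi>\<bar> <= norm x" "\<bar>st_p1 x \<xi>\<bar> <= norm x" "\<bar>st_p2 x \<xi>\<bar> <= norm x"
  "\<bar>st_r1 x \<xi>\<bar> <= norm x" "\<bar>st_r2 x \<xi>\<bar> <= norm x"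
proof -
  let ?z = "apply_bcontfun x \<xi>"
  have n0: "norm ?z <= norm x" by (rule norm_bounded)
  have n1: "norm (snd ?z) <= norm x" by (rule order_trans[OF norm_snd_le_norm n0])
  have n2: "norm (snd (snd ?z)) <= norm x" by (rule order_trans[OF norm_snd_le_norm n1])
  have n3: "norm (snd (snd (snd ?z))) <= norm x" by (rule order_trans[OF norm_snd_le_norm n2])
  show "\<bar>st_m x \<xi>\<bar> <= norm x" using order_trans[OF norm_fst_le_norm n0] by (simp add: st_m_def)
  show "\<bar>st_p1 x \<xi>\<bar> <= norm x" using order_trans[OF norm_fst_le_norm n1] by (simp add: st_p1_def)
  show "\<bar>st_p2 x \<xi>\<bar> <= norm x" using order_trans[OF norm_fst_le_norm n2] by (simp add: st_p2_def)
  show "\<bar>st_r1 x \<xi>\<bar> <= norm x" using order_trans[OF norm_fst_le_norm n3] by (simp add: st_r1_def)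
  show "\<bar>st_r2 x \<xi>\<bar> <= norm x" using order_trans[OF norm_snd_le_norm n3] by (simp add: st_r2_def)
qed

text \<open>
  All functionals of the state are built by a short list of operations from the components.  The
  property is the one these operations preserve: boundedness and Lipschitz dependence on bounded sets
  of states, uniformly in the label.
\<close>

definition loc_lipschitz :: "(state => real => real) => bool" where
  "loc_lipschitz f \<longleftrightarrow> (\<forall>x. continuous_on UNIV (f x)) \<and>
     (\<forall>R. \<exists>L C. \<forall>x y \<xi>. norm x <= R --> norm y <= R -->
        \<bar>f x \<xi>\<bar> <= C \<and> \<bar>f x \<xi> - f y \<xi>\<bar> <= L * norm (x - y))"

lemma loc_lipschitzI:
  assumes "\<And>x. continuous_on UNIV (f x)"
    and "\<And>R. \<exists>L C. \<forall>x y \<xi>. norm x <= R --> norm y <= R -->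
        \<bar>f x \<xi>\<bar> <= C \<and> \<bar>f x \<xi> - f y \<xi>\<bar> <= L * norm (x - y)"
  shows "loc_lipschitz f"
  using assms by (auto simp: loc_lipschitz_def)

lemma loc_lipschitzE:
  assumes "loc_lipschitz f"
  obtains L C where "0 <= L" "0 <= C" "\<And>x \<xi>. norm x <= R ==> \<bar>f x \<xi>\<bar> <= C"
    "\<And>x y \<xi>. norm x <= R ==> norm y <= R ==> \<bar>f x \<xi> - f y \<xi>\<bar> <= L * norm (x - y)"
proof -
  obtain L C where LC: "\<And>x y \<xi>. norm x <= R ==> norm y <= R ==> \<bar>f x \<xi>\<bar> <= C \<and> \<bar>f x \<xi> - f y \<xi>\<bar> <= L * norm (x - y)"
    using assms unfolding loc_lipschitz_def by blast
  show thesis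
  proof (rule that[of "max 0 L" "max 0 C"])
    show "\<bar>f x \<xi>\<bar> <= max 0 C" if "norm x <= R" for x \<xi>
    proof -
      have "\<bar>f x \<xi>\<bar> <= C" using LC that by blast
      then show ?thesis by simp
    qed
    show "\<bar>f x \<xi> - f y \<xi>\<bar> <= max 0 L * norm (x - y)" if "norm x <= R" "norm y <= R" for x y \<xi>
    proof -
      have "\<bar>f x \<xi> - f y \<xi>\<bar> <= L * norm (x - y)" using LC that by blast
      also have "... <= max 0 L * norm (x - y)" by (intro mult_right_mono) auto
      finally show ?thesis .
    qed
  qed auto
qed

lemma loc_lipschitz_continuous: "loc_lipschitz f ==> continuous_on A (f x)"
  unfolding loc_lipschitz_def by (meson continuous_on_subset subset_UNIV)

lemma loc_lipschitz_borel: "loc_lipschitz f ==> f x \<in> borel_measurable borel"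
  by (rule borel_measurable_continuous_onI[OF loc_lipschitz_continuous])

lemma continuous_on_st:
  "continuous_on A (st_m x)" "continuous_on A (st_p1 x)" "continuous_on A (st_p2 x)"
  "continuous_on A (st_r1 x)" "continuous_on A (st_r2 x)"
  unfolding st_defs by (intro continuous_intros continuous_on_apply_bcontfun)+

lemma loc_lipschitz_const: "loc_lipschitz (\<lambda>x \<xi>. c)"
  by (rule loc_lipschitzI) (auto intro!: exI[of _ 0] exI[of _ "\<bar>c\<bar>"])

lemma loc_lipschitz_st:
  "loc_lipschitz st_m" "loc_lipschitz st_p1" "loc_lipschitz st_p2" "loc_lipschitz st_r1" "loc_lipschitz st_r2"
proof -
  have "loc_lipschitz f" if c: "\<And>x. continuous_on UNIV (f x)" and l: "\<And>\<xi>. bounded_linear (\<lambda>x. f x \<xi>)"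
    and b: "\<And>x \<xi>. \<bar>f x \<xi>\<bar> <= norm x" for f
  proof (rule loc_lipschitzI[OF c])
    fix R
    have "\<bar>f x \<xi> - f y \<xi>\<bar> <= 1 * norm (x - y)" for x y \<xi>
      using b[of "x - y" \<xi>] linear_diff[OF bounded_linear.linear[OF l[of \<xi>]], of x y] by simp
    moreover have "\<bar>f x \<xi>\<bar> <= R" if "norm x <= R" for x \<xi> using b that order_trans by blast
    ultimately show "\<exists>L C. \<forall>x y \<xi>. norm x <= R --> norm y <= R -->
        \<bar>f x \<xi>\<bar> <= C \<and> \<bar>f x \<xi> - f y \<xi>\<bar> <= L * norm (x - y)" by blast
  qed
  note * = this
  show "loc_lipschitz st_m" "loc_lipschitz st_p1" "loc_lipschitz st_p2" "loc_lipschitz st_r1" "loc_lipschitz st_r2"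
    by (rule *, rule continuous_on_st, rule bounded_linear_st, rule abs_st_le)+
qed

lemma loc_lipschitz_add:
  assumes f: "loc_lipschitz f" and g: "loc_lipschitz g"
  shows "loc_lipschitz (\<lambda>x \<xi>. f x \<xi> + g x \<xi>)"
proof (rule loc_lipschitzI)
  show "continuous_on UNIV (\<lambda>\<xi>. f x \<xi> + g x \<xi>)" for x
    using assms by (intro continuous_intros loc_lipschitz_continuous)
  fix R
  obtain L1 C1 where 1: "\<And>x \<xi>. norm x <= R ==> \<bar>f x \<xi>\<bar> <= C1"
    "\<And>x y \<xi>. norm x <= R ==> norm y <= R ==> \<bar>f x \<xi> - f y \<xi>\<bar> <= L1 * norm (x - y)" using loc_lipschitzE[OF f] by metis
  obtain L2 C2 where 2: "\<And>x \<xi>. norm x <= R ==> \<bar>g x \<xi>\<bar> <= C2"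
    "\<And>x y \<xi>. norm x <= R ==> norm y <= R ==> \<bar>g x \<xi> - g y \<xi>\<bar> <= L2 * norm (x - y)" using loc_lipschitzE[OF g] by metis
  have "\<bar>f x \<xi> + g x \<xi>\<bar> <= C1 + C2 \<and> \<bar>f x \<xi> + g x \<xi> - (f y \<xi> + g y \<xi>)\<bar> <= (L1 + L2) * norm (x - y)"
    if "norm x <= R" "norm y <= R" for x y \<xi>
    using 1(1)[OF that(1), of \<xi>] 1(2)[OF that, of \<xi>] 2(1)[OF that(1), of \<xi>] 2(2)[OF that, of \<xi>]
    unfolding distrib_right by linarith
  then show "\<exists>L C. \<forall>x y \<xi>. norm x <= R --> norm y <= R -->
        \<bar>f x \<xi> + g x \<xi>\<bar> <= C \<and> \<bar>f x \<xi> + g x \<xi> - (f y \<xi> + g y \<xi>)\<bar> <= L * norm (x - y)" by blast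
qed

lemma loc_lipschitz_mult:
  assumes f: "loc_lipschitz f" and g: "loc_lipschitz g"
  shows "loc_lipschitz (\<lambda>x \<xi>. f x \<xi> * g x \<xi>)"
proof (rule loc_lipschitzI)
  show "continuous_on UNIV (\<lambda>\<xi>. f x \<xi> * g x \<xi>)" for x
    using assms by (intro continuous_intros loc_lipschitz_continuous)
  fix R
  obtain L1 C1 where 1: "0 <= L1" "0 <= C1" "\<And>x \<xi>. norm x <= R ==> \<bar>f x \<xi>\<bar> <= C1"
    "\<And>x y \<xi>. norm x <= R ==> norm y <= R ==> \<bar>f x \<xi> - f y \<xi>\<bar> <= L1 * norm (x - y)" using loc_lipschitzE[OF f] by metis
  obtain L2 C2 where 2: "0 <= L2" "0 <= C2" "\<And>x \<xi>. norm x <= R ==> \<bar>g x \<xi>\<bar> <= C2"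
    "\<And>x y \<xi>. norm x <= R ==> norm y <= R ==> \<bar>g x \<xi> - g y \<xi>\<bar> <= L2 * norm (x - y)" using loc_lipschitzE[OF g] by metis
  have "\<bar>f x \<xi> * g x \<xi>\<bar> <= C1 * C2 \<and> \<bar>f x \<xi> * g x \<xi> - f y \<xi> * g y \<xi>\<bar> <= (C1 * L2 + C2 * L1) * norm (x - y)"
    if R: "norm x <= R" "norm y <= R" for x y \<xi>
  proof
    show "\<bar>f x \<xi> * g x \<xi>\<bar> <= C1 * C2"
      unfolding abs_mult by (intro mult_mono 1 2 R) auto
    have eq: "f x \<xi> * g x \<xi> - f y \<xi> * g y \<xi> = f x \<xi> * (g x \<xi> - g y \<xi>) + g y \<xi> * (f x \<xi> - f y \<xi>)" by (simp add: algebra_simps)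
    have "\<bar>f x \<xi> * (g x \<xi> - g y \<xi>)\<bar> <= C1 * (L2 * norm (x - y))"
      unfolding abs_mult by (intro mult_mono 1 2 R) auto
    moreover have "\<bar>g y \<xi> * (f x \<xi> - f y \<xi>)\<bar> <= C2 * (L1 * norm (x - y))"
      unfolding abs_mult by (intro mult_mono 1 2 R) auto
    ultimately show "\<bar>f x \<xi> * g x \<xi> - f y \<xi> * g y \<xi>\<bar> <= (C1 * L2 + C2 * L1) * norm (x - y)"
      unfolding eq distrib_right mult.assoc by linarith
  qed
  then show "\<exists>L C. \<forall>x y \<xi>. norm x <= R --> norm y <= R -->
        \<bar>f x \<xi> * g x \<xi>\<bar> <= C \<and> \<bar>f x \<xi> * g x \<xi> - f y \<xi> * g y \<xi>\<bar> <= L * norm (x - y)" by blast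
qed

lemma loc_lipschitz_cmult: "loc_lipschitz f ==> loc_lipschitz (\<lambda>x \<xi>. c * f x \<xi>)"
  by (rule loc_lipschitz_mult[OF loc_lipschitz_const])

lemma loc_lipschitz_minus: "loc_lipschitz f ==> loc_lipschitz (\<lambda>x \<xi>. - f x \<xi>)"
  using loc_lipschitz_cmult[of f "-1"] by simp

lemma loc_lipschitz_diff: "loc_lipschitz f ==> loc_lipschitz g ==> loc_lipschitz (\<lambda>x \<xi>. f x \<xi> - g x \<xi>)"
  using loc_lipschitz_add[OF _ loc_lipschitz_minus, of f g] by simp

lemma loc_lipschitz_square: "loc_lipschitz f ==> loc_lipschitz (\<lambda>x \<xi>. (f x \<xi>)^2)"
  unfolding power2_eq_square by (rule loc_lipschitz_mult)

lemma loc_lipschitz_exp: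
  assumes f: "loc_lipschitz f"
  shows "loc_lipschitz (\<lambda>x \<xi>. exp (f x \<xi>))"
proof (rule loc_lipschitzI)
  show "continuous_on UNIV (\<lambda>\<xi>. exp (f x \<xi>))" for x
    using assms by (intro continuous_intros loc_lipschitz_continuous)
  fix R
  obtain L C where 1: "0 <= L" "0 <= C" "\<And>x \<xi>. norm x <= R ==> \<bar>f x \<xi>\<bar> <= C"
    "\<And>x y \<xi>. norm x <= R ==> norm y <= R ==> \<bar>f x \<xi> - f y \<xi>\<bar> <= L * norm (x - y)" using loc_lipschitzE[OF f] by metis
  have "\<bar>exp (f x \<xi>)\<bar> <= exp C \<and> \<bar>exp (f x \<xi>) - exp (f y \<xi>)\<bar> <= (exp C * L) * norm (x - y)"
    if R: "norm x <= R" "norm y <= R" for x y \<xi>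
  proof
    show "\<bar>exp (f x \<xi>)\<bar> <= exp C" using 1(3)[OF R(1), of \<xi>] by simp
    have "norm (exp (f x \<xi>) - exp (f y \<xi>)) <= exp C * norm (f x \<xi> - f y \<xi>)"
    proof (rule field_differentiable_bound[of "{-C..C}" exp exp])
      show "(exp has_field_derivative exp z) (at z within {-C..C})" for z :: real
        by (auto intro!: derivative_eq_intros)
      show "f x \<xi> \<in> {-C..C}" using 1(3)[OF R(1), of \<xi>] by (auto simp: abs_le_iff)
      show "f y \<xi> \<in> {-C..C}" using 1(3)[OF R(2), of \<xi>] by (auto simp: abs_le_iff)
    qed auto
    also have "... <= exp C * (L * norm (x - y))" using 1(4)[OF R, of \<xi>] by (intro mult_left_mono) auto
    finally show "\<bar>exp (f x \<xi>) - exp (f y \<xi>)\<bar> <= (exp C * L) * norm (x - y)" by (simp add: mult.assoc)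
  qed
  then show "\<exists>L C. \<forall>x y \<xi>. norm x <= R --> norm y <= R -->
        \<bar>exp (f x \<xi>)\<bar> <= C \<and> \<bar>exp (f x \<xi>) - exp (f y \<xi>)\<bar> <= L * norm (x - y)" by blast
qed

lemma loc_lipschitz_eval: "loc_lipschitz f ==> loc_lipschitz (\<lambda>x \<xi>. f x c)"
  unfolding loc_lipschitz_def by (auto, meson)

lemmas loc_lipschitz_intros = loc_lipschitz_const loc_lipschitz_st loc_lipschitz_add loc_lipschitz_mult
  loc_lipschitz_minus loc_lipschitz_diff loc_lipschitz_square loc_lipschitz_exp loc_lipschitz_eval

lemma loc_lipschitz_uniform_continuity:
  assumes f: "loc_lipschitz f" and X: "isCont X t" and e: "0 < e"
  shows "\<forall>\<^sub>F s in nhds t. \<forall>\<xi>. \<bar>f (X s) \<xi> - f (X t) \<xi>\<bar> < e"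
proof -
  obtain L C where L: "0 <= L" "\<And>x y \<xi>. norm x <= norm (X t) + 1 ==> norm y <= norm (X t) + 1 ==> \<bar>f x \<xi> - f y \<xi>\<bar> <= L * norm (x - y)"
    using loc_lipschitzE[OF f, of "norm (X t) + 1"] by metis
  define d where "d = min 1 (e / (L + 1))"
  have d: "d > 0" using e L by (simp add: d_def)
  have "(X \<longlongrightarrow> X t) (nhds t)" using X by (simp add: isCont_def tendsto_at_iff_tendsto_nhds)
  from tendstoD[OF this d] show ?thesis
  proof eventually_elim
    case (elim s)
    then have n: "norm (X s - X t) < d" by (simp add: dist_norm)
    have b: "norm (X s) <= norm (X t) + 1" using n norm_triangle_ineq2[of "X s" "X t"] by (simp add: d_def)
    show ?case
    proof
      fix \<xi>
      have "\<bar>f (X s) \<xi> - f (X t) \<xi>\<bar> <= L * norm (X s - X t)" by (rule L(2)[OF b]) simp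
      also have "... <= L * (e / (L + 1))" using n L(1) by (intro mult_left_mono) (auto simp: d_def)
      also have "... < e" using e L(1) by (simp add: field_simps)
      finally show "\<bar>f (X s) \<xi> - f (X t) \<xi>\<bar> < e" .
    qed
  qed
qed

text \<open>
  \<open>w\<close> is the derivative of the datum on one period, cut off outside.
\<close>

locale lagrangian =
  fixes w :: "real => real"
  assumes w_borel [measurable]: "w \<in> borel_measurable borel"
    and w_outside: "x \<notin> {0..1} ==> w x = 0"
    and w_square: "integrable lborel (\<lambda>x. (w x)^2)"
begin

abbreviation e0 :: "real => real" where "e0 \<equiv> indicat_real {0..1}"

definition weight :: "real => real" where "weight \<eta> = 2 * e0 \<eta> + 2 * (w \<eta>)^2"

lemma integrable_e0: "integrable lborel e0"
  by (rule integrable_real_indicator) auto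

lemma integrable_weight: "integrable lborel weight"
  unfolding weight_def by (intro Bochner_Integration.integrable_add integrable_mult_right integrable_e0 w_square)

lemma weight_nonneg: "0 <= weight \<eta>" by (simp add: weight_def)

text \<open>
  Products of two functions of the form \<open>p + q w\<close>, restricted to the period.  Since \<open>\<bar>w\<bar> <= 1 + w^2\<close>,
  bounded coefficients give an integrand bounded by a fixed integrable weight.
\<close>

definition quad :: "(real => real) => (real => real) => (real => real) => real => real" where
  "quad f g h \<eta> = f \<eta> * e0 \<eta> + g \<eta> * w \<eta> + h \<eta> * (w \<eta>)^2"

lemma quad_le:
  assumes "\<bar>f \<eta>\<bar> <= C" "\<bar>g \<eta>\<bar> <= C" "\<bar>h \<eta>\<bar> <= C"
  shows "\<bar>quad f g h \<eta>\<bar> <= C * weight \<eta>"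
proof -
  have C: "0 <= C" using assms(1) by linarith
  have "\<bar>w \<eta>\<bar> <= e0 \<eta> + (w \<eta>)^2"
  proof (cases "\<eta> \<in> {0..1}")
    case True
    have "0 <= (\<bar>w \<eta>\<bar> - 1)^2" by simp
    then have "2 * \<bar>w \<eta>\<bar> <= 1 + (w \<eta>)^2" by (simp add: power2_eq_square algebra_simps)
    then have "\<bar>w \<eta>\<bar> <= 1 + (w \<eta>)^2" by linarith
    then show ?thesis using True by simp
  next
    case False then show ?thesis using w_outside by simp
  qed
  then have "\<bar>g \<eta> * w \<eta>\<bar> <= C * (e0 \<eta> + (w \<eta>)^2)"
    unfolding abs_mult using assms C by (intro mult_mono) auto
  moreover have "\<bar>f \<eta> * e0 \<eta>\<bar> <= C * e0 \<eta>" unfolding abs_mult using assms by (intro mult_mono) auto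
  moreover have "\<bar>h \<eta> * (w \<eta>)^2\<bar> <= C * (w \<eta>)^2" unfolding abs_mult using assms by (intro mult_mono) auto
  ultimately show ?thesis unfolding quad_def weight_def by (simp add: algebra_simps)
qed

lemma quad_diff:
  "quad f g h \<eta> - quad f' g' h' \<eta> = quad (\<lambda>z. f z - f' z) (\<lambda>z. g z - g' z) (\<lambda>z. h z - h' z) \<eta>"
  by (simp add: quad_def algebra_simps)

lemma loc_lipschitz_quad:
  assumes "loc_lipschitz f" "loc_lipschitz g" "loc_lipschitz h"
  obtains L C where "0 <= L" "0 <= C" "\<And>x \<eta>. norm x <= R ==> \<bar>quad (f x) (g x) (h x) \<eta>\<bar> <= C * weight \<eta>"
    "\<And>x y \<eta>. norm x <= R ==> norm y <= R ==>
       \<bar>quad (f x) (g x) (h x) \<eta> - quad (f y) (g y) (h y) \<eta>\<bar> <= L * norm (x - y) * weight \<eta>"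
proof -
  obtain L1 C1 where 1: "0 <= L1" "0 <= C1" "\<And>x \<xi>. norm x <= R ==> \<bar>f x \<xi>\<bar> <= C1"
    "\<And>x y \<xi>. norm x <= R ==> norm y <= R ==> \<bar>f x \<xi> - f y \<xi>\<bar> <= L1 * norm (x - y)" using loc_lipschitzE[OF assms(1)] by metis
  obtain L2 C2 where 2: "0 <= L2" "0 <= C2" "\<And>x \<xi>. norm x <= R ==> \<bar>g x \<xi>\<bar> <= C2"
    "\<And>x y \<xi>. norm x <= R ==> norm y <= R ==> \<bar>g x \<xi> - g y \<xi>\<bar> <= L2 * norm (x - y)" using loc_lipschitzE[OF assms(2)] by metis
  obtain L3 C3 where 3: "0 <= L3" "0 <= C3" "\<And>x \<xi>. norm x <= R ==> \<bar>h x \<xi>\<bar> <= C3"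
    "\<And>x y \<xi>. norm x <= R ==> norm y <= R ==> \<bar>h x \<xi> - h y \<xi>\<bar> <= L3 * norm (x - y)" using loc_lipschitzE[OF assms(3)] by metis
  show thesis
  proof (rule that[of "L1 + L2 + L3" "C1 + C2 + C3"])
    fix x y :: state and \<eta> assume xy: "norm x <= R" "norm y <= R"
    have n: "0 <= norm (x - y)" by simp
    have le: "L1 * norm (x - y) <= (L1 + L2 + L3) * norm (x - y)" "L2 * norm (x - y) <= (L1 + L2 + L3) * norm (x - y)"
      "L3 * norm (x - y) <= (L1 + L2 + L3) * norm (x - y)"
      using 1(1) 2(1) 3(1) by (intro mult_right_mono n; simp)+
    show "\<bar>quad (f x) (g x) (h x) \<eta> - quad (f y) (g y) (h y) \<eta>\<bar> <= (L1 + L2 + L3) * norm (x - y) * weight \<eta>"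
      unfolding quad_diff
      by (rule quad_le) (use le 1(4)[OF xy, of \<eta>] 2(4)[OF xy, of \<eta>] 3(4)[OF xy, of \<eta>] in linarith)+
  next
    fix x :: state and \<eta> assume x: "norm x <= R"
    show "\<bar>quad (f x) (g x) (h x) \<eta>\<bar> <= (C1 + C2 + C3) * weight \<eta>"
      by (rule quad_le) (use 1(2) 2(2) 3(2) 1(3)[OF x, of \<eta>] 2(3)[OF x, of \<eta>] 3(3)[OF x, of \<eta>] in linarith)+
  qed (use 1 2 3 in auto)
qed

lemma quad_borel [measurable]:
  assumes [measurable]: "f \<in> borel_measurable borel" "g \<in> borel_measurable borel" "h \<in> borel_measurable borel"
  shows "quad f g h \<in> borel_measurable borel"
  unfolding quad_def[abs_def] by measurable

lemma quad_state_borel: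
  assumes "loc_lipschitz f" "loc_lipschitz g" "loc_lipschitz h"
  shows "quad (f x) (g x) (h x) \<in> borel_measurable borel"
  by (rule quad_borel) (use assms in \<open>auto intro: loc_lipschitz_borel\<close>)

lemma integrable_quad:
  assumes "loc_lipschitz f" "loc_lipschitz g" "loc_lipschitz h"
  shows "integrable lborel (quad (f x) (g x) (h x))"
proof -
  obtain L C where C: "0 <= C" "\<And>\<eta>. \<bar>quad (f x) (g x) (h x) \<eta>\<bar> <= C * weight \<eta>"
    using loc_lipschitz_quad[OF assms, of "norm x"] by (metis order_refl)
  show ?thesis
    by (rule Bochner_Integration.integrable_bound[of _ "\<lambda>\<eta>. C * weight \<eta>"])
       (use C quad_state_borel[OF assms] integrable_weight in \<open>auto simp: weight_nonneg\<close>)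
qed

definition iquad where
  "iquad f g h x \<xi> = (LINT \<eta>:{..\<xi>}|lborel. quad (f x) (g x) (h x) \<eta>)"

lemma iquad_density:
  assumes "loc_lipschitz f" "loc_lipschitz g" "loc_lipschitz h"
  shows "has_density (iquad f g h x) (quad (f x) (g x) (h x))"
  unfolding iquad_def by (rule has_density_indefinite_integral[OF integrable_quad[OF assms]])

lemma loc_lipschitz_iquad:
  assumes fgh: "loc_lipschitz f" "loc_lipschitz g" "loc_lipschitz h"
  shows "loc_lipschitz (iquad f g h)"
proof (rule loc_lipschitzI)
  show "continuous_on UNIV (iquad f g h x)" for x by (rule has_density_continuous[OF iquad_density[OF fgh]])
  fix R
  obtain L C where LC: "0 <= L" "0 <= C" "\<And>x \<eta>. norm x <= R ==> \<bar>quad (f x) (g x) (h x) \<eta>\<bar> <= C * weight \<eta>"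
    "\<And>x y \<eta>. norm x <= R ==> norm y <= R ==>
       \<bar>quad (f x) (g x) (h x) \<eta> - quad (f y) (g y) (h y) \<eta>\<bar> <= L * norm (x - y) * weight \<eta>"
    using loc_lipschitz_quad[OF fgh, of R] by metis
  define W where "W = (LINT \<eta>|lborel. weight \<eta>)"
  have bound: "\<bar>LINT \<eta>:{..\<xi>}|lborel. q \<eta>\<bar> <= D * W"
    if q: "integrable lborel q" "\<And>\<eta>. \<bar>q \<eta>\<bar> <= D * weight \<eta>" for q D \<xi>
  proof -
    have i: "integrable lborel (\<lambda>\<eta>. indicator {..\<xi>} \<eta> *\<^sub>R q \<eta>)"
      by (rule integrable_mult_indicator[OF _ q(1)]) simp
    have "\<bar>LINT \<eta>:{..\<xi>}|lborel. q \<eta>\<bar> <= (LINT \<eta>|lborel. D * weight \<eta>)"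
      unfolding set_lebesgue_integral_def real_norm_def[symmetric]
    proof (rule Bochner_Integration.integral_norm_bound_integral[OF i])
      show "integrable lborel (\<lambda>\<eta>. D * weight \<eta>)" using integrable_weight by simp
      show "norm (indicator {..\<xi>} \<eta> *\<^sub>R q \<eta>) <= D * weight \<eta>" for \<eta>
        using q(2)[of \<eta>] by (auto simp: indicator_def intro: order_trans[OF abs_ge_zero])
    qed
    then show ?thesis by (simp add: W_def)
  qed
  have "\<bar>iquad f g h x \<xi>\<bar> <= C * W \<and> \<bar>iquad f g h x \<xi> - iquad f g h y \<xi>\<bar> <= (L * W) * norm (x - y)"
    if xy: "norm x <= R" "norm y <= R" for x y \<xi>
  proof
    show "\<bar>iquad f g h x \<xi>\<bar> <= C * W"
      unfolding iquad_def by (rule bound[OF integrable_quad[OF fgh] LC(3)[OF xy(1)]])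
    have si: "set_integrable lborel {..\<xi>} (quad (f z) (g z) (h z))" for z
      unfolding set_integrable_def by (rule integrable_mult_indicator[OF _ integrable_quad[OF fgh]]) simp
    have "iquad f g h x \<xi> - iquad f g h y \<xi> =
       (LINT \<eta>:{..\<xi>}|lborel. quad (f x) (g x) (h x) \<eta> - quad (f y) (g y) (h y) \<eta>)"
      unfolding iquad_def by (rule set_integral_diff(2)[OF si si, symmetric])
    also have "\<bar>...\<bar> <= (L * norm (x - y)) * W"
      by (rule bound[OF Bochner_Integration.integrable_diff[OF integrable_quad[OF fgh] integrable_quad[OF fgh]] LC(4)[OF xy]])
    finally show "\<bar>iquad f g h x \<xi> - iquad f g h y \<xi>\<bar> <= (L * W) * norm (x - y)" by (simp add: mult_ac)
  qed
  then show "\<exists>L C. \<forall>x y \<xi>. norm x <= R --> norm y <= R -->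
        \<bar>iquad f g h x \<xi>\<bar> <= C \<and> \<bar>iquad f g h x \<xi> - iquad f g h y \<xi>\<bar> <= L * norm (x - y)" by blast
qed

text \<open>
  Differentiation under the integral sign.  The difference quotients of the integrand are dominated by
  a multiple of the weight because \<open>X\<close> is Lipschitz near \<open>t\<close>.
\<close>

lemma iquad_time_derivative:
  assumes fgh: "loc_lipschitz f" "loc_lipschitz g" "loc_lipschitz h"
    and X: "(X has_vector_derivative V) (at t)"
    and D: "\<And>\<eta>. ((\<lambda>s. quad (f (X s)) (g (X s)) (h (X s)) \<eta>) has_real_derivative G \<eta>) (at t)"
    and G [measurable]: "G \<in> borel_measurable borel"
  shows "((\<lambda>s. iquad f g h (X s) \<xi>) has_real_derivative (LINT \<eta>:{..\<xi>}|lborel. G \<eta>)) (at t)"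
  unfolding has_field_derivative_iff tendsto_at_iff_sequentially comp_def
proof (intro allI impI)
  fix s :: "nat => real" assume s: "\<forall>i. s i \<in> UNIV - {t}" and st: "s \<longlonglongrightarrow> t"
  let ?q = "\<lambda>\<tau> \<eta>. quad (f (X \<tau>)) (g (X \<tau>)) (h (X \<tau>)) \<eta>"
  have ne: "s i \<noteq> t" for i using s by auto
  have Xc: "isCont X t" using X has_vector_derivative_continuous by blast
  have "(\<lambda>i. X (s i)) \<longlonglongrightarrow> X t" using Xc st by (rule isCont_tendsto_compose)
  then have "Bseq (\<lambda>i. X (s i))" by (intro convergent_imp_Bseq convergentI)
  then obtain R where R: "\<And>i. norm (X (s i)) <= R" unfolding Bseq_def by blast
  have Rt: "norm (X t) <= R"
    by (rule Lim_bounded[OF tendsto_norm[OF \<open>(\<lambda>i. X (s i)) \<longlonglongrightarrow> X t\<close>]]) (use R in auto)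
  have "((\<lambda>u. norm (X u - X t - (u - t) *\<^sub>R V) / norm (u - t)) \<longlongrightarrow> 0) (at t)"
    using X unfolding has_vector_derivative_def has_derivative_iff_norm by blast
  then have "(\<lambda>i. norm (X (s i) - X t - (s i - t) *\<^sub>R V) / norm (s i - t)) \<longlonglongrightarrow> 0"
    unfolding tendsto_at_iff_sequentially comp_def using s st by blast
  then have "Bseq (\<lambda>i. norm (X (s i) - X t - (s i - t) *\<^sub>R V) / norm (s i - t))"
    by (intro convergent_imp_Bseq convergentI)
  then obtain K0 where K0: "\<And>i. norm (norm (X (s i) - X t - (s i - t) *\<^sub>R V) / norm (s i - t)) <= K0"
    unfolding Bseq_def by blast
  define K where "K = K0 + norm V"
  have K': "norm (X (s i) - X t) / \<bar>s i - t\<bar> <= K" for i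
  proof -
    have pos: "0 < \<bar>s i - t\<bar>" using ne[of i] by simp
    have "norm (X (s i) - X t) <= norm (X (s i) - X t - (s i - t) *\<^sub>R V) + norm ((s i - t) *\<^sub>R V)"
      using norm_triangle_ineq[of "X (s i) - X t - (s i - t) *\<^sub>R V" "(s i - t) *\<^sub>R V"] by simp
    then have "norm (X (s i) - X t) / \<bar>s i - t\<bar> <=
        norm (X (s i) - X t - (s i - t) *\<^sub>R V) / \<bar>s i - t\<bar> + norm ((s i - t) *\<^sub>R V) / \<bar>s i - t\<bar>"
      unfolding add_divide_distrib[symmetric] by (rule divide_right_mono) simp
    also have "norm ((s i - t) *\<^sub>R V) / \<bar>s i - t\<bar> = norm V" using pos by simp
    finally show ?thesis using K0[of i] by (simp add: K_def)
  qed
  obtain L C where L: "0 <= L" "\<And>x y \<eta>. norm x <= R ==> norm y <= R ==>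
       \<bar>quad (f x) (g x) (h x) \<eta> - quad (f y) (g y) (h y) \<eta>\<bar> <= L * norm (x - y) * weight \<eta>"
    using loc_lipschitz_quad[OF fgh, of R] by metis
  have qm [measurable]: "?q \<tau> \<in> borel_measurable borel" for \<tau> by (rule quad_state_borel[OF fgh])
  have lim: "(\<lambda>i. LINT \<eta>|lborel. indicator {..\<xi>} \<eta> * ((?q (s i) \<eta> - ?q t \<eta>) / (s i - t))) \<longlonglongrightarrow>
     (LINT \<eta>|lborel. indicator {..\<xi>} \<eta> * G \<eta>)"
  proof (rule integral_dominated_convergence[where s="\<lambda>i \<eta>. indicator {..\<xi>} \<eta> * ((?q (s i) \<eta> - ?q t \<eta>) / (s i - t))"
        and f="\<lambda>\<eta>. indicator {..\<xi>} \<eta> * G \<eta>" and w="\<lambda>\<eta>. (L * K) * weight \<eta>"])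
    show "integrable lborel (\<lambda>\<eta>. (L * K) * weight \<eta>)" using integrable_weight by simp
    show "AE \<eta> in lborel. (\<lambda>i. indicator {..\<xi>} \<eta> * ((?q (s i) \<eta> - ?q t \<eta>) / (s i - t))) \<longlonglongrightarrow> indicator {..\<xi>} \<eta> * G \<eta>"
    proof (rule AE_I2)
      fix \<eta>
      have "(\<lambda>i. (?q (s i) \<eta> - ?q t \<eta>) / (s i - t)) \<longlonglongrightarrow> G \<eta>"
        using D[of \<eta>] s st unfolding has_field_derivative_iff tendsto_at_iff_sequentially comp_def by blast
      then show "(\<lambda>i. indicator {..\<xi>} \<eta> * ((?q (s i) \<eta> - ?q t \<eta>) / (s i - t))) \<longlonglongrightarrow> indicator {..\<xi>} \<eta> * G \<eta>"
        by (intro tendsto_mult tendsto_const)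
    qed
    show "AE \<eta> in lborel. norm (indicator {..\<xi>} \<eta> * ((?q (s i) \<eta> - ?q t \<eta>) / (s i - t))) <= (L * K) * weight \<eta>" for i
    proof (rule AE_I2)
      fix \<eta>
      have "\<bar>(?q (s i) \<eta> - ?q t \<eta>) / (s i - t)\<bar> <= (L * norm (X (s i) - X t) * weight \<eta>) / \<bar>s i - t\<bar>"
        unfolding abs_divide using L(2)[OF R Rt] by (intro divide_right_mono) auto
      also have "... = L * (norm (X (s i) - X t) / \<bar>s i - t\<bar>) * weight \<eta>" by simp
      also have "... <= L * K * weight \<eta>" using L(1) K' weight_nonneg by (intro mult_right_mono mult_left_mono) auto
      finally have *: "\<bar>(?q (s i) \<eta> - ?q t \<eta>) / (s i - t)\<bar> <= (L * K) * weight \<eta>" by simp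
      then have "0 <= (L * K) * weight \<eta>" by (rule order_trans[OF abs_ge_zero])
      then show "norm (indicator {..\<xi>} \<eta> * ((?q (s i) \<eta> - ?q t \<eta>) / (s i - t))) <= (L * K) * weight \<eta>"
        using * by (simp add: indicator_def)
    qed
  qed measurable
  have "(iquad f g h (X (s i)) \<xi> - iquad f g h (X t) \<xi>) / (s i - t) =
     (LINT \<eta>|lborel. indicator {..\<xi>} \<eta> * ((?q (s i) \<eta> - ?q t \<eta>) / (s i - t)))" for i
  proof -
    have si: "set_integrable lborel {..\<xi>} (?q \<tau>)" for \<tau>
      unfolding set_integrable_def by (rule integrable_mult_indicator[OF _ integrable_quad[OF fgh]]) simp
    have "iquad f g h (X (s i)) \<xi> - iquad f g h (X t) \<xi> = (LINT \<eta>:{..\<xi>}|lborel. ?q (s i) \<eta> - ?q t \<eta>)"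
      unfolding iquad_def by (rule set_integral_diff(2)[OF si si, symmetric])
    then show ?thesis
      unfolding set_lebesgue_integral_def by (simp flip: integral_divide_zero)
  qed
  then show "(\<lambda>i. (iquad f g h (X (s i)) \<xi> - iquad f g h (X t) \<xi>) / (s i - t)) \<longlonglongrightarrow> (LINT \<eta>:{..\<xi>}|lborel. G \<eta>)"
    using lim by (simp only: set_lebesgue_integral_def real_scaleR_def)
qed

end

section \<open>The vector field along characteristics\<close>

lemma norm_tuple5_le:
  "norm (a, b, c, d, e) <= \<bar>a\<bar> + \<bar>b\<bar> + \<bar>c\<bar> + \<bar>d\<bar> + \<bar>e\<bar>" for a b c d e :: real
proof -
  have 1: "norm (d, e) <= \<bar>d\<bar> + \<bar>e\<bar>" using norm_Pair_le[of d e] by simp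
  have 2: "norm (c, d, e) <= \<bar>c\<bar> + norm (d, e)" using norm_Pair_le[of c "(d, e)"] by simp
  have 3: "norm (b, c, d, e) <= \<bar>b\<bar> + norm (c, d, e)" using norm_Pair_le[of b "(c, d, e)"] by simp
  have 4: "norm (a, b, c, d, e) <= \<bar>a\<bar> + norm (b, c, d, e)" using norm_Pair_le[of a "(b, c, d, e)"] by simp
  show ?thesis using 1 2 3 4 by linarith
qed

lemma tuple_bcontfun:
  assumes "loc_lipschitz f1" "loc_lipschitz f2" "loc_lipschitz f3" "loc_lipschitz f4" "loc_lipschitz f5"
  shows "(\<lambda>\<xi>. (f1 x \<xi>, f2 x \<xi>, f3 x \<xi>, f4 x \<xi>, f5 x \<xi>)) \<in> bcontfun"
proof -
  have "\<exists>C. \<forall>\<xi>. \<bar>f x \<xi>\<bar> <= C" if "loc_lipschitz f" for f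
    using loc_lipschitzE[OF that, of "norm x"] by (metis order_refl)
  then obtain C1 C2 C3 C4 C5 where C: "\<And>\<xi>. \<bar>f1 x \<xi>\<bar> <= C1" "\<And>\<xi>. \<bar>f2 x \<xi>\<bar> <= C2"
      "\<And>\<xi>. \<bar>f3 x \<xi>\<bar> <= C3" "\<And>\<xi>. \<bar>f4 x \<xi>\<bar> <= C4" "\<And>\<xi>. \<bar>f5 x \<xi>\<bar> <= C5"
    using assms by metis
  show ?thesis
  proof (rule bcontfun_normI)
    show "continuous_on UNIV (\<lambda>\<xi>. (f1 x \<xi>, f2 x \<xi>, f3 x \<xi>, f4 x \<xi>, f5 x \<xi>))"
      using assms by (intro continuous_on_Pair loc_lipschitz_continuous)
    show "norm (f1 x \<xi>, f2 x \<xi>, f3 x \<xi>, f4 x \<xi>, f5 x \<xi>) <= C1 + C2 + C3 + C4 + C5" for \<xi>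
      using norm_tuple5_le[of "f1 x \<xi>" "f2 x \<xi>" "f3 x \<xi>" "f4 x \<xi>" "f5 x \<xi>"] C(1)[of \<xi>] C(2)[of \<xi>] C(3)[of \<xi>] C(4)[of \<xi>] C(5)[of \<xi>]
      by linarith
  qed
qed

context lagrangian
begin

text \<open>
  \<open>alpha\<close> is a square root, of either sign, of the density \<open>Y_\<xi>\<close>, and \<open>beta\<close> its product with the
  gradient.  \<open>Y\<close> is the position relative to that of the label 0, \<open>U\<close> the velocity, and
  \<open>src\<close> the density of \<open>u^2 + u_x^2 / 2\<close> with respect to labels.  \<open>A\<close> and \<open>B\<close> integrate \<open>src\<close>
  against growing and decaying exponentials; \<open>k1\<close> and \<open>k2\<close> sum the geometric series over the copies of
  the period to the right and to the left, so that \<open>Mp\<close> and \<open>Mm\<close> are the integrals of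
  \<open>exp (- \<bar>y - y'\<bar>)\<close> over all \<open>y'\<close> on the right and on the left of \<open>y\<close>, \<open>P\<close> is the pressure and \<open>Q\<close>
  its spatial derivative.
\<close>

definition alpha :: "state => real => real" where
  "alpha x \<eta> = st_p1 x \<eta> * e0 \<eta> + st_p2 x \<eta> * w \<eta>"
definition beta :: "state => real => real" where
  "beta x \<eta> = st_r1 x \<eta> * e0 \<eta> + st_r2 x \<eta> * w \<eta>"

definition Y where "Y = iquad (\<lambda>x \<xi>. (st_p1 x \<xi>)^2) (\<lambda>x \<xi>. 2 * (st_p1 x \<xi> * st_p2 x \<xi>)) (\<lambda>x \<xi>. (st_p2 x \<xi>)^2)"
definition V where "V = iquad (\<lambda>x \<xi>. st_p1 x \<xi> * st_r1 x \<xi>)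
   (\<lambda>x \<xi>. st_p1 x \<xi> * st_r2 x \<xi> + st_p2 x \<xi> * st_r1 x \<xi>) (\<lambda>x \<xi>. st_p2 x \<xi> * st_r2 x \<xi>)"
definition U where "U x \<xi> = st_m x 0 + V x \<xi>"
definition s1 where "s1 x \<xi> = (U x \<xi>)^2 * (st_p1 x \<xi>)^2 + 1/2 * (st_r1 x \<xi>)^2"
definition s2 where "s2 x \<xi> = (U x \<xi>)^2 * (2 * (st_p1 x \<xi> * st_p2 x \<xi>)) + st_r1 x \<xi> * st_r2 x \<xi>"
definition s3 where "s3 x \<xi> = (U x \<xi>)^2 * (st_p2 x \<xi>)^2 + 1/2 * (st_r2 x \<xi>)^2"
definition src where "src x \<eta> = (U x \<eta>)^2 * (alpha x \<eta>)^2 + 1/2 * (beta x \<eta>)^2"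
definition A where "A = iquad (\<lambda>x \<xi>. exp (Y x \<xi>) * s1 x \<xi>) (\<lambda>x \<xi>. exp (Y x \<xi>) * s2 x \<xi>) (\<lambda>x \<xi>. exp (Y x \<xi>) * s3 x \<xi>)"
definition B where "B = iquad (\<lambda>x \<xi>. exp (- Y x \<xi>) * s1 x \<xi>) (\<lambda>x \<xi>. exp (- Y x \<xi>) * s2 x \<xi>) (\<lambda>x \<xi>. exp (- Y x \<xi>) * s3 x \<xi>)"
definition k1 :: real where "k1 = 1 / (1 - exp (- 1))"
definition k2 :: real where "k2 = 1 / (exp 1 - 1)"
definition Mp where "Mp x \<xi> = exp (Y x \<xi>) * (k1 * B x 1 - B x \<xi>)"
definition Mm where "Mm x \<xi> = exp (- Y x \<xi>) * (A x \<xi> + k2 * A x 1)"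
definition P where "P x \<xi> = 1/2 * (Mp x \<xi> + Mm x \<xi>)"
definition Q where "Q x \<xi> = 1/2 * (Mp x \<xi> - Mm x \<xi>)"
definition G where "G x \<xi> = (U x \<xi>)^2 - P x \<xi>"
definition energy where "energy = iquad (\<lambda>x \<xi>. (U x \<xi>)^2 * (st_p1 x \<xi>)^2 + (st_r1 x \<xi>)^2)
   (\<lambda>x \<xi>. (U x \<xi>)^2 * (2 * (st_p1 x \<xi> * st_p2 x \<xi>)) + 2 * (st_r1 x \<xi> * st_r2 x \<xi>))
   (\<lambda>x \<xi>. (U x \<xi>)^2 * (st_p2 x \<xi>)^2 + (st_r2 x \<xi>)^2)"

lemma ll_Y_coeffs: "loc_lipschitz (\<lambda>x \<xi>. (st_p1 x \<xi>)^2)" "loc_lipschitz (\<lambda>x \<xi>. 2 * (st_p1 x \<xi> * st_p2 x \<xi>))"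
  "loc_lipschitz (\<lambda>x \<xi>. (st_p2 x \<xi>)^2)"
  by (intro loc_lipschitz_intros)+
lemma ll_V_coeffs: "loc_lipschitz (\<lambda>x \<xi>. st_p1 x \<xi> * st_r1 x \<xi>)"
  "loc_lipschitz (\<lambda>x \<xi>. st_p1 x \<xi> * st_r2 x \<xi> + st_p2 x \<xi> * st_r1 x \<xi>)" "loc_lipschitz (\<lambda>x \<xi>. st_p2 x \<xi> * st_r2 x \<xi>)"
  by (intro loc_lipschitz_intros)+
lemma ll_Y: "loc_lipschitz Y" unfolding Y_def by (rule loc_lipschitz_iquad[OF ll_Y_coeffs])
lemma ll_V: "loc_lipschitz V" unfolding V_def by (rule loc_lipschitz_iquad[OF ll_V_coeffs])
lemma ll_U: "loc_lipschitz U" unfolding U_def[abs_def] by (intro loc_lipschitz_intros ll_V)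
lemma ll_energy_coeffs: "loc_lipschitz (\<lambda>x \<xi>. (U x \<xi>)^2 * (st_p1 x \<xi>)^2 + (st_r1 x \<xi>)^2)"
   "loc_lipschitz (\<lambda>x \<xi>. (U x \<xi>)^2 * (2 * (st_p1 x \<xi> * st_p2 x \<xi>)) + 2 * (st_r1 x \<xi> * st_r2 x \<xi>))"
   "loc_lipschitz (\<lambda>x \<xi>. (U x \<xi>)^2 * (st_p2 x \<xi>)^2 + (st_r2 x \<xi>)^2)"
  by (intro loc_lipschitz_intros ll_U)+
lemma ll_s: "loc_lipschitz s1" "loc_lipschitz s2" "loc_lipschitz s3"
  unfolding s1_def[abs_def] s2_def[abs_def] s3_def[abs_def] by (intro loc_lipschitz_intros ll_U)+
lemma ll_A: "loc_lipschitz A" unfolding A_def by (intro loc_lipschitz_iquad loc_lipschitz_intros ll_Y ll_s)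
lemma ll_B: "loc_lipschitz B" unfolding B_def by (intro loc_lipschitz_iquad loc_lipschitz_intros ll_Y ll_s)
lemma ll_Mp: "loc_lipschitz Mp" unfolding Mp_def[abs_def]
  by (intro loc_lipschitz_intros ll_Y ll_B)
lemma ll_Mm: "loc_lipschitz Mm" unfolding Mm_def[abs_def]
  by (intro loc_lipschitz_intros ll_Y ll_A)
lemma ll_P: "loc_lipschitz P" unfolding P_def[abs_def] by (intro loc_lipschitz_intros ll_Mp ll_Mm)
lemma ll_Q: "loc_lipschitz Q" unfolding Q_def[abs_def] by (intro loc_lipschitz_intros ll_Mp ll_Mm)
lemma ll_G: "loc_lipschitz G" unfolding G_def[abs_def] by (intro loc_lipschitz_intros ll_U ll_P)

lemma alpha_borel [measurable]: "alpha x \<in> borel_measurable borel"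
proof -
  have [measurable]: "st_p1 x \<in> borel_measurable borel" "st_p2 x \<in> borel_measurable borel"
    by (rule borel_measurable_continuous_onI[OF continuous_on_st(2)], rule borel_measurable_continuous_onI[OF continuous_on_st(3)])
  show ?thesis unfolding alpha_def[abs_def] by measurable
qed
lemma beta_borel [measurable]: "beta x \<in> borel_measurable borel"
proof -
  have [measurable]: "st_r1 x \<in> borel_measurable borel" "st_r2 x \<in> borel_measurable borel"
    by (rule borel_measurable_continuous_onI[OF continuous_on_st(4)], rule borel_measurable_continuous_onI[OF continuous_on_st(5)])
  show ?thesis unfolding beta_def[abs_def] by measurable
qed
lemma U_borel [measurable]: "U x \<in> borel_measurable borel" by (rule loc_lipschitz_borel[OF ll_U])
lemma Y_borel [measurable]: "Y x \<in> borel_measurable borel" by (rule loc_lipschitz_borel[OF ll_Y])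
lemma P_borel [measurable]: "P x \<in> borel_measurable borel" by (rule loc_lipschitz_borel[OF ll_P])
lemma Q_borel [measurable]: "Q x \<in> borel_measurable borel" by (rule loc_lipschitz_borel[OF ll_Q])
lemma G_borel [measurable]: "G x \<in> borel_measurable borel" by (rule loc_lipschitz_borel[OF ll_G])
lemma src_borel [measurable]: "src x \<in> borel_measurable borel" unfolding src_def[abs_def] by measurable

lemma alpha_outside: "\<eta> \<notin> {0..1} ==> alpha x \<eta> = 0" by (simp add: alpha_def w_outside)
lemma beta_outside: "\<eta> \<notin> {0..1} ==> beta x \<eta> = 0" by (simp add: beta_def w_outside)

lemma quad_outside: "\<eta> \<notin> {0..1} ==> quad f g h \<eta> = 0" by (simp add: quad_def w_outside)
lemma quad_inside: "\<eta> \<in> {0..1} ==> quad f g h \<eta> = f \<eta> + g \<eta> * w \<eta> + h \<eta> * (w \<eta>)^2" by (simp add: quad_def)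

lemma quad_Y: "quad (\<lambda>\<xi>. (st_p1 x \<xi>)^2) (\<lambda>\<xi>. 2 * (st_p1 x \<xi> * st_p2 x \<xi>)) (\<lambda>\<xi>. (st_p2 x \<xi>)^2) \<eta> = (alpha x \<eta>)^2"
  by (cases "\<eta> \<in> {0..1}", simp add: quad_inside alpha_def power2_eq_square algebra_simps)
     (simp add: quad_outside alpha_outside)

lemma quad_V: "quad (\<lambda>\<xi>. st_p1 x \<xi> * st_r1 x \<xi>) (\<lambda>\<xi>. st_p1 x \<xi> * st_r2 x \<xi> + st_p2 x \<xi> * st_r1 x \<xi>)
    (\<lambda>\<xi>. st_p2 x \<xi> * st_r2 x \<xi>) \<eta> = alpha x \<eta> * beta x \<eta>"
  by (cases "\<eta> \<in> {0..1}", simp add: quad_inside alpha_def beta_def power2_eq_square algebra_simps)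
     (simp add: quad_outside alpha_outside)

lemma quad_src: "quad (\<lambda>\<xi>. c \<xi> * s1 x \<xi>) (\<lambda>\<xi>. c \<xi> * s2 x \<xi>) (\<lambda>\<xi>. c \<xi> * s3 x \<xi>) \<eta> = c \<eta> * src x \<eta>"
  by (cases "\<eta> \<in> {0..1}", simp add: quad_inside src_def s1_def s2_def s3_def alpha_def beta_def power2_eq_square algebra_simps)
     (simp add: quad_outside alpha_outside beta_outside src_def)

lemma quad_energy: "quad (\<lambda>\<xi>. (U x \<xi>)^2 * (st_p1 x \<xi>)^2 + (st_r1 x \<xi>)^2)
   (\<lambda>\<xi>. (U x \<xi>)^2 * (2 * (st_p1 x \<xi> * st_p2 x \<xi>)) + 2 * (st_r1 x \<xi> * st_r2 x \<xi>))
   (\<lambda>\<xi>. (U x \<xi>)^2 * (st_p2 x \<xi>)^2 + (st_r2 x \<xi>)^2) \<eta> = (U x \<eta>)^2 * (alpha x \<eta>)^2 + (beta x \<eta>)^2"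
  by (cases "\<eta> \<in> {0..1}", simp add: quad_inside alpha_def beta_def power2_eq_square algebra_simps)
     (simp add: quad_outside alpha_outside beta_outside)

lemma Y_density: "has_density (Y x) (\<lambda>\<eta>. (alpha x \<eta>)^2)"
  unfolding Y_def quad_Y[symmetric] by (rule iquad_density[OF ll_Y_coeffs])
lemma U_density: "has_density (U x) (\<lambda>\<eta>. alpha x \<eta> * beta x \<eta>)"
proof -
  have "has_density (V x) (\<lambda>\<eta>. alpha x \<eta> * beta x \<eta>)"
    unfolding V_def quad_V[symmetric] by (rule iquad_density[OF ll_V_coeffs])
  from has_density_add[OF has_density_const this, of "st_m x 0"] show ?thesis by (simp add: U_def[abs_def])
qed
lemma A_density: "has_density (A x) (\<lambda>\<eta>. exp (Y x \<eta>) * src x \<eta>)"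
  unfolding A_def quad_src[of "\<lambda>\<xi>. exp (Y x \<xi>)", symmetric] by (intro iquad_density loc_lipschitz_intros ll_Y ll_s)
lemma B_density: "has_density (B x) (\<lambda>\<eta>. exp (- Y x \<eta>) * src x \<eta>)"
  unfolding B_def quad_src[of "\<lambda>\<xi>. exp (- Y x \<xi>)", symmetric] by (intro iquad_density loc_lipschitz_intros ll_Y ll_s)

lemma exp_Y_density: "has_density (\<lambda>\<xi>. exp (Y x \<xi>)) (\<lambda>\<eta>. exp (Y x \<eta>) * (alpha x \<eta>)^2)"
  by (rule has_density_compose[OF Y_density]) (auto intro!: derivative_eq_intros continuous_intros)
lemma exp_minus_Y_density: "has_density (\<lambda>\<xi>. exp (- Y x \<xi>)) (\<lambda>\<eta>. - exp (- Y x \<eta>) * (alpha x \<eta>)^2)"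
  by (rule has_density_compose[OF Y_density, of "\<lambda>y. exp (- y)" "\<lambda>y. - exp (- y)"])
     (auto intro!: derivative_eq_intros continuous_intros)

lemma Mp_density: "has_density (Mp x) (\<lambda>\<eta>. (alpha x \<eta>)^2 * Mp x \<eta> - src x \<eta>)"
proof -
  have "has_density (\<lambda>\<xi>. exp (Y x \<xi>) * (k1 * B x 1 - B x \<xi>))
     (\<lambda>\<eta>. (exp (Y x \<eta>) * (alpha x \<eta>)^2) * (k1 * B x 1 - B x \<eta>) + exp (Y x \<eta>) * (0 - exp (- Y x \<eta>) * src x \<eta>))"
    by (intro has_density_mult exp_Y_density has_density_diff has_density_const B_density)
  then show ?thesis by (simp add: Mp_def[abs_def] exp_minus algebra_simps)
qed
lemma Mm_density: "has_density (Mm x) (\<lambda>\<eta>. - ((alpha x \<eta>)^2 * Mm x \<eta>) + src x \<eta>)"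
proof -
  have "has_density (\<lambda>\<xi>. exp (- Y x \<xi>) * (A x \<xi> + k2 * A x 1))
     (\<lambda>\<eta>. (- exp (- Y x \<eta>) * (alpha x \<eta>)^2) * (A x \<eta> + k2 * A x 1) + exp (- Y x \<eta>) * (exp (Y x \<eta>) * src x \<eta> + 0))"
    by (intro has_density_mult exp_minus_Y_density has_density_add has_density_const A_density)
  then show ?thesis by (simp add: Mm_def[abs_def] exp_minus algebra_simps)
qed

text \<open>
  In terms of the position these two lemmas say \<open>P' = Q\<close> and \<open>Q' = P - (u^2 + u_x^2 / 2)\<close>.
\<close>

lemma P_density: "has_density (P x) (\<lambda>\<eta>. (alpha x \<eta>)^2 * Q x \<eta>)"
proof -
  have "has_density (\<lambda>\<xi>. 1/2 * (Mp x \<xi> + Mm x \<xi>))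
    (\<lambda>\<eta>. 1/2 * (((alpha x \<eta>)^2 * Mp x \<eta> - src x \<eta>) + (- ((alpha x \<eta>)^2 * Mm x \<eta>) + src x \<eta>)))"
    by (intro has_density_cmult has_density_add Mp_density Mm_density)
  then show ?thesis by (simp add: P_def[abs_def] Q_def[abs_def] algebra_simps)
qed
lemma Q_density: "has_density (Q x) (\<lambda>\<eta>. (alpha x \<eta>)^2 * P x \<eta> - src x \<eta>)"
proof -
  have "has_density (\<lambda>\<xi>. 1/2 * (Mp x \<xi> - Mm x \<xi>))
    (\<lambda>\<eta>. 1/2 * (((alpha x \<eta>)^2 * Mp x \<eta> - src x \<eta>) - (- ((alpha x \<eta>)^2 * Mm x \<eta>) + src x \<eta>)))"
    by (intro has_density_cmult has_density_diff Mp_density Mm_density)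
  moreover have "(\<lambda>\<eta>. 1/2 * (((alpha x \<eta>)^2 * Mp x \<eta> - src x \<eta>) - (- ((alpha x \<eta>)^2 * Mm x \<eta>) + src x \<eta>))) =
     (\<lambda>\<eta>. (alpha x \<eta>)^2 * P x \<eta> - src x \<eta>)" by (simp add: P_def[abs_def] fun_eq_iff algebra_simps)
  ultimately show ?thesis by (simp add: Q_def[abs_def])
qed

lemma set_integral_below_eq:
  assumes q: "\<And>\<eta>. \<eta> \<notin> {0..1} ==> q \<eta> = (0::real)" and \<xi>: "0 <= \<xi>"
  shows "(LINT \<eta>:{..\<xi>}|lborel. q \<eta>) = (LINT \<eta>:{0..\<xi>}|lborel. q \<eta>)"
  unfolding set_lebesgue_integral_def
  by (rule Bochner_Integration.integral_cong) (use q in \<open>auto simp: indicator_def\<close>)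

lemma set_integral_period:
  assumes q: "\<And>\<eta>. \<eta> \<notin> {0..1} ==> q \<eta> = (0::real)"
  shows "(LINT \<eta>:{..1}|lborel. q \<eta>) = (LINT \<eta>|lborel. q \<eta>)" "(LINT \<eta>:{0..1}|lborel. q \<eta>) = (LINT \<eta>|lborel. q \<eta>)"
  unfolding set_lebesgue_integral_def
  by (rule Bochner_Integration.integral_cong; use q in \<open>auto simp: indicator_def\<close>)+

lemma iquad_0: "iquad f g h x 0 = 0"
proof -
  have "AE \<eta> in lborel. \<eta> \<noteq> (0::real)" by (rule AE_lborel_singleton)
  then have "AE \<eta> in lborel. indicator {..0} \<eta> *\<^sub>R quad (f x) (g x) (h x) \<eta> = 0"
    by eventually_elim (auto simp: indicator_def quad_outside)
  then show ?thesis unfolding iquad_def set_lebesgue_integral_def by (rule integral_eq_zero_AE)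
qed

lemma Y_0 [simp]: "Y x 0 = 0" by (simp add: Y_def iquad_0)
lemma U_0: "U x 0 = st_m x 0" by (simp add: U_def V_def iquad_0)
lemma A_0: "A x 0 = 0" by (simp add: A_def iquad_0)
lemma B_0: "B x 0 = 0" by (simp add: B_def iquad_0)

lemma integrable_alpha_sq: "integrable lborel (\<lambda>\<eta>. (alpha x \<eta>)^2)"
  unfolding quad_Y[symmetric] by (rule integrable_quad[OF ll_Y_coeffs])
lemma integrable_alpha_beta: "integrable lborel (\<lambda>\<eta>. alpha x \<eta> * beta x \<eta>)"
  unfolding quad_V[symmetric] by (rule integrable_quad[OF ll_V_coeffs])
lemma integrable_src: "integrable lborel (src x)"
proof -
  have "integrable lborel (quad (\<lambda>\<xi>. 1 * s1 x \<xi>) (\<lambda>\<xi>. 1 * s2 x \<xi>) (\<lambda>\<xi>. 1 * s3 x \<xi>))"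
    by (rule integrable_quad[OF loc_lipschitz_cmult[OF ll_s(1)] loc_lipschitz_cmult[OF ll_s(2)] loc_lipschitz_cmult[OF ll_s(3)]])
  moreover have "quad (\<lambda>\<xi>. 1 * s1 x \<xi>) (\<lambda>\<xi>. 1 * s2 x \<xi>) (\<lambda>\<xi>. 1 * s3 x \<xi>) = src x"
    using quad_src[of "\<lambda>_. 1"] by (intro ext) simp
  ultimately show ?thesis by simp
qed
lemma integrable_energy: "integrable lborel (\<lambda>\<eta>. (U x \<eta>)^2 * (alpha x \<eta>)^2 + (beta x \<eta>)^2)"
  unfolding quad_energy[symmetric] by (rule integrable_quad[OF ll_energy_coeffs])
lemma integrable_beta_sq: "integrable lborel (\<lambda>\<eta>. (beta x \<eta>)^2)"
  by (rule Bochner_Integration.integrable_bound[OF integrable_energy[of x]]) auto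

lemma Y_1: "Y x 1 = (LINT \<eta>|lborel. (alpha x \<eta>)^2)"
  unfolding Y_def iquad_def quad_Y by (rule set_integral_period) (simp add: alpha_outside)

lemma energy_1: "energy x 1 = (LINT \<eta>|lborel. (U x \<eta>)^2 * (alpha x \<eta>)^2 + (beta x \<eta>)^2)"
  unfolding energy_def iquad_def quad_energy by (rule set_integral_period) (simp add: alpha_outside beta_outside)

text \<open>
  The characteristic system: \<open>alpha' = beta / 2\<close> and \<open>beta' = G alpha\<close>, written for the coefficients, with the
  velocity of the label 0 in the first component.
\<close>

definition F :: "state => state" where
  "F x = Bcontfun (\<lambda>\<xi>. (- Q x 0, 1/2 * st_r1 x \<xi>, 1/2 * st_r2 x \<xi>, G x \<xi> * st_p1 x \<xi>, G x \<xi> * st_p2 x \<xi>))"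

lemma apply_F: "apply_bcontfun (F x) \<xi> =
   (- Q x 0, 1/2 * st_r1 x \<xi>, 1/2 * st_r2 x \<xi>, G x \<xi> * st_p1 x \<xi>, G x \<xi> * st_p2 x \<xi>)"
proof -
  have "(\<lambda>\<xi>. (- Q x 0, 1/2 * st_r1 x \<xi>, 1/2 * st_r2 x \<xi>, G x \<xi> * st_p1 x \<xi>, G x \<xi> * st_p2 x \<xi>)) \<in> bcontfun"
    by (rule tuple_bcontfun[of "\<lambda>x \<xi>. - Q x 0"]) (intro loc_lipschitz_intros ll_Q ll_G)+
  then show ?thesis by (simp add: F_def Bcontfun_inverse)
qed

lemma st_F: "st_m (F x) \<xi> = - Q x 0" "st_p1 (F x) \<xi> = 1/2 * st_r1 x \<xi>" "st_p2 (F x) \<xi> = 1/2 * st_r2 x \<xi>"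
  "st_r1 (F x) \<xi> = G x \<xi> * st_p1 x \<xi>" "st_r2 (F x) \<xi> = G x \<xi> * st_p2 x \<xi>"
  by (simp_all add: st_defs apply_F)

lemma F_lipschitz: "\<exists>L. \<forall>x y. norm x <= R --> norm y <= R --> norm (F x - F y) <= L * norm (x - y)"
proof -
  have E: "\<exists>L. \<forall>x y \<xi>. norm x <= R --> norm y <= R --> \<bar>f x \<xi> - f y \<xi>\<bar> <= L * norm (x - y)" if "loc_lipschitz f" for f
    using that unfolding loc_lipschitz_def by meson
  have ll: "loc_lipschitz (\<lambda>x \<xi>. - Q x 0)" "loc_lipschitz (\<lambda>x \<xi>. 1/2 * st_r1 x \<xi>)" "loc_lipschitz (\<lambda>x \<xi>. 1/2 * st_r2 x \<xi>)"
    "loc_lipschitz (\<lambda>x \<xi>. G x \<xi> * st_p1 x \<xi>)" "loc_lipschitz (\<lambda>x \<xi>. G x \<xi> * st_p2 x \<xi>)"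
    by (intro loc_lipschitz_intros ll_Q ll_G)+
  obtain L1 where 1: "\<And>x y (\<xi>::real). norm x <= R ==> norm y <= R ==> \<bar>- Q x 0 - - Q y 0\<bar> <= L1 * norm (x - y)"
    using E[OF ll(1)] by blast
  obtain L2 where 2: "\<And>x y \<xi>. norm x <= R ==> norm y <= R ==> \<bar>1/2 * st_r1 x \<xi> - 1/2 * st_r1 y \<xi>\<bar> <= L2 * norm (x - y)"
    using E[OF ll(2)] by blast
  obtain L3 where 3: "\<And>x y \<xi>. norm x <= R ==> norm y <= R ==> \<bar>1/2 * st_r2 x \<xi> - 1/2 * st_r2 y \<xi>\<bar> <= L3 * norm (x - y)"
    using E[OF ll(3)] by blast
  obtain L4 where 4: "\<And>x y \<xi>. norm x <= R ==> norm y <= R ==> \<bar>G x \<xi> * st_p1 x \<xi> - G y \<xi> * st_p1 y \<xi>\<bar> <= L4 * norm (x - y)"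
    using E[OF ll(4)] by blast
  obtain L5 where 5: "\<And>x y \<xi>. norm x <= R ==> norm y <= R ==> \<bar>G x \<xi> * st_p2 x \<xi> - G y \<xi> * st_p2 y \<xi>\<bar> <= L5 * norm (x - y)"
    using E[OF ll(5)] by blast
  have "norm (F x - F y) <= (L1 + L2 + L3 + L4 + L5) * norm (x - y)" if xy: "norm x <= R" "norm y <= R" for x y
  proof (rule norm_bound)
    fix \<xi>
    have "norm (apply_bcontfun (F x - F y) \<xi>) <=
       \<bar>- Q x 0 - - Q y 0\<bar> + \<bar>1/2 * st_r1 x \<xi> - 1/2 * st_r1 y \<xi>\<bar> + \<bar>1/2 * st_r2 x \<xi> - 1/2 * st_r2 y \<xi>\<bar>
       + \<bar>G x \<xi> * st_p1 x \<xi> - G y \<xi> * st_p1 y \<xi>\<bar> + \<bar>G x \<xi> * st_p2 x \<xi> - G y \<xi> * st_p2 y \<xi>\<bar>"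
      unfolding minus_bcontfun.rep_eq apply_F minus_prod_def fst_conv snd_conv by (rule norm_tuple5_le)
    also have "... <= (L1 + L2 + L3 + L4 + L5) * norm (x - y)"
      unfolding distrib_right using 1[OF xy] 2[OF xy, of \<xi>] 3[OF xy, of \<xi>] 4[OF xy, of \<xi>] 5[OF xy, of \<xi>] by linarith
    finally show "norm (apply_bcontfun (F x - F y) \<xi>) <= (L1 + L2 + L3 + L4 + L5) * norm (x - y)" .
  qed
  then show ?thesis by blast
qed

lemma st_derivative:
  assumes "(X has_vector_derivative F (X t)) (at t)"
  shows "((\<lambda>s. st_m (X s) \<xi>) has_real_derivative - Q (X t) 0) (at t)"
    "((\<lambda>s. st_p1 (X s) \<xi>) has_real_derivative 1/2 * st_r1 (X t) \<xi>) (at t)"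
    "((\<lambda>s. st_p2 (X s) \<xi>) has_real_derivative 1/2 * st_r2 (X t) \<xi>) (at t)"
    "((\<lambda>s. st_r1 (X s) \<xi>) has_real_derivative G (X t) \<xi> * st_p1 (X t) \<xi>) (at t)"
    "((\<lambda>s. st_r2 (X s) \<xi>) has_real_derivative G (X t) \<xi> * st_p2 (X t) \<xi>) (at t)"
  unfolding has_real_derivative_iff_has_vector_derivative
  using bounded_linear.has_vector_derivative[OF bounded_linear_st(1) assms, of \<xi>]
    bounded_linear.has_vector_derivative[OF bounded_linear_st(2) assms, of \<xi>]
    bounded_linear.has_vector_derivative[OF bounded_linear_st(3) assms, of \<xi>]
    bounded_linear.has_vector_derivative[OF bounded_linear_st(4) assms, of \<xi>]
    bounded_linear.has_vector_derivative[OF bounded_linear_st(5) assms, of \<xi>]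
  by (simp_all only: st_F)

lemma alpha_derivative:
  assumes "(X has_vector_derivative F (X t)) (at t)"
  shows "((\<lambda>s. alpha (X s) \<eta>) has_real_derivative 1/2 * beta (X t) \<eta>) (at t)"
  unfolding alpha_def beta_def
  by (auto intro!: derivative_eq_intros st_derivative[OF assms] simp: algebra_simps)

lemma beta_derivative:
  assumes "(X has_vector_derivative F (X t)) (at t)"
  shows "((\<lambda>s. beta (X s) \<eta>) has_real_derivative G (X t) \<eta> * alpha (X t) \<eta>) (at t)"
  unfolding alpha_def beta_def
  by (auto intro!: derivative_eq_intros st_derivative[OF assms] simp: algebra_simps)

lemma Y_derivative:
  assumes X: "(X has_vector_derivative F (X t)) (at t)"
  shows "((\<lambda>s. Y (X s) \<xi>) has_real_derivative U (X t) \<xi> - st_m (X t) 0) (at t)"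
proof -
  have "((\<lambda>s. Y (X s) \<xi>) has_real_derivative (LINT \<eta>:{..\<xi>}|lborel. alpha (X t) \<eta> * beta (X t) \<eta>)) (at t)"
    unfolding Y_def
  proof (rule iquad_time_derivative[OF ll_Y_coeffs X])
    show "((\<lambda>s. quad (\<lambda>\<xi>. (st_p1 (X s) \<xi>)^2) (\<lambda>\<xi>. 2 * (st_p1 (X s) \<xi> * st_p2 (X s) \<xi>)) (\<lambda>\<xi>. (st_p2 (X s) \<xi>)^2) \<eta>)
       has_real_derivative alpha (X t) \<eta> * beta (X t) \<eta>) (at t)" for \<eta>
      unfolding quad_Y by (auto intro!: derivative_eq_intros alpha_derivative[OF X])
  qed measurable
  then show ?thesis by (simp add: U_def V_def iquad_def quad_V)
qed

text \<open>
  Differentiating \<open>U_\<xi> = alpha beta\<close> in time gives \<open>beta^2 / 2 + G alpha^2\<close>, which is minus the density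
  of \<open>Q\<close>.  So the state needs to carry only the value of \<open>U\<close> at the label 0.
\<close>

lemma U_derivative:
  assumes X: "(X has_vector_derivative F (X t)) (at t)" and \<xi>: "0 <= \<xi>"
  shows "((\<lambda>s. U (X s) \<xi>) has_real_derivative - Q (X t) \<xi>) (at t)"
proof -
  let ?g = "\<lambda>\<eta>. 1/2 * (beta (X t) \<eta>)^2 + G (X t) \<eta> * (alpha (X t) \<eta>)^2"
  have "((\<lambda>s. V (X s) \<xi>) has_real_derivative (LINT \<eta>:{..\<xi>}|lborel. ?g \<eta>)) (at t)"
    unfolding V_def
  proof (rule iquad_time_derivative[OF ll_V_coeffs X])
    show "((\<lambda>s. quad (\<lambda>\<xi>. st_p1 (X s) \<xi> * st_r1 (X s) \<xi>) (\<lambda>\<xi>. st_p1 (X s) \<xi> * st_r2 (X s) \<xi> + st_p2 (X s) \<xi> * st_r1 (X s) \<xi>)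
        (\<lambda>\<xi>. st_p2 (X s) \<xi> * st_r2 (X s) \<xi>) \<eta>) has_real_derivative ?g \<eta>) (at t)" for \<eta>
      unfolding quad_V
      by (auto intro!: derivative_eq_intros alpha_derivative[OF X] beta_derivative[OF X] simp: power2_eq_square algebra_simps)
  qed measurable
  moreover have "(LINT \<eta>:{..\<xi>}|lborel. ?g \<eta>) = (LINT \<eta>:{0..\<xi>}|lborel. ?g \<eta>)"
    by (rule set_integral_below_eq[OF _ \<xi>]) (simp add: alpha_outside beta_outside)
  moreover have "?g = (\<lambda>\<eta>. (- 1) * ((alpha (X t) \<eta>)^2 * P (X t) \<eta> - src (X t) \<eta>))"
    by (simp add: fun_eq_iff src_def G_def algebra_simps)
  then have "(LINT \<eta>:{0..\<xi>}|lborel. ?g \<eta>) = (-1) * (Q (X t) \<xi> - Q (X t) 0)"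
    using has_density_integral[OF has_density_cmult[OF Q_density, of "-1"] \<xi>] by (simp add: algebra_simps)
  ultimately have "((\<lambda>s. V (X s) \<xi>) has_real_derivative - (Q (X t) \<xi> - Q (X t) 0)) (at t)" by simp
  then show ?thesis unfolding U_def
    by (auto intro!: derivative_eq_intros st_derivative[OF X])
qed

text \<open>
  The sum over copies of the period is built for a period of length 1; the defect of periodicity is
  proportional to the deviation of \<open>Y x 1\<close> from 1.
\<close>

lemma Q_period:
  "Q x 1 - Q x 0 = 1/2 * ((exp (Y x 1 - 1) - 1) * Mp x 0 - (exp (1 - Y x 1) - 1) * Mm x 0)"
  "P x 1 - P x 0 = 1/2 * ((exp (Y x 1 - 1) - 1) * Mp x 0 + (exp (1 - Y x 1) - 1) * Mm x 0)"
proof -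
  have e1: "exp (1::real) > 1" by simp
  have k: "k1 - 1 = exp (- 1) * k1" "1 + k2 = exp 1 * k2"
    using e1 by (auto simp: k1_def k2_def exp_minus divide_simps)
  have "Mp x 1 = exp (Y x 1) * ((k1 - 1) * B x 1)" by (simp add: Mp_def algebra_simps)
  also have "... = exp (Y x 1 - 1) * Mp x 0" unfolding k by (simp add: Mp_def B_0 exp_diff exp_minus field_simps)
  finally have 1: "Mp x 1 = exp (Y x 1 - 1) * Mp x 0" .
  have "Mm x 1 = exp (- Y x 1) * ((1 + k2) * A x 1)" by (simp add: Mm_def algebra_simps)
  also have "... = exp (1 - Y x 1) * Mm x 0" unfolding k by (simp add: Mm_def A_0 exp_diff exp_minus field_simps)
  finally have 2: "Mm x 1 = exp (1 - Y x 1) * Mm x 0" .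
  show "Q x 1 - Q x 0 = 1/2 * ((exp (Y x 1 - 1) - 1) * Mp x 0 - (exp (1 - Y x 1) - 1) * Mm x 0)"
    "P x 1 - P x 0 = 1/2 * ((exp (Y x 1 - 1) - 1) * Mp x 0 + (exp (1 - Y x 1) - 1) * Mm x 0)"
    unfolding P_def Q_def 1 2 by (simp_all add: algebra_simps)
qed

end

section \<open>Conservation laws and global solutions\<close>

lemma exp_minus_one_le: "\<bar>exp z - 1\<bar> <= exp \<bar>z\<bar> * \<bar>z\<bar>" for z :: real
proof -
  have "norm (exp z - exp 0) <= exp \<bar>z\<bar> * norm (z - 0)"
  proof (rule field_differentiable_bound[of "{-\<bar>z\<bar>..\<bar>z\<bar>}" exp exp])
    show "(exp has_field_derivative exp y) (at y within {-\<bar>z\<bar>..\<bar>z\<bar>})" for y :: real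
      by (auto intro!: derivative_eq_intros)
  qed auto
  then show ?thesis by simp
qed

lemma abs_le_one_plus_square: "\<bar>a\<bar> <= 1 + a^2" for a :: real
proof -
  have "0 <= (\<bar>a\<bar> - 1)^2" by simp
  then have "2 * \<bar>a\<bar> <= 1 + a^2" by (simp add: power2_diff)
  then show ?thesis by linarith
qed

lemma abs_half_le: "\<bar>1/2 * (a - b)\<bar> <= \<bar>a\<bar> + \<bar>b\<bar>" "\<bar>1/2 * (a + b)\<bar> <= \<bar>a\<bar> + \<bar>b\<bar>" for a b :: real
proof -
  have "1/2 * c <= d" if "c <= d" "0 <= d" for c d :: real using that by simp
  from this[OF abs_triangle_ineq4[of a b]] this[OF abs_triangle_ineq[of a b]]
  show "\<bar>1/2 * (a - b)\<bar> <= \<bar>a\<bar> + \<bar>b\<bar>" "\<bar>1/2 * (a + b)\<bar> <= \<bar>a\<bar> + \<bar>b\<bar>" by (simp_all add: abs_mult)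
qed

lemma constant_of_zero_derivative:
  fixes f :: "real => real"
  assumes "\<And>t. \<bar>t\<bar> <= T ==> (f has_real_derivative 0) (at t)" "\<bar>t\<bar> <= T"
  shows "f t = f 0"
proof -
  have "norm (f t - f 0) <= (\<lambda>t. 0) \<bar>t\<bar> - (\<lambda>t. 0) (0::real)"
    by (rule derivative_norm_bound[where T=T and f'="\<lambda>t. 0" and \<phi>'="\<lambda>t. 0"])
       (use assms in \<open>auto simp: has_real_derivative_iff_has_vector_derivative[symmetric]\<close>)
  then show ?thesis by simp
qed

instance bcontfun :: (metric_space, banach) banach ..

context lagrangian
begin

definition solves :: "real => (real => state) => bool" where
  "solves T X \<longleftrightarrow> continuous_on UNIV X \<and> (\<forall>t. \<bar>t\<bar> <= T --> (X has_vector_derivative F (X t)) (at t))"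

lemma solvesD: "solves T X ==> \<bar>t\<bar> <= T ==> (X has_vector_derivative F (X t)) (at t)"
  by (simp add: solves_def)

text \<open>
  The two defects \<open>Y(1) - 1\<close> and \<open>U(1) - U(0)\<close> satisfy a homogeneous linear differential inequality:
  the first has the second as its derivative, and the derivative of the second is controlled by the
  first.  They vanish initially, hence always.
\<close>

lemma period_constraint:
  assumes X: "solves T X" and init: "Y (X 0) 1 = 1" "U (X 0) 1 = U (X 0) 0" and t: "\<bar>t\<bar> <= T"
  shows "Y (X t) 1 = 1" "U (X t) 1 = U (X t) 0"
proof -
  have "continuous_on {-T..T} X" using X continuous_on_subset by (auto simp: solves_def)
  from continuous_on_Icc_bounded[OF this] obtain R where R0: "\<forall>t\<in>{-T..T}. norm (X t) <= R" by blast
  have R: "norm (X t) <= R" if "\<bar>t\<bar> <= T" for t using R0 that by (simp add: abs_le_iff)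
  obtain LY CY where CY: "\<And>x \<xi>. norm x <= R ==> \<bar>Y x \<xi>\<bar> <= CY" using loc_lipschitzE[OF ll_Y, of R] by metis
  obtain LP CP where CP: "0 <= CP" "\<And>x \<xi>. norm x <= R ==> \<bar>Mp x \<xi>\<bar> <= CP" using loc_lipschitzE[OF ll_Mp, of R] by metis
  obtain LM CM where CM: "0 <= CM" "\<And>x \<xi>. norm x <= R ==> \<bar>Mm x \<xi>\<bar> <= CM" using loc_lipschitzE[OF ll_Mm, of R] by metis
  define K where "K = exp (CY + 1) * (CP + CM)"
  have K0: "0 <= K" using CP CM by (simp add: K_def)
  have dQ: "\<bar>Q (X s) 1 - Q (X s) 0\<bar> <= K * \<bar>Y (X s) 1 - 1\<bar>" if s: "\<bar>s\<bar> <= T" for s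
  proof -
    let ?z = "Y (X s) 1 - 1"
    have z: "\<bar>?z\<bar> <= CY + 1" using CY[OF R[OF s], of 1] by linarith
    have ez: "exp \<bar>?z\<bar> * \<bar>?z\<bar> <= exp (CY + 1) * \<bar>?z\<bar>" using z by (intro mult_right_mono) auto
    have e1: "\<bar>exp ?z - 1\<bar> <= exp (CY + 1) * \<bar>?z\<bar>" using exp_minus_one_le[of ?z] ez by linarith
    have e2: "\<bar>exp (1 - Y (X s) 1) - 1\<bar> <= exp (CY + 1) * \<bar>?z\<bar>"
      using exp_minus_one_le[of "- ?z"] ez by (simp add: abs_minus_commute)
    have 1: "\<bar>(exp ?z - 1) * Mp (X s) 0\<bar> <= (exp (CY + 1) * \<bar>?z\<bar>) * CP"
      unfolding abs_mult[of "exp ?z - 1"] by (intro mult_mono e1 CP(2) R[OF s]) auto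
    have 2: "\<bar>(exp (1 - Y (X s) 1) - 1) * Mm (X s) 0\<bar> <= (exp (CY + 1) * \<bar>?z\<bar>) * CM"
      unfolding abs_mult[of "exp (1 - Y (X s) 1) - 1"] by (intro mult_mono e2 CM(2) R[OF s]) auto
    have "\<bar>Q (X s) 1 - Q (X s) 0\<bar> <= (exp (CY + 1) * \<bar>?z\<bar>) * CP + (exp (CY + 1) * \<bar>?z\<bar>) * CM"
      unfolding Q_period(1) by (rule order_trans[OF abs_half_le(1) add_mono[OF 1 2]])
    also have "... = K * \<bar>?z\<bar>" by (simp add: K_def algebra_simps)
    finally show ?thesis .
  qed
  (* The square of the two defects is amenable to Gronwall's inequality. *)
  define f where "f = (\<lambda>s. (Y (X s) 1 - 1)^2 + (U (X s) 1 - U (X s) 0)^2)"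
  define f' where "f' = (\<lambda>s. 2 * (Y (X s) 1 - 1) * (U (X s) 1 - U (X s) 0)
     + 2 * (U (X s) 1 - U (X s) 0) * (- (Q (X s) 1 - Q (X s) 0)))"
  have "f t <= f 0 * exp ((1 + K) * \<bar>t\<bar>)"
  proof (rule gronwall_two_sided[where T=T and f'=f', OF _ _ t])
    fix s assume s: "\<bar>s\<bar> <= T"
    note D = solvesD[OF X s]
    show "(f has_real_derivative f' s) (at s)"
    proof -
      have dY: "((\<lambda>s. Y (X s) 1) has_real_derivative U (X s) 1 - U (X s) 0) (at s)"
        using Y_derivative[OF D, of 1] by (simp only: U_0)
      show ?thesis unfolding f_def f'_def
        by (auto intro!: derivative_eq_intros dY U_derivative[OF D] simp: algebra_simps)
    qed
    let ?a = "\<bar>Y (X s) 1 - 1\<bar>" and ?b = "\<bar>U (X s) 1 - U (X s) 0\<bar>"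
    have "\<bar>f' s\<bar> <= 2 * ?a * ?b + 2 * ?b * \<bar>Q (X s) 1 - Q (X s) 0\<bar>"
      unfolding f'_def by (rule order_trans[OF abs_triangle_ineq]) (simp only: abs_mult abs_minus_cancel abs_numeral order_refl)
    also have "... <= 2 * ?a * ?b + 2 * ?b * (K * ?a)"
      using dQ[OF s] by (intro add_left_mono mult_left_mono) auto
    also have "... = (1 + K) * (2 * ?a * ?b)" by (simp add: algebra_simps)
    also have "... <= (1 + K) * f s"
    proof (rule mult_left_mono)
      have "0 <= (?a - ?b)^2" by simp
      then show "2 * ?a * ?b <= f s" by (simp add: f_def power2_diff)
    qed (use K0 in simp)
    finally show "\<bar>f' s\<bar> <= (1 + K) * f s" .
  qed
  then have "f t <= 0" using init by (simp add: f_def)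
  then have "(Y (X t) 1 - 1)^2 = 0 \<and> (U (X t) 1 - U (X t) 0)^2 = 0"
    unfolding f_def by (meson add_nonneg_eq_0_iff antisym sum_power2_ge_zero zero_le_power2)
  then show "Y (X t) 1 = 1" "U (X t) 1 = U (X t) 0" by simp_all
qed

lemma P_Q_period: "Y x 1 = 1 ==> P x 1 = P x 0" "Y x 1 = 1 ==> Q x 1 = Q x 0"
  using Q_period[of x] by simp_all

text \<open>
  The time derivative of the energy density is the density of \<open>U^3 - 2 U P\<close>, which takes the same
  value at both ends of the period.
\<close>

lemma energy_derivative:
  assumes X: "(X has_vector_derivative F (X t)) (at t)"
    and per: "Y (X t) 1 = 1" "U (X t) 1 = U (X t) 0"
  shows "((\<lambda>s. energy (X s) 1) has_real_derivative 0) (at t)"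
proof -
  let ?x = "X t"
  let ?g = "\<lambda>\<eta>. 3 * (U ?x \<eta>)^2 * (alpha ?x \<eta> * beta ?x \<eta>) -
     2 * (alpha ?x \<eta> * beta ?x \<eta> * P ?x \<eta> + U ?x \<eta> * ((alpha ?x \<eta>)^2 * Q ?x \<eta>))"
  have "((\<lambda>s. energy (X s) 1) has_real_derivative (LINT \<eta>:{..1}|lborel. ?g \<eta>)) (at t)"
    unfolding energy_def
  proof (rule iquad_time_derivative[OF ll_energy_coeffs X])
    show "((\<lambda>s. quad (\<lambda>\<xi>. (U (X s) \<xi>)^2 * (st_p1 (X s) \<xi>)^2 + (st_r1 (X s) \<xi>)^2)
       (\<lambda>\<xi>. (U (X s) \<xi>)^2 * (2 * (st_p1 (X s) \<xi> * st_p2 (X s) \<xi>)) + 2 * (st_r1 (X s) \<xi> * st_r2 (X s) \<xi>))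
       (\<lambda>\<xi>. (U (X s) \<xi>)^2 * (st_p2 (X s) \<xi>)^2 + (st_r2 (X s) \<xi>)^2) \<eta>) has_real_derivative ?g \<eta>) (at t)" for \<eta>
      unfolding quad_energy
    proof (cases "\<eta> \<in> {0..1}")
      case True
      then have "0 <= \<eta>" by simp
      then show "((\<lambda>s. (U (X s) \<eta>)^2 * (alpha (X s) \<eta>)^2 + (beta (X s) \<eta>)^2) has_real_derivative ?g \<eta>) (at t)"
        by (auto intro!: derivative_eq_intros U_derivative[OF X] alpha_derivative[OF X] beta_derivative[OF X]
            simp: G_def power2_eq_square algebra_simps)
    next
      case False
      then show "((\<lambda>s. (U (X s) \<eta>)^2 * (alpha (X s) \<eta>)^2 + (beta (X s) \<eta>)^2) has_real_derivative ?g \<eta>) (at t)"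
        by (simp add: alpha_outside beta_outside)
    qed
  qed measurable
  moreover have "(LINT \<eta>:{..1}|lborel. ?g \<eta>) = (LINT \<eta>:{0..1}|lborel. ?g \<eta>)"
    by (rule set_integral_below_eq) (auto simp: alpha_outside beta_outside)
  moreover have "has_density (\<lambda>\<xi>. (U ?x \<xi>)^3 - 2 * (U ?x \<xi> * P ?x \<xi>)) ?g"
  proof (intro has_density_diff has_density_cmult has_density_mult U_density P_density)
    have "((\<lambda>x. x^3) has_real_derivative 3 * y^2) (at y)" for y :: real
      by (auto intro!: derivative_eq_intros simp: power2_eq_square)
    then show "has_density (\<lambda>x. U (X t) x ^ 3) (\<lambda>x. 3 * (U (X t) x)^2 * (alpha (X t) x * beta (X t) x))"
      by (rule has_density_compose[OF U_density, of "\<lambda>x. x^3" "\<lambda>x. 3 * x^2"]) (intro continuous_intros)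
  qed
  from has_density_integral[OF this, of 0 1] have "(LINT \<eta>:{0..1}|lborel. ?g \<eta>) = 0"
    using per P_Q_period(1)[OF per(1)] by simp
  ultimately show ?thesis by simp
qed

lemma energy_conserved:
  assumes X: "solves T X" and init: "Y (X 0) 1 = 1" "U (X 0) 1 = U (X 0) 0" and t: "\<bar>t\<bar> <= T"
  shows "energy (X t) 1 = energy (X 0) 1"
  by (rule constant_of_zero_derivative[of T "\<lambda>s. energy (X s) 1", OF _ t])
     (intro energy_derivative solvesD[OF X] period_constraint[OF X init])

text \<open>
  The coefficient vectors \<open>(p1, r1)\<close> and \<open>(p2, r2)\<close> solve one linear system with trace 0, so their
  Wronskian is constant.
\<close>

lemma det_conserved:
  assumes X: "solves T X" and t: "\<bar>t\<bar> <= T"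
  shows "st_p1 (X t) \<xi> * st_r2 (X t) \<xi> - st_p2 (X t) \<xi> * st_r1 (X t) \<xi> =
         st_p1 (X 0) \<xi> * st_r2 (X 0) \<xi> - st_p2 (X 0) \<xi> * st_r1 (X 0) \<xi>"
proof (rule constant_of_zero_derivative[of T "\<lambda>s. st_p1 (X s) \<xi> * st_r2 (X s) \<xi> - st_p2 (X s) \<xi> * st_r1 (X s) \<xi>", OF _ t])
  fix s assume s: "\<bar>s\<bar> <= T"
  show "((\<lambda>s. st_p1 (X s) \<xi> * st_r2 (X s) \<xi> - st_p2 (X s) \<xi> * st_r1 (X s) \<xi>) has_real_derivative 0) (at s)"
    by (auto intro!: derivative_eq_intros st_derivative[OF solvesD[OF X s]] simp: algebra_simps)
qed

lemma integral_bounds: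
  fixes q :: "real => real"
  assumes "integrable lborel q" "\<And>\<eta>. 0 <= q \<eta>" "S \<in> sets borel"
  shows "0 <= (LINT \<eta>:S|lborel. q \<eta>)" "(LINT \<eta>:S|lborel. q \<eta>) <= (LINT \<eta>|lborel. q (\<eta>::real))"
proof -
  have i: "integrable lborel (\<lambda>\<eta>. indicator S \<eta> *\<^sub>R q \<eta>)"
    by (rule integrable_mult_indicator[OF _ assms(1)]) (use assms(3) in simp)
  show "0 <= (LINT \<eta>:S|lborel. q \<eta>)" unfolding set_lebesgue_integral_def
    by (rule Bochner_Integration.integral_nonneg) (use assms in simp)
  show "(LINT \<eta>:S|lborel. q \<eta>) <= (LINT \<eta>|lborel. q \<eta>)" unfolding set_lebesgue_integral_def
    by (rule integral_mono[OF i assms(1)]) (use assms in \<open>auto simp: indicator_def\<close>)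
qed

lemma src_nonneg: "0 <= src x \<eta>" by (simp add: src_def)

lemma Y_bounds: "0 <= Y x \<xi>" "Y x \<xi> <= Y x 1"
proof -
  have eq: "Y x \<xi> = (LINT \<eta>:{..\<xi>}|lborel. (alpha x \<eta>)^2)" by (simp add: Y_def iquad_def quad_Y)
  show "0 <= Y x \<xi>" "Y x \<xi> <= Y x 1"
    unfolding Y_1 unfolding eq using integral_bounds[OF integrable_alpha_sq] by auto
qed

text \<open>
  \<open>\<bar>alpha beta\<bar> <= (alpha^2 + beta^2) / 2\<close> bounds the oscillation of \<open>U\<close>, and the energy bounds its
  mean square with respect to \<open>alpha^2\<close>, which has total mass 1.
\<close>

lemma static_bounds:
  assumes N: "Y x 1 = 1" and E: "energy x 1 = E"
  shows "0 <= E" "(LINT \<eta>|lborel. (beta x \<eta>)^2) <= E"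
    "\<bar>U x \<xi> - U x \<eta>\<bar> <= (1 + E) / 2"
    "(U x \<xi>)^2 <= 2 * E + 2 * ((1 + E) / 2)^2"
    "\<bar>P x \<xi>\<bar> <= exp 1 * (k1 + 1) * E + (1 + k2) * exp 1 * E"
    "\<bar>Q x \<xi>\<bar> <= exp 1 * (k1 + 1) * E + (1 + k2) * exp 1 * E"
proof -
  let ?I = "\<lambda>q. LINT \<eta>|lborel. q (\<eta>::real)"
  have E1: "?I (\<lambda>\<eta>. (U x \<eta>)^2 * (alpha x \<eta>)^2 + (beta x \<eta>)^2) = E" using E by (simp add: energy_1)
  show E0: "0 <= E" unfolding E1[symmetric] by (rule Bochner_Integration.integral_nonneg) simp
  show Eb: "?I (\<lambda>\<eta>. (beta x \<eta>)^2) <= E" unfolding E1[symmetric]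
    by (rule integral_mono[OF integrable_beta_sq integrable_energy]) simp
  have Ea: "?I (\<lambda>\<eta>. (alpha x \<eta>)^2) = 1" using N by (simp add: Y_1)
  define D where "D = (1 + E) / 2"
  have main: "\<bar>U x b - U x a\<bar> <= D" if ab: "a <= b" for a b
  proof -
    have i: "integrable lborel (\<lambda>\<eta>. indicator {a..b} \<eta> *\<^sub>R (alpha x \<eta> * beta x \<eta>))"
      by (rule integrable_mult_indicator[OF _ integrable_alpha_beta]) simp
    have "\<bar>U x b - U x a\<bar> = \<bar>?I (\<lambda>\<eta>. indicator {a..b} \<eta> *\<^sub>R (alpha x \<eta> * beta x \<eta>))\<bar>"
      using has_density_integral[OF U_density ab, of x] by (simp add: set_lebesgue_integral_def)
    also have "... <= ?I (\<lambda>\<eta>. 1/2 * ((alpha x \<eta>)^2 + (beta x \<eta>)^2))"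
      unfolding real_norm_def[symmetric]
    proof (rule Bochner_Integration.integral_norm_bound_integral[OF i])
      show "integrable lborel (\<lambda>\<eta>. 1/2 * ((alpha x \<eta>)^2 + (beta x \<eta>)^2))"
        using integrable_alpha_sq[of x] integrable_beta_sq[of x] by simp
      fix \<eta>
      have "0 <= (\<bar>alpha x \<eta>\<bar> - \<bar>beta x \<eta>\<bar>)^2" by simp
      then have *: "\<bar>alpha x \<eta>\<bar> * \<bar>beta x \<eta>\<bar> <= 1/2 * ((alpha x \<eta>)^2 + (beta x \<eta>)^2)" by (simp add: power2_diff)
      show "norm (indicator {a..b} \<eta> *\<^sub>R (alpha x \<eta> * beta x \<eta>)) <= 1/2 * ((alpha x \<eta>)^2 + (beta x \<eta>)^2)"
        using * by (cases "\<eta> \<in> {a..b}") (simp_all add: abs_mult)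
    qed
    also have "... = 1/2 * (1 + ?I (\<lambda>\<eta>. (beta x \<eta>)^2))"
      using Ea integrable_alpha_sq[of x] integrable_beta_sq[of x] by simp
    also have "... <= D" using Eb by (simp add: D_def)
    finally show ?thesis .
  qed
  have osc: "\<bar>U x a - U x b\<bar> <= D" for a b
    using main[of a b] main[of b a] by (cases "a <= b") (auto simp: abs_minus_commute)
  then show "\<bar>U x \<xi> - U x \<eta>\<bar> <= (1 + E) / 2" by (simp add: D_def)
  have "(U x \<xi>)^2 = ?I (\<lambda>\<eta>. (U x \<xi>)^2 * (alpha x \<eta>)^2)" using Ea by simp
  also have "... <= ?I (\<lambda>\<eta>. 2 * ((U x \<eta>)^2 * (alpha x \<eta>)^2 + (beta x \<eta>)^2) + 2 * D^2 * (alpha x \<eta>)^2)"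
  proof (rule integral_mono)
    show "integrable lborel (\<lambda>\<eta>. (U x \<xi>)^2 * (alpha x \<eta>)^2)" using integrable_alpha_sq by simp
    show "integrable lborel (\<lambda>\<eta>. 2 * ((U x \<eta>)^2 * (alpha x \<eta>)^2 + (beta x \<eta>)^2) + 2 * D^2 * (alpha x \<eta>)^2)"
      by (intro Bochner_Integration.integrable_add integrable_mult_right integrable_energy integrable_alpha_sq)
    fix \<eta>
    have "(u + v)^2 <= 2 * u^2 + 2 * v^2" for u v :: real
      using sum_squares_bound[of u v] by (simp add: power2_sum)
    from this[of "U x \<eta>" "U x \<xi> - U x \<eta>"]
    have "(U x \<xi>)^2 <= 2 * (U x \<eta>)^2 + 2 * (U x \<xi> - U x \<eta>)^2" by simp
    also have "(U x \<xi> - U x \<eta>)^2 <= D^2" using osc[of \<xi> \<eta>] by (rule power2_le_iff_abs_le[THEN iffD2, rotated]) (use E0 in \<open>simp add: D_def\<close>)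
    finally have "(U x \<xi>)^2 * (alpha x \<eta>)^2 <= (2 * (U x \<eta>)^2 + 2 * D^2) * (alpha x \<eta>)^2" by (intro mult_right_mono) auto
    then show "(U x \<xi>)^2 * (alpha x \<eta>)^2 <= 2 * ((U x \<eta>)^2 * (alpha x \<eta>)^2 + (beta x \<eta>)^2) + 2 * D^2 * (alpha x \<eta>)^2"
      by (simp add: algebra_simps) (smt (verit) zero_le_power2)
  qed
  also have "... = 2 * E + 2 * D^2"
    using E1 Ea integrable_energy[of x] integrable_alpha_sq[of x]
    by (subst Bochner_Integration.integral_add) (simp_all only: Bochner_Integration.integral_mult_right_zero integrable_mult_right mult_1_right)
  finally show "(U x \<xi>)^2 <= 2 * E + 2 * ((1 + E) / 2)^2" by (simp add: D_def)
  have srcE: "?I (src x) <= E" unfolding E1[symmetric]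
    by (rule integral_mono[OF integrable_src integrable_energy]) (simp add: src_def)
  have Yb: "0 <= Y x z" "Y x z <= 1" for z using Y_bounds[of x z] N by auto
  have eA: "exp (Y x \<eta>) * src x \<eta> <= exp 1 * src x \<eta>" for \<eta>
    using Yb src_nonneg by (intro mult_right_mono) auto
  have eB: "exp (- Y x \<eta>) * src x \<eta> <= 1 * src x \<eta>" for \<eta>
    using Yb src_nonneg by (intro mult_right_mono) auto
  have iA: "integrable lborel (\<lambda>\<eta>. exp (Y x \<eta>) * src x \<eta>)"
    by (rule Bochner_Integration.integrable_bound[of _ "\<lambda>\<eta>. exp 1 * src x \<eta>"])
       (use eA integrable_src src_nonneg in \<open>auto\<close>)
  have iB: "integrable lborel (\<lambda>\<eta>. exp (- Y x \<eta>) * src x \<eta>)"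
    by (rule Bochner_Integration.integrable_bound[of _ "\<lambda>\<eta>. 1 * src x \<eta>"])
       (use eB integrable_src src_nonneg in \<open>auto\<close>)
  have "?I (\<lambda>\<eta>. exp (Y x \<eta>) * src x \<eta>) <= ?I (\<lambda>\<eta>. exp 1 * src x \<eta>)"
    by (rule integral_mono[OF iA integrable_mult_right[OF integrable_src] eA])
  also have "... <= exp 1 * E" using srcE by simp
  finally have IA: "?I (\<lambda>\<eta>. exp (Y x \<eta>) * src x \<eta>) <= exp 1 * E" .
  have "?I (\<lambda>\<eta>. exp (- Y x \<eta>) * src x \<eta>) <= ?I (\<lambda>\<eta>. 1 * src x \<eta>)"
    by (rule integral_mono[OF iB integrable_mult_right[OF integrable_src] eB])
  also have "... <= E" using srcE by simp
  finally have IB: "?I (\<lambda>\<eta>. exp (- Y x \<eta>) * src x \<eta>) <= E" .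
  have Aeq: "A x z = (LINT \<eta>:{..z}|lborel. exp (Y x \<eta>) * src x \<eta>)" for z
    unfolding A_def iquad_def quad_src ..
  have Beq: "B x z = (LINT \<eta>:{..z}|lborel. exp (- Y x \<eta>) * src x \<eta>)" for z
    unfolding B_def iquad_def quad_src ..
  have Ab: "0 <= A x z" "A x z <= exp 1 * E" for z
    unfolding Aeq using integral_bounds[OF iA, of "{..z}"] IA src_nonneg by auto
  have Bb: "0 <= B x z" "B x z <= E" for z
    unfolding Beq using integral_bounds[OF iB, of "{..z}"] IB src_nonneg by auto
  have k: "0 <= k1" "0 <= k2" by (auto simp: k1_def k2_def)
  have "\<bar>k1 * B x 1 - B x z\<bar> <= (k1 + 1) * E" for z
  proof -
    have "0 <= k1 * B x 1" "k1 * B x 1 <= k1 * E" using Bb k by (auto intro: mult_left_mono)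
    then show ?thesis using Bb[of z] unfolding distrib_right by linarith
  qed
  then have Mpb: "\<bar>Mp x z\<bar> <= exp 1 * ((k1 + 1) * E)" for z
    unfolding Mp_def abs_mult using Yb[of z] by (intro mult_mono) auto
  have "\<bar>A x z + k2 * A x 1\<bar> <= (1 + k2) * (exp 1 * E)" for z
  proof -
    have "0 <= k2 * A x 1" "k2 * A x 1 <= k2 * (exp 1 * E)" using Ab k by (auto intro: mult_left_mono)
    then show ?thesis using Ab[of z] unfolding distrib_right by linarith
  qed
  then have Mmb: "\<bar>Mm x z\<bar> <= 1 * ((1 + k2) * (exp 1 * E))" for z
    unfolding Mm_def abs_mult using Yb[of z] by (intro mult_mono) auto
  show "\<bar>P x \<xi>\<bar> <= exp 1 * (k1 + 1) * E + (1 + k2) * exp 1 * E"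
    "\<bar>Q x \<xi>\<bar> <= exp 1 * (k1 + 1) * E + (1 + k2) * exp 1 * E"
    unfolding P_def Q_def
    using order_trans[OF abs_half_le(2) add_mono[OF Mpb[of \<xi>] Mmb[of \<xi>]]]
      order_trans[OF abs_half_le(1) add_mono[OF Mpb[of \<xi>] Mmb[of \<xi>]]]
    by (simp_all only: mult.assoc mult_1_left)
qed

definition init :: "real => state" where "init m = const_bcontfun (m, 1, 0, 0, 1)"

lemma st_init: "st_m (init m) \<xi> = m" "st_p1 (init m) \<xi> = 1" "st_p2 (init m) \<xi> = 0"
  "st_r1 (init m) \<xi> = 0" "st_r2 (init m) \<xi> = 1"
  by (simp_all add: st_defs init_def)

lemma alpha_init: "alpha (init m) \<eta> = e0 \<eta>" by (simp add: alpha_def st_init)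
lemma beta_init: "beta (init m) \<eta> = w \<eta>" by (simp add: beta_def st_init)

lemma Y_init: "Y (init m) 1 = 1" "0 <= \<xi> ==> \<xi> <= 1 ==> Y (init m) \<xi> = \<xi>"
proof -
  have *: "Y (init m) \<xi> = \<xi>" if "0 <= \<xi>" "\<xi> <= 1" for \<xi>
  proof -
    have "Y (init m) \<xi> = (LINT \<eta>:{..\<xi>}|lborel. (e0 \<eta>)^2)" by (simp add: Y_def iquad_def quad_Y alpha_init)
    also have "... = (LINT \<eta>|lborel. indicator {0..\<xi>} \<eta>)"
      unfolding set_lebesgue_integral_def by (rule Bochner_Integration.integral_cong) (use that in \<open>auto simp: indicator_def\<close>)
    also have "... = \<xi>" using that by simp
    finally show ?thesis .
  qed
  then show "Y (init m) 1 = 1" "0 <= \<xi> ==> \<xi> <= 1 ==> Y (init m) \<xi> = \<xi>" by simp_all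
qed

lemma U_init: "U (init m) \<xi> = m + (LINT \<eta>:{..\<xi>}|lborel. w \<eta>)"
proof -
  have "e0 \<eta> * w \<eta> = w \<eta>" for \<eta> by (cases "\<eta> \<in> {0..1}") (simp_all add: w_outside)
  moreover have "V (init m) \<xi> = (LINT \<eta>:{..\<xi>}|lborel. alpha (init m) \<eta> * beta (init m) \<eta>)"
    by (simp only: V_def iquad_def quad_V)
  ultimately show ?thesis unfolding U_def alpha_init beta_init st_init by (simp only:)
qed

lemma U_init_period: "(LINT \<eta>|lborel. w \<eta>) = 0 ==> U (init m) 1 = U (init m) 0"
  using set_integral_period(1)[of w] w_outside by (simp add: U_0 st_init) (simp add: U_init)

text \<open>
  The energy bounds \<open>U\<close>, \<open>P\<close> and \<open>Q\<close>.  Hence the value at the label 0 grows at most linearly and the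
  coefficients, which solve a linear system with bounded matrix, at most exponentially.
\<close>

lemma a_priori_bound:
  assumes X: "solves T X" and X0: "X 0 = init m" and w0: "(LINT \<eta>|lborel. w \<eta>) = 0" and t: "\<bar>t\<bar> <= T"
    and E_def: "E = energy (init m) 1"
    and C_def: "C = exp 1 * (k1 + 1) * E + (1 + k2) * exp 1 * E"
    and g_def: "g = 1 + 2 * (2 * E + 2 * ((1 + E) / 2)^2 + C)"
  shows "norm (X t) < \<bar>m\<bar> + C * \<bar>t\<bar> + 4 * (1 + 2 * exp (g * \<bar>t\<bar>)) + 1"
proof -
  have i: "Y (X 0) 1 = 1" "U (X 0) 1 = U (X 0) 0" using X0 Y_init U_init_period[OF w0] by simp_all
  have N: "Y (X s) 1 = 1" and En: "energy (X s) 1 = E" if "\<bar>s\<bar> <= T" for s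
    using period_constraint[OF X i that] energy_conserved[OF X i that] X0 by (simp_all add: E_def)
  note b = static_bounds[OF N En]
  have "norm (X t) <= \<bar>m\<bar> + C * \<bar>t\<bar> + 4 * (1 + 2 * exp (g * \<bar>t\<bar>))"
  proof (rule norm_bound)
    fix \<xi>
    have T0: "\<bar>0\<bar> <= T" using t by linarith
    have C0: "0 <= C" using b(6)[OF T0 T0, of \<xi>] by (simp add: C_def)
    have m: "\<bar>st_m (X t) \<xi> - m\<bar> <= C * \<bar>t\<bar>"
    proof -
      have "norm (st_m (X t) \<xi> - st_m (X 0) \<xi>) <= (\<lambda>t. C * t) \<bar>t\<bar> - (\<lambda>t. C * t) 0"
      proof (rule derivative_norm_bound[where T=T and f'="\<lambda>t. - Q (X t) 0" and \<phi>'="\<lambda>t. C"])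
        show "((\<lambda>s. st_m (X s) \<xi>) has_vector_derivative - Q (X s) 0) (at s)" if "\<bar>s\<bar> <= T" for s
          using st_derivative(1)[OF solvesD[OF X that]] by (simp add: has_real_derivative_iff_has_vector_derivative)
        show "((\<lambda>t. C * t) has_real_derivative C) (at t)" for t by (auto intro!: derivative_eq_intros)
        have *: "norm (- Q (X s) 0) <= C" if "\<bar>s\<bar> <= T" for s using b(6)[OF that that, of 0] by (simp add: C_def)
        show "norm (- Q (X s) 0) <= C \<and> norm (- Q (X (- s)) 0) <= C" if "0 <= s" "s <= T" for s
          using *[of s] *[of "- s"] that by simp
      qed (rule t)
      then show ?thesis using X0 by (simp add: st_init)
    qed
    have ab: "\<bar>a * b\<bar> <= a^2 + b^2" for a b :: real
    proof -
      have "2 * (\<bar>a\<bar> * \<bar>b\<bar>) <= a^2 + b^2" using sum_squares_bound[of "\<bar>a\<bar>" "\<bar>b\<bar>"] by (simp add: mult.assoc)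
      moreover have "0 <= \<bar>a\<bar> * \<bar>b\<bar>" by simp
      ultimately show ?thesis unfolding abs_mult by linarith
    qed
    define z where "z = (\<lambda>s. (st_p1 (X s) \<xi>)^2 + (st_p2 (X s) \<xi>)^2 + (st_r1 (X s) \<xi>)^2 + (st_r2 (X s) \<xi>)^2)"
    have "z t <= z 0 * exp (g * \<bar>t\<bar>)"
    proof (rule gronwall_two_sided[where T=T and f'="\<lambda>s. (1 + 2 * G (X s) \<xi>) * (st_p1 (X s) \<xi> * st_r1 (X s) \<xi> + st_p2 (X s) \<xi> * st_r2 (X s) \<xi>)", OF _ _ t])
      fix s assume s: "\<bar>s\<bar> <= T"
      show "(z has_real_derivative (1 + 2 * G (X s) \<xi>) * (st_p1 (X s) \<xi> * st_r1 (X s) \<xi> + st_p2 (X s) \<xi> * st_r2 (X s) \<xi>)) (at s)"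
        unfolding z_def by (auto intro!: derivative_eq_intros st_derivative[OF solvesD[OF X s]] simp: algebra_simps)
      have "\<bar>G (X s) \<xi>\<bar> <= \<bar>(U (X s) \<xi>)^2\<bar> + \<bar>P (X s) \<xi>\<bar>" unfolding G_def by (rule abs_triangle_ineq4)
      then have Gb: "\<bar>1 + 2 * G (X s) \<xi>\<bar> <= g"
        using b(4)[OF s s, of \<xi>] b(5)[OF s s, of \<xi>] unfolding g_def C_def by (simp add: abs_le_iff) linarith
      have "\<bar>st_p1 (X s) \<xi> * st_r1 (X s) \<xi>\<bar> <= (st_p1 (X s) \<xi>)^2 + (st_r1 (X s) \<xi>)^2"
        "\<bar>st_p2 (X s) \<xi> * st_r2 (X s) \<xi>\<bar> <= (st_p2 (X s) \<xi>)^2 + (st_r2 (X s) \<xi>)^2"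
        by (rule ab)+
      then have pr: "\<bar>st_p1 (X s) \<xi> * st_r1 (X s) \<xi> + st_p2 (X s) \<xi> * st_r2 (X s) \<xi>\<bar> <= z s" unfolding z_def by linarith
      show "\<bar>(1 + 2 * G (X s) \<xi>) * (st_p1 (X s) \<xi> * st_r1 (X s) \<xi> + st_p2 (X s) \<xi> * st_r2 (X s) \<xi>)\<bar> <= g * z s"
        unfolding abs_mult[of "1 + 2 * G (X s) \<xi>"] using Gb pr by (intro mult_mono) auto
    qed
    then have z: "z t <= 2 * exp (g * \<bar>t\<bar>)" using X0 by (simp add: z_def st_init)
    note sq = abs_le_one_plus_square
    have "\<bar>st_p1 (X t) \<xi>\<bar> <= 1 + z t" "\<bar>st_p2 (X t) \<xi>\<bar> <= 1 + z t" "\<bar>st_r1 (X t) \<xi>\<bar> <= 1 + z t" "\<bar>st_r2 (X t) \<xi>\<bar> <= 1 + z t"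
      unfolding z_def using sq[of "st_p1 (X t) \<xi>"] sq[of "st_p2 (X t) \<xi>"] sq[of "st_r1 (X t) \<xi>"] sq[of "st_r2 (X t) \<xi>"]
      zero_le_power2[of "st_p1 (X t) \<xi>"] zero_le_power2[of "st_p2 (X t) \<xi>"] zero_le_power2[of "st_r1 (X t) \<xi>"] zero_le_power2[of "st_r2 (X t) \<xi>"]
      by linarith+
    note pr_bounds = this
    have mb: "\<bar>st_m (X t) \<xi>\<bar> <= \<bar>m\<bar> + C * \<bar>t\<bar>" using m by linarith
    have "norm (apply_bcontfun (X t) \<xi>) <= \<bar>st_m (X t) \<xi>\<bar> + \<bar>st_p1 (X t) \<xi>\<bar> + \<bar>st_p2 (X t) \<xi>\<bar> + \<bar>st_r1 (X t) \<xi>\<bar> + \<bar>st_r2 (X t) \<xi>\<bar>"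
      unfolding state_apply by (rule norm_tuple5_le)
    also have "... <= (\<bar>m\<bar> + C * \<bar>t\<bar>) + (1 + z t) + (1 + z t) + (1 + z t) + (1 + z t)"
      by (intro add_mono mb pr_bounds)
    also have "... = \<bar>m\<bar> + C * \<bar>t\<bar> + 4 * (1 + z t)" by simp
    also have "... <= \<bar>m\<bar> + C * \<bar>t\<bar> + 4 * (1 + 2 * exp (g * \<bar>t\<bar>))"
      using z by (intro add_left_mono mult_left_mono) auto
    finally show "norm (apply_bcontfun (X t) \<xi>) <= \<bar>m\<bar> + C * \<bar>t\<bar> + 4 * (1 + 2 * exp (g * \<bar>t\<bar>))" .
  qed
  then show ?thesis by linarith
qed

theorem global_lagrangian_solution:
  assumes w0: "(LINT \<eta>|lborel. w \<eta>) = 0"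
  shows "\<exists>X. X 0 = init m \<and> (\<forall>t. (X has_vector_derivative F (X t)) (at t)) \<and>
     (\<forall>t. Y (X t) 1 = 1 \<and> U (X t) 1 = U (X t) 0 \<and> energy (X t) 1 = energy (init m) 1)"
proof -
  define E where "E = energy (init m) 1"
  define C where "C = exp 1 * (k1 + 1) * E + (1 + k2) * exp 1 * E"
  define g where "g = 1 + 2 * (2 * E + 2 * ((1 + E) / 2)^2 + C)"
  (* The bound depends continuously on time but not on the interval of existence. *)
  define R where "R = (\<lambda>\<tau>. \<bar>m\<bar> + C * \<bar>\<tau>\<bar> + 4 * (1 + 2 * exp (g * \<bar>\<tau>\<bar>)) + 1)"
  have C0: "0 <= C" using static_bounds(6)[OF Y_init(1) E_def[symmetric], of 0] by (simp add: C_def)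
  have sol: "solves T x" if "continuous_on UNIV x" "\<And>t. \<bar>t\<bar> <= T ==> (x has_vector_derivative F (x t)) (at t)" for T x
    using that by (simp add: solves_def)
  have "\<exists>x. x 0 = init m \<and> (\<forall>t. (x has_vector_derivative F (x t)) (at t)) \<and> (\<forall>t. norm (x t) < R \<bar>t\<bar>)"
  proof (rule global_solution_of_a_priori_bound[OF F_lipschitz])
    show "continuous_on UNIV R" unfolding R_def by (intro continuous_intros)
    have "0 <= C * \<bar>t\<bar>" for t using C0 by simp
    then show "0 < R t" for t unfolding R_def by (smt (verit) exp_gt_zero abs_ge_zero)
    show "\<forall>t. \<bar>t\<bar> <= T --> norm (x t) < R \<bar>t\<bar>"
      if "0 <= T" "x 0 = init m" "continuous_on UNIV x" "\<And>t. \<bar>t\<bar> <= T ==> (x has_vector_derivative F (x t)) (at t)" for x T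
      using a_priori_bound[OF sol[OF that(3,4)] that(2) w0 _ E_def C_def g_def] by (simp add: R_def)
    show "norm (init m) <= R 0"
    proof (rule norm_bound)
      fix \<xi>
      have "norm (apply_bcontfun (init m) \<xi>) <= \<bar>m\<bar> + \<bar>1\<bar> + \<bar>0\<bar> + \<bar>0\<bar> + \<bar>1\<bar>"
        unfolding init_def by (simp only: const_bcontfun.rep_eq) (rule norm_tuple5_le)
      then show "norm (apply_bcontfun (init m) \<xi>) <= R 0" by (simp add: R_def)
    qed
  qed
  then obtain X where X: "X 0 = init m" "\<And>t. (X has_vector_derivative F (X t)) (at t)" by blast
  have "continuous_on UNIV X"
    using X(2) has_vector_derivative_continuous by (blast intro: continuous_at_imp_continuous_on)
  then have S: "solves T X" for T using X by (simp add: solves_def)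
  have i: "Y (X 0) 1 = 1" "U (X 0) 1 = U (X 0) 0" using X Y_init U_init_period[OF w0] by simp_all
  have "Y (X t) 1 = 1 \<and> U (X t) 1 = U (X t) 0 \<and> energy (X t) 1 = energy (init m) 1" for t
    using period_constraint[OF S[of "\<bar>t\<bar>"] i, of t] energy_conserved[OF S[of "\<bar>t\<bar>"] i, of t] X(1) by simp
  then show ?thesis using X by blast
qed

end

section \<open>From labels to points of the circle\<close>

lemma periodic_frac: "periodic_fun_simple' f ==> f (frac x) = f x" for f :: "real => 'a"
  unfolding frac_def by (rule periodic_fun.minus_of_int[where gm="\<lambda>x y. x - y" and g="\<lambda>x y. x + y" and ?g1.0="\<lambda>x. x + 1" and ?gn1.0="\<lambda>x. x - 1"])
    (unfold_locales, auto simp: periodic_fun_simple'_def algebra_simps)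

lemma frac_add_int: "frac (x + of_int n) = frac x" for x :: real
  by (simp add: frac_def)

lemma periodic_frac_fun: "periodic_fun_simple' (\<lambda>x. f (frac (x + c)))" for f :: "real => 'a"
proof -
  have "frac (x + 1 + c) = frac (x + c)" for x :: real
  proof -
    have "frac (x + 1 + c) = frac ((x + c) + of_int 1)" by (rule arg_cong[where f=frac]) simp
    then show ?thesis by (simp only: frac_add_int)
  qed
  then show ?thesis by (simp add: periodic_fun_simple'_def)
qed

text \<open>
  The circle of length 1 as a probability measure on the line; it acts on periodic functions.
\<close>

definition circ :: "real measure" where
  "circ = density lborel (indicator {0..1})"

lemma sets_circ [measurable_cong, simp]: "sets circ = sets borel" by (simp add: circ_def)
lemma space_circ [simp]: "space circ = UNIV" by (simp add: circ_def)

lemma emeasure_circ: "A \<in> sets borel ==> emeasure circ A = (\<integral>\<^sup>+x. indicator A x * indicator {0..1} x \<partial>lborel)"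
  by (simp add: circ_def emeasure_density mult.commute)

lemma prob_circ: "emeasure circ UNIV = 1"
  by (simp add: emeasure_circ)

lemma finite_measure_circ: "finite_measure circ"
  by (rule finite_measureI) (simp add: prob_circ)

lemma integral_circ:
  fixes f :: "real => real"
  assumes "f \<in> borel_measurable borel"
  shows "(LINT x|circ. f x) = (LINT x:{0..1}|lborel. f x)"
    "integrable circ f \<longleftrightarrow> set_integrable lborel {0..1} f"
proof -
  have eq: "circ = density lborel (\<lambda>x. ennreal (indicator {0..1} x))"
    unfolding circ_def by (rule density_cong) (auto simp: indicator_def)
  show "(LINT x|circ. f x) = (LINT x:{0..1}|lborel. f x)"
    unfolding eq set_lebesgue_integral_def by (rule integral_density) (use assms in auto)
  show "integrable circ f \<longleftrightarrow> set_integrable lborel {0..1} f"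
    unfolding eq set_integrable_def by (rule integrable_density) (use assms in auto)
qed

lemma AE_circ: "AE x in lborel. Pr x ==> AE x in circ. Pr x"
  unfolding circ_def by (subst AE_density) (auto elim!: eventually_mono)

lemma nn_integral_Icc_split:
  fixes f :: "real => ennreal"
  assumes [measurable]: "f \<in> borel_measurable borel" and "a <= b" "b <= c"
  shows "(\<integral>\<^sup>+x. f x * indicator {a..c} x \<partial>lborel) =
    (\<integral>\<^sup>+x. f x * indicator {a..b} x \<partial>lborel) + (\<integral>\<^sup>+x. f x * indicator {b..c} x \<partial>lborel)"
proof -
  have "AE x in lborel. x \<noteq> b" by (rule AE_lborel_singleton)
  then have "AE x in lborel. f x * indicator {a..c} x = f x * indicator {a..b} x + f x * indicator {b..c} x"
    by eventually_elim (use assms(2,3) in \<open>auto simp: indicator_def\<close>)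
  then have "(\<integral>\<^sup>+x. f x * indicator {a..c} x \<partial>lborel) = (\<integral>\<^sup>+x. f x * indicator {a..b} x + f x * indicator {b..c} x \<partial>lborel)"
    by (rule nn_integral_cong_AE)
  then show ?thesis by (simp add: nn_integral_add)
qed

lemma nn_integral_periodic_shift:
  fixes f :: "real => ennreal"
  assumes f [measurable]: "f \<in> borel_measurable borel" and per: "periodic_fun_simple' f"
  shows "(\<integral>\<^sup>+x. f (x + c) * indicator {0..1} x \<partial>lborel) = (\<integral>\<^sup>+x. f x * indicator {0..1} x \<partial>lborel)"
proof -
  have shift: "(\<integral>\<^sup>+x. f (x + s) * indicator {a..b} x \<partial>lborel) = (\<integral>\<^sup>+x. f x * indicator {a + s..b + s} x \<partial>lborel)" for s a b
  proof -
    have "(\<integral>\<^sup>+x. f x * indicator {a + s..b + s} x \<partial>lborel) = (\<integral>\<^sup>+x. f (s + 1 * x) * indicator {a + s..b + s} (s + 1 * x) \<partial>lborel)"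
      by (subst nn_integral_real_affine[of _ 1 s]) auto
    also have "... = (\<integral>\<^sup>+x. f (x + s) * indicator {a..b} x \<partial>lborel)"
      by (rule nn_integral_cong) (auto simp: indicator_def add.commute)
    finally show ?thesis ..
  qed
  define r where "r = frac c"
  have r: "0 <= r" "r <= 1" using frac_lt_1[of c] by (auto simp: r_def less_imp_le)
  have fr: "f (x + c) = f (x + r)" for x
  proof -
    have "frac (x + c) = frac ((x + r) + of_int \<lfloor>c\<rfloor>)"
      by (rule arg_cong[where f=frac]) (simp add: r_def frac_def)
    then have "frac (x + c) = frac (x + r)" by (simp only: frac_add_int)
    then show ?thesis using periodic_frac[OF per] by metis
  qed
  have "(\<integral>\<^sup>+x. f (x + c) * indicator {0..1} x \<partial>lborel) = (\<integral>\<^sup>+x. f x * indicator {r..1 + r} x \<partial>lborel)"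
    using shift[of r 0 1] by (simp add: fr)
  also have "... = (\<integral>\<^sup>+x. f x * indicator {r..1} x \<partial>lborel) + (\<integral>\<^sup>+x. f x * indicator {1..1 + r} x \<partial>lborel)"
    by (rule nn_integral_Icc_split) (use r in auto)
  also have "(\<integral>\<^sup>+x. f x * indicator {1..1 + r} x \<partial>lborel) = (\<integral>\<^sup>+x. f x * indicator {0..r} x \<partial>lborel)"
    using shift[of 1 0 r] per by (simp add: periodic_fun_simple'_def add.commute)
  also have "(\<integral>\<^sup>+x. f x * indicator {r..1} x \<partial>lborel) + (\<integral>\<^sup>+x. f x * indicator {0..r} x \<partial>lborel) =
     (\<integral>\<^sup>+x. f x * indicator {0..1} x \<partial>lborel)"
    by (subst nn_integral_Icc_split[of f 0 r 1]) (use r in \<open>auto simp: add.commute\<close>)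
  finally show ?thesis .
qed

lemma frac_shift_borel [measurable]: "(\<lambda>x::real. frac (x + c)) \<in> borel_measurable borel"
  unfolding frac_def by measurable

text \<open>
  Periodic functions do not notice translations; testing with indicators of sets gives the statement
  about measures.
\<close>

lemma distr_circ_shift: "distr circ borel (\<lambda>x. frac (x + c)) = circ"
proof (rule measure_eqI)
  fix A assume "A \<in> sets (distr circ borel (\<lambda>x. frac (x + c)))"
  then have A [measurable]: "A \<in> sets borel" by simp
  have [measurable]: "(\<lambda>x::real. frac x) \<in> borel_measurable borel" using frac_shift_borel[of 0] by simp
  let ?f = "\<lambda>x::real. indicator A (frac x) :: ennreal"
  have per: "periodic_fun_simple' ?f" using periodic_frac_fun[of "\<lambda>x. indicator A x :: ennreal" 0] by simp
  have "emeasure (distr circ borel (\<lambda>x. frac (x + c))) A = emeasure circ ((\<lambda>x. frac (x + c)) -` A)"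
    by (subst emeasure_distr) auto
  also have "... = (\<integral>\<^sup>+x. ?f (x + c) * indicator {0..1} x \<partial>lborel)"
    by (subst emeasure_circ) (auto simp: indicator_def vimage_def intro!: nn_integral_cong)
  also have "... = (\<integral>\<^sup>+x. ?f x * indicator {0..1} x \<partial>lborel)"
    by (rule nn_integral_periodic_shift[OF _ per]) measurable
  also have "... = (\<integral>\<^sup>+x. indicator A x * indicator {0..1} x \<partial>lborel)"
  proof (rule nn_integral_cong_AE)
    have "AE x in lborel. x \<noteq> (1::real)" by (rule AE_lborel_singleton)
    then show "AE x in lborel. ?f x * indicator {0..1} x = indicator A x * indicator {0..1} x"
      by eventually_elim (auto simp: indicator_def frac_eq)
  qed
  also have "... = emeasure circ A" by (simp add: emeasure_circ)
  finally show "emeasure (distr circ borel (\<lambda>x. frac (x + c))) A = emeasure circ A" .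
qed simp

lemma circ_shift:
  fixes f :: "real => real"
  assumes f [measurable]: "f \<in> borel_measurable borel" and per: "periodic_fun_simple' f"
  shows "(LINT x|circ. f (x + c)) = (LINT x|circ. f x)" "integrable circ (\<lambda>x. f (x + c)) \<longleftrightarrow> integrable circ f"
proof -
  have fr: "f (frac (x + c)) = f (x + c)" for x by (rule periodic_frac[OF per])
  have m: "(\<lambda>x. frac (x + c)) \<in> measurable circ borel" by measurable
  have "(LINT x|circ. f x) = (LINT x|distr circ borel (\<lambda>x. frac (x + c)). f x)" by (simp only: distr_circ_shift)
  also have "... = (LINT x|circ. f (frac (x + c)))" by (rule integral_distr[OF m]) simp
  finally show "(LINT x|circ. f (x + c)) = (LINT x|circ. f x)" by (simp add: fr)
  have "integrable circ f \<longleftrightarrow> integrable (distr circ borel (\<lambda>x. frac (x + c))) f" by (simp only: distr_circ_shift)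
  also have "... \<longleftrightarrow> integrable circ (\<lambda>x. f (frac (x + c)))" by (rule integrable_distr_eq[OF m]) simp
  finally show "integrable circ (\<lambda>x. f (x + c)) \<longleftrightarrow> integrable circ f" by (simp add: fr)
qed

text \<open>
  One instant of time.  \<open>Yf\<close> maps labels to positions relative to a point \<open>c\<close>.  It is nondecreasing
  but may be constant on intervals, and \<open>Uf\<close> carries the velocity.
\<close>

locale profile =
  fixes al be Yf Uf :: "real => real" and c :: real
  assumes al_borel [measurable]: "al \<in> borel_measurable borel"
    and be_borel [measurable]: "be \<in> borel_measurable borel"
    and al_outside: "\<xi> \<notin> {0..1} ==> al \<xi> = 0" and be_outside: "\<xi> \<notin> {0..1} ==> be \<xi> = 0"
    and al_sq: "integrable lborel (\<lambda>\<xi>. (al \<xi>)^2)" and be_sq: "integrable lborel (\<lambda>\<xi>. (be \<xi>)^2)"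
    and al_be: "integrable lborel (\<lambda>\<xi>. al \<xi> * be \<xi>)"
    and Yd: "has_density Yf (\<lambda>\<xi>. (al \<xi>)^2)" and Ud: "has_density Uf (\<lambda>\<xi>. al \<xi> * be \<xi>)"
    and Y0: "Yf 0 = 0" and Y1: "Yf 1 = 1" and U01: "Uf 1 = Uf 0"
begin

lemma Y_mono: "\<xi> <= \<xi>' ==> Yf \<xi> <= Yf \<xi>'"
proof -
  assume le: "\<xi> <= \<xi>'"
  have "Yf \<xi>' - Yf \<xi> = (LINT z:{\<xi>..\<xi>'}|lborel. (al z)^2)" using has_density_integral[OF Yd le] by simp
  also have "... \<ge> 0" unfolding set_lebesgue_integral_def by (rule Bochner_Integration.integral_nonneg) simp
  finally show ?thesis by simp
qed

lemma Y_cont: "continuous_on S Yf" by (rule has_density_continuous[OF Yd])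

lemma Y_borel [measurable]: "Yf \<in> borel_measurable borel" by (rule borel_measurable_continuous_onI[OF Y_cont])

lemma Y_left: "\<xi> <= 0 ==> Yf \<xi> = 0"
proof -
  assume le: "\<xi> <= 0"
  have "(LINT z:{\<xi>..0}|lborel. (al z)^2) = 0"
  proof -
    have "AE z in lborel. z \<noteq> (0::real)" by (rule AE_lborel_singleton)
    then have "AE z in lborel. indicator {\<xi>..0} z *\<^sub>R (al z)^2 = 0"
      by eventually_elim (auto simp: indicator_def al_outside)
    then show ?thesis unfolding set_lebesgue_integral_def by (rule integral_eq_zero_AE)
  qed
  then show ?thesis using has_density_integral[OF Yd le] Y0 by simp
qed

lemma Y_right: "1 <= \<xi> ==> Yf \<xi> = 1"
proof -
  assume le: "1 <= \<xi>"
  have "(LINT z:{1..\<xi>}|lborel. (al z)^2) = 0"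
  proof -
    have "AE z in lborel. z \<noteq> (1::real)" by (rule AE_lborel_singleton)
    then have "AE z in lborel. indicator {1..\<xi>} z *\<^sub>R (al z)^2 = 0"
      by eventually_elim (auto simp: indicator_def al_outside)
    then show ?thesis unfolding set_lebesgue_integral_def by (rule integral_eq_zero_AE)
  qed
  then show ?thesis using has_density_integral[OF Yd le] Y1 by simp
qed

lemma Y_range: "0 <= Yf \<xi>" "Yf \<xi> <= 1"
  using Y_mono[of 0 \<xi>] Y_left[of \<xi>] Y0 Y_mono[of \<xi> 1] Y_right[of \<xi>] Y1 by (cases "0 <= \<xi>"; cases "\<xi> <= 1"; simp)+

lemma Y_surj: "0 <= x ==> x <= 1 ==> \<exists>\<xi>. \<xi> \<in> {0..1} \<and> Yf \<xi> = x"
  using IVT'[of Yf 0 x 1] Y0 Y1 Y_cont by auto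

definition energy_part :: "real => real" where "energy_part \<xi> = (LINT z:{..\<xi>}|lborel. (be z)^2)"

lemma energy_part_density: "has_density energy_part (\<lambda>\<xi>. (be \<xi>)^2)"
  unfolding energy_part_def by (rule has_density_indefinite_integral[OF be_sq])

lemma energy_part_mono: "\<xi> <= \<xi>' ==> energy_part \<xi> <= energy_part \<xi>'"
proof -
  assume le: "\<xi> <= \<xi>'"
  have "energy_part \<xi>' - energy_part \<xi> = (LINT z:{\<xi>..\<xi>'}|lborel. (be z)^2)"
    using has_density_integral[OF energy_part_density le] by simp
  also have "... \<ge> 0" unfolding set_lebesgue_integral_def by (rule Bochner_Integration.integral_nonneg) simp
  finally show ?thesis by simp
qed

text \<open>
  Weighted Young inequality \<open>\<bar>al be\<bar> <= K al^2 + be^2 / K\<close>.  The free parameter \<open>K\<close> makes the energy term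
  small when the first term is irrelevant.
\<close>

lemma U_increment:
  assumes le: "\<xi> <= \<xi>'" and K: "0 < K"
  shows "\<bar>Uf \<xi>' - Uf \<xi>\<bar> <= K * (Yf \<xi>' - Yf \<xi>) + 1/K * (energy_part \<xi>' - energy_part \<xi>)"
proof -
  have i: "integrable lborel (\<lambda>z. indicator {\<xi>..\<xi>'} z *\<^sub>R (al z * be z))"
    by (rule integrable_mult_indicator[OF _ al_be]) simp
  have i1: "integrable lborel (\<lambda>z. indicator {\<xi>..\<xi>'} z *\<^sub>R (al z)^2)" by (rule integrable_mult_indicator[OF _ al_sq]) simp
  have i2: "integrable lborel (\<lambda>z. indicator {\<xi>..\<xi>'} z *\<^sub>R (be z)^2)" by (rule integrable_mult_indicator[OF _ be_sq]) simp
  have "\<bar>Uf \<xi>' - Uf \<xi>\<bar> = \<bar>LINT z|lborel. indicator {\<xi>..\<xi>'} z *\<^sub>R (al z * be z)\<bar>"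
    using has_density_integral[OF Ud le] by (simp add: set_lebesgue_integral_def)
  also have "... <= (LINT z|lborel. K * (indicator {\<xi>..\<xi>'} z *\<^sub>R (al z)^2) + 1/K * (indicator {\<xi>..\<xi>'} z *\<^sub>R (be z)^2))"
    unfolding real_norm_def[symmetric]
  proof (rule Bochner_Integration.integral_norm_bound_integral[OF i])
    show "integrable lborel (\<lambda>z. K * (indicator {\<xi>..\<xi>'} z *\<^sub>R (al z)^2) + 1/K * (indicator {\<xi>..\<xi>'} z *\<^sub>R (be z)^2))"
      by (intro Bochner_Integration.integrable_add integrable_mult_right i1 i2)
    fix z
    have "0 <= (K * \<bar>al z\<bar> - \<bar>be z\<bar>)^2" by simp
    then have "2 * K * (\<bar>al z\<bar> * \<bar>be z\<bar>) <= K^2 * (al z)^2 + (be z)^2" by (simp add: power2_diff power_mult_distrib)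
    then have "2 * (\<bar>al z\<bar> * \<bar>be z\<bar>) <= K * (al z)^2 + 1/K * (be z)^2"
      using K by (simp add: field_simps power2_eq_square)
    moreover have "0 <= \<bar>al z\<bar> * \<bar>be z\<bar>" by simp
    ultimately have "\<bar>al z * be z\<bar> <= K * (al z)^2 + 1/K * (be z)^2" unfolding abs_mult by linarith
    then show "norm (indicator {\<xi>..\<xi>'} z *\<^sub>R (al z * be z)) <=
        K * (indicator {\<xi>..\<xi>'} z *\<^sub>R (al z)^2) + 1/K * (indicator {\<xi>..\<xi>'} z *\<^sub>R (be z)^2)"
      by (cases "z \<in> {\<xi>..\<xi>'}") simp_all
  qed
  also have "... = K * (LINT z|lborel. indicator {\<xi>..\<xi>'} z *\<^sub>R (al z)^2) + 1/K * (LINT z|lborel. indicator {\<xi>..\<xi>'} z *\<^sub>R (be z)^2)"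
    by (subst Bochner_Integration.integral_add) (use i1 i2 in \<open>simp_all only: integrable_mult_right Bochner_Integration.integral_mult_right_zero\<close>)
  also have "... = K * (Yf \<xi>' - Yf \<xi>) + 1/K * (energy_part \<xi>' - energy_part \<xi>)"
    using has_density_integral[OF Yd le] has_density_integral[OF energy_part_density le] by (simp add: set_lebesgue_integral_def)
  finally show ?thesis .
qed

text \<open>
  On a fibre of \<open>Yf\<close> only the term \<open>be^2 / K\<close> survives, and \<open>K\<close> is arbitrary.
\<close>

lemma U_constant_on_fibres:
  assumes "Yf \<xi> = Yf \<xi>'"
  shows "Uf \<xi> = Uf \<xi>'"
proof -
  have main: "Uf \<xi> = Uf \<xi>'" if le: "\<xi> <= \<xi>'" and eq: "Yf \<xi> = Yf \<xi>'" for \<xi> \<xi>'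
  proof (rule ccontr)
    assume ne: "Uf \<xi> \<noteq> Uf \<xi>'"
    define D where "D = energy_part \<xi>' - energy_part \<xi>"
    define d where "d = \<bar>Uf \<xi>' - Uf \<xi>\<bar>"
    have d: "d > 0" using ne by (simp add: d_def)
    have D: "0 <= D" using energy_part_mono[OF le] by (simp add: D_def)
    define K where "K = (D + 1) / d"
    have K: "K > 0" using d D by (simp add: K_def)
    have "d <= 1/K * D" using U_increment[OF le K] eq by (simp add: D_def d_def)
    also have "1/K * D = d * D / (D + 1)" by (simp add: K_def)
    finally have "d * (D + 1) <= d * D" using D by (simp add: pos_le_divide_eq)
    then show False using d by (simp add: algebra_simps)
  qed
  show ?thesis
  proof (cases "\<xi> <= \<xi>'")
    case True then show ?thesis by (rule main) (rule assms)
  next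
    case False
    then have "\<xi>' <= \<xi>" by simp
    from main[OF this assms[symmetric]] show ?thesis by (rule sym)
  qed
qed

text \<open>
  Any section of \<open>Yf\<close> will do, as \<open>Uf\<close> is constant on fibres; every section is nondecreasing.
\<close>

definition sel :: "real => real" where "sel x = (SOME \<xi>. \<xi> \<in> {0..1} \<and> Yf \<xi> = x)"

lemma sel: "0 <= x ==> x <= 1 ==> sel x \<in> {0..1} \<and> Yf (sel x) = x"
  unfolding sel_def by (rule someI_ex) (rule Y_surj)

lemma sel_mono: "0 <= x ==> x <= x' ==> x' <= 1 ==> sel x <= sel x'"
  using sel[of x] sel[of x'] Y_mono[of "sel x'" "sel x"] by (cases "sel x <= sel x'") (auto intro: order.antisym)

definition ut :: "real => real" where "ut x = Uf (sel x)"

lemma ut_Y: "ut (Yf \<xi>) = Uf \<xi>"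
  unfolding ut_def by (rule U_constant_on_fibres) (use sel[OF Y_range] in simp)

text \<open>
  In terms of positions the increment bound consists of a Lipschitz part and a monotone part whose
  total is inversely proportional to \<open>K\<close>.
\<close>

lemma ut_AC: "abs_continuous_on_interval 0 1 ut"
proof (rule abs_continuous_criterion)
  fix e :: real assume e: "0 < e"
  define D where "D = energy_part 1 - energy_part 0"
  have D: "0 <= D" using energy_part_mono[of 0 1] by (simp add: D_def)
  (* K large makes the monotone part, at most D / K in total, smaller than e. *)
  define K where "K = (D + 1) / e"
  have K: "0 < K" using e D by (simp add: K_def)
  let ?W = "\<lambda>x. 1/K * energy_part (sel x)"
  have "mono_on {0..1} ?W"
    unfolding mono_on_def using K energy_part_mono[OF sel_mono] by (auto intro!: divide_right_mono)
  moreover have "?W 1 - ?W 0 < e"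
  proof -
    have "energy_part (sel 1) - energy_part (sel 0) <= D"
      using energy_part_mono[of "sel 1" 1] energy_part_mono[of 0 "sel 0"] sel[of 0] sel[of 1] by (simp add: D_def)
    then have "1/K * (energy_part (sel 1) - energy_part (sel 0)) <= 1/K * D" using K by (intro mult_left_mono) auto
    also have "... < e" using e D by (simp add: K_def field_simps)
    finally show ?thesis by (simp add: algebra_simps)
  qed
  moreover have "\<bar>ut y - ut x\<bar> <= K * (y - x) + (?W y - ?W x)" if "0 <= x" "x <= y" "y <= 1" for x y
  proof -
    have "Yf (sel x) = x" "Yf (sel y) = y" using sel that by auto
    then show ?thesis using U_increment[OF sel_mono[OF that] K] by (simp add: ut_def algebra_simps)
  qed
  ultimately show "\<exists>L W. 0 <= L \<and> mono_on {0..1} W \<and> W 1 - W 0 < e \<and>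
     (\<forall>x y. 0 <= x --> x <= y --> y <= 1 --> \<bar>ut y - ut x\<bar> <= L * (y - x) + (W y - W x))"
    using K by (intro exI[of _ K] exI[of _ ?W]) auto
qed

definition utc :: "real => real" where "utc x = ut (max 0 (min 1 x))"
definition hh :: "real => real" where "hh = (SOME g. has_density utc g)"

lemma utc_density: "has_density utc hh"
proof -
  have "\<exists>g. has_density utc g" using abs_continuous_density[OF ut_AC] by (auto simp: utc_def[abs_def])
  then show ?thesis unfolding hh_def by (rule someI_ex)
qed

lemma utc_Y: "utc (Yf \<xi>) = Uf \<xi>"
  using Y_range[of \<xi>] by (simp add: utc_def ut_Y max_def min_def)

definition u :: "real => real" where "u x = utc (frac (x - c))"
definition h :: "real => real" where "h x = hh (frac (x - c))"

lemma h_borel [measurable]: "h \<in> borel_measurable borel"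
proof -
  have [measurable]: "hh \<in> borel_measurable borel" by (rule has_density_borel[OF utc_density])
  have [measurable]: "(\<lambda>x. frac (x - c)) \<in> borel_measurable borel" using frac_shift_borel[of "-c"] by simp
  show ?thesis unfolding h_def[abs_def] by measurable
qed

lemma u_density: "has_density u h"
  unfolding u_def[abs_def] h_def[abs_def]
proof (rule has_density_periodic_extension[OF utc_density])
  show "utc 0 = utc 1" using utc_Y[of 0] utc_Y[of 1] Y0 Y1 U01 by simp
qed

lemma u_periodic: "periodic_fun_simple' u" and h_periodic: "periodic_fun_simple' h"
  using periodic_frac_fun[of utc "- c"] periodic_frac_fun[of hh "- c"] by (simp_all add: u_def[abs_def] h_def[abs_def])

lemma u_Y: "u (c + Yf \<xi>) = Uf \<xi>"
proof (cases "Yf \<xi> = 1")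
  case True
  then have "u (c + Yf \<xi>) = utc 0" by (simp add: u_def)
  also have "... = Uf 0" using utc_Y[of 0] Y0 by simp
  also have "... = Uf 1" using U01 by simp
  also have "... = Uf \<xi>" by (rule U_constant_on_fibres) (simp add: Y1 True)
  finally show ?thesis .
next
  case False
  then have "frac (Yf \<xi>) = Yf \<xi>" using Y_range[of \<xi>] by (simp add: frac_eq)
  then show ?thesis by (simp add: u_def utc_Y)
qed

definition mu :: "real measure" where "mu = density lborel (\<lambda>\<xi>. ennreal ((al \<xi>)^2))"

lemma sets_mu [measurable_cong, simp]: "sets mu = sets borel" by (simp add: mu_def)
lemma space_mu [simp]: "space mu = UNIV" by (simp add: mu_def)

text \<open>
  Both measures give the same mass to half-lines, since \<open>al^2\<close> is the density of the nondecreasing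
  function \<open>Yf\<close>.
\<close>

lemma distr_Y: "distr mu borel Yf = circ"
proof -
  have em: "emeasure mu A = ennreal (LINT \<xi>:A|lborel. (al \<xi>)^2)" if A: "A \<in> sets borel" for A
  proof -
    have "emeasure mu A = (\<integral>\<^sup>+\<xi>. ennreal ((al \<xi>)^2) * indicator A \<xi> \<partial>lborel)"
      unfolding mu_def by (rule emeasure_density) (use A in auto)
    also have "... = (\<integral>\<^sup>+\<xi>. ennreal (indicator A \<xi> *\<^sub>R (al \<xi>)^2) \<partial>lborel)"
      by (rule nn_integral_cong) (auto simp: indicator_def)
    also have "... = ennreal (LINT \<xi>|lborel. indicator A \<xi> *\<^sub>R (al \<xi>)^2)"
      by (rule nn_integral_eq_integral[OF integrable_mult_indicator[OF _ al_sq]]) (use A in auto)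
    finally show ?thesis by (simp add: set_lebesgue_integral_def)
  qed
  have tail: "(LINT \<xi>:{a<..}|lborel. (al \<xi>)^2) = 1 - Yf a" for a
  proof -
    define b where "b = max a 1"
    have z: "al \<xi> = 0" if "b < \<xi>" for \<xi> using that by (intro al_outside) (auto simp: b_def)
    have "(LINT \<xi>:{a<..}|lborel. (al \<xi>)^2) = (LINT \<xi>:{a..b}|lborel. (al \<xi>)^2)"
      unfolding set_lebesgue_integral_def
    proof (rule integral_cong_AE)
      have "AE \<xi> in lborel. \<xi> \<noteq> a" by (rule AE_lborel_singleton)
      then show "AE \<xi> in lborel. indicator {a<..} \<xi> *\<^sub>R (al \<xi>)^2 = indicator {a..b} \<xi> *\<^sub>R (al \<xi>)^2"
        by eventually_elim (use z in \<open>auto simp: indicator_def not_le\<close>)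
    qed auto
    also have "... = Yf b - Yf a" by (rule has_density_integral[OF Yd]) (simp add: b_def)
    also have "Yf b = 1" by (rule Y_right) (simp add: b_def)
    finally show ?thesis .
  qed
  have circ_tail: "emeasure circ {x<..} = ennreal (1 - max 0 (min 1 x))" for x
  proof -
    have "emeasure circ {x<..} = (\<integral>\<^sup>+z. indicator ({x<..} \<inter> {0..1}) z \<partial>lborel)"
      by (subst emeasure_circ, simp, rule nn_integral_cong) (auto simp: indicator_def)
    also have "... = emeasure lborel ({x<..} \<inter> {0..1})" by (rule nn_integral_indicator) simp
    also have "... = ennreal (1 - max 0 (min 1 x))"
    proof (cases "x < 0")
      case True
      then have "{x<..} \<inter> {0..1} = {0..1::real}" by auto
      then show ?thesis using True by simp
    next
      case False
      then have "{x<..} \<inter> {0..1} = {x<..1::real}" by auto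
      then show ?thesis using False by (cases "x <= 1") (auto simp: emeasure_lborel_Ioc)
    qed
    finally show ?thesis .
  qed
  have distr_tail: "emeasure (distr mu borel Yf) {x<..} = ennreal (1 - max 0 (min 1 x))" for x
  proof -
    have "emeasure (distr mu borel Yf) {x<..} = emeasure mu {\<xi>. x < Yf \<xi>}"
      by (subst emeasure_distr) (auto simp: vimage_def greaterThan_def)
    also have "... = ennreal (1 - max 0 (min 1 x))"
    proof -
      consider "x < 0" | "1 <= x" | "0 <= x" "x < 1" by linarith
      then show ?thesis
      proof cases
        case 1
        then have "{\<xi>. x < Yf \<xi>} = {..0} \<union> {0<..}" using Y_range(1) by (auto intro: less_le_trans)
        moreover have "(LINT \<xi>:{..0} \<union> {0<..}|lborel. (al \<xi>)^2) = (LINT \<xi>:{-1<..}|lborel. (al \<xi>)^2)"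
          unfolding set_lebesgue_integral_def
          by (rule Bochner_Integration.integral_cong) (auto simp: indicator_def al_outside)
        ultimately show ?thesis using 1 tail[of "-1"] Y_left[of "-1"] by (subst em) auto
      next
        case 2
        then have "{\<xi>. x < Yf \<xi>} = {}" using Y_range(2) by (auto simp: not_less intro: order_trans)
        then show ?thesis using 2 by simp
      next
        case 3
        define S where "S = {0..1} \<inter> Yf -` {x}"
        have "compact S" unfolding S_def
        proof (rule compact_Int_closed)
          have "isCont Yf z" for z using Y_cont[of UNIV] by (simp add: continuous_on_eq_continuous_at)
          then show "closed (Yf -` {x})" by (intro continuous_closed_vimage) auto
        qed simp
        moreover have "S \<noteq> {}" using Y_surj[of x] 3 by (auto simp: S_def)
        ultimately obtain a where a: "a \<in> S" "\<And>b. b \<in> S ==> b <= a" using compact_attains_sup by metis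
        have aY: "Yf a = x" "0 <= a" "a <= 1" using a by (auto simp: S_def)
        have "{\<xi>. x < Yf \<xi>} = {a<..}"
        proof (intro set_eqI iffI)
          fix \<xi> assume "\<xi> \<in> {\<xi>. x < Yf \<xi>}"
          then have "x < Yf \<xi>" by simp
          then show "\<xi> \<in> {a<..}" using Y_mono[of \<xi> a] aY by (cases "a < \<xi>") auto
        next
          fix \<xi> assume \<xi>: "\<xi> \<in> {a<..}"
          have "x <= Yf \<xi>" using Y_mono[of a \<xi>] \<xi> aY by simp
          moreover have "x \<noteq> Yf \<xi>"
          proof
            assume eq: "x = Yf \<xi>"
            then have "\<xi> <= 1" using Y_right[of \<xi>] 3 by (cases "\<xi> <= 1") auto
            then have "\<xi> \<in> S" using \<xi> aY eq by (auto simp: S_def)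
            then show False using a(2) \<xi> by force
          qed
          ultimately show "\<xi> \<in> {\<xi>. x < Yf \<xi>}" by simp
        qed
        then show ?thesis using em[of "{a<..}"] tail[of a] aY 3 by simp
      qed
    qed
    finally show ?thesis .
  qed
  show ?thesis
    by (rule measure_eqI_lessThan) (simp_all add: distr_tail circ_tail)
qed

lemma distr_y: "distr mu borel (\<lambda>\<xi>. frac (c + Yf \<xi>)) = circ"
proof -
  have "distr (distr mu borel Yf) borel (\<lambda>x. frac (x + c)) = distr mu borel ((\<lambda>x. frac (x + c)) \<circ> Yf)"
    by (rule distr_distr) measurable
  then show ?thesis by (simp add: distr_Y distr_circ_shift comp_def add.commute)
qed

lemma y_frac_borel [measurable]: "(\<lambda>\<xi>. frac (c + Yf \<xi>)) \<in> borel_measurable borel"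
proof -
  have "(\<lambda>x. frac (x + c)) \<circ> Yf \<in> borel_measurable borel" by (rule measurable_comp[OF Y_borel frac_shift_borel])
  then show ?thesis by (simp add: comp_def add.commute)
qed

lemma change_of_variables:
  fixes f :: "real => real"
  assumes f [measurable]: "f \<in> borel_measurable borel" and per: "periodic_fun_simple' f"
  shows "(LINT x|circ. f x) = (LINT \<xi>|lborel. (al \<xi>)^2 * f (c + Yf \<xi>))"
    "integrable circ f \<longleftrightarrow> integrable lborel (\<lambda>\<xi>. (al \<xi>)^2 * f (c + Yf \<xi>))"
proof -
  have fr: "f (frac (c + Yf \<xi>)) = f (c + Yf \<xi>)" for \<xi> by (rule periodic_frac[OF per])
  have m: "(\<lambda>\<xi>. frac (c + Yf \<xi>)) \<in> measurable mu borel" by measurable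
  have m2: "(\<lambda>\<xi>. f (frac (c + Yf \<xi>))) \<in> borel_measurable lborel" by measurable
  have "(LINT x|circ. f x) = (LINT x|distr mu borel (\<lambda>\<xi>. frac (c + Yf \<xi>)). f x)" by (simp only: distr_y)
  also have "... = (LINT \<xi>|mu. f (frac (c + Yf \<xi>)))" by (rule integral_distr[OF m]) simp
  also have "... = (LINT \<xi>|lborel. (al \<xi>)^2 *\<^sub>R f (frac (c + Yf \<xi>)))"
    unfolding mu_def by (rule integral_density[OF m2]) auto
  finally show "(LINT x|circ. f x) = (LINT \<xi>|lborel. (al \<xi>)^2 * f (c + Yf \<xi>))" by (simp add: fr)
  have "integrable circ f \<longleftrightarrow> integrable (distr mu borel (\<lambda>\<xi>. frac (c + Yf \<xi>))) f" by (simp only: distr_y)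
  also have "... \<longleftrightarrow> integrable mu (\<lambda>\<xi>. f (frac (c + Yf \<xi>)))" by (rule integrable_distr_eq[OF m]) simp
  also have "... \<longleftrightarrow> integrable lborel (\<lambda>\<xi>. (al \<xi>)^2 *\<^sub>R f (frac (c + Yf \<xi>)))"
    unfolding mu_def by (rule integrable_density[OF m2]) auto
  finally show "integrable circ f \<longleftrightarrow> integrable lborel (\<lambda>\<xi>. (al \<xi>)^2 * f (c + Yf \<xi>))" by (simp add: fr)
qed

text \<open>
  Labels with \<open>al = 0\<close> may be sent into a null set; all others avoid it almost surely.
\<close>

lemma AE_change_of_variables:
  assumes "AE x in circ. Pr x"
  shows "AE \<xi> in lborel. al \<xi> = 0 \<or> Pr (frac (c + Yf \<xi>))"
proof -
  have "AE x in distr mu borel (\<lambda>\<xi>. frac (c + Yf \<xi>)). Pr x" using assms by (simp only: distr_y)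
  then have "AE \<xi> in mu. Pr (frac (c + Yf \<xi>))" by (rule AE_distrD[rotated]) measurable
  then have "AE \<xi> in lborel. 0 < ennreal ((al \<xi>)^2) --> Pr (frac (c + Yf \<xi>))"
    unfolding mu_def by (subst (asm) AE_density) auto
  then show ?thesis by eventually_elim auto
qed

text \<open>
  \<open>u (c + Yf \<xi>) = Uf \<xi>\<close> is differentiated at labels where \<open>Yf\<close> and \<open>Uf\<close> have derivatives and \<open>u\<close> has
  one at the image point.  Where \<open>al = 0\<close> both sides vanish.
\<close>

lemma h_chain: "AE \<xi> in lborel. h (c + Yf \<xi>) * (al \<xi>)^2 = al \<xi> * be \<xi>"
proof -
  have d: "AE x in circ. (u has_real_derivative h x) (at x)"
    by (rule AE_circ[OF has_density_AE_derivative[OF u_density]])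
  have n: "AE \<xi> in lborel. \<xi> \<noteq> (0::real)" "AE \<xi> in lborel. \<xi> \<noteq> (1::real)" by (rule AE_lborel_singleton)+
  show ?thesis
    using AE_change_of_variables[OF d] has_density_AE_derivative[OF Yd] has_density_AE_derivative[OF Ud] n
  proof eventually_elim
    case (elim \<xi>)
    show ?case
    proof (cases "al \<xi> = 0")
      case False
      let ?n = "of_int \<lfloor>c + Yf \<xi>\<rfloor> :: real"
      have "(u has_real_derivative h (frac (c + Yf \<xi>))) (at (frac (c + Yf \<xi>)))" using elim(1) False by blast
      then have "((\<lambda>x. u (x - ?n)) has_real_derivative h (c + Yf \<xi>)) (at (c + Yf \<xi>))"
        using DERIV_shift[of u "h (c + Yf \<xi>)" "c + Yf \<xi>" "- ?n"] periodic_frac[OF h_periodic] by (simp add: frac_def)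
      moreover have "u (x - ?n) = u x" for x
      proof -
        have "frac (x - ?n) = frac x" by (simp add: frac_def)
        then show ?thesis using periodic_frac[OF u_periodic] by metis
      qed
      ultimately have du: "(u has_real_derivative h (c + Yf \<xi>)) (at (c + Yf \<xi>))" by simp
      have dy: "((\<lambda>\<xi>. c + Yf \<xi>) has_real_derivative (al \<xi>)^2) (at \<xi>)"
        using DERIV_add[OF DERIV_const elim(2)] by simp
      have "((\<lambda>\<xi>. u (c + Yf \<xi>)) has_real_derivative h (c + Yf \<xi>) * (al \<xi>)^2) (at \<xi>)"
        by (rule DERIV_chain2[OF du dy])
      then have "(Uf has_real_derivative h (c + Yf \<xi>) * (al \<xi>)^2) (at \<xi>)" by (simp only: u_Y)
      then show ?thesis using elim(3) DERIV_unique by blast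
    qed simp
  qed
qed

end

section \<open>The flow and the convergence of transported functions\<close>

lemma integral_circ_const: "(LINT x|circ. (c::real)) = c"
proof -
  have "measure circ UNIV = 1" using prob_circ by (simp add: measure_def)
  then show ?thesis by simp
qed

lemma integrable_circ_bounded:
  fixes f :: "real => real"
  assumes "f \<in> borel_measurable borel" "\<And>x. \<bar>f x\<bar> <= C"
  shows "integrable circ f"
proof (rule finite_measure.integrable_const_bound[OF finite_measure_circ])
  show "AE x in circ. norm (f x) <= C" using assms(2) by simp
  show "f \<in> borel_measurable circ" using assms(1) by simp
qed

definition clampN :: "real => real => real" where "clampN N v = max (- N) (min N v)"

lemma clampN_bound: "0 <= N ==> \<bar>clampN N v\<bar> <= N" by (auto simp: clampN_def)
lemma clampN_cont: "continuous_on A (clampN N)" unfolding clampN_def by (intro continuous_intros)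

text \<open>
  The tail of a function beyond the level \<open>N\<close> is small in \<open>L^1\<close> if the function is bounded in \<open>L^2\<close>.
\<close>

lemma clampN_tail: "0 < N ==> \<bar>v - clampN N v\<bar> <= 1/N * v^2"
proof -
  assume N: "0 < N"
  show ?thesis
  proof (cases "\<bar>v\<bar> <= N")
    case True
    then have "clampN N v = v" by (auto simp: clampN_def)
    then show ?thesis using N by simp
  next
    case False
    have "\<bar>v - clampN N v\<bar> <= \<bar>v\<bar>" using N by (auto simp: clampN_def)
    also have "... <= 1/N * v^2"
    proof -
      have "N * \<bar>v\<bar> <= \<bar>v\<bar> * \<bar>v\<bar>" using False by (intro mult_right_mono) auto
      then show ?thesis using N by (simp add: field_simps power2_eq_square)
    qed
    finally show ?thesis .
  qed
qed

lemma bounded_borel_has_primitive: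
  fixes f :: "real => real"
  assumes f [measurable]: "f \<in> borel_measurable borel" and b: "\<And>x. \<bar>f x\<bar> <= C"
  shows "\<exists>F. has_density F f"
proof -
  have si: "set_integrable lborel {a..b} f" for a b
    unfolding set_integrable_def
  proof (rule Bochner_Integration.integrable_bound[of _ "\<lambda>x. C * indicator {a..b} x"])
    show "integrable lborel (\<lambda>x. C * indicator {a..b} x)"
      by (intro integrable_mult_right integrable_real_indicator) (auto simp: emeasure_lborel_Icc_eq)
    have C0: "0 <= C" using b[of 0] by linarith
    show "AE x in lborel. norm (indicator {a..b} x *\<^sub>R f x) <= norm (C * indicator {a..b} x)"
      using b C0 by (auto simp: indicator_def)
  qed simp
  define F where "F = (\<lambda>x. (LINT z:{0..x}|lborel. f z) - (LINT z:{x..0}|lborel. f z))"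
  have e: "(LINT z:{p..q}|lborel. f z) = 0" if "q < p" for p q using that by (simp add: set_lebesgue_integral_def)
  have e0: "(LINT z:{p..p}|lborel. f z) = 0" for p
    using set_integral_Icc_split(2)[OF si si, of p p p] by simp
  have "(LINT z:{a..b}|lborel. f z) = F b - F a" if ab: "a <= b" for a b
  proof -
    consider "0 <= a" | "a < 0" "0 <= b" | "b < 0" by linarith
    then show ?thesis
    proof cases
      case 1
      have "F a = (LINT z:{0..a}|lborel. f z)" "F b = (LINT z:{0..b}|lborel. f z)"
        using 1 ab e[of 0 a] e[of 0 b] e0[of 0] unfolding F_def by (cases "a = 0"; cases "b = 0"; simp)+
      then show ?thesis using set_integral_Icc_split(2)[OF si si, of 0 a b] 1 ab by simp
    next
      case 2
      have "F a = - (LINT z:{a..0}|lborel. f z)" "F b = (LINT z:{0..b}|lborel. f z)"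
        using 2 ab e[of 0 b] e[of a 0] e0[of 0] unfolding F_def by (cases "b = 0"; simp)+
      then show ?thesis using set_integral_Icc_split(2)[OF si si, of a 0 b] 2 by simp
    next
      case 3
      have "F a = - (LINT z:{a..0}|lborel. f z)" "F b = - (LINT z:{b..0}|lborel. f z)"
        using 3 ab e[of a 0] e[of b 0] unfolding F_def by simp_all
      then show ?thesis using set_integral_Icc_split(2)[OF si si, of a b 0] 3 ab by simp
    qed
  qed
  then have "has_density F f" using si f by (simp add: has_density_def)
  then show ?thesis by blast
qed

text \<open>
  Difference quotients of a primitive are continuous, periodic and obey the same bound, and they
  converge almost everywhere to the function.
\<close>

lemma bounded_periodic_approx_continuous:
  fixes \<phi> :: "real => real"
  assumes m [measurable]: "\<phi> \<in> borel_measurable borel" and b: "\<And>x. \<bar>\<phi> x\<bar> <= C" and per: "periodic_fun_simple' \<phi>" and e: "0 < e"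
  shows "\<exists>k. continuous_on UNIV k \<and> periodic_fun_simple' k \<and> (\<forall>x. \<bar>k x\<bar> <= C) \<and> (LINT x|circ. \<bar>k x - \<phi> x\<bar>) < e"
proof -
  obtain F where F: "has_density F \<phi>" using bounded_borel_has_primitive[OF m b] by blast
  define k where "k = (\<lambda>j::nat. \<lambda>x. (F (x + 1 / real (Suc j)) - F x) / (1 / real (Suc j)))"
  have kc: "continuous_on UNIV (k j)" for j
    unfolding k_def
    by (intro continuous_intros has_density_continuous[OF F] continuous_on_compose2[OF has_density_continuous[OF F, of UNIV]]) auto
  have C0: "0 <= C" using b[of 0] by linarith
  have inc: "F (x + d) - F x = (LINT z:{x..x+d}|lborel. \<phi> z)" if "0 <= d" for x d
    using has_density_integral[OF F, of x "x + d"] that by simp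
  have kb: "\<bar>k j x\<bar> <= C" for j x
  proof -
    let ?d = "1 / real (Suc j)"
    have "\<bar>F (x + ?d) - F x\<bar> = \<bar>LINT z|lborel. indicator {x..x+?d} z *\<^sub>R \<phi> z\<bar>"
      by (subst inc) (simp_all add: set_lebesgue_integral_def)
    also have "... <= (LINT z|lborel. indicator {x..x+?d} z * C)"
      unfolding real_norm_def[symmetric]
    proof (rule Bochner_Integration.integral_norm_bound_integral)
      show "integrable lborel (\<lambda>z. indicator {x..x+?d} z *\<^sub>R \<phi> z)"
        using has_density_integrable[OF F, of x "x + ?d"] by (simp add: set_integrable_def)
      show "integrable lborel (\<lambda>z. indicator {x..x+?d} z * C)"
        by (intro integrable_mult_left integrable_real_indicator) (auto simp: emeasure_lborel_Icc_eq)
      show "norm (indicator {x..x+?d} z *\<^sub>R \<phi> z) <= indicator {x..x+?d} z * C" for z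
        using b C0 by (simp add: indicator_def)
    qed
    also have "... = ?d * C" by simp
    finally have "\<bar>F (x + ?d) - F x\<bar> / ?d <= (?d * C) / ?d" by (intro divide_right_mono) auto
    then show ?thesis by (simp add: k_def abs_mult)
  qed
  have kp: "periodic_fun_simple' (k j)" for j
  proof -
    have "k j (x + 1) = k j x" for x
    proof -
      let ?d = "1 / real (Suc j)"
      have s: "has_density (\<lambda>x. F (x + 1)) \<phi>"
        using has_density_shift[OF F, of 1] per by (simp add: periodic_fun_simple'_def)
      have "F (x + ?d + 1) - F (x + 1) = F (x + ?d) - F x"
        using has_density_integral[OF s, of x "x + ?d"] has_density_integral[OF F, of x "x + ?d"] by simp
      then show ?thesis by (simp add: k_def add_ac)
    qed
    then show ?thesis by (simp add: periodic_fun_simple'_def)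
  qed
  have km [measurable]: "k j \<in> borel_measurable borel" for j by (rule borel_measurable_continuous_onI[OF kc])
  have d0: "(\<lambda>j. 1 / real (Suc j)) \<longlonglongrightarrow> 0"
    using LIMSEQ_inverse_real_of_nat by (simp add: inverse_eq_divide)
  have lim: "(\<lambda>j. LINT x|circ. \<bar>k j x - \<phi> x\<bar>) \<longlonglongrightarrow> (LINT x|circ. 0)"
  proof (rule integral_dominated_convergence[where s="\<lambda>j x. \<bar>k j x - \<phi> x\<bar>" and f="\<lambda>x. 0" and w="\<lambda>x. 2 * C"])
    show "integrable circ (\<lambda>x. 2 * C)" by (rule integrable_circ_bounded[of _ "\<bar>2 * C\<bar>"]) auto
    have "AE x in circ. (F has_real_derivative \<phi> x) (at x)" by (rule AE_circ[OF has_density_AE_derivative[OF F]])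
    then show "AE x in circ. (\<lambda>j. \<bar>k j x - \<phi> x\<bar>) \<longlonglongrightarrow> 0"
    proof eventually_elim
      case (elim x)
      have "((\<lambda>d. (F (x + d) - F x) / d) \<longlongrightarrow> \<phi> x) (at 0)" using elim by (simp add: DERIV_def)
      moreover have "filterlim (\<lambda>j. 1 / real (Suc j)) (at 0) sequentially" using d0 by (simp add: filterlim_at)
      ultimately have "(\<lambda>j. k j x) \<longlonglongrightarrow> \<phi> x" unfolding k_def by (rule filterlim_compose)
      then have "(\<lambda>j. k j x - \<phi> x) \<longlonglongrightarrow> 0" by (rule LIM_zero)
      then show ?case by (rule tendsto_rabs_zero)
    qed
    show "AE x in circ. norm \<bar>k j x - \<phi> x\<bar> <= 2 * C" for j
    proof (rule AE_I2)
      fix x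
      have "\<bar>k j x - \<phi> x\<bar> <= \<bar>k j x\<bar> + \<bar>\<phi> x\<bar>" by (rule abs_triangle_ineq4)
      also have "... <= C + C" by (intro add_mono kb b)
      finally show "norm \<bar>k j x - \<phi> x\<bar> <= 2 * C" by simp
    qed
  qed simp_all
  then have "\<forall>\<^sub>F j in sequentially. (LINT x|circ. \<bar>k j x - \<phi> x\<bar>) < e"
    using e by (intro order_tendstoD(2)) auto
  then obtain j where "(LINT x|circ. \<bar>k j x - \<phi> x\<bar>) < e" by (auto simp: eventually_sequentially)
  then show ?thesis using kc kp kb by blast
qed

text \<open>
  \<open>eta\<close> is the trajectory of the label 0, so \<open>y\<close> below gives absolute positions.
\<close>

locale flow = lagrangian +
  fixes X :: "real => state" and eta :: "real => real" and m0 E :: real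
  assumes X_ode: "\<And>t. (X has_vector_derivative F (X t)) (at t)"
    and X_0: "X 0 = init m0"
    and X_per: "\<And>t. Y (X t) 1 = 1" "\<And>t. U (X t) 1 = U (X t) 0"
    and X_energy: "\<And>t. energy (X t) 1 = E"
    and eta_0: "eta 0 = 0"
    and eta_ode: "\<And>t. (eta has_real_derivative U (X t) 0) (at t)"
begin

lemma prof: "profile (alpha (X t)) (beta (X t)) (Y (X t)) (U (X t))"
  by unfold_locales
     (auto intro: alpha_outside beta_outside integrable_alpha_sq integrable_beta_sq integrable_alpha_beta
       Y_density U_density simp: X_per)

definition y :: "real => real => real" where "y t \<xi> = eta t + Y (X t) \<xi>"
definition uu :: "real => real => real" where "uu t = profile.u (Y (X t)) (U (X t)) (eta t)"
definition hx :: "real => real => real" where "hx t = profile.h (Y (X t)) (U (X t)) (eta t)"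

lemma uu_density: "has_density (uu t) (hx t)"
  unfolding uu_def hx_def by (rule profile.u_density[OF prof])
lemma uu_periodic: "periodic_fun_simple' (uu t)" and hx_periodic: "periodic_fun_simple' (hx t)"
  unfolding uu_def hx_def by (rule profile.u_periodic[OF prof] profile.h_periodic[OF prof])+
lemma hx_borel [measurable]: "hx t \<in> borel_measurable borel" by (rule has_density_borel[OF uu_density])
lemma uu_cont: "continuous_on S (uu t)" by (rule has_density_continuous[OF uu_density])
lemma uu_borel [measurable]: "uu t \<in> borel_measurable borel" by (rule borel_measurable_continuous_onI[OF uu_cont])
lemma uu_y: "uu t (y t \<xi>) = U (X t) \<xi>" unfolding uu_def y_def by (rule profile.u_Y[OF prof])

lemma change_variables:
  fixes f :: "real => real"
  assumes "f \<in> borel_measurable borel" "periodic_fun_simple' f"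
  shows "(LINT x|circ. f x) = (LINT \<xi>|lborel. (alpha (X t) \<xi>)^2 * f (y t \<xi>))"
    "integrable circ f \<longleftrightarrow> integrable lborel (\<lambda>\<xi>. (alpha (X t) \<xi>)^2 * f (y t \<xi>))"
  unfolding y_def using profile.change_of_variables[OF prof assms, of t "eta t"] by auto

lemma hx_chain: "AE \<xi> in lborel. alpha (X t) \<xi> = 0 \<or> hx t (y t \<xi>) = beta (X t) \<xi> / alpha (X t) \<xi>"
  using profile.h_chain[OF prof, of "t" "eta t"] unfolding hx_def y_def
proof eventually_elim
  case (elim \<xi>)
  show ?case
  proof (cases "alpha (X t) \<xi> = 0")
    case False
    then have "profile.h (Y (X t)) (U (X t)) (eta t) (eta t + Y (X t) \<xi>) * alpha (X t) \<xi> = beta (X t) \<xi>"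
      using elim by (simp add: power2_eq_square)
    then show ?thesis using False by (simp add: nonzero_eq_divide_eq)
  qed simp
qed

lemma y_borel [measurable]: "y t \<in> borel_measurable borel" unfolding y_def[abs_def] by measurable

lemma X_isCont: "isCont X t" using X_ode has_vector_derivative_continuous by blast
lemma alpha_tendsto: "s \<longlonglongrightarrow> t ==> (\<lambda>n. alpha (X (s n)) \<xi>) \<longlonglongrightarrow> alpha (X t) \<xi>"
  by (rule isCont_tendsto_compose[OF DERIV_isCont[OF alpha_derivative[OF X_ode]]])
lemma beta_tendsto: "s \<longlonglongrightarrow> t ==> (\<lambda>n. beta (X (s n)) \<xi>) \<longlonglongrightarrow> beta (X t) \<xi>"
  by (rule isCont_tendsto_compose[OF DERIV_isCont[OF beta_derivative[OF X_ode]]])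

lemma Y_U_st: "((\<lambda>s. Y (X s) \<xi>) has_real_derivative U (X t) \<xi> - U (X t) 0) (at t)"
  using Y_derivative[OF X_ode, of \<xi> t] by (simp only: U_0)

lemma y_ode: "((\<lambda>s. y s \<xi>) has_real_derivative U (X t) \<xi>) (at t)"
  unfolding y_def using DERIV_add[OF eta_ode[of t] Y_U_st[of \<xi> t]] by simp

lemma y_tendsto: "s \<longlonglongrightarrow> t ==> (\<lambda>n. y (s n) \<xi>) \<longlonglongrightarrow> y t \<xi>"
  by (rule isCont_tendsto_compose[OF DERIV_isCont[OF y_ode]])

lemma loc_lipschitz_tendsto: "loc_lipschitz f ==> s \<longlonglongrightarrow> t ==> (\<lambda>n. f (X (s n)) \<xi>) \<longlonglongrightarrow> f (X t) \<xi>"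
proof -
  assume f: "loc_lipschitz f" and s: "s \<longlonglongrightarrow> t"
  have "((\<lambda>s. f (X s) \<xi>) \<longlongrightarrow> f (X t) \<xi>) (nhds t)"
  proof (rule tendstoI)
    fix e :: real assume e: "0 < e"
    show "\<forall>\<^sub>F x in nhds t. dist (f (X x) \<xi>) (f (X t) \<xi>) < e"
      using loc_lipschitz_uniform_continuity[OF f X_isCont e, of t]
      by eventually_elim (simp add: dist_real_def)
  qed
  then have "isCont (\<lambda>s. f (X s) \<xi>) t" unfolding isCont_def by (rule tendsto_mono[OF at_within_le_nhds])
  then show ?thesis using s by (rule isCont_tendsto_compose)
qed

lemma X_seq_bounded: "s \<longlonglongrightarrow> t ==> \<exists>R. \<forall>n. norm (X (s n)) <= R"
proof -
  assume "s \<longlonglongrightarrow> t"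
  then have "(\<lambda>i. X (s i)) \<longlonglongrightarrow> X t" by (rule isCont_tendsto_compose[OF X_isCont])
  then have "Bseq (\<lambda>i. X (s i))" by (intro convergent_imp_Bseq convergentI)
  then show ?thesis unfolding Bseq_def by blast
qed

lemma alpha_dominated: "s \<longlonglongrightarrow> t ==> \<exists>K\<ge>0. \<forall>n \<xi>. (alpha (X (s n)) \<xi>)^2 <= K * weight \<xi> \<and> (beta (X (s n)) \<xi>)^2 <= K * weight \<xi>"
proof -
  assume "s \<longlonglongrightarrow> t"
  then obtain R where R: "\<And>n. norm (X (s n)) <= R" using X_seq_bounded by blast
  obtain C1 where 1: "0 <= C1" "\<And>x \<eta>. norm x <= R ==> \<bar>quad (\<lambda>\<xi>. (st_p1 x \<xi>)^2) (\<lambda>\<xi>. 2 * (st_p1 x \<xi> * st_p2 x \<xi>)) (\<lambda>\<xi>. (st_p2 x \<xi>)^2) \<eta>\<bar> <= C1 * weight \<eta>"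
    by (rule loc_lipschitz_quad[OF ll_Y_coeffs, of R]) (rule that, assumption, assumption)
  obtain C2 where 2: "0 <= C2" "\<And>x \<eta>. norm x <= R ==> \<bar>quad (\<lambda>\<xi>. (U x \<xi>)^2 * (st_p1 x \<xi>)^2 + (st_r1 x \<xi>)^2)
   (\<lambda>\<xi>. (U x \<xi>)^2 * (2 * (st_p1 x \<xi> * st_p2 x \<xi>)) + 2 * (st_r1 x \<xi> * st_r2 x \<xi>))
   (\<lambda>\<xi>. (U x \<xi>)^2 * (st_p2 x \<xi>)^2 + (st_r2 x \<xi>)^2) \<eta>\<bar> <= C2 * weight \<eta>"
    by (rule loc_lipschitz_quad[OF ll_energy_coeffs, of R]) (rule that, assumption, assumption)
  have "(alpha (X (s n)) \<xi>)^2 <= (C1 + C2) * weight \<xi> \<and> (beta (X (s n)) \<xi>)^2 <= (C1 + C2) * weight \<xi>" for n \<xi>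
  proof -
    have w: "0 <= C1 * weight \<xi>" "0 <= C2 * weight \<xi>" using 1(1) 2(1) weight_nonneg by auto
    have a: "(alpha (X (s n)) \<xi>)^2 <= C1 * weight \<xi>" using 1(2)[OF R, of n \<xi>] unfolding quad_Y by simp
    have "(U (X (s n)) \<xi>)^2 * (alpha (X (s n)) \<xi>)^2 + (beta (X (s n)) \<xi>)^2 <= C2 * weight \<xi>"
      using 2(2)[OF R, of n \<xi>] unfolding quad_energy by simp
    moreover have "0 <= (U (X (s n)) \<xi>)^2 * (alpha (X (s n)) \<xi>)^2" by simp
    ultimately have "(beta (X (s n)) \<xi>)^2 <= C2 * weight \<xi>" by linarith
    then show ?thesis using a w unfolding distrib_right by linarith
  qed
  then show ?thesis using 1(1) 2(1) by (intro exI[of _ "C1 + C2"]) auto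
qed

text \<open>
  Functions \<open>g t\<close> on the circle whose values along characteristics are continuous in time as long as
  \<open>alpha \<noteq> 0\<close>.
\<close>

definition transported :: "(real => real => real) => (real => real => real) => bool" where
  "transported g \<Gamma> \<longleftrightarrow> (\<forall>t. g t \<in> borel_measurable borel \<and> periodic_fun_simple' (g t) \<and> \<Gamma> t \<in> borel_measurable borel \<and>
     (AE \<xi> in lborel. alpha (X t) \<xi> = 0 \<or> g t (y t \<xi>) = \<Gamma> t \<xi>)) \<and>
     (\<forall>s t \<xi>. s \<longlonglongrightarrow> t --> alpha (X t) \<xi> \<noteq> 0 --> (\<lambda>n. \<Gamma> (s n) \<xi>) \<longlonglongrightarrow> \<Gamma> t \<xi>)"

text \<open>
  Change variables to labels, where dominated convergence applies: the integrands are bounded by a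
  multiple of the weight, they converge where \<open>alpha \<noteq> 0\<close>, and elsewhere the factor \<open>alpha^2\<close> tends to 0.
  The translation by \<open>z n\<close> moves to the continuous test function.
\<close>

lemma transported_pairing:
  fixes \<psi> k :: "real => real"
  assumes g: "transported g \<Gamma>" and st: "s \<longlonglongrightarrow> t" and z0: "z \<longlonglongrightarrow> 0"
    and psi: "continuous_on UNIV \<psi>" "\<And>v. \<bar>\<psi> v\<bar> <= C"
    and k: "continuous_on UNIV k" "periodic_fun_simple' k" "\<And>x. \<bar>k x\<bar> <= D"
  shows "(\<lambda>n. LINT x|circ. \<psi> (g (s n) (x + z n)) * k x) \<longlonglongrightarrow> (LINT x|circ. \<psi> (g t x) * k x)"
proof -
  have gm [measurable]: "g \<tau> \<in> borel_measurable borel" and Gm [measurable]: "\<Gamma> \<tau> \<in> borel_measurable borel"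
    and gp: "periodic_fun_simple' (g \<tau>)"
    and gG: "AE \<xi> in lborel. alpha (X \<tau>) \<xi> = 0 \<or> g \<tau> (y \<tau> \<xi>) = \<Gamma> \<tau> \<xi>" for \<tau>
    using g by (auto simp: transported_def)
  have [measurable]: "\<psi> \<in> borel_measurable borel" "k \<in> borel_measurable borel"
    by (rule borel_measurable_continuous_onI, fact)+
  have eq: "(LINT x|circ. \<psi> (g \<tau> (x + c)) * k x) = (LINT \<xi>|lborel. (alpha (X \<tau>) \<xi>)^2 * (\<psi> (\<Gamma> \<tau> \<xi>) * k (y \<tau> \<xi> - c)))" for \<tau> c
  proof -
    let ?f = "\<lambda>x. \<psi> (g \<tau> x) * k (x - c)"
    have fm: "?f \<in> borel_measurable borel" by measurable
    have kp: "k (x + 1) = k x" and gp': "g \<tau> (x + 1) = g \<tau> x" for x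
      using k(2) gp by (simp_all add: periodic_fun_simple'_def)
    have fp: "periodic_fun_simple' ?f"
      unfolding periodic_fun_simple'_def using kp[of "x - c" for x] gp' by (simp add: algebra_simps)
    have "(LINT x|circ. \<psi> (g \<tau> (x + c)) * k x) = (LINT x|circ. ?f (x + c))" by simp
    also have "... = (LINT x|circ. ?f x)" by (rule circ_shift(1)[OF fm fp])
    also have "... = (LINT \<xi>|lborel. (alpha (X \<tau>) \<xi>)^2 * ?f (y \<tau> \<xi>))" by (rule change_variables(1)[OF fm fp])
    also have "... = (LINT \<xi>|lborel. (alpha (X \<tau>) \<xi>)^2 * (\<psi> (\<Gamma> \<tau> \<xi>) * k (y \<tau> \<xi> - c)))"
      by (rule integral_cong_AE) (use gG[of \<tau>] in \<open>simp_all, eventually_elim, auto\<close>)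
    finally show ?thesis .
  qed
  obtain K where K: "0 <= K" "\<And>n \<xi>. (alpha (X (s n)) \<xi>)^2 <= K * weight \<xi>" using alpha_dominated[OF st] by blast
  have C0: "0 <= C" using psi(2)[of 0] by linarith
  have D0: "0 <= D" using k(3)[of 0] by linarith
  have "(\<lambda>n. LINT \<xi>|lborel. (alpha (X (s n)) \<xi>)^2 * (\<psi> (\<Gamma> (s n) \<xi>) * k (y (s n) \<xi> - z n))) \<longlonglongrightarrow>
     (LINT \<xi>|lborel. (alpha (X t) \<xi>)^2 * (\<psi> (\<Gamma> t \<xi>) * k (y t \<xi> - 0)))"
  proof (rule integral_dominated_convergence[where s="\<lambda>n \<xi>. (alpha (X (s n)) \<xi>)^2 * (\<psi> (\<Gamma> (s n) \<xi>) * k (y (s n) \<xi> - z n))"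
        and f="\<lambda>\<xi>. (alpha (X t) \<xi>)^2 * (\<psi> (\<Gamma> t \<xi>) * k (y t \<xi> - 0))" and w="\<lambda>\<xi>. (C * D * K) * weight \<xi>"])
    show "integrable lborel (\<lambda>\<xi>. (C * D * K) * weight \<xi>)" using integrable_weight by simp
    show "AE \<xi> in lborel. (\<lambda>n. (alpha (X (s n)) \<xi>)^2 * (\<psi> (\<Gamma> (s n) \<xi>) * k (y (s n) \<xi> - z n))) \<longlonglongrightarrow>
        (alpha (X t) \<xi>)^2 * (\<psi> (\<Gamma> t \<xi>) * k (y t \<xi> - 0))"
    proof (rule AE_I2)
      fix \<xi>
      have a: "(\<lambda>n. (alpha (X (s n)) \<xi>)^2) \<longlonglongrightarrow> (alpha (X t) \<xi>)^2" by (intro tendsto_intros alpha_tendsto st)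
      show "(\<lambda>n. (alpha (X (s n)) \<xi>)^2 * (\<psi> (\<Gamma> (s n) \<xi>) * k (y (s n) \<xi> - z n))) \<longlonglongrightarrow>
        (alpha (X t) \<xi>)^2 * (\<psi> (\<Gamma> t \<xi>) * k (y t \<xi> - 0))"
      proof (cases "alpha (X t) \<xi> = 0")
        case True
        have "(\<lambda>n. (alpha (X (s n)) \<xi>)^2 * (\<psi> (\<Gamma> (s n) \<xi>) * k (y (s n) \<xi> - z n))) \<longlonglongrightarrow> 0"
        proof (rule Lim_null_comparison)
          show "\<forall>\<^sub>F n in sequentially. norm ((alpha (X (s n)) \<xi>)^2 * (\<psi> (\<Gamma> (s n) \<xi>) * k (y (s n) \<xi> - z n))) <= (alpha (X (s n)) \<xi>)^2 * (C * D)"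
          proof (rule always_eventually, rule allI)
            fix n
            have "\<bar>\<psi> (\<Gamma> (s n) \<xi>) * k (y (s n) \<xi> - z n)\<bar> <= C * D"
              unfolding abs_mult using psi(2) k(3) C0 by (intro mult_mono) auto
            then show "norm ((alpha (X (s n)) \<xi>)^2 * (\<psi> (\<Gamma> (s n) \<xi>) * k (y (s n) \<xi> - z n))) <= (alpha (X (s n)) \<xi>)^2 * (C * D)"
              unfolding real_norm_def abs_mult[of "(alpha (X (s n)) \<xi>)^2"] by (simp add: mult_left_mono)
          qed
          show "(\<lambda>n. (alpha (X (s n)) \<xi>)^2 * (C * D)) \<longlonglongrightarrow> 0" using tendsto_mult_right[OF a, of "C * D"] True by simp
        qed
        then show ?thesis using True by simp
      next
        case False
        have G: "(\<lambda>n. \<Gamma> (s n) \<xi>) \<longlonglongrightarrow> \<Gamma> t \<xi>" using g st False by (auto simp: transported_def)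
        have yz: "(\<lambda>n. y (s n) \<xi> - z n) \<longlonglongrightarrow> y t \<xi> - 0" by (intro tendsto_diff y_tendsto st z0)
        have pc: "isCont \<psi> v" and kc: "isCont k v" for v
          using psi(1) k(1) by (simp_all add: continuous_on_eq_continuous_at)
        show ?thesis
          by (intro tendsto_mult a isCont_tendsto_compose[OF pc G] isCont_tendsto_compose[OF kc yz])
      qed
    qed
    show "AE \<xi> in lborel. norm ((alpha (X (s n)) \<xi>)^2 * (\<psi> (\<Gamma> (s n) \<xi>) * k (y (s n) \<xi> - z n))) <= (C * D * K) * weight \<xi>" for n
    proof (rule AE_I2)
      fix \<xi>
      have p: "\<bar>\<psi> (\<Gamma> (s n) \<xi>) * k (y (s n) \<xi> - z n)\<bar> <= C * D"
        unfolding abs_mult using psi(2) k(3) C0 by (intro mult_mono) auto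
      have "norm ((alpha (X (s n)) \<xi>)^2 * (\<psi> (\<Gamma> (s n) \<xi>) * k (y (s n) \<xi> - z n))) <= (K * weight \<xi>) * (C * D)"
        unfolding real_norm_def abs_mult[of "(alpha (X (s n)) \<xi>)^2"]
        by (intro mult_mono p) (use K weight_nonneg in auto)
      then show "norm ((alpha (X (s n)) \<xi>)^2 * (\<psi> (\<Gamma> (s n) \<xi>) * k (y (s n) \<xi> - z n))) <= (C * D * K) * weight \<xi>"
        by (simp add: mult_ac)
    qed
  qed measurable
  then show ?thesis using eq[of "s n" "z n" for n] eq[of t 0] by simp
qed

text \<open>
  Expand the square.  The pairing lemma with the test function 1 handles the squares, and the mixed
  term is the pairing with the fixed function \<open>\<psi> \<circ> g t\<close>, approximated by a continuous one.  Weak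
  convergence together with convergence of norms is strong convergence.
\<close>

lemma transported_truncated_convergence:
  fixes \<psi> :: "real => real"
  assumes g: "transported g \<Gamma>" and st: "s \<longlonglongrightarrow> t" and z0: "z \<longlonglongrightarrow> 0" 
    and psi: "continuous_on UNIV \<psi>" "\<And>v. \<bar>\<psi> v\<bar> <= C"
  shows "(\<lambda>n. LINT x|circ. (\<psi> (g (s n) (x + z n)) - \<psi> (g t x))^2) \<longlonglongrightarrow> 0"
proof -
  have gm [measurable]: "g \<tau> \<in> borel_measurable borel" and gp: "periodic_fun_simple' (g \<tau>)" for \<tau>
    using g by (auto simp: transported_def)
  have [measurable]: "\<psi> \<in> borel_measurable borel" by (rule borel_measurable_continuous_onI[OF psi(1)])
  have C0: "0 <= C" using psi(2)[of 0] by linarith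
  have prodb: "\<bar>\<psi> v * \<psi> v'\<bar> <= C * C" for v v' unfolding abs_mult by (intro mult_mono psi C0) auto
  let ?p = "\<lambda>n x. \<psi> (g (s n) (x + z n))" and ?q = "\<lambda>x. \<psi> (g t x)"
  have i1: "integrable circ (\<lambda>x. ?p n x * ?q x)" for n by (rule integrable_circ_bounded[OF _ prodb]) measurable
  have i2: "integrable circ (\<lambda>x. ?p n x * ?p n x)" for n by (rule integrable_circ_bounded[OF _ prodb]) measurable
  have i3: "integrable circ (\<lambda>x. ?q x * ?q x)" by (rule integrable_circ_bounded[OF _ prodb]) measurable
  have sq: "(\<lambda>n. LINT x|circ. ?p n x * ?p n x) \<longlonglongrightarrow> (LINT x|circ. ?q x * ?q x)"
  proof -
    have "periodic_fun_simple' (\<lambda>x::real. 1::real)" by (simp add: periodic_fun_simple'_def)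
    moreover have "continuous_on UNIV (\<lambda>v. \<psi> v * \<psi> v)" by (intro continuous_on_mult psi)
    ultimately show ?thesis
      using transported_pairing[where k="\<lambda>x. 1" and D=1 and \<psi>="\<lambda>v. \<psi> v * \<psi> v" and C="C * C",
        OF g st z0 _ prodb continuous_on_const] by simp
  qed
  have cross: "(\<lambda>n. LINT x|circ. ?p n x * ?q x) \<longlonglongrightarrow> (LINT x|circ. ?q x * ?q x)"
  proof (rule LIMSEQ_I)
    fix e :: real assume e: "0 < e"
    define d where "d = e / (3 * (C + 1))"
    have d: "d > 0" using e C0 by (simp add: d_def)
    have Cd: "C * d <= e / 3" using e C0 by (simp add: d_def field_simps)
    have qp: "periodic_fun_simple' ?q" using gp by (simp add: periodic_fun_simple'_def)
    (* Weak convergence has been tested with continuous functions only; psi o g t is merely bounded. *)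
    obtain k where k: "continuous_on UNIV k" "periodic_fun_simple' k" "\<And>x. \<bar>k x\<bar> <= C" "(LINT x|circ. \<bar>k x - ?q x\<bar>) < d"
      using bounded_periodic_approx_continuous[of ?q C d] psi(2) qp d by auto
    have [measurable]: "k \<in> borel_measurable borel" by (rule borel_measurable_continuous_onI[OF k(1)])
    have kb: "\<bar>\<psi> v * k x\<bar> <= C * C" for v x unfolding abs_mult by (intro mult_mono psi k C0) auto
    have ik: "integrable circ (\<lambda>x. \<bar>k x - ?q x\<bar>)"
    proof (rule integrable_circ_bounded[of _ "C + C"])
      fix x
      have "\<bar>k x - ?q x\<bar> <= \<bar>k x\<bar> + \<bar>?q x\<bar>" by (rule abs_triangle_ineq4)
      also have "... <= C + C" by (intro add_mono k psi)
      finally show "\<bar>\<bar>k x - ?q x\<bar>\<bar> <= C + C" by simp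
    qed simp
    have err: "\<bar>(LINT x|circ. r x * ?q x) - (LINT x|circ. r x * k x)\<bar> <= C * d"
      if r [measurable]: "r \<in> borel_measurable borel" and rb: "\<And>x. \<bar>r x\<bar> <= C" for r
    proof -
      have ir1: "integrable circ (\<lambda>x. r x * ?q x)"
        by (rule integrable_circ_bounded[of _ "C * C"]) (auto simp: abs_mult intro!: mult_mono rb psi C0)
      have ir2: "integrable circ (\<lambda>x. r x * k x)"
        by (rule integrable_circ_bounded[of _ "C * C"]) (auto simp: abs_mult intro!: mult_mono rb k C0)
      have "(LINT x|circ. r x * ?q x) - (LINT x|circ. r x * k x) = (LINT x|circ. r x * ?q x - r x * k x)"
        by (rule Bochner_Integration.integral_diff[OF ir1 ir2, symmetric])
      also have "\<bar>...\<bar> <= (LINT x|circ. C * \<bar>k x - ?q x\<bar>)"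
        unfolding real_norm_def[symmetric]
      proof (rule Bochner_Integration.integral_norm_bound_integral[OF Bochner_Integration.integrable_diff[OF ir1 ir2] integrable_mult_right[OF ik[folded real_norm_def]]])
        fix x
        have "norm (r x * ?q x - r x * k x) = \<bar>r x\<bar> * \<bar>?q x - k x\<bar>"
          by (simp only: real_norm_def abs_mult[symmetric] right_diff_distrib)
        also have "... = \<bar>r x\<bar> * \<bar>k x - ?q x\<bar>" by (simp only: abs_minus_commute)
        also have "... <= C * \<bar>k x - ?q x\<bar>" by (intro mult_right_mono rb) simp
        finally show "norm (r x * ?q x - r x * k x) <= C * norm (k x - ?q x)" by simp
      qed
      also have "... = C * (LINT x|circ. \<bar>k x - ?q x\<bar>)" by simp
      also have "... <= C * d" using k(4) C0 by (intro mult_left_mono) auto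
      finally show ?thesis .
    qed
    have "(\<lambda>n. LINT x|circ. ?p n x * k x) \<longlonglongrightarrow> (LINT x|circ. ?q x * k x)"
      by (rule transported_pairing[OF g st z0 psi k(1-3)])
    from LIMSEQ_D[OF this, of "e/3"] e obtain N where
      N: "\<And>n. n \<ge> N ==> \<bar>(LINT x|circ. ?p n x * k x) - (LINT x|circ. ?q x * k x)\<bar> < e/3" by auto
    have "\<bar>(LINT x|circ. ?p n x * ?q x) - (LINT x|circ. ?q x * ?q x)\<bar> < e" if "n \<ge> N" for n
    proof -
      have "\<bar>(LINT x|circ. ?p n x * ?q x) - (LINT x|circ. ?p n x * k x)\<bar> <= C * d" by (rule err) (measurable, rule psi(2))
      moreover have "\<bar>(LINT x|circ. ?q x * ?q x) - (LINT x|circ. ?q x * k x)\<bar> <= C * d" by (rule err) (measurable, rule psi(2))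
      ultimately show ?thesis using N[OF that] Cd unfolding abs_le_iff abs_less_iff by linarith
    qed
    then show "\<exists>N. \<forall>n\<ge>N. norm ((LINT x|circ. ?p n x * ?q x) - (LINT x|circ. ?q x * ?q x)) < e" by auto
  qed
  have "(LINT x|circ. (?p n x - ?q x)^2) = (LINT x|circ. ?p n x * ?p n x) - 2 * (LINT x|circ. ?p n x * ?q x) + (LINT x|circ. ?q x * ?q x)" for n
  proof -
    have "(LINT x|circ. (?p n x - ?q x)^2) = (LINT x|circ. (?p n x * ?p n x - 2 * (?p n x * ?q x)) + ?q x * ?q x)"
      by (rule Bochner_Integration.integral_cong) (simp_all add: power2_eq_square algebra_simps)
    also have "... = (LINT x|circ. ?p n x * ?p n x) - (LINT x|circ. 2 * (?p n x * ?q x)) + (LINT x|circ. ?q x * ?q x)"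
      by (subst Bochner_Integration.integral_add[OF Bochner_Integration.integrable_diff[OF i2 integrable_mult_right[OF i1]] i3],
          subst Bochner_Integration.integral_diff[OF i2 integrable_mult_right[OF i1]]) (rule refl)
    finally show ?thesis by simp
  qed
  moreover have "(\<lambda>n. (LINT x|circ. ?p n x * ?p n x) - 2 * (LINT x|circ. ?p n x * ?q x) + (LINT x|circ. ?q x * ?q x)) \<longlonglongrightarrow>
     (LINT x|circ. ?q x * ?q x) - 2 * (LINT x|circ. ?q x * ?q x) + (LINT x|circ. ?q x * ?q x)"
    by (intro tendsto_intros sq cross)
  ultimately show ?thesis by simp
qed

lemma transported_L1_convergence:
  assumes g: "transported g \<Gamma>" and st: "s \<longlonglongrightarrow> t" and z0: "z \<longlonglongrightarrow> 0"
    and L2: "\<And>\<tau>. integrable circ (\<lambda>x. (g \<tau> x)^2)" "\<And>\<tau>. (LINT x|circ. (g \<tau> x)^2) <= M"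
  shows "(\<lambda>n. LINT x|circ. \<bar>g (s n) (x + z n) - g t x\<bar>) \<longlonglongrightarrow> 0"
proof (rule LIMSEQ_I)
  fix e :: real assume e: "0 < e"
  have gm [measurable]: "g \<tau> \<in> borel_measurable borel" and gp: "periodic_fun_simple' (g \<tau>)" for \<tau>
    using g by (auto simp: transported_def)
  have M0: "0 <= M" using order_trans[OF Bochner_Integration.integral_nonneg L2(2)[of 0]] by simp
  (* Level at which both tails, at most M / N each, contribute at most e/8. *)
  define N where "N = 8 * (M + 1) / e"
  have N: "N > 0" using M0 e by (simp add: N_def)
  have MN: "1/N * M <= e/8" using M0 e by (simp add: N_def field_simps)
  define \<psi> where "\<psi> = clampN N"
  have psi: "continuous_on UNIV \<psi>" "\<And>v. \<bar>\<psi> v\<bar> <= N" using clampN_cont clampN_bound N by (auto simp: \<psi>_def)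
  have [measurable]: "\<psi> \<in> borel_measurable borel" by (rule borel_measurable_continuous_onI[OF psi(1)])
  have sqp: "periodic_fun_simple' (\<lambda>x. (g \<tau> x)^2)" for \<tau> using gp[of \<tau>] by (simp add: periodic_fun_simple'_def)
  have sh: "integrable circ (\<lambda>x. (g \<tau> (x + c))^2)" "(LINT x|circ. (g \<tau> (x + c))^2) <= M" for \<tau> c
    using circ_shift[of "\<lambda>x. (g \<tau> x)^2" c] sqp L2[of \<tau>] by auto
  have "(\<lambda>n. LINT x|circ. (\<psi> (g (s n) (x + z n)) - \<psi> (g t x))^2) \<longlonglongrightarrow> 0"
    by (rule transported_truncated_convergence[OF g st z0 psi])
  moreover have "0 < (e/4)^2" using e by simp
  ultimately have "\<exists>n0. \<forall>n\<ge>n0. norm ((LINT x|circ. (\<psi> (g (s n) (x + z n)) - \<psi> (g t x))^2) - 0) < (e/4)^2" by (rule LIMSEQ_D)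
  then obtain n0 where n0: "\<And>n. n \<ge> n0 ==> \<bar>LINT x|circ. (\<psi> (g (s n) (x + z n)) - \<psi> (g t x))^2\<bar> < (e/4)^2"
    unfolding diff_zero real_norm_def by blast
  have "(LINT x|circ. \<bar>g (s n) (x + z n) - g t x\<bar>) < e" if n: "n \<ge> n0" for n
  proof -
    let ?a = "\<lambda>x. g (s n) (x + z n)" and ?b = "\<lambda>x. g t x"
    have pd: "\<bar>\<psi> (?a x) - \<psi> (?b x)\<bar> <= N + N" for x
      by (rule order_trans[OF abs_triangle_ineq4 add_mono[OF psi(2) psi(2)]])
    have isq: "integrable circ (\<lambda>x. (\<psi> (?a x) - \<psi> (?b x))^2)"
    proof (rule integrable_circ_bounded[of _ "(N + N)^2"])
      show "\<bar>(\<psi> (?a x) - \<psi> (?b x))^2\<bar> <= (N + N)^2" for x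
        using power_mono[OF pd[of x] abs_ge_zero, of 2] by simp
    qed measurable
    have ib: "integrable circ (\<lambda>x. (e/4 + 4/e * (\<psi> (?a x) - \<psi> (?b x))^2) + (1/N * (?a x)^2 + 1/N * (?b x)^2))"
      using isq sh[of "s n" "z n"] L2[of t] integrable_circ_bounded[of "\<lambda>x. e/4" "\<bar>e/4\<bar>"]
      by (intro Bochner_Integration.integrable_add integrable_mult_right) auto
    have pw: "\<bar>?a x - ?b x\<bar> <= (e/4 + 4/e * (\<psi> (?a x) - \<psi> (?b x))^2) + (1/N * (?a x)^2 + 1/N * (?b x)^2)" for x
    proof -
      define r where "r = \<bar>\<psi> (?a x) - \<psi> (?b x)\<bar>"
      (* Young's inequality turns the L^1 norm of the truncated difference into its squared L^2 norm. *)
      have "0 <= (r - e/4)^2" by simp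
      then have "2 * r * (e/4) <= r^2 + (e/4)^2" by (simp add: power2_diff)
      then have "(2 * r * (e/4)) * (4/e) <= (r^2 + (e/4)^2) * (4/e)" using e by (intro mult_right_mono) auto
      moreover have "(2 * r * (e/4)) * (4/e) = 2 * r" using e by simp
      moreover have "(r^2 + (e/4)^2) * (4/e) = 4/e * r^2 + e/4" using e by (simp add: field_simps power2_eq_square)
      moreover have "0 <= r" by (simp add: r_def)
      ultimately have r: "r <= e/4 + 4/e * r^2" by linarith
      have "?a x - ?b x = (\<psi> (?a x) - \<psi> (?b x)) + ((?a x - \<psi> (?a x)) - (?b x - \<psi> (?b x)))" by simp
      then have "\<bar>?a x - ?b x\<bar> <= r + (\<bar>?a x - \<psi> (?a x)\<bar> + \<bar>?b x - \<psi> (?b x)\<bar>)"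
        unfolding r_def
        using abs_triangle_ineq[of "\<psi> (?a x) - \<psi> (?b x)" "(?a x - \<psi> (?a x)) - (?b x - \<psi> (?b x))"]
          abs_triangle_ineq4[of "?a x - \<psi> (?a x)" "?b x - \<psi> (?b x)"] by linarith
      also have "... <= (e/4 + 4/e * r^2) + (1/N * (?a x)^2 + 1/N * (?b x)^2)"
        unfolding \<psi>_def by (intro add_mono r clampN_tail[OF N])
      finally show ?thesis by (simp add: r_def)
    qed
    have "(LINT x|circ. \<bar>?a x - ?b x\<bar>) <= (LINT x|circ. (e/4 + 4/e * (\<psi> (?a x) - \<psi> (?b x))^2) + (1/N * (?a x)^2 + 1/N * (?b x)^2))"
    proof (rule integral_mono[OF _ ib pw])
      show "integrable circ (\<lambda>x. \<bar>?a x - ?b x\<bar>)"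
        by (rule Bochner_Integration.integrable_bound[OF ib]) (use pw in \<open>auto intro: order_trans[OF _ abs_ge_self]\<close>)
    qed
    also have "... = (e/4 + 4/e * (LINT x|circ. (\<psi> (?a x) - \<psi> (?b x))^2)) + (1/N * (LINT x|circ. (?a x)^2) + 1/N * (LINT x|circ. (?b x)^2))"
    proof -
      have ic: "integrable circ (\<lambda>x. e/4)" by (rule integrable_circ_bounded[of _ "\<bar>e/4\<bar>"]) auto
      note i1 = integrable_mult_right[OF isq, of "4/e"] and i2 = integrable_mult_right[OF sh(1)[of "s n" "z n"], of "1/N"]
        and i3 = integrable_mult_right[OF L2(1)[of t], of "1/N"]
      show ?thesis
        by (subst Bochner_Integration.integral_add[OF Bochner_Integration.integrable_add[OF ic i1] Bochner_Integration.integrable_add[OF i2 i3]],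
            subst Bochner_Integration.integral_add[OF ic i1], subst Bochner_Integration.integral_add[OF i2 i3])
           (simp only: integral_circ_const Bochner_Integration.integral_mult_right_zero)
    qed
    also have "... <= (e/4 + 4/e * (e/4)^2) + (e/8 + e/8)"
    proof (intro add_mono order_refl)
      show "4/e * (LINT x|circ. (\<psi> (?a x) - \<psi> (?b x))^2) <= 4/e * (e/4)^2" using n0[OF n] e by (intro mult_left_mono) auto
      have "1/N * (LINT x|circ. (?a x)^2) <= 1/N * M" using sh(2) N by (intro mult_left_mono) auto
      then show "1/N * (LINT x|circ. (?a x)^2) <= e/8" using MN by linarith
      have "1/N * (LINT x|circ. (?b x)^2) <= 1/N * M" using L2(2) N by (intro mult_left_mono) auto
      then show "1/N * (LINT x|circ. (?b x)^2) <= e/8" using MN by linarith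
    qed
    also have "... < e" using e by (simp add: power2_eq_square)
    finally show ?thesis .
  qed
  moreover have "0 <= (LINT x|circ. \<bar>g (s n) (x + z n) - g t x\<bar>)" for n by (rule Bochner_Integration.integral_nonneg) simp
  ultimately show "\<exists>n0. \<forall>n\<ge>n0. norm ((LINT x|circ. \<bar>g (s n) (x + z n) - g t x\<bar>) - 0) < e" by auto
qed

end

section \<open>The gradient and the velocity of the solution\<close>

lemma square_add3_le: "(a + b + c)^2 <= 3 * a^2 + 3 * b^2 + 3 * c^2" for a b c :: real
proof -
  have "0 <= (a - b)^2 + (b - c)^2 + (a - c)^2" by simp
  then show ?thesis by (simp add: power2_eq_square algebra_simps)
qed

lemma square_add_le: "(a + b)^2 <= 2 * a^2 + 2 * b^2" for a b :: real
  using sum_squares_bound[of a b] by (simp add: power2_sum)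

lemma square_diff_le: "(a - b)^2 <= 2 * a^2 + 2 * b^2" for a b :: real
  using square_add_le[of a "- b"] by simp

lemma integrable_circ_const: "integrable circ (\<lambda>x. c::real)"
  by (rule integrable_circ_bounded[of _ "\<bar>c\<bar>"]) auto

lemma has_density_id: "has_density (\<lambda>z. z) (\<lambda>z. 1)"
  by (auto simp: has_density_def set_integrable_def set_lebesgue_integral_def emeasure_lborel_Icc_eq intro!: integrable_real_indicator)

text \<open>
  What the truncation removes from \<open>b / a\<close>, weighted by \<open>a^2\<close>, is continuous in \<open>(a, b)\<close> even at
  \<open>a = 0\<close>.
\<close>

lemma clampN_excess:
  assumes "0 < N" "a \<noteq> 0"
  shows "a^2 * (b / a - clampN N (b / a))^2 = (max 0 (\<bar>b\<bar> - N * \<bar>a\<bar>))^2"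
proof -
  have 1: "\<bar>v - clampN N v\<bar> = max 0 (\<bar>v\<bar> - N)" for v using assms(1) by (auto simp: clampN_def max_def min_def)
  have "\<bar>a\<bar> * \<bar>b / a - clampN N (b / a)\<bar> = max 0 (\<bar>b\<bar> - N * \<bar>a\<bar>)"
  proof -
    have "\<bar>a\<bar> * max 0 (\<bar>b / a\<bar> - N) = max (\<bar>a\<bar> * 0) (\<bar>a\<bar> * (\<bar>b / a\<bar> - N))"
      by (rule max_mult_distrib_left[THEN trans]) simp
    also have "\<bar>a\<bar> * (\<bar>b / a\<bar> - N) = \<bar>b\<bar> - N * \<bar>a\<bar>" using assms(2) by (simp add: right_diff_distrib mult.commute)
    finally show ?thesis by (simp add: 1)
  qed
  then have "(\<bar>a\<bar> * \<bar>b / a - clampN N (b / a)\<bar>)^2 = (max 0 (\<bar>b\<bar> - N * \<bar>a\<bar>))^2" by simp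
  then show ?thesis by (simp add: power_mult_distrib)
qed

context flow
begin

lemma energy_integral: "(LINT \<xi>|lborel. (U (X t) \<xi>)^2 * (alpha (X t) \<xi>)^2 + (beta (X t) \<xi>)^2) = E"
  using X_energy energy_1 by simp

lemmas bounds = static_bounds[OF X_per(1) X_energy]

lemma E_nonneg: "0 <= E" by (rule bounds(1))

text \<open>
  One bound, uniform in time, for \<open>U\<close>, \<open>P\<close> and \<open>Q\<close>.
\<close>

definition Cb :: real where
  "Cb = 1 + (2 * E + 2 * ((1 + E) / 2)^2) + (exp 1 * (k1 + 1) * E + (1 + k2) * exp 1 * E)"

lemma k_nonneg: "0 <= k1" "0 <= k2" by (auto simp: k1_def k2_def)

lemma Cb_pos: "1 <= Cb" using E_nonneg k_nonneg by (auto simp: Cb_def intro!: add_nonneg_nonneg)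

lemma abs_bounds: "\<bar>U (X t) \<xi>\<bar> <= Cb" "\<bar>P (X t) \<xi>\<bar> <= Cb" "\<bar>Q (X t) \<xi>\<bar> <= Cb"
proof -
  have p: "0 <= exp 1 * (k1 + 1) * E + (1 + k2) * exp 1 * E" "0 <= 2 * E + 2 * ((1 + E) / 2)^2"
    using E_nonneg k_nonneg by (auto intro!: add_nonneg_nonneg)
  show "\<bar>U (X t) \<xi>\<bar> <= Cb"
    using abs_le_one_plus_square[of "U (X t) \<xi>"] bounds(4)[of t \<xi>] p unfolding Cb_def by linarith
  show "\<bar>P (X t) \<xi>\<bar> <= Cb" "\<bar>Q (X t) \<xi>\<bar> <= Cb"
    using bounds(5)[of t \<xi>] bounds(6)[of t \<xi>] p unfolding Cb_def by linarith+
qed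

lemma hx_sq_change: "AE \<xi> in lborel. (alpha (X t) \<xi>)^2 * (hx t (y t \<xi>))^2 = (if alpha (X t) \<xi> = 0 then 0 else (beta (X t) \<xi>)^2)"
  using hx_chain[of t] by eventually_elim (auto simp: power_divide)

lemma hx_sq_periodic: "periodic_fun_simple' (\<lambda>x. (hx t x)^2)"
  using hx_periodic[of t] by (simp add: periodic_fun_simple'_def)

lemma hx_L2: "integrable circ (\<lambda>x. (hx t x)^2)" "(LINT x|circ. (hx t x)^2) <= E"
proof -
  have m: "(\<lambda>x. (hx t x)^2) \<in> borel_measurable borel" by measurable
  have i: "integrable lborel (\<lambda>\<xi>. (alpha (X t) \<xi>)^2 * (hx t (y t \<xi>))^2)"
    by (rule Bochner_Integration.integrable_bound[OF integrable_beta_sq[of "X t"]])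
       (simp, use hx_sq_change[of t] in eventually_elim, auto)
  then show "integrable circ (\<lambda>x. (hx t x)^2)" using change_variables(2)[OF m hx_sq_periodic] by blast
  have "(LINT x|circ. (hx t x)^2) = (LINT \<xi>|lborel. (alpha (X t) \<xi>)^2 * (hx t (y t \<xi>))^2)"
    by (rule change_variables(1)[OF m hx_sq_periodic])
  also have "... <= (LINT \<xi>|lborel. (beta (X t) \<xi>)^2)"
    by (rule integral_mono_AE[OF i integrable_beta_sq]) (use hx_sq_change[of t] in eventually_elim, auto)
  also have "... <= E" by (rule bounds(2))
  finally show "(LINT x|circ. (hx t x)^2) <= E" .
qed

lemma transported_hx: "transported hx (\<lambda>t \<xi>. beta (X t) \<xi> / alpha (X t) \<xi>)"
  unfolding transported_def
proof (intro conjI allI impI)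
  show "(\<lambda>n. beta (X (s n)) \<xi> / alpha (X (s n)) \<xi>) \<longlonglongrightarrow> beta (X t) \<xi> / alpha (X t) \<xi>"
    if "s \<longlonglongrightarrow> t" "alpha (X t) \<xi> \<noteq> 0" for s t \<xi>
    using that by (intro tendsto_divide alpha_tendsto beta_tendsto)
qed (use hx_periodic hx_chain in \<open>auto\<close>)

text \<open>
  A label of the characteristic that passes through \<open>x\<close> at time \<open>t\<close>, up to periods.
\<close>

definition lab :: "real => real => real" where "lab t x = profile.sel (Y (X t)) (frac (x - eta t))"

lemma lab: "lab t x \<in> {0..1}" "\<exists>n::int. x = y t (lab t x) + of_int n"
proof -
  have "0 <= frac (x - eta t)" "frac (x - eta t) <= 1" using frac_lt_1[of "x - eta t"] by auto
  from profile.sel[OF prof this] show "lab t x \<in> {0..1}" by (simp add: lab_def)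
  from profile.sel[OF prof \<open>0 <= frac (x - eta t)\<close> \<open>frac (x - eta t) <= 1\<close>]
  have "Y (X t) (lab t x) = frac (x - eta t)" by (simp add: lab_def)
  then have "x = y t (lab t x) + of_int \<lfloor>x - eta t\<rfloor>" by (simp add: y_def frac_def)
  then show "\<exists>n::int. x = y t (lab t x) + of_int n" by blast
qed

lemma lab_borel [measurable]: "lab t \<in> borel_measurable borel"
proof -
  let ?sel = "profile.sel (Y (X t))"
  have "mono (\<lambda>x. ?sel (max 0 (min 1 x)))"
    by (intro monoI profile.sel_mono[OF prof]) auto
  then have 1: "(\<lambda>x. ?sel (max 0 (min 1 x))) \<in> borel_measurable borel" by (rule borel_measurable_mono)
  have 2: "(\<lambda>x. frac (x - eta t)) \<in> borel_measurable borel" using frac_shift_borel[of "- eta t"] by simp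
  have "(\<lambda>x. ?sel (max 0 (min 1 (frac (x - eta t))))) \<in> borel_measurable borel"
    using measurable_comp[OF 2 1] by (simp add: comp_def)
  moreover have "max 0 (min 1 (frac z)) = frac z" for z :: real using frac_lt_1[of z] by (simp add: min_def)
  ultimately show ?thesis unfolding lab_def[abs_def] by simp
qed

lemma lab_periodic: "periodic_fun_simple' (lab t)"
  using periodic_frac_fun[of "profile.sel (Y (X t))" "- eta t"] by (simp add: lab_def[abs_def])

lemma periodic_int_shift: "periodic_fun_simple' f ==> f (x + of_int n) = f x" for f :: "real => real"
  using periodic_frac[of f] frac_add_int[of x n] by metis

lemma uu_lab: "uu t x = U (X t) (lab t x)"
proof -
  obtain n :: int where "x = y t (lab t x) + of_int n" using lab(2) by blast
  then have "uu t x = uu t (y t (lab t x))" using periodic_int_shift[OF uu_periodic] by metis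
  then show ?thesis by (simp add: uu_y)
qed

text \<open>
  Where \<open>Y\<close> has a positive derivative its fibre is a single label.
\<close>

lemma lab_y: "AE \<xi> in lborel. alpha (X t) \<xi> = 0 \<or> lab t (y t \<xi>) = \<xi>"
proof -
  have n: "AE \<xi> in lborel. \<xi> \<noteq> (0::real)" "AE \<xi> in lborel. \<xi> \<noteq> (1::real)" by (rule AE_lborel_singleton)+
  show ?thesis
    using has_density_AE_derivative[OF Y_density[of "X t"]] n
  proof eventually_elim
    case (elim \<xi>)
    show ?case
    proof (cases "alpha (X t) \<xi> = 0")
      case False
      have uniq: "\<xi>' = \<xi>" if eq: "Y (X t) \<xi>' = Y (X t) \<xi>" for \<xi>'
      proof (rule ccontr)
        assume ne: "\<xi>' \<noteq> \<xi>"
        have pos: "0 < (alpha (X t) \<xi>)^2" using False by simp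
        have ym: "a <= b ==> Y (X t) a <= Y (X t) b" for a b by (rule profile.Y_mono[OF prof])
        show False
        proof (cases "\<xi> < \<xi>'")
          case True
          from DERIV_pos_inc_right[OF elim(1) pos] obtain d where d: "d > 0" "\<And>h. 0 < h ==> h < d ==> Y (X t) \<xi> < Y (X t) (\<xi> + h)" by blast
          define h where "h = min (d/2) (\<xi>' - \<xi>)"
          have "Y (X t) \<xi> < Y (X t) (\<xi> + h)" using d True by (intro d(2)) (auto simp: h_def)
          also have "... <= Y (X t) \<xi>'" by (rule ym) (simp add: h_def min_def)
          finally show False using eq by simp
        next
          case F: False
          from DERIV_pos_inc_left[OF elim(1) pos] obtain d where d: "d > 0" "\<And>h. 0 < h ==> h < d ==> Y (X t) (\<xi> - h) < Y (X t) \<xi>" by blast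
          define h where "h = min (d/2) (\<xi> - \<xi>')"
          have "Y (X t) \<xi>' <= Y (X t) (\<xi> - h)" by (rule ym) (simp add: h_def min_def)
          also have "... < Y (X t) \<xi>" using d F ne by (intro d(2)) (auto simp: h_def)
          finally show False using eq by simp
        qed
      qed
      have "Y (X t) \<xi> \<noteq> 1"
      proof
        assume "Y (X t) \<xi> = 1"
        then have "1 = \<xi>" by (intro uniq) (simp add: X_per)
        then show False using elim(3) by simp
      qed
      then have fr: "frac (Y (X t) \<xi>) = Y (X t) \<xi>"
        using profile.Y_range[OF prof, of t \<xi>] by (simp add: frac_eq)
      have "Y (X t) (lab t (y t \<xi>)) = Y (X t) \<xi>"
        using profile.sel[OF prof, of "Y (X t) \<xi>" t] profile.Y_range[OF prof, of t \<xi>] fr by (simp add: lab_def y_def)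
      then show ?thesis using uniq by blast
    qed simp
  qed
qed

text \<open>
  \<open>qx\<close> is the spatial derivative of the pressure and \<open>vx\<close> the expected time derivative of \<open>uu\<close>.
\<close>

definition qx :: "real => real => real" where "qx t x = Q (X t) (lab t x)"
definition vx :: "real => real => real" where "vx t x = - uu t x * hx t x - qx t x"

lemma qx_borel [measurable]: "qx t \<in> borel_measurable borel"
  unfolding qx_def[abs_def] using measurable_comp[OF lab_borel Q_borel[of "X t"]] by (simp add: comp_def)
lemma qx_periodic: "periodic_fun_simple' (qx t)"
  using lab_periodic[of t] by (simp add: periodic_fun_simple'_def qx_def)
lemma vx_borel [measurable]: "vx t \<in> borel_measurable borel" unfolding vx_def[abs_def] by measurable
lemma vx_periodic: "periodic_fun_simple' (vx t)"
  using uu_periodic[of t] hx_periodic[of t] qx_periodic[of t] by (simp add: periodic_fun_simple'_def vx_def)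

lemma uu_bound: "\<bar>uu t x\<bar> <= Cb" by (simp add: uu_lab abs_bounds)
lemma qx_bound: "\<bar>qx t x\<bar> <= Cb" by (simp add: qx_def abs_bounds)

lemma vx_chain: "AE \<xi> in lborel. alpha (X t) \<xi> = 0 \<or>
   vx t (y t \<xi>) = - U (X t) \<xi> * (beta (X t) \<xi> / alpha (X t) \<xi>) - Q (X t) \<xi>"
  using hx_chain[of t] lab_y[of t] by eventually_elim (auto simp: vx_def qx_def uu_y)

lemma transported_vx: "transported vx (\<lambda>t \<xi>. - U (X t) \<xi> * (beta (X t) \<xi> / alpha (X t) \<xi>) - Q (X t) \<xi>)"
  unfolding transported_def
proof (intro conjI allI impI)
  show "(\<lambda>n. - U (X (s n)) \<xi> * (beta (X (s n)) \<xi> / alpha (X (s n)) \<xi>) - Q (X (s n)) \<xi>) \<longlonglongrightarrow>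
     - U (X t) \<xi> * (beta (X t) \<xi> / alpha (X t) \<xi>) - Q (X t) \<xi>"
    if "s \<longlonglongrightarrow> t" "alpha (X t) \<xi> \<noteq> 0" for s t \<xi>
    using that by (intro tendsto_intros tendsto_divide alpha_tendsto beta_tendsto loc_lipschitz_tendsto ll_U ll_Q)
qed (use vx_periodic vx_chain in \<open>auto\<close>)

lemma vx_sq_le: "(vx t x)^2 <= 2 * Cb^2 * (hx t x)^2 + 2 * Cb^2"
proof -
  have u: "(uu t x)^2 <= Cb^2" using power_mono[OF uu_bound abs_ge_zero, of t x 2] by simp
  have q: "(qx t x)^2 <= Cb^2" using power_mono[OF qx_bound abs_ge_zero, of t x 2] by simp
  have "(vx t x)^2 <= 2 * (- uu t x * hx t x)^2 + 2 * (qx t x)^2" unfolding vx_def by (rule square_diff_le)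
  also have "(- uu t x * hx t x)^2 = (uu t x)^2 * (hx t x)^2" by (simp add: power_mult_distrib)
  also have "... <= Cb^2 * (hx t x)^2" using u by (intro mult_right_mono) auto
  finally show ?thesis using q by linarith
qed

lemma vx_L2: "integrable circ (\<lambda>x. (vx t x)^2)" "(LINT x|circ. (vx t x)^2) <= 2 * Cb^2 * E + 2 * Cb^2"
proof -
  have i: "integrable circ (\<lambda>x. 2 * Cb^2 * (hx t x)^2 + 2 * Cb^2)"
    by (intro Bochner_Integration.integrable_add integrable_mult_right hx_L2 integrable_circ_const)
  show iv: "integrable circ (\<lambda>x. (vx t x)^2)"
    by (rule Bochner_Integration.integrable_bound[OF i]) (use vx_sq_le[of t] in \<open>auto intro: order_trans[OF _ abs_ge_self]\<close>)
  have "(LINT x|circ. (vx t x)^2) <= (LINT x|circ. 2 * Cb^2 * (hx t x)^2 + 2 * Cb^2)"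
    by (rule integral_mono[OF iv i vx_sq_le])
  also have "... = 2 * Cb^2 * (LINT x|circ. (hx t x)^2) + 2 * Cb^2"
    by (subst Bochner_Integration.integral_add[OF integrable_mult_right[OF hx_L2(1)] integrable_circ_const]) (simp only: integral_circ_const Bochner_Integration.integral_mult_right_zero)
  also have "... <= 2 * Cb^2 * E + 2 * Cb^2" using hx_L2(2) by (intro add_right_mono mult_left_mono) auto
  finally show "(LINT x|circ. (vx t x)^2) <= 2 * Cb^2 * E + 2 * Cb^2" .
qed

text \<open>
  No energy is concentrated on a null set of the circle at these times.
\<close>

definition regular :: "real => bool" where
  "regular t \<longleftrightarrow> (AE \<xi> in lborel. \<xi> \<in> {0..1} --> alpha (X t) \<xi> \<noteq> 0)"

lemma energy_regular:
  assumes "regular t"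
  shows "integrable circ (\<lambda>x. (uu t x)^2 + (hx t x)^2)" "(LINT x|circ. (uu t x)^2 + (hx t x)^2) = E"
proof -
  let ?f = "\<lambda>x. (uu t x)^2 + (hx t x)^2"
  have m: "?f \<in> borel_measurable borel" by measurable
  have p: "periodic_fun_simple' ?f" using uu_periodic[of t] hx_periodic[of t] by (simp add: periodic_fun_simple'_def)
  show "integrable circ ?f"
    using hx_L2(1)[of t] integrable_circ_bounded[of "\<lambda>x. (uu t x)^2" "Cb^2"] power_mono[OF uu_bound abs_ge_zero, of t _ 2]
    by (intro Bochner_Integration.integrable_add) auto
  have "(LINT x|circ. ?f x) = (LINT \<xi>|lborel. (alpha (X t) \<xi>)^2 * ?f (y t \<xi>))" by (rule change_variables(1)[OF m p])
  also have "... = (LINT \<xi>|lborel. (U (X t) \<xi>)^2 * (alpha (X t) \<xi>)^2 + (beta (X t) \<xi>)^2)"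
  proof (rule integral_cong_AE)
    show "AE \<xi> in lborel. (alpha (X t) \<xi>)^2 * ?f (y t \<xi>) = (U (X t) \<xi>)^2 * (alpha (X t) \<xi>)^2 + (beta (X t) \<xi>)^2"
      using assms[unfolded regular_def] hx_sq_change[of t]
    proof eventually_elim
      case (elim \<xi>)
      show ?case
      proof (cases "\<xi> \<in> {0..1}")
        case True
        then show ?thesis using elim by (simp add: uu_y distrib_left mult.commute)
      next
        case False then show ?thesis by (simp add: alpha_outside beta_outside)
      qed
    qed
  qed simp_all
  also have "... = E" by (rule energy_integral)
  finally show "(LINT x|circ. ?f x) = E" .
qed

text \<open>
  The energy of gradients beyond the level \<open>N\<close>, including the part where \<open>alpha = 0\<close>.  In this form it is
  continuous in time, and at regular times it vanishes as \<open>N\<close> grows.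
\<close>

definition excess :: "nat => real => real" where
  "excess N t = (LINT \<xi>|lborel. (max 0 (\<bar>beta (X t) \<xi>\<bar> - real N * \<bar>alpha (X t) \<xi>\<bar>))^2)"

lemma excess_le_beta: "(max 0 (\<bar>b\<bar> - real N * \<bar>a\<bar>))^2 <= b^2"
proof -
  have "max 0 (\<bar>b\<bar> - real N * \<bar>a\<bar>) <= \<bar>b\<bar>" by simp
  then have "(max 0 (\<bar>b\<bar> - real N * \<bar>a\<bar>))^2 <= \<bar>b\<bar>^2" by (rule power_mono) simp
  then show ?thesis by simp
qed

lemma integrable_excess: "integrable lborel (\<lambda>\<xi>. (max 0 (\<bar>beta (X t) \<xi>\<bar> - real N * \<bar>alpha (X t) \<xi>\<bar>))^2)"
  by (rule Bochner_Integration.integrable_bound[OF integrable_beta_sq[of "X t"]]) (simp_all add: excess_le_beta)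

lemma excess_tendsto:
  assumes st: "s \<longlonglongrightarrow> t"
  shows "(\<lambda>n. excess N (s n)) \<longlonglongrightarrow> excess N t"
proof -
  obtain K where K: "0 <= K" "\<And>n \<xi>. (beta (X (s n)) \<xi>)^2 <= K * weight \<xi>" using alpha_dominated[OF st] by blast
  show ?thesis
    unfolding excess_def
  proof (rule integral_dominated_convergence[where s="\<lambda>n \<xi>. (max 0 (\<bar>beta (X (s n)) \<xi>\<bar> - real N * \<bar>alpha (X (s n)) \<xi>\<bar>))^2"
     and f="\<lambda>\<xi>. (max 0 (\<bar>beta (X t) \<xi>\<bar> - real N * \<bar>alpha (X t) \<xi>\<bar>))^2" and w="\<lambda>\<xi>. K * weight \<xi>"])
    show "integrable lborel (\<lambda>\<xi>. K * weight \<xi>)" using integrable_weight by simp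
    show "AE \<xi> in lborel. (\<lambda>n. (max 0 (\<bar>beta (X (s n)) \<xi>\<bar> - real N * \<bar>alpha (X (s n)) \<xi>\<bar>))^2) \<longlonglongrightarrow>
       (max 0 (\<bar>beta (X t) \<xi>\<bar> - real N * \<bar>alpha (X t) \<xi>\<bar>))^2"
      by (intro AE_I2 tendsto_intros alpha_tendsto beta_tendsto st)
    show "AE \<xi> in lborel. norm ((max 0 (\<bar>beta (X (s n)) \<xi>\<bar> - real N * \<bar>alpha (X (s n)) \<xi>\<bar>))^2) <= K * weight \<xi>" for n
      using order_trans[OF excess_le_beta K(2)] by auto
  qed measurable
qed

lemma excess_regular:
  assumes "regular t"
  shows "(\<lambda>N. excess N t) \<longlonglongrightarrow> 0"
proof -
  have "(\<lambda>N. excess N t) \<longlonglongrightarrow> (LINT \<xi>|lborel. 0 * (\<xi>::real))"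
    unfolding excess_def
  proof (rule integral_dominated_convergence[where s="\<lambda>N \<xi>. (max 0 (\<bar>beta (X t) \<xi>\<bar> - real N * \<bar>alpha (X t) \<xi>\<bar>))^2"
     and f="\<lambda>\<xi>. 0 * \<xi>" and w="\<lambda>\<xi>. (beta (X t) \<xi>)^2"])
    show "integrable lborel (\<lambda>\<xi>. (beta (X t) \<xi>)^2)" by (rule integrable_beta_sq)
    show "AE \<xi> in lborel. (\<lambda>N. (max 0 (\<bar>beta (X t) \<xi>\<bar> - real N * \<bar>alpha (X t) \<xi>\<bar>))^2) \<longlonglongrightarrow> 0 * \<xi>"
      using assms[unfolded regular_def]
    proof eventually_elim
      case (elim \<xi>)
      show ?case
      proof (cases "\<xi> \<in> {0..1}")
        case True
        then have a: "0 < \<bar>alpha (X t) \<xi>\<bar>" using elim by simp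
        obtain M :: nat where M: "\<bar>beta (X t) \<xi>\<bar> / \<bar>alpha (X t) \<xi>\<bar> <= real M" using real_arch_simple by blast
        have "\<forall>\<^sub>F N in sequentially. (max 0 (\<bar>beta (X t) \<xi>\<bar> - real N * \<bar>alpha (X t) \<xi>\<bar>))^2 = 0 * \<xi>"
          using eventually_ge_at_top[of M]
        proof eventually_elim
          case (elim N)
          then have "\<bar>beta (X t) \<xi>\<bar> / \<bar>alpha (X t) \<xi>\<bar> <= real N" using M by simp
          then have "\<bar>beta (X t) \<xi>\<bar> <= real N * \<bar>alpha (X t) \<xi>\<bar>" using a by (simp add: divide_le_eq)
          then show ?case by simp
        qed
        then show ?thesis by (rule tendsto_eventually)
      next
        case False then show ?thesis by (simp add: beta_outside alpha_outside)
      qed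
    qed
    show "AE \<xi> in lborel. norm ((max 0 (\<bar>beta (X t) \<xi>\<bar> - real N * \<bar>alpha (X t) \<xi>\<bar>))^2) <= (beta (X t) \<xi>)^2" for N
      using excess_le_beta by auto
  qed measurable
  then show ?thesis by simp
qed

lemma hx_tail:
  assumes N: "0 < N"
  shows "integrable circ (\<lambda>x. (hx t x - clampN (real N) (hx t x))^2)"
    "(LINT x|circ. (hx t x - clampN (real N) (hx t x))^2) <= excess N t"
proof -
  let ?f = "\<lambda>x. (hx t x - clampN (real N) (hx t x))^2"
  have [measurable]: "clampN (real N) \<in> borel_measurable borel" by (rule borel_measurable_continuous_onI[OF clampN_cont])
  have m: "?f \<in> borel_measurable borel" by measurable
  have p: "periodic_fun_simple' ?f" using hx_periodic[of t] by (simp add: periodic_fun_simple'_def)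
  have ae: "AE \<xi> in lborel. (alpha (X t) \<xi>)^2 * ?f (y t \<xi>) <= (max 0 (\<bar>beta (X t) \<xi>\<bar> - real N * \<bar>alpha (X t) \<xi>\<bar>))^2"
    using hx_chain[of t]
  proof eventually_elim
    case (elim \<xi>)
    then show ?case using clampN_excess[of "real N" "alpha (X t) \<xi>" "beta (X t) \<xi>"] N by (cases "alpha (X t) \<xi> = 0") auto
  qed
  have i: "integrable lborel (\<lambda>\<xi>. (alpha (X t) \<xi>)^2 * ?f (y t \<xi>))"
    by (rule Bochner_Integration.integrable_bound[OF integrable_excess[of t N]]) (simp, use ae in eventually_elim, simp)
  then show "integrable circ ?f" using change_variables(2)[OF m p] by blast
  show "(LINT x|circ. ?f x) <= excess N t"
    unfolding change_variables(1)[OF m p, of t] excess_def by (rule integral_mono_AE[OF i integrable_excess ae])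
qed

text \<open>
  Below the level \<open>N\<close> convergence holds at all times.  The tail at time \<open>t\<close> is small since \<open>t\<close> is
  regular, and the tails at nearby times are small by continuity of the excess.
\<close>

lemma hx_L2_convergence:
  assumes gd: "regular t" and st: "s \<longlonglongrightarrow> t" and z0: "z \<longlonglongrightarrow> 0"
  shows "(\<lambda>n. LINT x|circ. (hx (s n) (x + z n) - hx t x)^2) \<longlonglongrightarrow> 0"
proof (rule LIMSEQ_I)
  fix e :: real assume e: "0 < e"
  have "\<forall>\<^sub>F N in sequentially. excess N t < e/12" using excess_regular[OF gd] e by (intro order_tendstoD(2)) auto
  moreover have "\<forall>\<^sub>F N::nat in sequentially. 0 < N" by (rule eventually_gt_at_top)
  ultimately have "\<forall>\<^sub>F N in sequentially. excess N t < e/12 \<and> 0 < N" by (rule eventually_conj)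
  then obtain N where N: "excess N t < e/12" "0 < N" by (auto simp: eventually_sequentially)
  define \<psi> where "\<psi> = clampN (real N)"
  have psi: "continuous_on UNIV \<psi>" "\<And>v. \<bar>\<psi> v\<bar> <= real N" using clampN_cont clampN_bound by (auto simp: \<psi>_def)
  have [measurable]: "\<psi> \<in> borel_measurable borel" by (rule borel_measurable_continuous_onI[OF psi(1)])
  have "\<forall>\<^sub>F n in sequentially. excess N (s n) < e/12"
    using excess_tendsto[OF st, of N] N(1) by (rule order_tendstoD(2))
  moreover have "\<forall>\<^sub>F n in sequentially. (LINT x|circ. (\<psi> (hx (s n) (x + z n)) - \<psi> (hx t x))^2) < e/12"
    using transported_truncated_convergence[OF transported_hx st z0 psi] e by (intro order_tendstoD(2)) auto
  ultimately have "\<forall>\<^sub>F n in sequentially. (LINT x|circ. (hx (s n) (x + z n) - hx t x)^2) < e"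
  proof eventually_elim
    case (elim n)
    let ?a = "\<lambda>x. hx (s n) (x + z n)" and ?b = "\<lambda>x. hx t x"
    have tp: "periodic_fun_simple' (\<lambda>x. (hx (s n) x - \<psi> (hx (s n) x))^2)"
      using hx_periodic[of "s n"] by (simp add: periodic_fun_simple'_def)
    have tm: "(\<lambda>x. (hx (s n) x - \<psi> (hx (s n) x))^2) \<in> borel_measurable borel" by measurable
    have t1: "integrable circ (\<lambda>x. (?a x - \<psi> (?a x))^2)" "(LINT x|circ. (?a x - \<psi> (?a x))^2) <= excess N (s n)"
      using circ_shift[OF tm tp, of "z n"] hx_tail[OF N(2), of "s n"] by (simp_all add: \<psi>_def)
    have t2: "integrable circ (\<lambda>x. (?b x - \<psi> (?b x))^2)" "(LINT x|circ. (?b x - \<psi> (?b x))^2) <= excess N t"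
      using hx_tail[OF N(2), of t] by (simp_all add: \<psi>_def)
    have t3: "integrable circ (\<lambda>x. (\<psi> (?a x) - \<psi> (?b x))^2)"
    proof (rule integrable_circ_bounded[of _ "(real N + real N)^2"])
      show "\<bar>(\<psi> (?a x) - \<psi> (?b x))^2\<bar> <= (real N + real N)^2" for x
        using power_mono[OF order_trans[OF abs_triangle_ineq4 add_mono[OF psi(2)[of "?a x"] psi(2)[of "?b x"]]] abs_ge_zero, of 2] by simp
    qed measurable
    have ib: "integrable circ (\<lambda>x. 3 * (\<psi> (?a x) - \<psi> (?b x))^2 + 3 * (?a x - \<psi> (?a x))^2 + 3 * (?b x - \<psi> (?b x))^2)"
      by (intro Bochner_Integration.integrable_add integrable_mult_right t1 t2 t3)
    have pw: "(?a x - ?b x)^2 <= 3 * (\<psi> (?a x) - \<psi> (?b x))^2 + 3 * (?a x - \<psi> (?a x))^2 + 3 * (?b x - \<psi> (?b x))^2" for x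
    proof -
      have "?a x - ?b x = (\<psi> (?a x) - \<psi> (?b x)) + (?a x - \<psi> (?a x)) + (\<psi> (?b x) - ?b x)" by simp
      then have "(?a x - ?b x)^2 <= 3 * (\<psi> (?a x) - \<psi> (?b x))^2 + 3 * (?a x - \<psi> (?a x))^2 + 3 * (\<psi> (?b x) - ?b x)^2"
        by (metis square_add3_le)
      then show ?thesis by (simp only: power2_commute[of "\<psi> (?b x)"])
    qed
    have "(LINT x|circ. (?a x - ?b x)^2) <= (LINT x|circ. 3 * (\<psi> (?a x) - \<psi> (?b x))^2 + 3 * (?a x - \<psi> (?a x))^2 + 3 * (?b x - \<psi> (?b x))^2)"
    proof (rule integral_mono[OF _ ib pw])
      show "integrable circ (\<lambda>x. (?a x - ?b x)^2)"
        by (rule Bochner_Integration.integrable_bound[OF ib]) (use pw in \<open>auto intro: order_trans[OF _ abs_ge_self]\<close>)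
    qed
    also have "... = 3 * (LINT x|circ. (\<psi> (?a x) - \<psi> (?b x))^2) + 3 * (LINT x|circ. (?a x - \<psi> (?a x))^2) + 3 * (LINT x|circ. (?b x - \<psi> (?b x))^2)"
      by (subst Bochner_Integration.integral_add[OF Bochner_Integration.integrable_add[OF integrable_mult_right[OF t3] integrable_mult_right[OF t1(1)]] integrable_mult_right[OF t2(1)]],
          subst Bochner_Integration.integral_add[OF integrable_mult_right[OF t3] integrable_mult_right[OF t1(1)]])
         (simp only: Bochner_Integration.integral_mult_right_zero)
    also have "... < e" using t1(2) t2(2) elim N(1) e by linarith
    finally show ?case .
  qed
  then show "\<exists>n0. \<forall>n\<ge>n0. norm ((LINT x|circ. (hx (s n) (x + z n) - hx t x)^2) - 0) < e"
    by (simp add: eventually_sequentially)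
qed

lemmas hx_L1_convergence = transported_L1_convergence[OF transported_hx _ _ hx_L2]
lemmas vx_L1_convergence = transported_L1_convergence[OF transported_vx _ _ vx_L2]

end

section \<open>Difference quotients in time\<close>

text \<open>
  The first term dominates below the level \<open>N\<close>, the second one above it.
\<close>

lemma powr_le_interpolation:
  fixes v :: real
  assumes p: "1 <= p" "p < 2" and N: "1 <= N"
  shows "\<bar>v\<bar> powr p <= N * \<bar>v\<bar> + N powr (p - 2) * v^2"
proof (cases "\<bar>v\<bar> <= N")
  case True
  have "\<bar>v\<bar> powr p = \<bar>v\<bar> * \<bar>v\<bar> powr (p - 1)" using powr_mult_base[of "\<bar>v\<bar>" "p - 1"] by simp
  also have "\<bar>v\<bar> powr (p - 1) <= N powr (p - 1)" using p True by (intro powr_mono2) auto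
  also have "... <= N powr 1" using p N by (intro powr_mono) auto
  also have "\<bar>v\<bar> * N powr 1 = N * \<bar>v\<bar>" using N by simp
  also have "... <= N * \<bar>v\<bar> + N powr (p - 2) * v^2" by simp
  finally show ?thesis by (simp add: mult_left_mono)
next
  case False
  have "\<bar>v\<bar> powr p = \<bar>v\<bar> powr (p - 2) * \<bar>v\<bar> powr 2" by (simp only: powr_add[symmetric]) simp
  also have "\<bar>v\<bar> powr 2 = v^2" using False N by (simp add: powr_numeral)
  also have "\<bar>v\<bar> powr (p - 2) * v^2 <= N powr (p - 2) * v^2"
    using False N p by (intro mult_right_mono powr_mono2') auto
  also have "... <= N * \<bar>v\<bar> + N powr (p - 2) * v^2" using N by simp
  finally show ?thesis .
qed

lemma Lp_tendsto_interpolation: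
  fixes f :: "'i => real => real"
  assumes m: "\<And>s. f s \<in> borel_measurable borel"
    and L2: "\<And>s. integrable circ (\<lambda>x. (f s x)^2)" "\<And>s. (LINT x|circ. (f s x)^2) <= M"
    and L1: "((\<lambda>s. LINT x|circ. \<bar>f s x\<bar>) \<longlongrightarrow> 0) Fl" and p: "1 <= p" "p < 2"
  shows "\<And>s. integrable circ (\<lambda>x. \<bar>f s x\<bar> powr p)" "((\<lambda>s. LINT x|circ. \<bar>f s x\<bar> powr p) \<longlongrightarrow> 0) Fl"
proof -
  note m [measurable]
  have i1: "integrable circ (\<lambda>x. \<bar>f s x\<bar>)" for s
    by (rule Bochner_Integration.integrable_bound[OF Bochner_Integration.integrable_add[OF integrable_circ_const[of 1] L2(1)[of s]]])
       (use abs_le_one_plus_square in \<open>auto intro: order_trans[OF _ abs_ge_self]\<close>)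
  have ib: "integrable circ (\<lambda>x. N * \<bar>f s x\<bar> + N powr (p - 2) * (f s x)^2)" for s N
    by (intro Bochner_Integration.integrable_add integrable_mult_right i1 L2)
  show ip: "integrable circ (\<lambda>x. \<bar>f s x\<bar> powr p)" for s
    by (rule Bochner_Integration.integrable_bound[OF ib[of 1 s]])
       (use powr_le_interpolation[OF p, of 1] in \<open>auto intro: order_trans[OF _ abs_ge_self]\<close>)
  have le: "(LINT x|circ. \<bar>f s x\<bar> powr p) <= N * (LINT x|circ. \<bar>f s x\<bar>) + N powr (p - 2) * M" if N: "1 <= N" for s N
  proof -
    have "(LINT x|circ. \<bar>f s x\<bar> powr p) <= (LINT x|circ. N * \<bar>f s x\<bar> + N powr (p - 2) * (f s x)^2)"
      by (rule integral_mono[OF ip ib powr_le_interpolation[OF p N]])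
    also have "... = N * (LINT x|circ. \<bar>f s x\<bar>) + N powr (p - 2) * (LINT x|circ. (f s x)^2)"
      by (subst Bochner_Integration.integral_add[OF integrable_mult_right[OF i1] integrable_mult_right[OF L2(1)]])
         (simp only: Bochner_Integration.integral_mult_right_zero)
    also have "... <= N * (LINT x|circ. \<bar>f s x\<bar>) + N powr (p - 2) * M"
      by (intro add_left_mono mult_left_mono L2) simp
    finally show ?thesis .
  qed
  show "((\<lambda>s. LINT x|circ. \<bar>f s x\<bar> powr p) \<longlongrightarrow> 0) Fl"
  proof (rule tendstoI)
    fix e :: real assume e: "0 < e"
    have "((\<lambda>N. N powr (p - 2) * M) \<longlongrightarrow> 0 * M) at_top"
      by (intro tendsto_mult tendsto_const tendsto_neg_powr filterlim_ident) (use p in simp)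
    then have "\<forall>\<^sub>F N in at_top. N powr (p - 2) * M < e/2" using e by (intro order_tendstoD(2)) auto
    then have "\<exists>N0::real. \<forall>N\<ge>N0. N powr (p - 2) * M < e/2" by (simp add: eventually_at_top_linorder)
    then obtain N0 :: real where N0: "\<forall>N\<ge>N0. N powr (p - 2) * M < e/2" by blast
    define N where "N = max 1 N0"
    have N: "1 <= N" "N powr (p - 2) * M < e/2" using N0 by (auto simp: N_def)
    have "\<forall>\<^sub>F s in Fl. (LINT x|circ. \<bar>f s x\<bar>) < e / (2 * N)" using L1 e N by (intro order_tendstoD(2)) auto
    then show "\<forall>\<^sub>F s in Fl. dist (LINT x|circ. \<bar>f s x\<bar> powr p) 0 < e"
    proof eventually_elim
      case (elim s)
      have "N * (LINT x|circ. \<bar>f s x\<bar>) < e/2" using elim N by (simp add: field_simps)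
      then have "(LINT x|circ. \<bar>f s x\<bar> powr p) < e" using le[OF N(1), of s] N(2) by linarith
      moreover have "0 <= (LINT x|circ. \<bar>f s x\<bar> powr p)" by (rule Bochner_Integration.integral_nonneg) simp
      ultimately show ?case by simp
    qed
  qed
qed

lemma has_density_increment_bound:
  assumes G: "has_density G g"
  shows "ennreal \<bar>G b - G a\<bar> <= (\<integral>\<^sup>+z. ennreal \<bar>g z\<bar> * indicator {min a b..max a b} z \<partial>lborel)"
proof -
  have "\<bar>G b - G a\<bar> = \<bar>LINT z|lborel. indicator {min a b..max a b} z *\<^sub>R g z\<bar>"
    using has_density_integral[OF G, of "min a b" "max a b"]
    by (cases "a <= b") (simp_all add: set_lebesgue_integral_def min_def max_def abs_minus_commute)
  also have "ennreal ... <= (\<integral>\<^sup>+z. ennreal (norm (indicator {min a b..max a b} z *\<^sub>R g z)) \<partial>lborel)"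
    unfolding real_norm_def[symmetric]
    by (rule integral_norm_bound_ennreal) (use has_density_integrable[OF G] in \<open>simp add: set_integrable_def\<close>)
  also have "... = (\<integral>\<^sup>+z. ennreal \<bar>g z\<bar> * indicator {min a b..max a b} z \<partial>lborel)"
    by (intro nn_integral_cong) (simp add: indicator_def)
  finally show ?thesis .
qed

lemma ennreal_power_add_le:
  fixes a :: real and R :: ennreal
  assumes k: "k = 1 \<or> k = (2::nat)" and a: "0 <= a"
  shows "(ennreal a + R) ^ k <= ennreal (2 * a ^ k) + 2 * R ^ k"
proof (cases R)
  case (real r)
  have "(a + r) ^ k <= 2 * a ^ k + 2 * r ^ k"
    using k square_add_le[of a r] a real by auto
  then have "ennreal ((a + r) ^ k) <= ennreal (2 * a ^ k + 2 * r ^ k)" by (rule ennreal_leI)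
  moreover have "(ennreal a + R) ^ k = ennreal ((a + r) ^ k)" using ennreal_power[of "a + r" k] a real by simp
  moreover have "ennreal (2 * a ^ k + 2 * r ^ k) = ennreal (2 * a ^ k) + 2 * R ^ k"
    using a real by (simp add: ennreal_power ennreal_mult)
  ultimately show ?thesis by simp
next
  case top
  then show ?thesis using k by (auto simp: ennreal_mult_top)
qed

context flow
begin

lemma real_lipschitz_of_derivative:
  assumes "\<And>\<tau>. (g has_real_derivative g' \<tau>) (at \<tau>)" "\<And>\<tau>. \<bar>g' \<tau>\<bar> <= (C::real)"
  shows "\<bar>g s - g t\<bar> <= C * \<bar>s - t\<bar>"
  using field_differentiable_bound[of UNIV g g' C s t] assms by (simp add: has_field_derivative_at_within)

lemma y_lipschitz: "\<bar>y s \<xi> - y t \<xi>\<bar> <= Cb * \<bar>s - t\<bar>"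
  by (rule real_lipschitz_of_derivative[OF y_ode abs_bounds(1)])

lemma U_lipschitz: "0 <= \<xi> ==> \<bar>U (X s) \<xi> - U (X t) \<xi>\<bar> <= Cb * \<bar>s - t\<bar>"
  by (rule real_lipschitz_of_derivative[OF U_derivative[OF X_ode]]) (simp_all add: abs_bounds)

text \<open>
  The mean value theorem, with the oscillation of the derivative uniform in the label.
\<close>

lemma uniform_difference_quotient:
  assumes f: "loc_lipschitz f" and g: "\<And>\<tau> \<xi>. 0 <= \<xi> ==> ((\<lambda>\<tau>. g \<tau> \<xi>) has_real_derivative f (X \<tau>) \<xi>) (at \<tau>)" and e: "0 < e"
  shows "\<forall>\<^sub>F s in nhds t. \<forall>\<xi>\<ge>0. \<bar>g s \<xi> - g t \<xi> - (s - t) * f (X t) \<xi>\<bar> <= e * \<bar>s - t\<bar>"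
proof -
  have "\<exists>d>0. \<forall>s. dist s t < d --> (\<forall>\<xi>. \<bar>f (X s) \<xi> - f (X t) \<xi>\<bar> < e)"
    using loc_lipschitz_uniform_continuity[OF f X_isCont e, of t] by (simp add: eventually_nhds_metric)
  then obtain d where d: "d > 0" "\<And>s \<xi>. dist s t < d ==> \<bar>f (X s) \<xi> - f (X t) \<xi>\<bar> < e" by blast
  have "\<bar>g s \<xi> - g t \<xi> - (s - t) * f (X t) \<xi>\<bar> <= e * \<bar>s - t\<bar>" if s: "dist s t < d" and \<xi>: "0 <= \<xi>" for s \<xi>
  proof -
    have "norm ((g s \<xi> - s * f (X t) \<xi>) - (g t \<xi> - t * f (X t) \<xi>)) <= e * norm (s - t)"
    proof (rule field_differentiable_bound[where S="ball t d" and f="\<lambda>\<tau>. g \<tau> \<xi> - \<tau> * f (X t) \<xi>" and f'="\<lambda>\<tau>. f (X \<tau>) \<xi> - f (X t) \<xi>"])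
      fix \<tau> assume \<tau>: "\<tau> \<in> ball t d"
      show "((\<lambda>\<tau>. g \<tau> \<xi> - \<tau> * f (X t) \<xi>) has_field_derivative f (X \<tau>) \<xi> - f (X t) \<xi>) (at \<tau> within ball t d)"
        by (rule has_field_derivative_at_within) (auto intro!: derivative_eq_intros g \<xi>)
      show "norm (f (X \<tau>) \<xi> - f (X t) \<xi>) <= e" using d(2)[of \<tau> \<xi>] \<tau> by (simp add: dist_commute)
    qed (use s d in \<open>auto simp: dist_commute\<close>)
    then show ?thesis by (simp add: algebra_simps)
  qed
  then show ?thesis using d(1) unfolding eventually_nhds_metric by blast
qed

text \<open>
  The mean deviation of the gradient at time \<open>s\<close> from the value \<open>\<kappa> x\<close>, over the interval around \<open>x\<close> that
  characteristics can traverse between the times \<open>t\<close> and \<open>s\<close>, scaled to fixed length.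
\<close>

definition spread :: "(real => real) => real => real => nat => real => ennreal" where
  "spread \<kappa> s t k x = (\<integral>\<^sup>+\<theta>. ennreal (\<bar>hx s (x + (s - t) * \<theta>) - \<kappa> x\<bar> ^ k) * indicator {- Cb..Cb} \<theta> \<partial>lborel)"

lemma uu_increment_bound:
  assumes st: "s \<noteq> t" and x': "\<bar>x' - x\<bar> <= Cb * \<bar>s - t\<bar>"
  shows "ennreal (\<bar>(uu s x' - \<kappa> x * x') - (uu s x - \<kappa> x * x)\<bar> / \<bar>s - t\<bar>) <= spread \<kappa> s t 1 x"
proof -
  let ?d = "s - t" and ?c = "\<bar>(uu s x' - \<kappa> x * x') - (uu s x - \<kappa> x * x)\<bar>"
  (* Subtracting a linear function turns the increment into an integral of hx s - kappa. *)
  have dens: "has_density (\<lambda>z. uu s z - \<kappa> x * z) (\<lambda>z. hx s z - \<kappa> x * 1)"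
    by (intro has_density_diff uu_density has_density_cmult has_density_id)
  have "ennreal ?c <= (\<integral>\<^sup>+z. ennreal \<bar>hx s z - \<kappa> x * 1\<bar> * indicator {min x x'..max x x'} z \<partial>lborel)"
    by (rule has_density_increment_bound[OF dens])
  also have "... <= (\<integral>\<^sup>+z. ennreal \<bar>hx s z - \<kappa> x\<bar> * indicator {x - Cb * \<bar>?d\<bar>..x + Cb * \<bar>?d\<bar>} z \<partial>lborel)"
    using x' Cb_pos by (intro nn_integral_mono) (auto simp: indicator_def abs_le_iff min_def max_def split: if_splits)
  also have "... = ennreal \<bar>?d\<bar> * (\<integral>\<^sup>+\<theta>. ennreal \<bar>hx s (x + ?d * \<theta>) - \<kappa> x\<bar> * indicator {x - Cb * \<bar>?d\<bar>..x + Cb * \<bar>?d\<bar>} (x + ?d * \<theta>) \<partial>lborel)"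
    by (rule nn_integral_real_affine) (use st in auto)
  also have "(\<integral>\<^sup>+\<theta>. ennreal \<bar>hx s (x + ?d * \<theta>) - \<kappa> x\<bar> * indicator {x - Cb * \<bar>?d\<bar>..x + Cb * \<bar>?d\<bar>} (x + ?d * \<theta>) \<partial>lborel) = spread \<kappa> s t 1 x"
    unfolding spread_def
  proof (rule nn_integral_cong)
    fix \<theta> :: real
    have "x + ?d * \<theta> \<in> {x - Cb * \<bar>?d\<bar>..x + Cb * \<bar>?d\<bar>} \<longleftrightarrow> \<bar>?d * \<theta>\<bar> <= Cb * \<bar>?d\<bar>" by auto
    also have "... \<longleftrightarrow> \<bar>\<theta>\<bar> <= Cb" using st by (simp add: abs_mult mult.commute)
    also have "... \<longleftrightarrow> \<theta> \<in> {- Cb..Cb}" by auto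
    finally show "ennreal \<bar>hx s (x + ?d * \<theta>) - \<kappa> x\<bar> * indicator {x - Cb * \<bar>?d\<bar>..x + Cb * \<bar>?d\<bar>} (x + ?d * \<theta>) =
       ennreal (\<bar>hx s (x + ?d * \<theta>) - \<kappa> x\<bar> ^ 1) * indicator {- Cb..Cb} \<theta>" by (simp add: indicator_def)
  qed
  finally have le: "ennreal ?c <= ennreal \<bar>?d\<bar> * spread \<kappa> s t 1 x" .
  show ?thesis
  proof (cases "spread \<kappa> s t 1 x")
    case (real r)
    then have "?c <= \<bar>?d\<bar> * r" using le by (simp add: ennreal_mult[symmetric] ennreal_le_iff)
    then have "?c / \<bar>?d\<bar> <= r" using st by (simp add: divide_le_eq mult.commute)
    then show ?thesis using real by (simp add: ennreal_leI)
  qed simp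
qed

lemma spread_power:
  assumes k: "k = 1 \<or> k = 2"
  shows "(spread \<kappa> s t 1 x) ^ k <= ennreal (2 * Cb) * spread \<kappa> s t k x"
proof -
  have C1: "1 <= ennreal (2 * Cb)" using Cb_pos by (simp add: ennreal_1[symmetric] del: ennreal_1)
  let ?f = "\<lambda>\<theta>. ennreal \<bar>hx s (x + (s - t) * \<theta>) - \<kappa> x\<bar> * indicator {- Cb..Cb} \<theta>" and ?g = "\<lambda>\<theta>. indicator {- Cb..Cb} \<theta> :: ennreal"
  have "(\<integral>\<^sup>+\<theta>. ?f \<theta> * ?g \<theta> \<partial>lborel)^2 <= (\<integral>\<^sup>+\<theta>. (?f \<theta>)^2 \<partial>lborel) * (\<integral>\<^sup>+\<theta>. (?g \<theta>)^2 \<partial>lborel)"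
    by (rule Cauchy_Schwarz_nn_integral) measurable
  moreover have "(\<integral>\<^sup>+\<theta>. ?f \<theta> * ?g \<theta> \<partial>lborel) = spread \<kappa> s t 1 x"
    unfolding spread_def by (intro nn_integral_cong) (simp add: indicator_def)
  moreover have "(\<integral>\<^sup>+\<theta>. (?f \<theta>)^2 \<partial>lborel) = spread \<kappa> s t 2 x"
    unfolding spread_def by (intro nn_integral_cong) (simp add: indicator_def ennreal_power)
  moreover have "(\<integral>\<^sup>+\<theta>. (?g \<theta>)^2 \<partial>lborel) = (\<integral>\<^sup>+\<theta>. ?g \<theta> \<partial>lborel)"
    by (intro nn_integral_cong) (simp add: indicator_def)
  moreover have "(\<integral>\<^sup>+\<theta>. ?g \<theta> \<partial>lborel) = ennreal (2 * Cb)" using Cb_pos by simp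
  ultimately have 2: "(spread \<kappa> s t 1 x)^2 <= ennreal (2 * Cb) * spread \<kappa> s t 2 x" by (simp add: mult.commute)
  show ?thesis using k 2 mult_right_mono[OF C1, of "spread \<kappa> s t 1 x"] by auto
qed

lemma spread_borel [measurable]:
  assumes [measurable]: "\<kappa> \<in> borel_measurable borel"
  shows "spread \<kappa> s t k \<in> borel_measurable borel"
  unfolding spread_def[abs_def] by measurable

lemma spread_integral:
  assumes \<kappa> [measurable]: "\<kappa> \<in> borel_measurable borel"
  shows "(\<integral>\<^sup>+x. spread \<kappa> s t k x \<partial>circ) =
    (\<integral>\<^sup>+\<theta>. (\<integral>\<^sup>+x. ennreal (\<bar>hx s (x + (s - t) * \<theta>) - \<kappa> x\<bar> ^ k) \<partial>circ) * indicator {- Cb..Cb} \<theta> \<partial>lborel)"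
proof -
  interpret C: finite_measure circ by (rule finite_measure_circ)
  interpret CL: pair_sigma_finite lborel circ by unfold_locales
  have "(\<integral>\<^sup>+x. spread \<kappa> s t k x \<partial>circ) =
    (\<integral>\<^sup>+\<theta>. (\<integral>\<^sup>+x. ennreal (\<bar>hx s (x + (s - t) * \<theta>) - \<kappa> x\<bar> ^ k) * indicator {- Cb..Cb} \<theta> \<partial>circ) \<partial>lborel)"
    unfolding spread_def by (rule CL.Fubini') measurable
  also have "... = (\<integral>\<^sup>+\<theta>. (\<integral>\<^sup>+x. ennreal (\<bar>hx s (x + (s - t) * \<theta>) - \<kappa> x\<bar> ^ k) \<partial>circ) * indicator {- Cb..Cb} \<theta> \<partial>lborel)"
    by (intro nn_integral_cong nn_integral_multc) measurable
  finally show ?thesis .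
qed

lemma hx_difference_integrable:
  assumes k: "k = 1 \<or> k = (2::nat)"
  shows "integrable circ (\<lambda>x. \<bar>hx s (x + c) - hx t x\<bar> ^ k)" "(LINT x|circ. \<bar>hx s (x + c) - hx t x\<bar> ^ k) <= 1 + 4 * E"
proof -
  have m: "(\<lambda>x. (hx s x)^2) \<in> borel_measurable borel" by measurable
  note sh = circ_shift[OF m hx_sq_periodic, of c]
  have i: "integrable circ (\<lambda>x. (hx s (x + c))^2)" "(LINT x|circ. (hx s (x + c))^2) <= E" using sh hx_L2[of s] by auto
  have ib: "integrable circ (\<lambda>x. 1 + (2 * (hx s (x + c))^2 + 2 * (hx t x)^2))"
    by (intro Bochner_Integration.integrable_add integrable_mult_right i integrable_circ_const hx_L2)
  have pw: "\<bar>hx s (x + c) - hx t x\<bar> ^ k <= 1 + (2 * (hx s (x + c))^2 + 2 * (hx t x)^2)" for x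
    using k abs_le_one_plus_square[of "hx s (x + c) - hx t x"] square_diff_le[of "hx s (x + c)" "hx t x"] by auto
  show id: "integrable circ (\<lambda>x. \<bar>hx s (x + c) - hx t x\<bar> ^ k)"
    by (rule Bochner_Integration.integrable_bound[OF ib]) (use pw in \<open>auto intro: order_trans[OF _ abs_ge_self]\<close>)
  have "(LINT x|circ. \<bar>hx s (x + c) - hx t x\<bar> ^ k) <= (LINT x|circ. 1 + (2 * (hx s (x + c))^2 + 2 * (hx t x)^2))"
    by (rule integral_mono[OF id ib pw])
  also have "... = 1 + (2 * (LINT x|circ. (hx s (x + c))^2) + 2 * (LINT x|circ. (hx t x)^2))"
    by (subst Bochner_Integration.integral_add[OF integrable_circ_const Bochner_Integration.integrable_add[OF integrable_mult_right[OF i(1)] integrable_mult_right[OF hx_L2(1)]]],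
        subst Bochner_Integration.integral_add[OF integrable_mult_right[OF i(1)] integrable_mult_right[OF hx_L2(1)]])
       (simp only: integral_circ_const Bochner_Integration.integral_mult_right_zero)
  also have "... <= 1 + 4 * E" using i(2) hx_L2(2)[of t] by linarith
  finally show "(LINT x|circ. \<bar>hx s (x + c) - hx t x\<bar> ^ k) <= 1 + 4 * E" .
qed

text \<open>
  \<open>x'\<close> is the position at time \<open>s\<close> of the particle that is at \<open>x\<close> at time \<open>t\<close>.
\<close>

lemma lab_path:
  obtains \<xi> x' where "\<xi> = lab t x" "0 <= \<xi>" "uu t x = U (X t) \<xi>" "uu s x' = U (X s) \<xi>" "x' - x = y s \<xi> - y t \<xi>"
    "\<bar>x' - x\<bar> <= Cb * \<bar>s - t\<bar>"
proof -
  obtain n :: int where n: "x = y t (lab t x) + of_int n" using lab(2) by blast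
  have 1: "uu s (y s (lab t x) + of_int n) = U (X s) (lab t x)"
    using periodic_int_shift[OF uu_periodic] by (simp add: uu_y)
  have 2: "(y s (lab t x) + of_int n) - x = y s (lab t x) - y t (lab t x)" using n by linarith
  have 3: "\<bar>(y s (lab t x) + of_int n) - x\<bar> <= Cb * \<bar>s - t\<bar>" unfolding 2 by (rule y_lipschitz)
  show ?thesis by (rule that[OF refl _ uu_lab 1 2 3]) (use lab(1)[of t x] in simp)
qed

text \<open>
  Going from \<open>(t, x)\<close> to \<open>(s, x')\<close> along the characteristic changes \<open>u\<close> by at most \<open>Cb \<bar>s - t\<bar>\<close>; going back
  from \<open>x'\<close> to \<open>x\<close> at time \<open>s\<close> costs \<open>\<bar>s - t\<bar>\<close> times a mean of the gradient, bounded in \<open>L^2\<close>.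
\<close>

lemma uu_lipschitz_L2:
  "integrable circ (\<lambda>x. (uu s x - uu t x)^2)" "(LINT x|circ. (uu s x - uu t x)^2) <= (2 * Cb^2 + 8 * Cb^2 * E) * (s - t)^2"
proof -
  have b: "\<bar>(uu s x - uu t x)^2\<bar> <= (Cb + Cb)^2" for x
    using power_mono[OF order_trans[OF abs_triangle_ineq4 add_mono[OF uu_bound[of s x] uu_bound[of t x]]] abs_ge_zero, of 2] by simp
  show i: "integrable circ (\<lambda>x. (uu s x - uu t x)^2)"
    by (rule integrable_circ_bounded[OF _ b]) measurable
  show "(LINT x|circ. (uu s x - uu t x)^2) <= (2 * Cb^2 + 8 * Cb^2 * E) * (s - t)^2"
  proof (cases "s = t")
    case False
    let ?d = "\<bar>s - t\<bar>" and ?S = "spread (\<lambda>x. 0) s t"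
    have d: "?d > 0" using False by simp
    have "ennreal (((uu s x - uu t x) / ?d)^2) <= ennreal (2 * Cb^2) + 2 * (ennreal (2 * Cb) * ?S 2 x)" for x
    proof -
      obtain \<xi> x' where \<xi>: "\<xi> = lab t x" "0 <= \<xi>" "uu t x = U (X t) \<xi>" "uu s x' = U (X s) \<xi>" "x' - x = y s \<xi> - y t \<xi>"
        "\<bar>x' - x\<bar> <= Cb * \<bar>s - t\<bar>" by (rule lab_path)
      have "ennreal (\<bar>(uu s x' - 0 * x') - (uu s x - 0 * x)\<bar> / ?d) <= ?S 1 x"
        by (rule uu_increment_bound[OF False \<xi>(6)])
      then have J: "ennreal (\<bar>uu s x' - uu s x\<bar> / ?d) <= ?S 1 x" by simp
      have "\<bar>uu s x - uu t x\<bar> <= \<bar>uu s x' - uu t x\<bar> + \<bar>uu s x' - uu s x\<bar>" by (simp add: abs_if)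
      also have "\<bar>uu s x' - uu t x\<bar> <= Cb * ?d" using U_lipschitz[OF \<xi>(2), of s t] \<xi> by simp
      finally have "\<bar>uu s x - uu t x\<bar> / ?d <= (Cb * ?d + \<bar>uu s x' - uu s x\<bar>) / ?d" using d by (intro divide_right_mono) auto
      then have "\<bar>uu s x - uu t x\<bar> / ?d <= Cb + \<bar>uu s x' - uu s x\<bar> / ?d" using d by (simp add: add_divide_distrib)
      then have "ennreal (\<bar>uu s x - uu t x\<bar> / ?d) <= ennreal (Cb + \<bar>uu s x' - uu s x\<bar> / ?d)" by (rule ennreal_leI)
      also have "... = ennreal Cb + ennreal (\<bar>uu s x' - uu s x\<bar> / ?d)" using Cb_pos by (intro ennreal_plus) auto
      also have "... <= ennreal Cb + ?S 1 x" by (intro add_left_mono J)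
      finally have "(ennreal (\<bar>uu s x - uu t x\<bar> / ?d))^2 <= (ennreal Cb + ?S 1 x)^2" by (rule power_mono) simp
      also have "... <= ennreal (2 * Cb^2) + 2 * (?S 1 x)^2" using Cb_pos by (intro ennreal_power_add_le) auto
      also have "... <= ennreal (2 * Cb^2) + 2 * (ennreal (2 * Cb) * ?S 2 x)"
        by (intro add_left_mono mult_left_mono spread_power) auto
      finally show ?thesis by (simp add: ennreal_power power_divide)
    qed
    then have "(\<integral>\<^sup>+x. ennreal (((uu s x - uu t x) / ?d)^2) \<partial>circ) <= (\<integral>\<^sup>+x. ennreal (2 * Cb^2) + 2 * (ennreal (2 * Cb) * ?S 2 x) \<partial>circ)"
      by (intro nn_integral_mono) auto
    also have "... = ennreal (2 * Cb^2) + 2 * (ennreal (2 * Cb) * (\<integral>\<^sup>+x. ?S 2 x \<partial>circ))"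
      by (simp add: nn_integral_add nn_integral_cmult prob_circ)
    also have "(\<integral>\<^sup>+x. ?S 2 x \<partial>circ) = (\<integral>\<^sup>+\<theta>. (\<integral>\<^sup>+x. ennreal (\<bar>hx s (x + (s - t) * \<theta>) - 0\<bar> ^ 2) \<partial>circ) * indicator {- Cb..Cb} \<theta> \<partial>lborel)"
      by (rule spread_integral) simp
    also have "... <= (\<integral>\<^sup>+\<theta>. ennreal E * indicator {- Cb..Cb} \<theta> \<partial>lborel)"
    proof (intro nn_integral_mono mult_right_mono)
      fix \<theta>
      have m: "(\<lambda>x. (hx s x)^2) \<in> borel_measurable borel" by measurable
      have "(\<integral>\<^sup>+x. ennreal (\<bar>hx s (x + (s - t) * \<theta>) - 0\<bar> ^ 2) \<partial>circ) = ennreal (LINT x|circ. (hx s (x + (s - t) * \<theta>))^2)"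
        using circ_shift(2)[OF m hx_sq_periodic] hx_L2(1) by (simp add: nn_integral_eq_integral)
      then show "(\<integral>\<^sup>+x. ennreal (\<bar>hx s (x + (s - t) * \<theta>) - 0\<bar> ^ 2) \<partial>circ) <= ennreal E"
        using circ_shift(1)[OF m hx_sq_periodic, of "(s - t) * \<theta>"] hx_L2(2)[of s] by (simp add: ennreal_leI)
    qed simp
    also have "(\<integral>\<^sup>+\<theta>. ennreal E * indicator {- Cb..Cb} \<theta> \<partial>lborel) = ennreal (E * (2 * Cb))"
      using Cb_pos E_nonneg by (simp add: nn_integral_cmult ennreal_mult)
    finally have "(\<integral>\<^sup>+x. ennreal (((uu s x - uu t x) / ?d)^2) \<partial>circ) <= ennreal (2 * Cb^2) + 2 * (ennreal (2 * Cb) * ennreal (E * (2 * Cb)))"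
      by (simp add: mult_left_mono add_left_mono)
    also have "... = ennreal (2 * Cb^2 + 8 * Cb^2 * E)"
    proof -
      have "2 * (ennreal (2 * Cb) * ennreal (E * (2 * Cb))) = ennreal 2 * (ennreal (2 * Cb) * ennreal (E * (2 * Cb)))" by simp
      also have "... = ennreal (2 * ((2 * Cb) * (E * (2 * Cb))))" using Cb_pos E_nonneg by (simp only: ennreal_mult mult_nonneg_nonneg)
      also have "2 * ((2 * Cb) * (E * (2 * Cb))) = 8 * Cb^2 * E" by (simp add: power2_eq_square)
      finally show ?thesis using Cb_pos E_nonneg by (simp add: ennreal_plus)
    qed
    finally have "(LINT x|circ. ((uu s x - uu t x) / ?d)^2) <= 2 * Cb^2 + 8 * Cb^2 * E"
      using E_nonneg by (intro integral_real_bounded) auto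
    moreover have "(LINT x|circ. ((uu s x - uu t x) / ?d)^2) = (LINT x|circ. (uu s x - uu t x)^2) / (s - t)^2"
      by (simp add: power_divide)
    ultimately show ?thesis using False by (simp add: divide_le_eq)
  qed simp
qed

definition dq :: "real => real => real => real" where "dq s t x = (uu s x - uu t x) / (s - t) - vx t x"

lemma dq_borel [measurable]: "dq s t \<in> borel_measurable borel" unfolding dq_def[abs_def] by measurable

lemma dq_L2: "integrable circ (\<lambda>x. (dq s t x)^2)"
  "(LINT x|circ. (dq s t x)^2) <= 2 * (2 * Cb^2 + 8 * Cb^2 * E) + 2 * (2 * Cb^2 * E + 2 * Cb^2)"
proof -
  let ?a = "\<lambda>x. (uu s x - uu t x) / (s - t)"
  have ia: "integrable circ (\<lambda>x. (?a x)^2)" using uu_lipschitz_L2(1)[of s t] by (simp add: power_divide)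
  have la: "(LINT x|circ. (?a x)^2) <= 2 * Cb^2 + 8 * Cb^2 * E"
    using uu_lipschitz_L2(2)[of s t] E_nonneg by (cases "s = t") (simp_all add: power_divide divide_le_eq)
  have ib: "integrable circ (\<lambda>x. 2 * (?a x)^2 + 2 * (vx t x)^2)"
    by (intro Bochner_Integration.integrable_add integrable_mult_right ia vx_L2)
  have pw: "(dq s t x)^2 <= 2 * (?a x)^2 + 2 * (vx t x)^2" for x unfolding dq_def by (rule square_diff_le)
  show i: "integrable circ (\<lambda>x. (dq s t x)^2)"
    by (rule Bochner_Integration.integrable_bound[OF ib]) (use pw in \<open>auto intro: order_trans[OF _ abs_ge_self]\<close>)
  have "(LINT x|circ. (dq s t x)^2) <= (LINT x|circ. 2 * (?a x)^2 + 2 * (vx t x)^2)" by (rule integral_mono[OF i ib pw])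
  also have "... = 2 * (LINT x|circ. (?a x)^2) + 2 * (LINT x|circ. (vx t x)^2)"
    by (subst Bochner_Integration.integral_add[OF integrable_mult_right[OF ia] integrable_mult_right[OF vx_L2(1)]])
       (simp only: Bochner_Integration.integral_mult_right_zero)
  also have "... <= 2 * (2 * Cb^2 + 8 * Cb^2 * E) + 2 * (2 * Cb^2 * E + 2 * Cb^2)"
    by (intro add_mono mult_left_mono la vx_L2) simp_all
  finally show "(LINT x|circ. (dq s t x)^2) <= 2 * (2 * Cb^2 + 8 * Cb^2 * E) + 2 * (2 * Cb^2 * E + 2 * Cb^2)" .
qed

text \<open>
  The error splits into the error of the time derivative of \<open>U\<close> along the characteristic, the gradient
  times the error of the speed of the characteristic, and the mean deviation of the gradient at time
  \<open>s\<close> from its value at \<open>(t, x)\<close>.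
\<close>

lemma dq_bound:
  assumes st: "s \<noteq> t" and e: "0 <= e"
    and yq: "\<And>\<xi>. 0 <= \<xi> ==> \<bar>y s \<xi> - y t \<xi> - (s - t) * U (X t) \<xi>\<bar> <= e * \<bar>s - t\<bar>"
    and uq: "\<And>\<xi>. 0 <= \<xi> ==> \<bar>U (X s) \<xi> - U (X t) \<xi> - (s - t) * (- Q (X t) \<xi>)\<bar> <= e * \<bar>s - t\<bar>"
  shows "ennreal \<bar>dq s t x\<bar> <= ennreal (e * (1 + \<bar>hx t x\<bar>)) + spread (hx t) s t 1 x"
proof -
  obtain \<xi> x' where \<xi>: "\<xi> = lab t x" "0 <= \<xi>" "uu t x = U (X t) \<xi>" "uu s x' = U (X s) \<xi>" "x' - x = y s \<xi> - y t \<xi>"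
    "\<bar>x' - x\<bar> <= Cb * \<bar>s - t\<bar>" by (rule lab_path)
  (* The increment of u(s) between x and x' is compared with its linearization of slope kappa. *)
  define \<kappa> where "\<kappa> = hx t x"
  define a where "a = U (X s) \<xi> - U (X t) \<xi> - (s - t) * (- Q (X t) \<xi>)"
  define b where "b = y s \<xi> - y t \<xi> - (s - t) * U (X t) \<xi>"
  define c where "c = (uu s x' - \<kappa> * x') - (uu s x - \<kappa> * x)"
  have d: "0 < \<bar>s - t\<bar>" using st by simp
  have "dq s t x * (s - t) = (uu s x - uu t x) - vx t x * (s - t)"
    unfolding dq_def left_diff_distrib[of "(uu s x - uu t x) / (s - t)"] using st by simp
  also have "... = a - \<kappa> * b - c"
  proof -
    have v: "vx t x = - U (X t) \<xi> * \<kappa> - Q (X t) \<xi>" by (simp add: vx_def qx_def \<xi>(1,3)[symmetric] \<kappa>_def[symmetric])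
    have c: "c = U (X s) \<xi> - uu s x - \<kappa> * (y s \<xi> - y t \<xi>)" unfolding c_def \<xi>(4) \<xi>(5)[symmetric] by (simp add: algebra_simps)
    show ?thesis unfolding v c a_def b_def \<xi>(3) by (simp add: algebra_simps)
  qed
  finally have id: "dq s t x * (s - t) = a - \<kappa> * b - c" .
  have "\<bar>dq s t x\<bar> * \<bar>s - t\<bar> = \<bar>a - \<kappa> * b - c\<bar>" unfolding abs_mult[symmetric] id ..
  also have "... <= \<bar>a\<bar> + \<bar>\<kappa> * b\<bar> + \<bar>c\<bar>" using abs_triangle_ineq4[of "a - \<kappa> * b" c] abs_triangle_ineq4[of a "\<kappa> * b"] by linarith
  also have "\<bar>\<kappa> * b\<bar> <= \<bar>\<kappa>\<bar> * (e * \<bar>s - t\<bar>)" unfolding abs_mult b_def by (intro mult_left_mono yq \<xi>) simp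
  also have "\<bar>a\<bar> <= e * \<bar>s - t\<bar>" unfolding a_def by (intro uq \<xi>)
  also have "e * \<bar>s - t\<bar> + \<bar>\<kappa>\<bar> * (e * \<bar>s - t\<bar>) + \<bar>c\<bar> = (e * (1 + \<bar>\<kappa>\<bar>) + \<bar>c\<bar> / \<bar>s - t\<bar>) * \<bar>s - t\<bar>"
    using d by (simp add: algebra_simps)
  finally have "\<bar>dq s t x\<bar> <= e * (1 + \<bar>\<kappa>\<bar>) + \<bar>c\<bar> / \<bar>s - t\<bar>" using d by simp
  then have "ennreal \<bar>dq s t x\<bar> <= ennreal (e * (1 + \<bar>\<kappa>\<bar>) + \<bar>c\<bar> / \<bar>s - t\<bar>)" by (rule ennreal_leI)
  also have "... = ennreal (e * (1 + \<bar>\<kappa>\<bar>)) + ennreal (\<bar>c\<bar> / \<bar>s - t\<bar>)" using e by (intro ennreal_plus) auto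
  also have "... <= ennreal (e * (1 + \<bar>\<kappa>\<bar>)) + spread (hx t) s t 1 x"
    unfolding c_def \<kappa>_def by (intro add_left_mono uu_increment_bound st \<xi>)
  finally show ?thesis unfolding \<kappa>_def .
qed

lemma dq_integral_bound:
  assumes k: "k = 1 \<or> k = 2" and st: "s \<noteq> t" and e: "0 <= e" "e <= 1" and r: "0 <= r"
    and yq: "\<And>\<xi>. 0 <= \<xi> ==> \<bar>y s \<xi> - y t \<xi> - (s - t) * U (X t) \<xi>\<bar> <= e * \<bar>s - t\<bar>"
    and uq: "\<And>\<xi>. 0 <= \<xi> ==> \<bar>U (X s) \<xi> - U (X t) \<xi> - (s - t) * (- Q (X t) \<xi>)\<bar> <= e * \<bar>s - t\<bar>"
    and S: "(\<integral>\<^sup>+x. spread (hx t) s t k x \<partial>circ) <= ennreal r"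
  shows "(LINT x|circ. \<bar>dq s t x\<bar> ^ k) <= 4 * (1 + E) * e + 4 * Cb * r"
proof -
  have "ennreal (\<bar>dq s t x\<bar> ^ k) <= ennreal (4 * e * (1 + (hx t x)^2)) + 2 * (ennreal (2 * Cb) * spread (hx t) s t k x)" for x
  proof -
    let ?h = "\<bar>hx t x\<bar>"
    have "ennreal (\<bar>dq s t x\<bar> ^ k) = (ennreal \<bar>dq s t x\<bar>) ^ k" by (simp add: ennreal_power)
    also have "... <= (ennreal (e * (1 + ?h)) + spread (hx t) s t 1 x) ^ k"
      by (intro power_mono dq_bound[OF st e(1) yq uq]) auto
    also have "... <= ennreal (2 * (e * (1 + ?h)) ^ k) + 2 * (spread (hx t) s t 1 x) ^ k"
      by (rule ennreal_power_add_le[OF k]) (use e in simp)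
    also have "... <= ennreal (4 * e * (1 + (hx t x)^2)) + 2 * (ennreal (2 * Cb) * spread (hx t) s t k x)"
    proof (intro add_mono ennreal_leI mult_left_mono spread_power k)
      have "(1 + ?h) ^ k <= 2 * (1 + (hx t x)^2)"
      proof -
        have "1 + ?h <= 2 * (1 + (hx t x)^2)"
          using abs_le_one_plus_square[of "hx t x"] zero_le_power2[of "hx t x"] unfolding distrib_left by linarith
        then show ?thesis using k square_add_le[of 1 ?h] by auto
      qed
      moreover have "e ^ k <= e" using k e by (auto simp: power2_eq_square mult_left_le)
      ultimately have "e ^ k * (1 + ?h) ^ k <= e * (2 * (1 + (hx t x)^2))" using e by (intro mult_mono) auto
      then have "2 * (e ^ k * (1 + ?h) ^ k) <= 2 * (e * (2 * (1 + (hx t x)^2)))" by (rule mult_left_mono) simp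
      also have "... = 4 * e * (1 + (hx t x)^2)" by simp
      finally show "2 * (e * (1 + ?h)) ^ k <= 4 * e * (1 + (hx t x)^2)" by (simp only: power_mult_distrib)
    qed simp
    finally show ?thesis .
  qed
  then have "(\<integral>\<^sup>+x. ennreal (\<bar>dq s t x\<bar> ^ k) \<partial>circ) <= (\<integral>\<^sup>+x. ennreal (4 * e * (1 + (hx t x)^2)) + 2 * (ennreal (2 * Cb) * spread (hx t) s t k x) \<partial>circ)"
    by (intro nn_integral_mono) auto
  also have "... = (\<integral>\<^sup>+x. ennreal (4 * e * (1 + (hx t x)^2)) \<partial>circ) + 2 * (ennreal (2 * Cb) * (\<integral>\<^sup>+x. spread (hx t) s t k x \<partial>circ))"
    by (simp add: nn_integral_add nn_integral_cmult)
  also have "... <= ennreal (4 * e * (1 + E)) + 2 * (ennreal (2 * Cb) * ennreal r)"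
  proof (intro add_mono mult_left_mono S)
    have i: "integrable circ (\<lambda>x. 1 + (hx t x)^2)" by (intro Bochner_Integration.integrable_add integrable_circ_const hx_L2)
    have "(\<integral>\<^sup>+x. ennreal (4 * e * (1 + (hx t x)^2)) \<partial>circ) = ennreal (LINT x|circ. 4 * e * (1 + (hx t x)^2))"
      by (rule nn_integral_eq_integral) (use i e in auto)
    also have "(LINT x|circ. 4 * e * (1 + (hx t x)^2)) = 4 * e * (1 + (LINT x|circ. (hx t x)^2))"
      by (subst Bochner_Integration.integral_mult_right_zero, subst Bochner_Integration.integral_add[OF integrable_circ_const hx_L2(1)])
         (simp only: integral_circ_const)
    also have "ennreal ... <= ennreal (4 * e * (1 + E))" using e hx_L2(2) by (intro ennreal_leI mult_left_mono add_left_mono) auto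
    finally show "(\<integral>\<^sup>+x. ennreal (4 * e * (1 + (hx t x)^2)) \<partial>circ) <= ennreal (4 * e * (1 + E))" .
  qed simp_all
  also have "... = ennreal (4 * (1 + E) * e + 4 * Cb * r)"
  proof -
    have "2 * (ennreal (2 * Cb) * ennreal r) = ennreal 2 * (ennreal (2 * Cb) * ennreal r)" by simp
    also have "... = ennreal (2 * ((2 * Cb) * r))" using Cb_pos r by (simp only: ennreal_mult mult_nonneg_nonneg)
    also have "2 * ((2 * Cb) * r) = 4 * Cb * r" by simp
    finally show ?thesis using Cb_pos E_nonneg e r by (simp add: ennreal_plus mult_ac)
  qed
  finally show ?thesis using E_nonneg e r Cb_pos by (intro integral_real_bounded) auto
qed

text \<open>
  By Tonelli the mean deviation is an average over \<open>\<theta>\<close> of norms of translated differences of gradients.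
  Each tends to 0, and they are bounded uniformly, so the average tends to 0 as well.
\<close>

lemma dq_tendsto:
  assumes k: "k = 1 \<or> k = (2::nat)"
    and H: "\<And>\<sigma> z. \<sigma> \<longlonglongrightarrow> t ==> z \<longlonglongrightarrow> 0 ==> (\<lambda>n. LINT x|circ. \<bar>hx (\<sigma> n) (x + z n) - hx t x\<bar> ^ k) \<longlonglongrightarrow> 0"
  shows "((\<lambda>s. LINT x|circ. \<bar>dq s t x\<bar> ^ k) \<longlongrightarrow> 0) (at t)"
  unfolding tendsto_at_iff_sequentially comp_def
proof (intro allI impI)
  fix \<sigma> :: "nat => real" assume ne: "\<forall>i. \<sigma> i \<in> UNIV - {t}" and st: "\<sigma> \<longlonglongrightarrow> t"
  interpret C: finite_measure circ by (rule finite_measure_circ)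
  let ?I = "\<lambda>n \<theta>. \<integral>\<^sup>+x. ennreal (\<bar>hx (\<sigma> n) (x + (\<sigma> n - t) * \<theta>) - hx t x\<bar> ^ k) \<partial>circ"
  let ?S = "\<lambda>n. \<integral>\<^sup>+x. spread (hx t) (\<sigma> n) t k x \<partial>circ"
  have I: "?I n \<theta> = ennreal (LINT x|circ. \<bar>hx (\<sigma> n) (x + (\<sigma> n - t) * \<theta>) - hx t x\<bar> ^ k)" for n \<theta>
    by (rule nn_integral_eq_integral[OF hx_difference_integrable(1)[OF k]]) simp
  have "(\<lambda>n. \<integral>\<^sup>+\<theta>. ?I n \<theta> * indicator {- Cb..Cb} \<theta> \<partial>lborel) \<longlonglongrightarrow> (\<integral>\<^sup>+\<theta>. 0 \<partial>(lborel::real measure))"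
  proof (rule nn_integral_dominated_convergence[where w="\<lambda>\<theta>. ennreal (1 + 4 * E) * indicator {- Cb..Cb} \<theta>"])
    show "AE \<theta> in lborel. ?I n \<theta> * indicator {- Cb..Cb} \<theta> <= ennreal (1 + 4 * E) * indicator {- Cb..Cb} \<theta>" for n
      unfolding I by (intro AE_I2 mult_right_mono ennreal_leI hx_difference_integrable(2)[OF k]) simp
    show "(\<integral>\<^sup>+\<theta>. ennreal (1 + 4 * E) * indicator {- Cb..Cb} \<theta> \<partial>lborel) < \<infinity>"
      using Cb_pos by (simp add: nn_integral_cmult ennreal_mult_less_top)
    show "AE \<theta> in lborel. (\<lambda>n. ?I n \<theta> * indicator {- Cb..Cb} \<theta>) \<longlonglongrightarrow> 0"
    proof (rule AE_I2)
      fix \<theta> :: real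
      have "(\<lambda>n. (\<sigma> n - t) * \<theta>) \<longlonglongrightarrow> (t - t) * \<theta>" by (intro tendsto_intros st)
      then have "(\<lambda>n. (\<sigma> n - t) * \<theta>) \<longlonglongrightarrow> 0" by simp
      from tendsto_ennrealI[OF H[OF st this]] have "(\<lambda>n. ?I n \<theta>) \<longlonglongrightarrow> 0" unfolding I by simp
      then show "(\<lambda>n. ?I n \<theta> * indicator {- Cb..Cb} \<theta>) \<longlonglongrightarrow> 0" by (cases "\<theta> \<in> {- Cb..Cb}") simp_all
    qed
  qed measurable
  then have S0: "?S \<longlonglongrightarrow> 0" by (simp add: spread_integral)
  have r0: "(\<lambda>n. enn2real (?S n)) \<longlonglongrightarrow> 0" using S0 by (intro tendsto_enn2real) simp_all
  show "(\<lambda>n. LINT x|circ. \<bar>dq (\<sigma> n) t x\<bar> ^ k) \<longlonglongrightarrow> 0"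
  proof (rule tendstoI)
    fix \<epsilon> :: real assume \<epsilon>: "0 < \<epsilon>"
    define e where "e = min 1 (\<epsilon> / (16 * (1 + E)))"
    have e: "0 < e" "e <= 1" using \<epsilon> E_nonneg by (auto simp: e_def)
    have "e <= \<epsilon> / (16 * (1 + E))" by (simp add: e_def)
    then have e2: "4 * (1 + E) * e <= \<epsilon>/4" using E_nonneg by (simp add: field_simps)
    have ev1: "\<forall>\<^sub>F n in sequentially. \<forall>\<xi>\<ge>0. \<bar>y (\<sigma> n) \<xi> - y t \<xi> - (\<sigma> n - t) * U (X t) \<xi>\<bar> <= e * \<bar>\<sigma> n - t\<bar>"
      by (rule eventually_compose_filterlim[OF uniform_difference_quotient[OF ll_U y_ode e(1)] st])
    have ev2: "\<forall>\<^sub>F n in sequentially. \<forall>\<xi>\<ge>0. \<bar>U (X (\<sigma> n)) \<xi> - U (X t) \<xi> - (\<sigma> n - t) * (- Q (X t) \<xi>)\<bar> <= e * \<bar>\<sigma> n - t\<bar>"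
      by (rule eventually_compose_filterlim[OF uniform_difference_quotient[OF loc_lipschitz_minus[OF ll_Q] U_derivative[OF X_ode] e(1)] st])
    have ev3: "\<forall>\<^sub>F n in sequentially. ?S n < 1" using S0 by (rule order_tendstoD(2)) simp
    have ev4: "\<forall>\<^sub>F n in sequentially. enn2real (?S n) < \<epsilon> / (8 * Cb)" using r0 \<epsilon> Cb_pos by (intro order_tendstoD(2)) auto
    show "\<forall>\<^sub>F n in sequentially. dist (LINT x|circ. \<bar>dq (\<sigma> n) t x\<bar> ^ k) 0 < \<epsilon>"
      using ev1 ev2 ev3 ev4
    proof eventually_elim
      case (elim n)
      have fin: "?S n < top" using elim(3) by (rule order.strict_trans) simp
      have "(LINT x|circ. \<bar>dq (\<sigma> n) t x\<bar> ^ k) <= 4 * (1 + E) * e + 4 * Cb * enn2real (?S n)"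
      proof (rule dq_integral_bound[OF k _ _ e(2)])
        show "\<sigma> n \<noteq> t" using ne by auto
        show "?S n <= ennreal (enn2real (?S n))" using fin by simp
      qed (use elim(1,2) e(1) in auto)
      moreover have "4 * Cb * enn2real (?S n) <= \<epsilon>/2" using elim(4) Cb_pos by (simp add: field_simps)
      moreover have "0 <= (LINT x|circ. \<bar>dq (\<sigma> n) t x\<bar> ^ k)" by (rule Bochner_Integration.integral_nonneg) simp
      ultimately show ?case using e2 \<epsilon> by simp
    qed
  qed
qed

lemma dq_L1: "((\<lambda>s. LINT x|circ. \<bar>dq s t x\<bar>) \<longlongrightarrow> 0) (at t)"
  using dq_tendsto[of 1 t] hx_L1_convergence by simp

lemma dq_L2_regular: "regular t ==> ((\<lambda>s. LINT x|circ. (dq s t x)^2) \<longlongrightarrow> 0) (at t)"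
  using dq_tendsto[of 2 t] hx_L2_convergence by simp

lemmas dq_Lp = Lp_tendsto_interpolation[OF dq_borel dq_L2 dq_L1]

lemma vx_Lp:
  assumes p: "1 <= p" "p < 2"
  shows "((\<lambda>s. LINT x|circ. \<bar>vx s x - vx t x\<bar> powr p) \<longlongrightarrow> 0) (at t)"
proof (rule Lp_tendsto_interpolation(2)[OF _ _ _ _ p])
  let ?M = "2 * Cb^2 * E + 2 * Cb^2"
  have ib: "integrable circ (\<lambda>x. 2 * (vx s x)^2 + 2 * (vx t x)^2)" for s
    by (intro Bochner_Integration.integrable_add integrable_mult_right vx_L2)
  show i: "integrable circ (\<lambda>x. (vx s x - vx t x)^2)" for s
    by (rule Bochner_Integration.integrable_bound[OF ib[of s]]) (use square_diff_le in \<open>auto intro: order_trans[OF _ abs_ge_self]\<close>)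
  show "(LINT x|circ. (vx s x - vx t x)^2) <= 2 * ?M + 2 * ?M" for s
  proof -
    have "(LINT x|circ. (vx s x - vx t x)^2) <= (LINT x|circ. 2 * (vx s x)^2 + 2 * (vx t x)^2)"
      by (rule integral_mono[OF i ib square_diff_le])
    also have "... = 2 * (LINT x|circ. (vx s x)^2) + 2 * (LINT x|circ. (vx t x)^2)"
      by (subst Bochner_Integration.integral_add[OF integrable_mult_right[OF vx_L2(1)] integrable_mult_right[OF vx_L2(1)]])
         (simp only: Bochner_Integration.integral_mult_right_zero)
    also have "... <= 2 * ?M + 2 * ?M" by (intro add_mono mult_left_mono vx_L2) simp_all
    finally show ?thesis .
  qed
  show "((\<lambda>s. LINT x|circ. \<bar>vx s x - vx t x\<bar>) \<longlongrightarrow> 0) (at t)"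
    unfolding tendsto_at_iff_sequentially comp_def
    using vx_L1_convergence[of _ t "\<lambda>_. 0"] by auto
qed measurable

end

section \<open>The nonlocal pressure\<close>

text \<open>
  Used for \<open>deriv\<close>, whose values on the exceptional null set are not under control.
\<close>

lemma measurable_lebesgue_cong_AE:
  fixes f g :: "real => real"
  assumes f: "f \<in> borel_measurable borel" and ae: "AE x in lborel. f x = g x"
  shows "g \<in> borel_measurable lebesgue"
proof -
  obtain N where N: "N \<in> null_sets lborel" "{x. f x \<noteq> g x} \<subseteq> N"
    using ae by (auto simp: eventually_ae_filter)
  have null: "S \<in> sets lebesgue" if "S \<subseteq> N" for S
    using null_sets_completion_subset[OF that N(1)[THEN null_sets_completionI]] by auto
  show ?thesis
  proof (rule measurableI)
    fix A :: "real set" assume A: "A \<in> sets borel"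
    have "f -` A \<in> sets lborel" using measurable_sets[OF f A] by simp
    then have 1: "f -` A \<in> sets lebesgue" by auto
    have dec: "g -` A = (f -` A - (f -` A \<inter> {x. f x \<noteq> g x})) \<union> (g -` A \<inter> {x. f x \<noteq> g x})" by auto
    have "f -` A \<inter> {x. f x \<noteq> g x} \<in> sets lebesgue" "g -` A \<inter> {x. f x \<noteq> g x} \<in> sets lebesgue"
      using N(2) by (auto intro!: null)
    then have "g -` A \<in> sets lebesgue" by (subst dec) (intro sets.Un sets.Diff 1)
    then show "g -` A \<inter> space lebesgue \<in> sets lebesgue" by simp
  qed simp
qed

text \<open>
  \<open>exp (z - x) (p - q)\<close> and \<open>- exp (x - z) (p + q)\<close> are primitives of \<open>exp (z - x) f\<close> and
  \<open>exp (x - z) f\<close>.  Integrate over \<open>[x - n, x]\<close> and \<open>[x, x + n]\<close>; the outer boundary terms vanish in the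
  limit because \<open>p\<close> and \<open>q\<close> are bounded.
\<close>

lemma exponential_convolution_identity:
  fixes f p q :: "real => real"
  assumes p: "has_density p q" and q: "has_density q (\<lambda>x. p x - f x)" and f0: "\<And>x. 0 <= f x"
    and f [measurable]: "f \<in> borel_measurable borel"
    and bp: "\<And>x. \<bar>p x\<bar> <= C" and bq: "\<And>x. \<bar>q x\<bar> <= C"
  shows "(LINT z|lborel. 1/2 * exp (- \<bar>x - z\<bar>) * f z) = p x"
proof -
  have de: "has_density (\<lambda>z. exp (z - x)) (\<lambda>z. exp (z - x) * 1)"
    by (rule has_density_compose[OF has_density_id, of "\<lambda>z. exp (z - x)" "\<lambda>z. exp (z - x)"])
       (auto intro!: derivative_eq_intros continuous_intros)
  have de': "has_density (\<lambda>z. exp (x - z)) (\<lambda>z. - exp (x - z) * 1)"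
    by (rule has_density_compose[OF has_density_id, of "\<lambda>z. exp (x - z)" "\<lambda>z. - exp (x - z)"])
       (auto intro!: derivative_eq_intros continuous_intros)
  have l: "has_density (\<lambda>z. exp (z - x) * (p z - q z)) (\<lambda>z. exp (z - x) * f z)"
    using has_density_mult[OF de has_density_diff[OF p q]] by (simp add: algebra_simps)
  have r: "has_density (\<lambda>z. (-1) * (exp (x - z) * (p z + q z))) (\<lambda>z. exp (x - z) * f z)"
    using has_density_cmult[OF has_density_mult[OF de' has_density_add[OF p q]], of "-1"] by (simp add: algebra_simps)
  let ?g = "\<lambda>z. 1/2 * exp (- \<bar>x - z\<bar>) * f z"
  let ?gl = "\<lambda>n z. 1/2 * (indicator {x - real n..x} z * (exp (z - x) * f z))"
    and ?gr = "\<lambda>n z. 1/2 * (indicator {x..x + real n} z * (exp (x - z) * f z))"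
  have il: "integrable lborel (?gl n)" and ir: "integrable lborel (?gr n)" for n
    using has_density_integrable[OF l, of "x - real n" x] has_density_integrable[OF r, of x "x + real n"]
    by (simp_all add: set_integrable_def)
  have vl: "(LINT z|lborel. ?gl n z) = 1/2 * ((p x - q x) - exp (- real n) * (p (x - real n) - q (x - real n)))" for n
    using has_density_integral[OF l, of "x - real n" x] by (simp add: set_lebesgue_integral_def)
  have vr: "(LINT z|lborel. ?gr n z) = 1/2 * ((p x + q x) - exp (- real n) * (p (x + real n) + q (x + real n)))" for n
    using has_density_integral[OF r, of x "x + real n"] by (simp add: set_lebesgue_integral_def algebra_simps)
  have ex0: "(\<lambda>n. exp (- real n)) \<longlonglongrightarrow> 0"
    by (rule filterlim_compose[OF exp_at_bot]) (rule filterlim_compose[OF filterlim_uminus_at_bot_at_top filterlim_real_sequentially])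
  have small: "(\<lambda>n. exp (- real n) * b n) \<longlonglongrightarrow> 0" if b: "\<And>n. \<bar>b n\<bar> <= C + C" for b :: "nat => real"
  proof (rule Lim_null_comparison)
    show "\<forall>\<^sub>F n in sequentially. norm (exp (- real n) * b n) <= exp (- real n) * (C + C)"
      using b by (intro always_eventually allI) (simp add: abs_mult)
    show "(\<lambda>n. exp (- real n) * (C + C)) \<longlonglongrightarrow> 0" using tendsto_mult_right[OF ex0, of "C + C"] by simp
  qed
  show ?thesis
  proof (rule integral_monotone_convergence[where f="\<lambda>n z. ?gl n z + ?gr n z"])
    show "integrable lborel (\<lambda>z. ?gl n z + ?gr n z)" for n by (intro Bochner_Integration.integrable_add il ir)
    show "AE z in lborel. mono (\<lambda>n. ?gl n z + ?gr n z)"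
      using f0 by (intro AE_I2 monoI add_mono mult_left_mono mult_right_mono) (auto simp: indicator_def)
    have "AE z in lborel. z \<noteq> x" by (rule AE_lborel_singleton)
    then show "AE z in lborel. (\<lambda>n. ?gl n z + ?gr n z) \<longlonglongrightarrow> ?g z"
    proof eventually_elim
      case (elim z)
      obtain N :: nat where N: "\<bar>x - z\<bar> <= real N" using real_arch_simple by blast
      have "\<forall>\<^sub>F n in sequentially. ?gl n z + ?gr n z = ?g z"
        using eventually_ge_at_top[of N]
      proof eventually_elim
        case n: (elim n)
        then have "\<bar>x - z\<bar> <= real n" using N by simp
        then show ?case using elim by (cases "z < x") (auto simp: indicator_def)
      qed
      then show ?case by (rule tendsto_eventually)
    qed
    have "(\<lambda>n. 1/2 * ((p x - q x) - exp (- real n) * (p (x - real n) - q (x - real n))) +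
        1/2 * ((p x + q x) - exp (- real n) * (p (x + real n) + q (x + real n)))) \<longlonglongrightarrow>
        1/2 * ((p x - q x) - 0) + 1/2 * ((p x + q x) - 0)"
      by (intro tendsto_intros small order_trans[OF abs_triangle_ineq4 add_mono[OF bp bq]] order_trans[OF abs_triangle_ineq add_mono[OF bp bq]])
    moreover have "1/2 * ((p x - q x) - 0) + 1/2 * ((p x + q x) - 0) = p x" by (simp add: field_simps)
    ultimately show "(\<lambda>n. LINT z|lborel. ?gl n z + ?gr n z) \<longlonglongrightarrow> p x"
      unfolding Bochner_Integration.integral_add[OF il ir] vl vr by (simp only:)
  qed measurable
qed

lemma has_density_derivative:
  assumes F: "has_density F f" and c: "continuous_on UNIV f"
  shows "(F has_real_derivative f x) (at x)"
proof -
  have "((\<lambda>z. integral {x - 1..z} f) has_vector_derivative f x) (at x within {x - 1..x + 1})"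
    by (rule integral_has_vector_derivative) (use c continuous_on_subset in auto)
  then have "((\<lambda>z. integral {x - 1..z} f) has_real_derivative f x) (at x)"
    by (simp add: has_real_derivative_iff_has_vector_derivative at_within_Icc_at)
  then have d: "((\<lambda>z. F (x - 1) + integral {x - 1..z} f) has_real_derivative f x) (at x)"
    by (auto intro!: derivative_eq_intros)
  show ?thesis
  proof (rule has_field_derivative_transform_within_open[OF d, of "{x - 1<..<x + 1}"])
    fix z assume "z \<in> {x - 1<..<x + 1}"
    then have "integral {x - 1..z} f = F z - F (x - 1)"
      using has_density_integral_HK[OF F, of "x - 1" z] by (simp add: integral_unique)
    then show "F (x - 1) + integral {x - 1..z} f = F z" by simp
  qed simp_all
qed

context flow
begin

lemma Y_strict:
  assumes gd: "regular t" and ab: "0 <= a" "a < b" "b <= 1"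
  shows "Y (X t) a < Y (X t) b"
proof (rule ccontr)
  assume "\<not> Y (X t) a < Y (X t) b"
  then have eq: "Y (X t) b - Y (X t) a = 0" using profile.Y_mono[OF prof, of a b t] ab by simp
  have "(LINT \<xi>:{a..b}|lborel. (alpha (X t) \<xi>)^2) = 0"
    using has_density_integral[OF Y_density[of "X t"], of a b] ab eq by simp
  moreover have "integrable lborel (\<lambda>\<xi>. indicator {a..b} \<xi> *\<^sub>R (alpha (X t) \<xi>)^2)"
    using has_density_integrable[OF Y_density[of "X t"], of a b] by (simp add: set_integrable_def)
  ultimately have z: "AE \<xi> in lborel. indicator {a..b} \<xi> *\<^sub>R (alpha (X t) \<xi>)^2 = 0"
    unfolding set_lebesgue_integral_def by (subst (asm) integral_nonneg_eq_0_iff_AE) simp_all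
  have "AE \<xi> in lborel. \<xi> \<notin> {a..b}" using z gd[unfolded regular_def] by eventually_elim (use ab in \<open>auto simp: indicator_def split: if_splits\<close>)
  then have "emeasure lborel {a..b} = 0" by (subst (asm) AE_iff_measurable[of "{a..b}"]) auto
  then show False using ab by simp
qed

lemma lab_section:
  assumes gd: "regular t" and r: "0 <= r" "r <= 1" and \<xi>: "\<xi> \<in> {0..1}"
  shows "Y (X t) \<xi> <= r \<longleftrightarrow> \<xi> <= profile.sel (Y (X t)) r"
proof -
  let ?s = "profile.sel (Y (X t)) r"
  have s: "?s \<in> {0..1}" "Y (X t) ?s = r" using profile.sel[OF prof r, of t] by auto
  show ?thesis
  proof
    assume "Y (X t) \<xi> <= r"
    moreover have "Y (X t) ?s < Y (X t) \<xi>" if "?s < \<xi>" using s(1) \<xi> that by (intro Y_strict[OF gd]) auto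
    ultimately show "\<xi> <= ?s" using s(2) by linarith
  next
    assume "\<xi> <= ?s"
    then show "Y (X t) \<xi> <= r" using profile.Y_mono[OF prof, of \<xi> ?s t] s by simp
  qed
qed

text \<open>
  At regular times positions and labels correspond one to one, so indefinite integrals can be
  transferred from labels to positions: first on one period by the change of variables, then to the
  line by periodicity.
\<close>

lemma eulerian_density:
  assumes gd: "regular t" and g [measurable]: "g \<in> borel_measurable borel" and gp: "periodic_fun_simple' g"
    and \<Phi>: "has_density \<Phi> (\<lambda>\<xi>. (alpha (X t) \<xi>)^2 * g (y t \<xi>))" and per: "\<Phi> 1 = \<Phi> 0"
  shows "has_density (\<lambda>x. \<Phi> (lab t x)) g"
proof -
  let ?sel = "profile.sel (Y (X t))"
  have frz: "frac z = z" if "0 <= z" "z < 1" for z :: real using that by (simp add: frac_eq)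
  have n1: "AE z in lborel. z \<noteq> (1::real)" by (rule AE_lborel_singleton)
  have Y1: "AE \<xi> in lborel. \<xi> \<in> {0..1} --> Y (X t) \<xi> < 1"
    using n1
  proof eventually_elim
    case (elim \<xi>)
    then show ?case using Y_strict[OF gd, of \<xi> 1] X_per(1)[of t] by auto
  qed
  have id: "set_integrable lborel {0..1} (\<lambda>\<xi>. (alpha (X t) \<xi>)^2 * g (y t \<xi>))" by (rule has_density_integrable[OF \<Phi>])
  have idl: "integrable lborel (\<lambda>\<xi>. (alpha (X t) \<xi>)^2 * g (y t \<xi>))"
  proof -
    have "(\<lambda>\<xi>. indicator {0..1} \<xi> *\<^sub>R ((alpha (X t) \<xi>)^2 * g (y t \<xi>))) = (\<lambda>\<xi>. (alpha (X t) \<xi>)^2 * g (y t \<xi>))"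
    proof
      show "indicator {0..1} \<xi> *\<^sub>R ((alpha (X t) \<xi>)^2 * g (y t \<xi>)) = (alpha (X t) \<xi>)^2 * g (y t \<xi>)" for \<xi>
        by (cases "\<xi> \<in> {0..1}") (simp_all add: alpha_outside)
    qed
    then show ?thesis using id by (simp add: set_integrable_def)
  qed
  have gs: "periodic_fun_simple' (\<lambda>z. g (z + c))" for c
    unfolding periodic_fun_simple'_def
  proof
    fix z have "g ((z + c) + 1) = g (z + c)" using gp unfolding periodic_fun_simple'_def by blast
    then show "g (z + 1 + c) = g (z + c)" by (simp add: add_ac)
  qed
  have gfr: "g (frac (z - eta t) + eta t) = g z" for z
    using periodic_frac[OF gs[of "eta t"], of "z - eta t"] by simp
  define f where "f = (\<lambda>r. g (r + eta t) * indicator {0..1} r)"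
  have [measurable]: "f \<in> borel_measurable borel" unfolding f_def by measurable
  have if_: "integrable lborel f"
  proof -
    have "integrable circ g" using change_variables(2)[OF g gp, of t] idl by blast
    then have "integrable circ (\<lambda>z. g (z + eta t))" using circ_shift(2)[OF g gp] by blast
    then show ?thesis by (simp add: integral_circ(2) set_integrable_def f_def mult.commute)
  qed
  let ?H = "\<lambda>r. LINT z:{..r}|lborel. f z"
  have H: "?H r = \<Phi> (?sel r) - \<Phi> 0" if r: "0 <= r" "r <= 1" for r
  proof -
    let ?k = "\<lambda>z. g z * indicator {0..r} (frac (z - eta t))"
    have km: "?k \<in> borel_measurable borel" using frac_shift_borel[of "- eta t"] by simp measurable
    have kp: "periodic_fun_simple' ?k"
      using gp periodic_frac_fun[of "\<lambda>z. indicator {0..r} z :: real" "- eta t"] by (simp add: periodic_fun_simple'_def)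
    have "?H r = (LINT z|circ. g (z + eta t) * indicator {0..r} z)"
      unfolding set_lebesgue_integral_def using r
      by (subst integral_circ(1)) (auto simp: f_def set_lebesgue_integral_def indicator_def intro!: Bochner_Integration.integral_cong)
    also have "... = (LINT z|circ. ?k (z + eta t))"
    proof (rule integral_cong_AE)
      have "AE z in circ. 0 <= z \<and> z <= (1::real)" unfolding circ_def by (subst AE_density) (auto simp: indicator_def split: if_splits)
      then show "AE z in circ. g (z + eta t) * indicator {0..r} z = ?k (z + eta t)"
        using AE_circ[OF n1] by eventually_elim (simp add: frz)
    qed (use km in measurable)
    also have "... = (LINT z|circ. ?k z)" by (rule circ_shift(1)[OF km kp])
    also have "... = (LINT \<xi>|lborel. (alpha (X t) \<xi>)^2 * ?k (y t \<xi>))" by (rule change_variables(1)[OF km kp])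
    also have "... = (LINT \<xi>|lborel. indicator {0..?sel r} \<xi> *\<^sub>R ((alpha (X t) \<xi>)^2 * g (y t \<xi>)))"
    proof (rule integral_cong_AE)
      show "AE \<xi> in lborel. (alpha (X t) \<xi>)^2 * ?k (y t \<xi>) = indicator {0..?sel r} \<xi> *\<^sub>R ((alpha (X t) \<xi>)^2 * g (y t \<xi>))"
        using Y1
      proof eventually_elim
        case (elim \<xi>)
        show ?case
        proof (cases "\<xi> \<in> {0..1}")
          case True
          have "frac (y t \<xi> - eta t) = Y (X t) \<xi>" using elim True profile.Y_range(1)[OF prof, of t \<xi>] by (simp add: y_def frz)
          then show ?thesis using lab_section[OF gd r True] True profile.Y_range(1)[OF prof, of t \<xi>] by (simp add: indicator_def)
        qed (simp add: alpha_outside)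
      qed
    qed (use km in measurable)
    also have "... = \<Phi> (?sel r) - \<Phi> 0"
      using has_density_integral[OF \<Phi>, of 0 "?sel r"] profile.sel[OF prof r, of t] by (simp add: set_lebesgue_integral_def)
    finally show ?thesis .
  qed
  have s01: "?sel 0 = 0" "?sel 1 = 1"
  proof -
    have s: "?sel 0 \<in> {0..1}" "Y (X t) (?sel 0) = 0" "?sel 1 \<in> {0..1}" "Y (X t) (?sel 1) = 1"
      using profile.sel[OF prof, of 0 t] profile.sel[OF prof, of 1 t] by auto
    show "?sel 0 = 0"
    proof (rule ccontr)
      assume "?sel 0 \<noteq> 0"
      then have "Y (X t) 0 < Y (X t) (?sel 0)" using s by (intro Y_strict[OF gd]) auto
      then show False using s by (simp add: Y_0)
    qed
    show "?sel 1 = 1"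
    proof (rule ccontr)
      assume "?sel 1 \<noteq> 1"
      then have "Y (X t) (?sel 1) < Y (X t) 1" using s by (intro Y_strict[OF gd]) auto
      then show False using s by (simp add: X_per)
    qed
  qed
  have "has_density (\<lambda>x. ?H (frac (x - eta t))) (\<lambda>x. f (frac (x - eta t)))"
    by (rule has_density_periodic_extension[OF has_density_indefinite_integral[OF if_]]) (simp only: H zero_le_one order_refl s01 per)
  moreover have "?H (frac (x - eta t)) = \<Phi> (lab t x) - \<Phi> 0" for x
    using H[of "frac (x - eta t)"] frac_lt_1[of "x - eta t"] by (simp add: lab_def)
  moreover have "f (frac (x - eta t)) = g x" for x
    using frac_lt_1[of "x - eta t"] by (simp add: f_def gfr)
  ultimately have "has_density (\<lambda>x. \<Phi> (lab t x) - \<Phi> 0) g" by simp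
  from has_density_add[OF this has_density_const[of "\<Phi> 0"]] show ?thesis by simp
qed

definition px :: "real => real => real" where "px t x = P (X t) (lab t x)"

lemma px_borel [measurable]: "px t \<in> borel_measurable borel"
  unfolding px_def[abs_def] using measurable_comp[OF lab_borel P_borel[of "X t"]] by (simp add: comp_def)

lemma px_density: assumes "regular t" shows "has_density (px t) (qx t)"
  unfolding px_def[abs_def]
proof (rule eulerian_density[OF assms qx_borel qx_periodic _ P_Q_period(1)[OF X_per(1)]])
  show "has_density (P (X t)) (\<lambda>\<xi>. (alpha (X t) \<xi>)^2 * qx t (y t \<xi>))"
    by (rule has_density_cong_AE[OF P_density]) (measurable, use lab_y[of t] in eventually_elim, auto simp: qx_def)
qed

lemma qx_density: assumes gd: "regular t" shows "has_density (qx t) (\<lambda>x. px t x - ((uu t x)^2 + (hx t x)^2 / 2))"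
proof -
  have "has_density (\<lambda>x. Q (X t) (lab t x)) (\<lambda>x. px t x - ((uu t x)^2 + (hx t x)^2 / 2))"
  proof (rule eulerian_density[OF gd _ _ _ P_Q_period(2)[OF X_per(1)]])
    show "periodic_fun_simple' (\<lambda>x. px t x - ((uu t x)^2 + (hx t x)^2 / 2))"
      using uu_periodic[of t] hx_periodic[of t] lab_periodic[of t] by (simp add: periodic_fun_simple'_def px_def)
    show "has_density (Q (X t)) (\<lambda>\<xi>. (alpha (X t) \<xi>)^2 * (px t (y t \<xi>) - ((uu t (y t \<xi>))^2 + (hx t (y t \<xi>))^2 / 2)))"
    proof (rule has_density_cong_AE[OF Q_density])
      show "AE \<xi> in lborel. (alpha (X t) \<xi>)^2 * P (X t) \<xi> - src (X t) \<xi> =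
         (alpha (X t) \<xi>)^2 * (px t (y t \<xi>) - ((uu t (y t \<xi>))^2 + (hx t (y t \<xi>))^2 / 2))"
        using gd[unfolded regular_def] lab_y[of t] hx_chain[of t]
      proof eventually_elim
        case (elim \<xi>)
        show ?case
        proof (cases "\<xi> \<in> {0..1}")
          case True
          then have a: "alpha (X t) \<xi> \<noteq> 0" using elim(1) by blast
          then show ?thesis using elim(2,3) by (simp add: px_def uu_y src_def right_diff_distrib distrib_left power_divide)
        qed (simp add: alpha_outside beta_outside src_def)
      qed
    qed measurable
  qed measurable
  then show ?thesis by (simp add: qx_def[abs_def])
qed

lemma deriv_uu: "AE x in lborel. hx t x = deriv (uu t) x"
  using has_density_AE_derivative[OF uu_density[of t]] by eventually_elim (simp add: DERIV_imp_deriv)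

lemma deriv_uu_lebesgue [measurable]: "deriv (uu t) \<in> borel_measurable lebesgue"
  by (rule measurable_lebesgue_cong_AE[OF hx_borel deriv_uu])

lemma CH_P_uu:
  assumes gd: "regular t"
  shows "CH_P (uu t) x = px t x"
proof -
  let ?f = "\<lambda>x. (uu t x)^2 + (hx t x)^2 / 2"
  have "CH_P (uu t) x = (LINT z|lebesgue. 1/2 * exp (- \<bar>x - z\<bar>) * ((uu t z)^2 + (deriv (uu t) z)^2 / 2))"
    by (simp add: CH_P_def convolve_def)
  also have "... = (LINT z|lebesgue. 1/2 * exp (- \<bar>x - z\<bar>) * ?f z)"
  proof (rule integral_cong_AE)
    have [measurable]: "uu t \<in> borel_measurable lebesgue" "hx t \<in> borel_measurable lebesgue"
      "(\<lambda>z. exp (- \<bar>x - z\<bar>)) \<in> borel_measurable lebesgue"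
      by (intro measurable_completion, measurable)+
    show "(\<lambda>z. 1/2 * exp (- \<bar>x - z\<bar>) * ((uu t z)^2 + (deriv (uu t) z)^2 / 2)) \<in> borel_measurable lebesgue"
      "(\<lambda>z. 1/2 * exp (- \<bar>x - z\<bar>) * ?f z) \<in> borel_measurable lebesgue" by measurable
    show "AE z in lebesgue. 1/2 * exp (- \<bar>x - z\<bar>) * ((uu t z)^2 + (deriv (uu t) z)^2 / 2) = 1/2 * exp (- \<bar>x - z\<bar>) * ?f z"
      using AE_completion[OF deriv_uu[of t]] by eventually_elim simp
  qed
  also have "... = (LINT z|lborel. 1/2 * exp (- \<bar>x - z\<bar>) * ?f z)" by (rule integral_completion) measurable
  also have "... = px t x"
    by (rule exponential_convolution_identity[OF px_density[OF gd] qx_density[OF gd], of Cb])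
       (simp_all add: px_def qx_def abs_bounds)
  finally show ?thesis .
qed

lemma deriv_CH_P_uu: "regular t ==> deriv (CH_P (uu t)) x = qx t x"
proof -
  assume gd: "regular t"
  have "CH_P (uu t) = px t" using CH_P_uu[OF gd] by auto
  moreover have "(px t has_real_derivative qx t x) (at x)"
    by (rule has_density_derivative[OF px_density[OF gd] has_density_continuous[OF qx_density[OF gd]]])
  ultimately show ?thesis by (simp add: DERIV_imp_deriv)
qed

end

section \<open>Breaking times are negligible; existence of the solution\<close>

text \<open>
  A zero that is a limit of zeros would have derivative 0; so the zeros have no limit point.
\<close>

lemma transversal_zeros_countable:
  fixes \<phi> :: "real => real"
  assumes d: "\<And>t. (\<phi> has_real_derivative \<phi>' t) (at t)" and tr: "\<And>t. \<phi> t = 0 ==> \<phi>' t \<noteq> 0"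
  shows "countable {t. \<phi> t = 0}"
proof -
  have "\<not> t islimpt {t. \<phi> t = 0}" for t
  proof
    assume "t islimpt {t. \<phi> t = 0}"
    then obtain z where z: "\<And>n. z n \<in> {t. \<phi> t = 0} - {t}" "z \<longlonglongrightarrow> t" unfolding islimpt_sequential by blast
    have z0: "\<phi> (z n) = 0" "z n \<noteq> t" for n using z(1)[of n] by auto
    have "(\<lambda>n. \<phi> (z n)) \<longlonglongrightarrow> \<phi> t" by (rule isCont_tendsto_compose[OF DERIV_isCont[OF d] z(2)])
    then have t0: "\<phi> t = 0" using LIMSEQ_unique[OF _ tendsto_const] z0 by simp
    have "((\<lambda>s. (\<phi> s - \<phi> t) / (s - t)) \<longlongrightarrow> \<phi>' t) (at t)" using d[of t] by (simp add: has_field_derivative_iff)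
    moreover have "filterlim z (at t) sequentially" using z(2) z0(2) by (simp add: filterlim_at)
    ultimately have "(\<lambda>n. (\<phi> (z n) - \<phi> t) / (z n - t)) \<longlonglongrightarrow> \<phi>' t" by (rule filterlim_compose)
    then have "\<phi>' t = 0" using LIMSEQ_unique[OF _ tendsto_const] z0 t0 by simp
    then show False using tr[OF t0] by simp
  qed
  then have "{t. \<phi> t = 0} sparse_in UNIV" unfolding sparse_in_def by blast
  from sparse_imp_countable[OF open_UNIV this] show ?thesis by simp
qed

lemma continuous_eval:
  fixes X :: "real => ('a::metric_space \<Rightarrow>\<^sub>C 'b::metric_space)"
  assumes "continuous_on UNIV X"
  shows "continuous_on UNIV (\<lambda>z. apply_bcontfun (X (fst z)) (snd z))"
  unfolding continuous_on_def
proof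
  fix z0 :: "real \<times> 'a"
  have X: "((\<lambda>z. X (fst z)) \<longlongrightarrow> X (fst z0)) (at z0 within UNIV)"
    using continuous_on_compose2[OF assms continuous_on_fst[OF continuous_on_id], of UNIV]
    unfolding continuous_on_def by (rule bspec) simp_all
  have f: "((\<lambda>z. apply_bcontfun (X (fst z0)) (snd z)) \<longlongrightarrow> apply_bcontfun (X (fst z0)) (snd z0)) (at z0 within UNIV)"
    using continuous_on_compose2[OF continuous_on_apply_bcontfun[of UNIV "X (fst z0)"] continuous_on_snd[OF continuous_on_id], of UNIV]
    unfolding continuous_on_def by (rule bspec) simp_all
  have "((\<lambda>z. dist (X (fst z)) (X (fst z0)) + dist (apply_bcontfun (X (fst z0)) (snd z)) (apply_bcontfun (X (fst z0)) (snd z0))) \<longlongrightarrow> 0 + 0) (at z0 within UNIV)"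
    using X f unfolding tendsto_dist_iff[of _ "X (fst z0)"] tendsto_dist_iff[of _ "apply_bcontfun (X (fst z0)) (snd z0)"] by (rule tendsto_add)
  then have lim: "((\<lambda>z. dist (X (fst z)) (X (fst z0)) + dist (apply_bcontfun (X (fst z0)) (snd z)) (apply_bcontfun (X (fst z0)) (snd z0))) \<longlongrightarrow> 0) (at z0 within UNIV)" by simp
  show "((\<lambda>z. apply_bcontfun (X (fst z)) (snd z)) \<longlongrightarrow> apply_bcontfun (X (fst z0)) (snd z0)) (at z0 within UNIV)"
    unfolding tendsto_dist_iff[of "\<lambda>z. apply_bcontfun (X (fst z)) (snd z)"]
  proof (rule Lim_null_comparison[OF always_eventually lim], rule allI)
    fix z :: "real \<times> 'a"
    show "norm (dist (apply_bcontfun (X (fst z)) (snd z)) (apply_bcontfun (X (fst z0)) (snd z0))) <=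
      dist (X (fst z)) (X (fst z0)) + dist (apply_bcontfun (X (fst z0)) (snd z)) (apply_bcontfun (X (fst z0)) (snd z0))"
      using dist_triangle[of "apply_bcontfun (X (fst z)) (snd z)" "apply_bcontfun (X (fst z0)) (snd z0)" "apply_bcontfun (X (fst z0)) (snd z)"]
        dist_bounded[of "X (fst z)" "snd z" "X (fst z0)"] by simp
  qed
qed

text \<open>
  Passage from Lebesgue measurable functions to Borel representatives.
\<close>

lemma integral_unit_period:
  fixes g f :: "real => real"
  assumes g [measurable]: "g \<in> borel_measurable borel" and ae: "AE x in lborel. g x = f x"
  shows "(LINT x:{0..1}|lebesgue. f x) = (LINT x|circ. g x)" "set_integrable lebesgue {0..1} f \<longleftrightarrow> integrable circ g"
proof -
  have fm: "f \<in> borel_measurable lebesgue" by (rule measurable_lebesgue_cong_AE[OF g ae])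
  have gm: "g \<in> borel_measurable lebesgue" using g by (intro measurable_completion) simp
  have mf: "(\<lambda>x. indicator {0..1} x *\<^sub>R f x) \<in> borel_measurable lebesgue"
    and mg: "(\<lambda>x. indicator {0..1} x *\<^sub>R g x) \<in> borel_measurable lebesgue"
    by (intro borel_measurable_scaleR borel_measurable_indicator fm gm; simp)+
  have ae': "AE x in lebesgue. indicator {0..1} x *\<^sub>R f x = indicator {0..1} x *\<^sub>R g x"
    using AE_completion[OF ae] by eventually_elim simp
  have m: "(\<lambda>x. indicator {0..1} x *\<^sub>R g x) \<in> borel_measurable lborel" by measurable
  have "(LINT x:{0..1}|lebesgue. f x) = (LINT x|lebesgue. indicator {0..1} x *\<^sub>R g x)"
    unfolding set_lebesgue_integral_def by (rule integral_cong_AE[OF mf mg ae'])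
  also have "... = (LINT x|circ. g x)"
    by (subst integral_completion[OF m]) (simp add: integral_circ(1) set_lebesgue_integral_def)
  finally show "(LINT x:{0..1}|lebesgue. f x) = (LINT x|circ. g x)" .
  have "set_integrable lebesgue {0..1} f \<longleftrightarrow> integrable lebesgue (\<lambda>x. indicator {0..1} x *\<^sub>R g x)"
    unfolding set_integrable_def by (rule integrable_cong_AE[OF mf mg ae'])
  also have "... \<longleftrightarrow> integrable circ g"
    by (subst integrable_completion[OF m]) (simp add: integral_circ(2) set_integrable_def)
  finally show "set_integrable lebesgue {0..1} f \<longleftrightarrow> integrable circ g" .
qed

lemma Lp_representative:
  fixes g f :: "real => real"
  assumes g [measurable]: "g \<in> borel_measurable borel" and ae: "AE x in lborel. g x = f x"
  shows "Lp_norm p f = (LINT x|circ. \<bar>g x\<bar> powr p) powr (1 / p)"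
    "periodic_fun_simple' f ==> integrable circ (\<lambda>x. \<bar>g x\<bar> powr p) ==> f \<in> Lp_per p"
proof -
  have m: "(\<lambda>x. \<bar>g x\<bar> powr p) \<in> borel_measurable borel" by measurable
  have ae': "AE x in lborel. \<bar>g x\<bar> powr p = \<bar>f x\<bar> powr p" using ae by eventually_elim simp
  show "Lp_norm p f = (LINT x|circ. \<bar>g x\<bar> powr p) powr (1 / p)"
    unfolding Lp_norm_def integral_unit_period(1)[OF m ae'] ..
  show "periodic_fun_simple' f ==> integrable circ (\<lambda>x. \<bar>g x\<bar> powr p) ==> f \<in> Lp_per p"
    using integral_unit_period(2)[OF m ae'] measurable_lebesgue_cong_AE[OF g ae] by (simp add: Lp_per_def)
qed

lemma abs_powr_two: "\<bar>v\<bar> powr 2 = v^2" for v :: real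
  by (cases "v = 0") (simp_all add: powr_numeral)

lemma periodic_deriv:
  fixes f :: "real => real"
  assumes "periodic_fun_simple' f"
  shows "periodic_fun_simple' (deriv f)"
proof -
  have f1: "(\<lambda>x. f (x + 1)) = f" using assms by (auto simp: periodic_fun_simple'_def)
  have "deriv f (x + 1) = deriv f x" for x
    unfolding deriv_def using DERIV_shift[of f _ x 1] by (simp only: f1)
  then show ?thesis by (simp add: periodic_fun_simple'_def)
qed

context flow
begin

text \<open>
  If \<open>alpha\<close> and \<open>beta\<close> vanished together, the Wronskian \<open>p1 r2 - p2 r1\<close> would be 0, but it is 1.  So each
  label has \<open>alpha = 0\<close> at countably many times only, and Fubini exchanges labels and times.
\<close>

lemma regular_AE: "AE t in lborel. regular t"
proof -
  have sol: "solves T X" for T unfolding solves_def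
    by (intro conjI allI impI X_ode continuous_at_imp_continuous_on ballI X_isCont)
  have det: "st_p1 (X t) \<xi> * st_r2 (X t) \<xi> - st_p2 (X t) \<xi> * st_r1 (X t) \<xi> = 1" for t \<xi>
    using det_conserved[OF sol[of "\<bar>t\<bar>"], of t \<xi>] by (simp add: X_0 st_init)
  have Xc: "continuous_on UNIV X" using sol[of 0] by (simp add: solves_def)
  have [measurable]: "(\<lambda>z. st_p1 (X (fst z)) (snd z)) \<in> borel_measurable (borel \<Otimes>\<^sub>M borel)"
     "(\<lambda>z. st_p2 (X (fst z)) (snd z)) \<in> borel_measurable (borel \<Otimes>\<^sub>M borel)"
    unfolding st_p1_def st_p2_def borel_prod
    by (intro borel_measurable_continuous_onI continuous_on_fst continuous_on_snd continuous_eval Xc)+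
  have joint: "(\<lambda>z. alpha (X (fst z)) (snd z)) \<in> borel_measurable (lborel \<Otimes>\<^sub>M lborel)"
  proof -
    have "(\<lambda>z::real \<times> real. alpha (X (fst z)) (snd z)) \<in> borel_measurable (borel \<Otimes>\<^sub>M borel)"
      unfolding alpha_def by measurable
    then show ?thesis by simp
  qed
  have "AE t in lborel. \<xi> \<in> {0..1} --> alpha (X t) \<xi> \<noteq> 0" for \<xi>
  proof (cases "\<xi> \<in> {0..1}")
    case True
    have "countable {t. alpha (X t) \<xi> = 0}"
    proof (rule transversal_zeros_countable[OF alpha_derivative[OF X_ode]])
      fix t assume a: "alpha (X t) \<xi> = 0"
      show "1/2 * beta (X t) \<xi> \<noteq> 0"
      proof
        assume "1/2 * beta (X t) \<xi> = 0"
        then have p: "st_p1 (X t) \<xi> = - (st_p2 (X t) \<xi> * w \<xi>)" "st_r1 (X t) \<xi> = - (st_r2 (X t) \<xi> * w \<xi>)"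
          using a True by (simp_all add: alpha_def beta_def add_eq_0_iff2)
        show False using det[of t \<xi>] unfolding p by simp
      qed
    qed
    then have "{t. alpha (X t) \<xi> = 0} \<in> null_sets lborel" by (rule countable_imp_null_set_lborel)
    then have "AE t in lborel. t \<notin> {t. alpha (X t) \<xi> = 0}" by (rule AE_not_in)
    then show ?thesis by eventually_elim simp
  next
    case False
    then show ?thesis by (intro AE_I2) blast
  qed
  then have "AE \<xi> in lborel. AE t in lborel. \<xi> \<in> {0..1} --> alpha (X t) \<xi> \<noteq> 0" by simp
  moreover have "{z \<in> space (lborel \<Otimes>\<^sub>M lborel). snd z \<in> {0..1::real} --> alpha (X (fst z)) (snd z) \<noteq> 0} \<in> sets (lborel \<Otimes>\<^sub>M lborel)"
    using joint by measurable
  ultimately show ?thesis unfolding regular_def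
    using lborel_pair.AE_commute[of "\<lambda>t \<xi>. \<xi> \<in> {0..1} --> alpha (X t) \<xi> \<noteq> 0"] by blast
qed

text \<open>
  Time 0 identifies the conserved energy with that of the datum.
\<close>

lemma regular_0: "regular 0"
  unfolding regular_def X_0 alpha_init by simp

lemma energy_lebesgue:
  assumes "regular t"
  shows "(LINT x:{0..1}|lebesgue. (uu t x)^2 + (deriv (uu t) x)^2) = E"
proof -
  have "(LINT x:{0..1}|lebesgue. (uu t x)^2 + (deriv (uu t) x)^2) = (LINT x|circ. (uu t x)^2 + (hx t x)^2)"
    by (rule integral_unit_period) (measurable, use deriv_uu[of t] in eventually_elim, simp)
  then show ?thesis using energy_regular(2)[OF assms] by simp
qed

lemma uu_H1: "uu t \<in> H1_per"
proof -
  have "deriv (uu t) \<in> Lp_per 2"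
    by (rule Lp_representative(2)[OF hx_borel deriv_uu periodic_deriv[OF uu_periodic]]) (simp add: abs_powr_two hx_L2)
  then show ?thesis using uu_periodic has_density_abs_continuous[OF uu_density] by (simp add: H1_per_def)
qed

lemma uu_Lp: "uu t \<in> Lp_per p" if "0 <= p"
proof (rule Lp_representative(2)[OF uu_borel _ uu_periodic])
  show "integrable circ (\<lambda>x. \<bar>uu t x\<bar> powr p)"
    by (rule integrable_circ_bounded[of _ "Cb powr p"]) (use uu_bound that in \<open>auto intro: powr_mono2\<close>)
qed simp

lemma uu_lipschitz: "lipschitz_into_Lp 2 uu"
proof -
  define K where "K = 2 * Cb^2 + 8 * Cb^2 * E"
  have "Lp_norm 2 (\<lambda>x. uu s x - uu t x) <= sqrt K * \<bar>s - t\<bar>" for s t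
  proof -
    have m: "(\<lambda>x. uu s x - uu t x) \<in> borel_measurable borel" by measurable
    have i0: "0 <= (LINT x|circ. (uu s x - uu t x)^2)" by (rule Bochner_Integration.integral_nonneg) simp
    have "Lp_norm 2 (\<lambda>x. uu s x - uu t x) = (LINT x|circ. \<bar>uu s x - uu t x\<bar> powr 2) powr (1/2)"
      by (rule Lp_representative(1)[OF m]) simp
    also have "... = sqrt (LINT x|circ. (uu s x - uu t x)^2)" by (simp only: abs_powr_two powr_half_sqrt[OF i0])
    also have "... <= sqrt (K * (s - t)^2)" unfolding K_def by (rule real_sqrt_le_mono[OF uu_lipschitz_L2(2)])
    also have "... = sqrt K * \<bar>s - t\<bar>" by (simp add: real_sqrt_mult)
    finally show ?thesis .
  qed
  then show ?thesis unfolding lipschitz_into_Lp_def using uu_Lp[of 2] by auto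
qed

lemma Lp_derivative_uu:
  assumes p: "1 <= p" and i: "integrable circ (\<lambda>x. \<bar>vx t x\<bar> powr p)"
    and lim: "((\<lambda>s. LINT x|circ. \<bar>dq s t x\<bar> powr p) \<longlongrightarrow> 0) (at t)"
    and v: "AE x in lborel. vx t x = v x" "periodic_fun_simple' v"
  shows "has_Lp_derivative p uu v t"
  unfolding has_Lp_derivative_def
proof (intro conjI allI)
  show "uu s \<in> Lp_per p" for s using p by (intro uu_Lp) simp
  show "v \<in> Lp_per p" by (rule Lp_representative(2)[OF vx_borel v i])
  have "((\<lambda>s. (LINT x|circ. \<bar>dq s t x\<bar> powr p) powr (1 / p)) \<longlongrightarrow> 0) (at t)"
    by (rule tendsto_zero_powrI[OF lim tendsto_const]) (use p in \<open>auto intro!: always_eventually Bochner_Integration.integral_nonneg\<close>)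
  from LIM_offset_zero[OF this]
  have "((\<lambda>h. (LINT x|circ. \<bar>dq (t + h) t x\<bar> powr p) powr (1 / p)) \<longlongrightarrow> 0) (at 0)" .
  moreover have "Lp_norm p (\<lambda>x. (uu (t + h) x - uu t x) / h - v x) = (LINT x|circ. \<bar>dq (t + h) t x\<bar> powr p) powr (1 / p)" for h
    by (rule Lp_representative(1)[OF dq_borel]) (use v(1) in eventually_elim, simp add: dq_def)
  ultimately show "((\<lambda>h. Lp_norm p (\<lambda>x. (uu (t + h) x - uu t x) / h - v x)) \<longlongrightarrow> 0) (at 0)" by simp
qed

lemma vx_powr_integrable:
  assumes p: "1 <= p" "p <= 2"
  shows "integrable circ (\<lambda>x. \<bar>vx t x\<bar> powr p)"
proof (rule Bochner_Integration.integrable_bound[OF Bochner_Integration.integrable_add[OF integrable_circ_const[of 1] vx_L2(1)[of t]]])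
  have "\<bar>v\<bar> powr p <= 1 + v^2" for v :: real
  proof (cases "\<bar>v\<bar> <= 1")
    case True
    then have "\<bar>v\<bar> powr p <= 1" using p powr_mono2[of p "\<bar>v\<bar>" 1] by simp
    then show ?thesis using zero_le_power2[of v] by linarith
  next
    case False
    then have "\<bar>v\<bar> powr p <= \<bar>v\<bar> powr 2" using p by (intro powr_mono) auto
    then show ?thesis by (simp add: abs_powr_two)
  qed
  then show "AE x in circ. norm (\<bar>vx t x\<bar> powr p) <= norm (1 + (vx t x)^2)" by (auto intro: order_trans[OF _ abs_ge_self])
qed measurable

lemma uu_C1:
  assumes p: "1 <= p" "p < 2"
  shows "C1_into_Lp p uu"
  unfolding C1_into_Lp_def
proof (intro exI[of _ vx] conjI allI)
  fix t
  show "has_Lp_derivative p uu (vx t) t"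
    by (rule Lp_derivative_uu[OF p(1) vx_powr_integrable dq_Lp(2)[OF p] _ vx_periodic]) (use p in auto)
  have "((\<lambda>s. (LINT x|circ. \<bar>vx s x - vx t x\<bar> powr p) powr (1 / p)) \<longlongrightarrow> 0) (at t)"
    by (rule tendsto_zero_powrI[OF vx_Lp[OF p] tendsto_const]) (use p in \<open>auto intro!: always_eventually Bochner_Integration.integral_nonneg\<close>)
  moreover have "Lp_norm p (\<lambda>x. vx s x - vx t x) = (LINT x|circ. \<bar>vx s x - vx t x\<bar> powr p) powr (1 / p)" for s
    by (rule Lp_representative(1)) simp_all
  ultimately show "((\<lambda>s. Lp_norm p (\<lambda>x. vx s x - vx t x)) \<longlongrightarrow> 0) (at t)" by simp
qed

lemma uu_equation:
  assumes gd: "regular t" and p: "1 <= p" "p <= 2"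
  shows "has_Lp_derivative p uu (\<lambda>x. - uu t x * deriv (uu t) x - deriv (CH_P (uu t)) x) t"
proof (rule Lp_derivative_uu[OF p(1) vx_powr_integrable[OF p]])
  show "((\<lambda>s. LINT x|circ. \<bar>dq s t x\<bar> powr p) \<longlongrightarrow> 0) (at t)"
  proof (cases "p = 2")
    case True
    then show ?thesis using dq_L2_regular[OF gd] by (simp add: abs_powr_two)
  next
    case False
    then show ?thesis using dq_Lp(2)[of p t] p by simp
  qed
  show "AE x in lborel. vx t x = - uu t x * deriv (uu t) x - deriv (CH_P (uu t)) x"
    using deriv_uu[of t] by eventually_elim (simp add: vx_def deriv_CH_P_uu[OF gd])
  show "periodic_fun_simple' (\<lambda>x. - uu t x * deriv (uu t) x - deriv (CH_P (uu t)) x)"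
    using uu_periodic[of t] periodic_deriv[OF uu_periodic[of t]] qx_periodic[of t]
    by (simp add: periodic_fun_simple'_def deriv_CH_P_uu[OF gd])
qed

end

theorem (in lagrangian) flow_exists:
  assumes w0: "(LINT \<eta>|lborel. w \<eta>) = 0"
  shows "\<exists>X eta E. flow w X eta m E"
proof -
  obtain X where X: "X 0 = init m" "\<And>t. (X has_vector_derivative F (X t)) (at t)"
    "\<And>t. Y (X t) 1 = 1" "\<And>t. U (X t) 1 = U (X t) 0" "\<And>t. energy (X t) 1 = energy (init m) 1"
    using global_lagrangian_solution[OF w0, of m] by blast
  define E where "E = energy (init m) 1"
  have E: "energy (X t) 1 = E" for t using X(5) by (simp add: E_def)
  have dU: "((\<lambda>s. U (X s) 0) has_real_derivative - Q (X t) 0) (at t)" for t by (rule U_derivative[OF X(2)]) simp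
  have c: "continuous_on UNIV (\<lambda>t. U (X t) 0)"
    by (intro continuous_at_imp_continuous_on ballI DERIV_isCont[OF dU])
  obtain eta where eta: "eta 0 = 0" "\<And>t. (eta has_vector_derivative U (X t) 0) (at t)"
    using ex_antiderivative[OF c] by blast
  have "flow w X eta m E"
    by unfold_locales (simp_all add: X(1-4) E eta has_real_derivative_iff_has_vector_derivative)
  then show ?thesis by blast
qed

lemma (in flow) uu_0:
  assumes per: "periodic_fun_simple' f" and f: "\<And>\<xi>. \<xi> \<in> {0..1} ==> f \<xi> = m0 + (LINT \<eta>:{..\<xi>}|lborel. w \<eta>)"
  shows "uu 0 = f"
proof
  fix x
  obtain n :: int where n: "x = y 0 (lab 0 x) + of_int n" using lab(2) by blast
  have "y 0 (lab 0 x) = lab 0 x" using lab(1)[of 0 x] by (simp add: y_def eta_0 X_0 Y_init)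
  then have "f x = f (lab 0 x + of_int n)" using n by simp
  also have "... = f (lab 0 x)" by (rule periodic_int_shift[OF per])
  finally show "uu 0 x = f x" using f[OF lab(1)] by (simp add: uu_lab X_0 U_init)
qed

theorem theorem1:
  fixes ubar :: "real \<Rightarrow> real"
  assumes "ubar \<in> H1_per"
  shows "\<exists>u :: real \<Rightarrow> real \<Rightarrow> real.
    (\<forall>t. u t \<in> H1_per) \<and>
    u 0 = ubar \<and>
    lipschitz_into_Lp 2 u \<and>
    (AE t in lebesgue.
       has_Lp_derivative 2 u (\<lambda>x. - u t x * deriv (u t) x - deriv (CH_P (u t)) x) t) \<and>
    (\<forall>p\<in>{1..<2}.
       C1_into_Lp p u \<and>
       (AE t in lebesgue.
          has_Lp_derivative p u (\<lambda>x. - u t x * deriv (u t) x - deriv (CH_P (u t)) x) t)) \<and>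
    (AE t in lebesgue.
       (LINT x:{0..1}|lebesgue. (u t x)\<^sup>2 + (deriv (u t) x)\<^sup>2) =
       (LINT x:{0..1}|lebesgue. (ubar x)\<^sup>2 + (deriv ubar x)\<^sup>2))"
proof -
  have per: "periodic_fun_simple' ubar" and ac: "abs_continuous_on_interval 0 1 ubar" and L2: "deriv ubar \<in> Lp_per 2"
    using assms by (auto simp: H1_per_def)
  obtain g where g: "integrable lborel g" "has_density (\<lambda>x. ubar (max 0 (min 1 x))) g"
    using abs_continuous_density[OF ac] by auto
  have [measurable]: "g \<in> borel_measurable borel" using g(2) by (rule has_density_borel)
  (* A Borel representative of the derivative of the datum on one period. *)
  define w where "w = (\<lambda>x. indicator {0..1} x * g x)"
  have wm [measurable]: "w \<in> borel_measurable borel" unfolding w_def by measurable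
  have int: "(LINT \<eta>:{..\<xi>}|lborel. w \<eta>) = ubar \<xi> - ubar 0" if "\<xi> \<in> {0..1}" for \<xi>
  proof -
    have "(LINT \<eta>:{..\<xi>}|lborel. w \<eta>) = (LINT \<eta>:{0..\<xi>}|lborel. g \<eta>)"
      unfolding set_lebesgue_integral_def w_def
      by (rule Bochner_Integration.integral_cong) (use that in \<open>auto simp: indicator_def\<close>)
    then show ?thesis using has_density_integral[OF g(2), of 0 \<xi>] that by simp
  qed
  have w0: "(LINT \<eta>|lborel. w \<eta>) = 0"
  proof -
    have "(LINT \<eta>|lborel. w \<eta>) = (LINT \<eta>:{..1}|lborel. w \<eta>)"
      unfolding set_lebesgue_integral_def w_def by (rule Bochner_Integration.integral_cong) (auto simp: indicator_def)
    moreover have "ubar (0 + 1) = ubar 0" using per unfolding periodic_fun_simple'_def by blast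
    ultimately show ?thesis using int[of 1] by simp
  qed
  (* The end points are excluded because the clamped function has a corner there. *)
  have dg: "AE x in lborel. x \<in> {0..1} --> g x = deriv ubar x"
  proof -
    have "AE x in lborel. x \<noteq> (0::real)" "AE x in lborel. x \<noteq> (1::real)" by (rule AE_lborel_singleton)+
    then show ?thesis using has_density_AE_derivative[OF g(2)]
    proof eventually_elim
      case (elim x)
      show ?case
      proof
        assume "x \<in> {0..1}"
        then have x: "x \<in> {0<..<1}" using elim by auto
        have "(ubar has_real_derivative g x) (at x)"
          by (rule has_field_derivative_transform_within_open[OF elim(3) _ x]) auto
        then show "g x = deriv ubar x" by (simp add: DERIV_imp_deriv)
      qed
    qed
  qed
  have w2: "integrable lborel (\<lambda>x. (w x)^2)"
  proof -
    have di: "set_integrable lebesgue {0..1} (\<lambda>x. \<bar>deriv ubar x\<bar> powr 2)"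
      using L2 by (simp add: Lp_per_def)
    have wl: "w \<in> borel_measurable lebesgue" using wm by (intro measurable_completion) simp
    have "integrable lebesgue (\<lambda>x. (w x)^2) \<longleftrightarrow> integrable lebesgue (\<lambda>x. indicator {0..1} x *\<^sub>R \<bar>deriv ubar x\<bar> powr 2)"
    proof (rule integrable_cong_AE)
      show "AE x in lebesgue. (w x)^2 = indicator {0..1} x *\<^sub>R \<bar>deriv ubar x\<bar> powr 2"
        using AE_completion[OF dg] by eventually_elim (auto simp: w_def abs_powr_two indicator_def)
      show "(\<lambda>x. (w x)^2) \<in> borel_measurable lebesgue" by (intro borel_measurable_power wl)
      show "(\<lambda>x. indicator {0..1} x *\<^sub>R \<bar>deriv ubar x\<bar> powr 2) \<in> borel_measurable lebesgue"
        using di unfolding set_integrable_def by (rule borel_measurable_integrable)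
    qed
    then have "integrable lebesgue (\<lambda>x. (w x)^2)" using di by (simp add: set_integrable_def)
    moreover have "(\<lambda>x. (w x)^2) \<in> borel_measurable lborel" by measurable
    ultimately show ?thesis using integrable_completion by blast
  qed
  interpret lagrangian w by unfold_locales (use wm w2 in \<open>auto simp: w_def\<close>)
  obtain X eta E where "flow w X eta (ubar 0) E" using flow_exists[OF w0, of "ubar 0"] by blast
  then interpret S: flow w X eta "ubar 0" E .
  have u0: "S.uu 0 = ubar" by (rule S.uu_0[OF per]) (simp add: int)
  have gd: "AE t in lebesgue. S.regular t" by (rule AE_completion[OF S.regular_AE])
  show ?thesis
  proof (intro exI[of _ S.uu] conjI allI ballI)
    show "S.uu t \<in> H1_per" for t by (rule S.uu_H1)
    show "S.uu 0 = ubar" by (rule u0)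
    show "lipschitz_into_Lp 2 S.uu" by (rule S.uu_lipschitz)
    show "AE t in lebesgue. has_Lp_derivative 2 S.uu (\<lambda>x. - S.uu t x * deriv (S.uu t) x - deriv (CH_P (S.uu t)) x) t"
      using gd by eventually_elim (rule S.uu_equation, simp_all)
    show "AE t in lebesgue. (LINT x:{0..1}|lebesgue. (S.uu t x)^2 + (deriv (S.uu t) x)^2) =
       (LINT x:{0..1}|lebesgue. (ubar x)^2 + (deriv ubar x)^2)"
      using gd
    proof eventually_elim
      case (elim t)
      show ?case using S.energy_lebesgue[OF elim] S.energy_lebesgue[OF S.regular_0] by (simp add: u0)
    qed
    fix p :: real assume p: "p \<in> {1..<2}"
    then show "C1_into_Lp p S.uu" by (intro S.uu_C1) auto
    show "AE t in lebesgue. has_Lp_derivative p S.uu (\<lambda>x. - S.uu t x * deriv (S.uu t) x - deriv (CH_P (S.uu t)) x) t"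
      using gd by eventually_elim (rule S.uu_equation, use p in auto)
  qed
qed

end
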